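(* (1) If there is no nonuniform subExp-optimal proof system for $\mathsf{TAUT}$, then for every $k$, $\mathsf{NE}_k\neq\mathsf{CoNE}_k$. (2) If there is no subExp-optimal proof system for $\mathsf{TAUT}$, then for every $k$, $\mathsf{E}_k\neq\mathsf{NE}_k$. (3) If there is no nonuniform Qp-optimal proof system for $\mathsf{TAUT}$, then $\mathsf{NEXP}\neq\mathsf{CoNEXP}$. (4) If there is no Qp-optimal proof system for $\mathsf{TAUT}$, then $\mathsf{EXP}\neq\mathsf{NEXP}$.
   Context: $\mathsf{S^1_2}$ is Buss's bounded arithmetic theory in $\mathcal{L}_{BA}=\{0,S,+,\cdot,|x|,\lfloor x/2\rfloor,x\#y\}$; $\Sigma^b_1,\Pi^b_1$ are the bounded formula classes, and a formula is $\Delta^b_1$ in $\mathsf{S^1_2}$ if it is $\Sigma^b_1$ and $\mathsf{S^1_2}$-provably equivalent to a $\Pi^b_1$ formula. Define $2^x_0=x$, $2^x_{n+1}=2^{2^x_n}$. For $L\subseteq\mathbb{N}$: $L\in\mathsf{E}_k$ iff there is a formula $\phi(x)$, $\Delta^b_1$ in $\mathsf{S^1_2}$, with $\forall n(n\in L\leftrightarrow\phi(2^n_k))$; $L\in\mathsf{NE}_k$ iff the same holds with some $\Sigma^b_1$ formula $\phi$; $L\in\mathsf{CoNE}_k$ iff the same holds with some $\Pi^b_1$ formula $\phi$. $\mathsf{EXP},\mathsf{NEXP},\mathsf{CoNEXP}$ are the standard classes. A proof system for $\mathsf{TAUT}$ (the set of propositional tautologies) is a polynomial-time function with range $\mathsf{TAUT}$.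 For a class of time bounds — subexponential $2^{o(n)}$ (subExp) or quasipolynomial $2^{(\log n)^{O(1)}}$ (Qp) — a proof system $P$ (uniformly) simulates $Q$ if there is a function $f$ computable within such a time bound with $P(f(\pi))=Q(\pi)$ for all $\pi$, and nonuniformly simulates $Q$ if there is a bound $h$ of that kind such that whenever $Q(\pi)=\theta$ there is $\pi'$ with $|\pi'|\le h(|\pi|)$ and $P(\pi')=\theta$. $P$ is (nonuniform) subExp-optimal, resp. Qp-optimal, if it (nonuniformly) simulates in this sense every proof system for $\mathsf{TAUT}$. *)

theory Defs
  imports Complex_Main "HOL-Library.Landau_Symbols" "HOL-Library.Log_Nat"
begin

section \<open>Terms and formulas of bounded arithmetic\<close>

text \<open>Variables are de Bruijn indices, and an index that is not bound is a free variable.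
  As in Buss, the order is an atomic relation symbol.\<close>

datatype trm =
    Var nat
  | Zero
  | Sc trm
  | Add trm trm  (infixl "\<^bold>+" 65)
  | Mul trm trm  (infixl "\<^bold>*" 70)
  | Len trm
  | Half trm
  | Smash trm trm  (infixl "\<^bold>#" 68)

datatype fm =
    Eq trm trm  (infix "\<^bold>=" 50)
  | Le trm trm  (infix "\<^bold>\<le>" 50)
  | Neg fm  ("\<^bold>\<not> _" [40] 40)
  | And fm fm  (infixr "\<^bold>\<and>" 35)
  | Or fm fm  (infixr "\<^bold>\<or>" 30)
  | Imp fm fm  (infixr "\<^bold>\<longrightarrow>" 25)
  | All fm
  | Ex fm

abbreviation Iff :: "fm \<Rightarrow> fm \<Rightarrow> fm"  (infixr "\<^bold>\<longleftrightarrow>" 25) where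
  "\<phi> \<^bold>\<longleftrightarrow> \<psi> \<equiv> (\<phi> \<^bold>\<longrightarrow> \<psi>) \<^bold>\<and> (\<psi> \<^bold>\<longrightarrow> \<phi>)"

fun subst_trm :: "(nat \<Rightarrow> trm) \<Rightarrow> trm \<Rightarrow> trm" where
  "subst_trm \<sigma> (Var i) = \<sigma> i"
| "subst_trm \<sigma> Zero = Zero"
| "subst_trm \<sigma> (Sc t) = Sc (subst_trm \<sigma> t)"
| "subst_trm \<sigma> (s \<^bold>+ t) = subst_trm \<sigma> s \<^bold>+ subst_trm \<sigma> t"
| "subst_trm \<sigma> (s \<^bold>* t) = subst_trm \<sigma> s \<^bold>* subst_trm \<sigma> t"
| "subst_trm \<sigma> (Len t) = Len (subst_trm \<sigma> t)"
| "subst_trm \<sigma> (Half t) = Half (subst_trm \<sigma> t)"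
| "subst_trm \<sigma> (s \<^bold># t) = subst_trm \<sigma> s \<^bold># subst_trm \<sigma> t"

abbreviation lift_trm :: "trm \<Rightarrow> trm" where
  "lift_trm \<equiv> subst_trm (\<lambda>i. Var (Suc i))"

definition under_binder :: "(nat \<Rightarrow> trm) \<Rightarrow> nat \<Rightarrow> trm" where
  "under_binder \<sigma> = case_nat (Var 0) (\<lambda>i. lift_trm (\<sigma> i))"

fun subst :: "(nat \<Rightarrow> trm) \<Rightarrow> fm \<Rightarrow> fm" where
  "subst \<sigma> (s \<^bold>= t) = (subst_trm \<sigma> s \<^bold>= subst_trm \<sigma> t)"
| "subst \<sigma> (s \<^bold>\<le> t) = (subst_trm \<sigma> s \<^bold>\<le> subst_trm \<sigma> t)"
| "subst \<sigma> (\<^bold>\<not> \<phi>) = (\<^bold>\<not> subst \<sigma> \<phi>)"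
| "subst \<sigma> (\<phi> \<^bold>\<and> \<psi>) = (subst \<sigma> \<phi> \<^bold>\<and> subst \<sigma> \<psi>)"
| "subst \<sigma> (\<phi> \<^bold>\<or> \<psi>) = (subst \<sigma> \<phi> \<^bold>\<or> subst \<sigma> \<psi>)"
| "subst \<sigma> (\<phi> \<^bold>\<longrightarrow> \<psi>) = (subst \<sigma> \<phi> \<^bold>\<longrightarrow> subst \<sigma> \<psi>)"
| "subst \<sigma> (All \<phi>) = All (subst (under_binder \<sigma>) \<phi>)"
| "subst \<sigma> (Ex \<phi>) = Ex (subst (under_binder \<sigma>) \<phi>)"

abbreviation lift_fm :: "fm \<Rightarrow> fm" where
  "lift_fm \<equiv> subst (\<lambda>i. Var (Suc i))"

text \<open>The body of a quantifier instantiated with a term: index 0 is replaced and the other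
  indices drop by one.\<close>

abbreviation inst :: "fm \<Rightarrow> trm \<Rightarrow> fm" where
  "inst \<phi> t \<equiv> subst (case_nat t Var) \<phi>"

fun fv_trm :: "trm \<Rightarrow> nat set" where
  "fv_trm (Var i) = {i}"
| "fv_trm Zero = {}"
| "fv_trm (Sc t) = fv_trm t"
| "fv_trm (s \<^bold>+ t) = fv_trm s \<union> fv_trm t"
| "fv_trm (s \<^bold>* t) = fv_trm s \<union> fv_trm t"
| "fv_trm (Len t) = fv_trm t"
| "fv_trm (Half t) = fv_trm t"
| "fv_trm (s \<^bold># t) = fv_trm s \<union> fv_trm t"

fun fv :: "fm \<Rightarrow> nat set" where
  "fv (s \<^bold>= t) = fv_trm s \<union> fv_trm t"
| "fv (s \<^bold>\<le> t) = fv_trm s \<union> fv_trm t"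
| "fv (\<^bold>\<not> \<phi>) = fv \<phi>"
| "fv (\<phi> \<^bold>\<and> \<psi>) = fv \<phi> \<union> fv \<psi>"
| "fv (\<phi> \<^bold>\<or> \<psi>) = fv \<phi> \<union> fv \<psi>"
| "fv (\<phi> \<^bold>\<longrightarrow> \<psi>) = fv \<phi> \<union> fv \<psi>"
| "fv (All \<phi>) = {i. Suc i \<in> fv \<phi>}"
| "fv (Ex \<phi>) = {i. Suc i \<in> fv \<phi>}"

section \<open>Truth in the standard model\<close>

fun eval :: "(nat \<Rightarrow> nat) \<Rightarrow> trm \<Rightarrow> nat" where
  "eval e (Var i) = e i"
| "eval e Zero = 0"
| "eval e (Sc t) = Suc (eval e t)"
| "eval e (s \<^bold>+ t) = eval e s + eval e t"
| "eval e (s \<^bold>* t) = eval e s * eval e t"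
| "eval e (Len t) = floorlog 2 (eval e t)"
| "eval e (Half t) = eval e t div 2"
| "eval e (s \<^bold># t) = 2 ^ (floorlog 2 (eval e s) * floorlog 2 (eval e t))"

fun sat :: "(nat \<Rightarrow> nat) \<Rightarrow> fm \<Rightarrow> bool" where
  "sat e (s \<^bold>= t) \<longleftrightarrow> eval e s = eval e t"
| "sat e (s \<^bold>\<le> t) \<longleftrightarrow> eval e s \<le> eval e t"
| "sat e (\<^bold>\<not> \<phi>) \<longleftrightarrow> \<not> sat e \<phi>"
| "sat e (\<phi> \<^bold>\<and> \<psi>) \<longleftrightarrow> sat e \<phi> \<and> sat e \<psi>"
| "sat e (\<phi> \<^bold>\<or> \<psi>) \<longleftrightarrow> sat e \<phi> \<or> sat e \<psi>"
| "sat e (\<phi> \<^bold>\<longrightarrow> \<psi>) \<longleftrightarrow> (sat e \<phi> \<longrightarrow> sat e \<psi>)"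
| "sat e (All \<phi>) \<longleftrightarrow> (\<forall>n. sat (case_nat n e) \<phi>)"
| "sat e (Ex \<phi>) \<longleftrightarrow> (\<exists>n. sat (case_nat n e) \<phi>)"

section \<open>Bounded formula classes\<close>

text \<open>The bounding term is read outside the quantifier, so it cannot mention the quantified
  variable.\<close>

definition bAll :: "trm \<Rightarrow> fm \<Rightarrow> fm" where
  "bAll t \<phi> = All (Var 0 \<^bold>\<le> lift_trm t \<^bold>\<longrightarrow> \<phi>)"

definition bEx :: "trm \<Rightarrow> fm \<Rightarrow> fm" where
  "bEx t \<phi> = Ex (Var 0 \<^bold>\<le> lift_trm t \<^bold>\<and> \<phi>)"

inductive sharply_bounded :: "fm \<Rightarrow> bool" where
  "sharply_bounded (s \<^bold>= t)"
| "sharply_bounded (s \<^bold>\<le> t)"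
| "sharply_bounded \<phi> \<Longrightarrow> sharply_bounded (\<^bold>\<not> \<phi>)"
| "sharply_bounded \<phi> \<Longrightarrow> sharply_bounded \<psi> \<Longrightarrow> sharply_bounded (\<phi> \<^bold>\<and> \<psi>)"
| "sharply_bounded \<phi> \<Longrightarrow> sharply_bounded \<psi> \<Longrightarrow> sharply_bounded (\<phi> \<^bold>\<or> \<psi>)"
| "sharply_bounded \<phi> \<Longrightarrow> sharply_bounded \<psi> \<Longrightarrow> sharply_bounded (\<phi> \<^bold>\<longrightarrow> \<psi>)"
| "sharply_bounded \<phi> \<Longrightarrow> sharply_bounded (bAll (Len t) \<phi>)"
| "sharply_bounded \<phi> \<Longrightarrow> sharply_bounded (bEx (Len t) \<phi>)"

inductive Sigma_b1 :: "fm \<Rightarrow> bool" and Pi_b1 :: "fm \<Rightarrow> bool" where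
  "sharply_bounded \<phi> \<Longrightarrow> Sigma_b1 \<phi>"
| "Pi_b1 \<phi> \<Longrightarrow> Sigma_b1 (\<^bold>\<not> \<phi>)"
| "Sigma_b1 \<phi> \<Longrightarrow> Sigma_b1 \<psi> \<Longrightarrow> Sigma_b1 (\<phi> \<^bold>\<and> \<psi>)"
| "Sigma_b1 \<phi> \<Longrightarrow> Sigma_b1 \<psi> \<Longrightarrow> Sigma_b1 (\<phi> \<^bold>\<or> \<psi>)"
| "Pi_b1 \<phi> \<Longrightarrow> Sigma_b1 \<psi> \<Longrightarrow> Sigma_b1 (\<phi> \<^bold>\<longrightarrow> \<psi>)"
| "Sigma_b1 \<phi> \<Longrightarrow> Sigma_b1 (bAll (Len t) \<phi>)"
| "Sigma_b1 \<phi> \<Longrightarrow> Sigma_b1 (bEx t \<phi>)"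
| "sharply_bounded \<phi> \<Longrightarrow> Pi_b1 \<phi>"
| "Sigma_b1 \<phi> \<Longrightarrow> Pi_b1 (\<^bold>\<not> \<phi>)"
| "Pi_b1 \<phi> \<Longrightarrow> Pi_b1 \<psi> \<Longrightarrow> Pi_b1 (\<phi> \<^bold>\<and> \<psi>)"
| "Pi_b1 \<phi> \<Longrightarrow> Pi_b1 \<psi> \<Longrightarrow> Pi_b1 (\<phi> \<^bold>\<or> \<psi>)"
| "Sigma_b1 \<phi> \<Longrightarrow> Pi_b1 \<psi> \<Longrightarrow> Pi_b1 (\<phi> \<^bold>\<longrightarrow> \<psi>)"
| "Pi_b1 \<phi> \<Longrightarrow> Pi_b1 (bAll t \<phi>)"
| "Pi_b1 \<phi> \<Longrightarrow> Pi_b1 (bEx (Len t) \<phi>)"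

section \<open>Buss's theory\<close>

abbreviation (input) one :: trm where "one \<equiv> Sc Zero"
abbreviation (input) two :: trm where "two \<equiv> Sc (Sc Zero)"

text \<open>Buss's 32 open axioms BASIC, in his order.\<close>

definition BASIC :: "fm set" where
  "BASIC = (let x = Var 0; y = Var 1; z = Var 2; u = Var 3; v = Var 4 in
    { y \<^bold>\<le> x \<^bold>\<longrightarrow> y \<^bold>\<le> Sc x,
      \<^bold>\<not> (x \<^bold>= Sc x),
      Zero \<^bold>\<le> x,
      (x \<^bold>\<le> y \<^bold>\<and> \<^bold>\<not> (x \<^bold>= y)) \<^bold>\<longleftrightarrow> Sc x \<^bold>\<le> y,
      \<^bold>\<not> (x \<^bold>= Zero) \<^bold>\<longrightarrow> \<^bold>\<not> (two \<^bold>* x \<^bold>= Zero),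
      y \<^bold>\<le> x \<^bold>\<or> x \<^bold>\<le> y,
      x \<^bold>\<le> y \<^bold>\<and> y \<^bold>\<le> x \<^bold>\<longrightarrow> x \<^bold>= y,
      x \<^bold>\<le> y \<^bold>\<and> y \<^bold>\<le> z \<^bold>\<longrightarrow> x \<^bold>\<le> z,
      Len Zero \<^bold>= Zero,
      \<^bold>\<not> (x \<^bold>= Zero) \<^bold>\<longrightarrow>
        Len (two \<^bold>* x) \<^bold>= Sc (Len x) \<^bold>\<and> Len (Sc (two \<^bold>* x)) \<^bold>= Sc (Len x),
      Len one \<^bold>= one,
      x \<^bold>\<le> y \<^bold>\<longrightarrow> Len x \<^bold>\<le> Len y,
      Len (x \<^bold># y) \<^bold>= Sc (Len x \<^bold>* Len y),
      Zero \<^bold># y \<^bold>= one,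
      \<^bold>\<not> (x \<^bold>= Zero) \<^bold>\<longrightarrow>
        one \<^bold># (two \<^bold>* x) \<^bold>= two \<^bold>* (one \<^bold># x) \<^bold>\<and>
        one \<^bold># Sc (two \<^bold>* x) \<^bold>= two \<^bold>* (one \<^bold># x),
      x \<^bold># y \<^bold>= y \<^bold># x,
      Len x \<^bold>= Len y \<^bold>\<longrightarrow> x \<^bold># z \<^bold>= y \<^bold># z,
      Len x \<^bold>= Len u \<^bold>+ Len v \<^bold>\<longrightarrow> x \<^bold># y \<^bold>= (u \<^bold># y) \<^bold>* (v \<^bold># y),
      x \<^bold>\<le> x \<^bold>+ y,
      x \<^bold>\<le> y \<^bold>\<and> \<^bold>\<not> (x \<^bold>= y) \<^bold>\<longrightarrow>
        Sc (two \<^bold>* x) \<^bold>\<le> two \<^bold>* y \<^bold>\<and> \<^bold>\<not> (Sc (two \<^bold>* x) \<^bold>= two \<^bold>* y),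
      x \<^bold>+ y \<^bold>= y \<^bold>+ x,
      x \<^bold>+ Zero \<^bold>= x,
      x \<^bold>+ Sc y \<^bold>= Sc (x \<^bold>+ y),
      (x \<^bold>+ y) \<^bold>+ z \<^bold>= x \<^bold>+ (y \<^bold>+ z),
      x \<^bold>+ y \<^bold>\<le> x \<^bold>+ z \<^bold>\<longleftrightarrow> y \<^bold>\<le> z,
      x \<^bold>* Zero \<^bold>= Zero,
      x \<^bold>* Sc y \<^bold>= (x \<^bold>* y) \<^bold>+ x,
      x \<^bold>* y \<^bold>= y \<^bold>* x,
      x \<^bold>* (y \<^bold>+ z) \<^bold>= (x \<^bold>* y) \<^bold>+ (x \<^bold>* z),
      one \<^bold>\<le> x \<^bold>\<longrightarrow> (x \<^bold>* y \<^bold>\<le> x \<^bold>* z \<^bold>\<longleftrightarrow> y \<^bold>\<le> z),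
      \<^bold>\<not> (x \<^bold>= Zero) \<^bold>\<longrightarrow> Len x \<^bold>= Sc (Len (Half x)),
      x \<^bold>= Half y \<^bold>\<longleftrightarrow> (two \<^bold>* x \<^bold>= y \<^bold>\<or> Sc (two \<^bold>* x) \<^bold>= y) })"

text \<open>The induction variable is index 0 of \<open>\<phi>\<close>; all other free indices are parameters.\<close>

definition PIND :: "fm \<Rightarrow> fm" where
  "PIND \<phi> =
    (inst \<phi> Zero \<^bold>\<and>
     All (subst (case_nat (Half (Var 0)) (\<lambda>i. Var (Suc i))) \<phi> \<^bold>\<longrightarrow> \<phi>)
     \<^bold>\<longrightarrow> All \<phi>)"

definition S12 :: "fm set" where
  "S12 = BASIC \<union> {PIND \<phi> | \<phi>. Sigma_b1 \<phi>}"

text \<open>Classical natural deduction with equality. \<open>prov T \<Gamma> \<phi>\<close> says that \<open>\<phi>\<close> is derivable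
  from the hypotheses \<open>\<Gamma>\<close> in the theory \<open>T\<close>. The free variables of members of \<open>T\<close> are read as
  universally quantified (rule \<open>AllI\<close> does not restrict them), whereas those of \<open>\<Gamma>\<close> are
  parameters.\<close>

inductive prov :: "fm set \<Rightarrow> fm set \<Rightarrow> fm \<Rightarrow> bool" for T :: "fm set" where
  Axiom: "\<phi> \<in> T \<Longrightarrow> prov T \<Gamma> \<phi>"
| Assm: "\<phi> \<in> \<Gamma> \<Longrightarrow> prov T \<Gamma> \<phi>"
| NegI: "prov T (insert \<phi> \<Gamma>) \<psi> \<Longrightarrow> prov T (insert \<phi> \<Gamma>) (\<^bold>\<not> \<psi>) \<Longrightarrow> prov T \<Gamma> (\<^bold>\<not> \<phi>)"
| Classical: "prov T (insert (\<^bold>\<not> \<phi>) \<Gamma>) \<psi> \<Longrightarrow> prov T (insert (\<^bold>\<not> \<phi>) \<Gamma>) (\<^bold>\<not> \<psi>)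
    \<Longrightarrow> prov T \<Gamma> \<phi>"
| AndI: "prov T \<Gamma> \<phi> \<Longrightarrow> prov T \<Gamma> \<psi> \<Longrightarrow> prov T \<Gamma> (\<phi> \<^bold>\<and> \<psi>)"
| AndE1: "prov T \<Gamma> (\<phi> \<^bold>\<and> \<psi>) \<Longrightarrow> prov T \<Gamma> \<phi>"
| AndE2: "prov T \<Gamma> (\<phi> \<^bold>\<and> \<psi>) \<Longrightarrow> prov T \<Gamma> \<psi>"
| OrI1: "prov T \<Gamma> \<phi> \<Longrightarrow> prov T \<Gamma> (\<phi> \<^bold>\<or> \<psi>)"
| OrI2: "prov T \<Gamma> \<psi> \<Longrightarrow> prov T \<Gamma> (\<phi> \<^bold>\<or> \<psi>)"
| OrE: "prov T \<Gamma> (\<phi> \<^bold>\<or> \<psi>) \<Longrightarrow> prov T (insert \<phi> \<Gamma>) \<chi> \<Longrightarrow> prov T (insert \<psi> \<Gamma>) \<chi>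
    \<Longrightarrow> prov T \<Gamma> \<chi>"
| ImpI: "prov T (insert \<phi> \<Gamma>) \<psi> \<Longrightarrow> prov T \<Gamma> (\<phi> \<^bold>\<longrightarrow> \<psi>)"
| ImpE: "prov T \<Gamma> (\<phi> \<^bold>\<longrightarrow> \<psi>) \<Longrightarrow> prov T \<Gamma> \<phi> \<Longrightarrow> prov T \<Gamma> \<psi>"
| AllI: "prov T (lift_fm ` \<Gamma>) \<phi> \<Longrightarrow> prov T \<Gamma> (All \<phi>)"
| AllE: "prov T \<Gamma> (All \<phi>) \<Longrightarrow> prov T \<Gamma> (inst \<phi> t)"
| ExI: "prov T \<Gamma> (inst \<phi> t) \<Longrightarrow> prov T \<Gamma> (Ex \<phi>)"
| ExE: "prov T \<Gamma> (Ex \<phi>) \<Longrightarrow> prov T (insert \<phi> (lift_fm ` \<Gamma>)) (lift_fm \<psi>) \<Longrightarrow> prov T \<Gamma> \<psi>"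
| EqRefl: "prov T \<Gamma> (t \<^bold>= t)"
| EqSubst: "prov T \<Gamma> (s \<^bold>= t) \<Longrightarrow> prov T \<Gamma> (inst \<phi> s) \<Longrightarrow> prov T \<Gamma> (inst \<phi> t)"

definition Delta_b1_in_S12 :: "fm \<Rightarrow> bool" where
  "Delta_b1_in_S12 \<phi> \<longleftrightarrow> Sigma_b1 \<phi> \<and> (\<exists>\<psi>. Pi_b1 \<psi> \<and> prov S12 {} (\<phi> \<^bold>\<longleftrightarrow> \<psi>))"

section \<open>The classes defined by towers\<close>

fun tower :: "nat \<Rightarrow> nat \<Rightarrow> nat" where
  "tower 0 x = x"
| "tower (Suc k) x = 2 ^ tower k x"

text \<open>\<open>\<phi>(n)\<close> for a formula with \<open>fv \<phi> \<subseteq> {0}\<close>; the value is assigned to every index, only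
  index 0 matters.\<close>

definition holds_at :: "fm \<Rightarrow> nat \<Rightarrow> bool" where
  "holds_at \<phi> n \<longleftrightarrow> sat (\<lambda>_. n) \<phi>"

definition E_class :: "nat \<Rightarrow> nat set set" where
  "E_class k = {L. \<exists>\<phi>. fv \<phi> \<subseteq> {0} \<and> Delta_b1_in_S12 \<phi> \<and>
     (\<forall>n. n \<in> L \<longleftrightarrow> holds_at \<phi> (tower k n))}"

definition NE_class :: "nat \<Rightarrow> nat set set" where
  "NE_class k = {L. \<exists>\<phi>. fv \<phi> \<subseteq> {0} \<and> Sigma_b1 \<phi> \<and>
     (\<forall>n. n \<in> L \<longleftrightarrow> holds_at \<phi> (tower k n))}"

definition CoNE_class :: "nat \<Rightarrow> nat set set" where
  "CoNE_class k = {L. \<exists>\<phi>. fv \<phi> \<subseteq> {0} \<and> Pi_b1 \<phi> \<and>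
     (\<forall>n. n \<in> L \<longleftrightarrow> holds_at \<phi> (tower k n))}"

section \<open>Turing machines\<close>

text \<open>Multitape, nondeterministic machines with two-way infinite tapes. States and tape symbols
  are natural numbers; finiteness of the set of instructions makes both effectively finite.
  An instruction \<open>(q, rs, q', as)\<close> applies in state \<open>q\<close> when the heads read \<open>rs\<close>, and then
  writes and moves on each tape according to \<open>as\<close>. State 0 is initial, state 1 is accepting;
  symbol 0 is the blank, symbols 1 and 2 are the bits.\<close>

datatype move = MLeft | MStay | MRight

fun offset :: "move \<Rightarrow> int" where
  "offset MLeft = -1"
| "offset MStay = 0"
| "offset MRight = 1"

record machine =
  num_tapes :: nat
  instrs :: "(nat \<times> nat list \<times> nat \<times> (nat \<times> move) list) set"

definition TM :: "machine \<Rightarrow> bool" where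
  "TM M \<longleftrightarrow> num_tapes M \<ge> 1 \<and> finite (instrs M) \<and>
     (\<forall>(q, rs, q', as) \<in> instrs M. length rs = num_tapes M \<and> length as = num_tapes M)"

definition deterministic :: "machine \<Rightarrow> bool" where
  "deterministic M \<longleftrightarrow>
     (\<forall>q rs a b. (q, rs, a) \<in> instrs M \<and> (q, rs, b) \<in> instrs M \<longrightarrow> a = b)"

text \<open>A configuration is a state together with the contents and head position of each tape.\<close>

type_synonym config = "nat \<times> ((int \<Rightarrow> nat) \<times> int) list"

fun act :: "nat \<times> move \<Rightarrow> (int \<Rightarrow> nat) \<times> int \<Rightarrow> (int \<Rightarrow> nat) \<times> int" where
  "act (w, d) (tp, h) = (tp(h := w), h + offset d)"

definition step :: "machine \<Rightarrow> config \<Rightarrow> config \<Rightarrow> bool" where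
  "step M c c' \<longleftrightarrow>
     (\<exists>q ts q' as. c = (q, ts) \<and> (q, map (\<lambda>(tp, h). tp h) ts, q', as) \<in> instrs M \<and>
        c' = (q', map2 act as ts))"

definition halted :: "machine \<Rightarrow> config \<Rightarrow> bool" where
  "halted M c \<longleftrightarrow> (\<nexists>c'. step M c c')"

definition bit_symbol :: "bool \<Rightarrow> nat" where
  "bit_symbol b = (if b then 2 else 1)"

definition input_tape :: "bool list \<Rightarrow> int \<Rightarrow> nat" where
  "input_tape x i = (if 0 \<le> i \<and> i < int (length x) then bit_symbol (x ! nat i) else 0)"

definition start_config :: "machine \<Rightarrow> bool list \<Rightarrow> config" where
  "start_config M x = (0, (input_tape x, 0) # replicate (num_tapes M - 1) (\<lambda>_. 0, 0))"

text \<open>The output is read on the first tape, from cell 0 up to the first blank.\<close>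

definition has_output :: "config \<Rightarrow> bool list \<Rightarrow> bool" where
  "has_output c y \<longleftrightarrow>
     (let tp = fst (hd (snd c))
      in (\<forall>i < length y. tp (int i) = bit_symbol (y ! i)) \<and> tp (int (length y)) = 0)"

definition computes_within :: "machine \<Rightarrow> (bool list \<Rightarrow> bool list) \<Rightarrow> (nat \<Rightarrow> nat) \<Rightarrow> bool" where
  "computes_within M f T \<longleftrightarrow> TM M \<and> deterministic M \<and>
     (\<forall>x. \<exists>n \<le> T (length x). \<exists>c. (step M ^^ n) (start_config M x) c \<and> halted M c \<and>
        has_output c (f x))"

text \<open>All computation paths halt within the time bound, and membership means that some path
  halts in the accepting state.\<close>

definition decides_within :: "machine \<Rightarrow> bool list set \<Rightarrow> (nat \<Rightarrow> nat) \<Rightarrow> bool" where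
  "decides_within M L T \<longleftrightarrow> TM M \<and>
     (\<forall>x. (\<forall>n c. (step M ^^ n) (start_config M x) c \<longrightarrow> n \<le> T (length x)) \<and>
          (x \<in> L \<longleftrightarrow> (\<exists>c. (step M)\<^sup>*\<^sup>* (start_config M x) c \<and> halted M c \<and> fst c = 1)))"

section \<open>Classes of bounds\<close>

definition Poly :: "(nat \<Rightarrow> nat) set" where
  "Poly = {T. \<exists>c::nat. (\<lambda>n. real (T n)) \<in> O(\<lambda>n. real n ^ c)}"

definition Qp :: "(nat \<Rightarrow> nat) set" where
  "Qp = {T. \<exists>c::nat. \<exists>g \<in> O(\<lambda>n. log 2 (real n) ^ c). \<forall>n. real (T n) \<le> 2 powr g n}"

definition subExp :: "(nat \<Rightarrow> nat) set" where
  "subExp = {T. \<exists>g \<in> o(\<lambda>n. real n). \<forall>n. real (T n) \<le> 2 powr g n}"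

definition Expo :: "(nat \<Rightarrow> nat) set" where
  "Expo = {T. \<exists>c::nat. \<exists>g \<in> O(\<lambda>n. real n ^ c). \<forall>n. real (T n) \<le> 2 powr g n}"

definition computable_in :: "(nat \<Rightarrow> nat) set \<Rightarrow> (bool list \<Rightarrow> bool list) \<Rightarrow> bool" where
  "computable_in C f \<longleftrightarrow> (\<exists>T \<in> C. \<exists>M. computes_within M f T)"

definition EXP :: "bool list set set" where
  "EXP = {L. \<exists>T \<in> Expo. \<exists>M. deterministic M \<and> decides_within M L T}"

definition NEXP :: "bool list set set" where
  "NEXP = {L. \<exists>T \<in> Expo. \<exists>M. decides_within M L T}"

definition CoNEXP :: "bool list set set" where
  "CoNEXP = {L. - L \<in> NEXP}"

section \<open>Propositional proof systems\<close>

datatype pform = Atom nat | PNot pform | PAnd pform pform | POr pform pform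

fun psat :: "(nat \<Rightarrow> bool) \<Rightarrow> pform \<Rightarrow> bool" where
  "psat v (Atom i) \<longleftrightarrow> v i"
| "psat v (PNot A) \<longleftrightarrow> \<not> psat v A"
| "psat v (PAnd A B) \<longleftrightarrow> psat v A \<and> psat v B"
| "psat v (POr A B) \<longleftrightarrow> psat v A \<or> psat v B"

text \<open>Least significant bit first.\<close>

fun bits :: "nat \<Rightarrow> bool list" where
  "bits n = (if n = 0 then [] else odd n # bits (n div 2))"

declare bits.simps [simp del]

text \<open>Formulas as binary strings in prefix notation: a tag of two bits for the outermost
  constructor, and atom indices in binary, each bit preceded by \<open>True\<close> and the last one
  followed by \<open>False\<close>.\<close>

fun encode :: "pform \<Rightarrow> bool list" where
  "encode (Atom i) = [False, False] @ concat (map (\<lambda>b. [True, b]) (bits i)) @ [False]"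
| "encode (PNot A) = [False, True] @ encode A"
| "encode (PAnd A B) = [True, False] @ encode A @ encode B"
| "encode (POr A B) = [True, True] @ encode A @ encode B"

definition TAUT :: "bool list set" where
  "TAUT = encode ` {A. \<forall>v. psat v A}"

definition proof_system :: "(bool list \<Rightarrow> bool list) \<Rightarrow> bool" where
  "proof_system P \<longleftrightarrow> computable_in Poly P \<and> range P = TAUT"

definition simulates ::
    "(nat \<Rightarrow> nat) set \<Rightarrow> (bool list \<Rightarrow> bool list) \<Rightarrow> (bool list \<Rightarrow> bool list) \<Rightarrow> bool" where
  "simulates C P Q \<longleftrightarrow> (\<exists>f. computable_in C f \<and> (\<forall>\<pi>. P (f \<pi>) = Q \<pi>))"

definition nonuniformly_simulates ::
    "(nat \<Rightarrow> nat) set \<Rightarrow> (bool list \<Rightarrow> bool list) \<Rightarrow> (bool list \<Rightarrow> bool list) \<Rightarrow> bool" where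
  "nonuniformly_simulates C P Q \<longleftrightarrow>
     (\<exists>h \<in> C. \<forall>\<pi> \<theta>. Q \<pi> = \<theta> \<longrightarrow> (\<exists>\<pi>'. length \<pi>' \<le> h (length \<pi>) \<and> P \<pi>' = \<theta>))"

definition optimal :: "(nat \<Rightarrow> nat) set \<Rightarrow> (bool list \<Rightarrow> bool list) \<Rightarrow> bool" where
  "optimal C P \<longleftrightarrow> proof_system P \<and> (\<forall>Q. proof_system Q \<longrightarrow> simulates C P Q)"

definition nonuniform_optimal :: "(nat \<Rightarrow> nat) set \<Rightarrow> (bool list \<Rightarrow> bool list) \<Rightarrow> bool" where
  "nonuniform_optimal C P \<longleftrightarrow>
     proof_system P \<and> (\<forall>Q. proof_system Q \<longrightarrow> nonuniformly_simulates C P Q)"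

end

(*
 Let a ticket consist of a machine c and a bound N. "c outputs only tautologies on inputs of length
 at most N within N steps" is a coNP property of (c, 1^N). A proof system P that accepts certified
 tickets and then runs c on the rest of the proof simulates every proof system, at a cost determined
 by the smallest certificate. If N = 2^2^...^m is a tower that is coded by the small number m, the
 certificates come from NE_k = CoNE_k; if N is given in binary, they come from NEXP = CoNEXP. In the
 uniform cases the certificates can moreover be computed. For E_k this needs Buss's witnessing
 theorem (Delta^b_1 formulas of S^1_2 define polynomial-time sets), obtained here by forcing over the
 filters of functions that are definable from generic strings by polynomial-time functions:
 S^1_2 is forced, and a generic filter decides which of two Sigma^b_1 formulas has a witness.
*)
theory Submission
 imports Defs "HOL-Real_Asymp.Real_Asymp"
begin

section \<open>Polynomial time as an algebra of string functions\<close>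

section \<open>Polynomial domination\<close>

text \<open>The calculus \<open>prov\<close> is natural deduction with arbitrary detours, so
  witnesses cannot be read off derivations without normalising them. Forcing replaces this: every
  rule is sound for \<open>frc\<close>, which leaves only the axioms of S^1_2 to be forced. One
  generic string stands for all inputs at once, and this makes the resulting decision procedure
  uniform.

  Polynomial time is represented by the function algebra \<open>Fn\<close>. Machines occur only at
  its border: programs are compiled to machines, and \<open>UM\<close> interprets machines inside
  the algebra.

  An equality of classes at \<open>k\<close> is used at \<open>k + 2\<close>. One level is spent on
  coding a string of length \<open>N\<close> by the number \<open>2 ^ N\<close>. The other gives
  \<open>N = 2 ^ X\<close> with \<open>X = tower k m\<close>, where \<open>m\<close> has to name a
  machine besides a length. This turns the iterated logarithm \<open>y\<close> of the required bound
  into \<open>a * y + b\<close>. After the exponentials the overshoot need not stay polynomial, but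
  \<open>X ^ 2 \<le> n + K\<close> holds; this is the origin of the subexponential bound. Binary
  bounds do not overshoot: their cost is exponential time on inputs of length O(log n), hence
  quasipolynomial.\<close>

definition pb :: "('a => nat) => ('a => nat) => bool" where
 "pb F S \<longleftrightarrow> (\<exists>C. \<forall>x. F x \<le> (S x + C) ^ C)"

text \<open>One constant \<open>C\<close> serves as additive shift and as exponent. Since the bound
  grows with \<open>C\<close>, several dominations can share one constant; the shift keeps the bound
  meaningful where the measure is 0.\<close>

lemma power_bound_mono:
 fixes s t :: nat
 assumes "s \<le> t" "C \<le> D"
 shows "(s + C) ^ C \<le> (t + D) ^ D"
proof (cases "D = 0")
 case False
 have "(s + C) ^ C \<le> (t + D) ^ C" using assms by (intro power_mono) auto
 also have "\<dots> \<le> (t + D) ^ D" using assms False by (intro power_increasing) auto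
 finally show ?thesis .
qed (use assms in auto)

lemma pbI: "(\<And>x. F x \<le> (S x + C) ^ C) ==> pb F S"
 unfolding pb_def by blast

lemma pb_refl: "pb S S"
 by (rule pbI[where C = 1]) simp

lemma pb_mono:
 assumes "pb G S" "\<And>x. F x \<le> G x" shows "pb F S"
 using assms unfolding pb_def by (meson le_trans)

lemma pb_le: "(\<And>x. F x \<le> S x) ==> pb F S"
 using pb_mono pb_refl by blast

lemma pb_const: "pb (%_. c) S"
proof (rule pbI[where C = "Suc c"])
 fix x
 have "c \<le> (S x + Suc c) ^ 1" by simp
 also have "\<dots> \<le> (S x + Suc c) ^ Suc c" by (rule power_increasing) auto
 finally show "c \<le> (S x + Suc c) ^ Suc c" .
qed

lemma pb_two:
 assumes "pb F S" "pb G S"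
 obtains C where "\<And>x. F x \<le> (S x + C) ^ C" "\<And>x. G x \<le> (S x + C) ^ C" "C \<ge> 2"
proof -
 obtain A B where A: "\<And>x. F x \<le> (S x + A) ^ A" and B: "\<And>x. G x \<le> (S x + B) ^ B"
  using assms unfolding pb_def by blast
 show ?thesis
 proof (rule that[of "A + B + 2"])
  show "F x \<le> (S x + (A + B + 2)) ^ (A + B + 2)" for x
   using A[of x] power_bound_mono[of "S x" "S x" A "A + B + 2"] by (meson le_add1 le_trans order_refl add.assoc)
  show "G x \<le> (S x + (A + B + 2)) ^ (A + B + 2)" for x
   using B[of x] power_bound_mono[of "S x" "S x" B "A + B + 2"] by (meson le_add1 le_add2 le_trans order_refl)
 qed auto
qed

lemma pb_add:
 assumes "pb F S" "pb G S" shows "pb (%x. F x + G x) S"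
proof -
 obtain C where C: "\<And>x. F x \<le> (S x + C) ^ C" "\<And>x. G x \<le> (S x + C) ^ C" "C \<ge> 2"
  using pb_two[OF assms] by metis
 show ?thesis
 proof (rule pbI[where C = "Suc C"])
  fix x
  have "F x + G x \<le> 2 * (S x + C) ^ C" using C(1,2)[of x] by simp
  also have "\<dots> \<le> (S x + C) * (S x + C) ^ C" using C(3) by (intro mult_right_mono) auto
  also have "\<dots> = (S x + C) ^ Suc C" by simp
  also have "\<dots> \<le> (S x + Suc C) ^ Suc C" by (intro power_mono) auto
  finally show "F x + G x \<le> (S x + Suc C) ^ Suc C" .
 qed
qed

lemma pb_mult:
 assumes "pb F S" "pb G S" shows "pb (%x. F x * G x) S"
proof -
 obtain C where C: "\<And>x. F x \<le> (S x + C) ^ C" "\<And>x. G x \<le> (S x + C) ^ C" "C \<ge> 2"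
  using pb_two[OF assms] by metis
 show ?thesis
 proof (rule pbI[where C = "C + C"])
  fix x
  have "F x * G x \<le> (S x + C) ^ C * (S x + C) ^ C" using C(1,2)[of x] by (intro mult_mono) auto
  also have "\<dots> = (S x + C) ^ (C + C)" by (simp add: power_add)
  also have "\<dots> \<le> (S x + (C + C)) ^ (C + C)" by (intro power_mono) auto
  finally show "F x * G x \<le> (S x + (C + C)) ^ (C + C)" .
 qed
qed

lemma pb_Suc: "pb F S ==> pb (%x. Suc (F x)) S"
 using pb_add[OF _ pb_const[of 1]] by simp

lemma pb_power: "pb F S ==> pb (%x. F x ^ n) S"
 by (induction n) (auto intro: pb_const pb_mult)

lemma pb_trans:
 assumes "pb F G" "pb G S" shows "pb F S"
proof -
 obtain C where C: "\<And>x. F x \<le> (G x + C) ^ C" using assms(1) unfolding pb_def by blast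
 have "pb (%x. (G x + C) ^ C) S" by (intro pb_power pb_add assms pb_const)
 then show ?thesis by (rule pb_mono) (rule C)
qed

lemma pb_comp: "pb F S ==> pb (%x. F (g x)) (%x. S (g x))"
 unfolding pb_def by blast

lemmas pb_intros = pb_refl pb_const pb_Suc pb_add pb_mult pb_power

section \<open>Strings and pairing\<close>

type_synonym str = "bool list"

text \<open>The length of \<open>a\<close> is written in unary in front, so no escape symbols are
  needed. The price is that \<open>a\<close> counts twice in the length, hence nested pairs keep the
  long component on the right.\<close>

definition pr :: "str => str => str" where
 "pr a b = replicate (length a) True @ False # a @ b"

definition plen :: "str => nat" where
 "plen x = length (takeWhile id x)"

definition prest :: "str => str" where
 "prest x = tl (dropWhile id x)"

definition sfst :: "str => str" where
 "sfst x = take (plen x) (prest x)"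

definition ssnd :: "str => str" where
 "ssnd x = drop (plen x) (prest x)"

lemma takeWhile_pr: "takeWhile id (replicate n True @ False # xs) = replicate n True"
 by (induction n) auto

lemma dropWhile_pr: "dropWhile id (replicate n True @ False # xs) = False # xs"
 by (induction n) auto

lemma sfst_pr [simp]: "sfst (pr a b) = a" and ssnd_pr [simp]: "ssnd (pr a b) = b"
 by (simp_all add: sfst_def ssnd_def plen_def prest_def pr_def takeWhile_pr dropWhile_pr)

lemma pr_eq_iff [simp]: "pr a b = pr c d \<longleftrightarrow> a = c & b = d"
 by (metis sfst_pr ssnd_pr)

lemma length_pr [simp]: "length (pr a b) = 2 * length a + length b + 1"
 by (simp add: pr_def)

lemma pr_neq_Nil [simp]: "pr a b \<noteq> []" "[] \<noteq> pr a b"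
 by (auto simp: pr_def)

lemma sfst_Nil [simp]: "sfst [] = []" and ssnd_Nil [simp]: "ssnd [] = []"
 by (simp_all add: sfst_def ssnd_def prest_def)

lemma string_cases:
 obtains (ones) n where "x = replicate n True"
 | (split) n r where "x = replicate n True @ False # r"
proof (induction x arbitrary: thesis)
 case Nil
 show ?case by (rule Nil(1)[of 0]) simp
next
 case (Cons b x)
 show ?case
 proof (cases b)
  case True
  show ?thesis
  proof (rule Cons.IH)
   show "x = replicate n True ==> thesis" for n
    using Cons.prems(1)[of "Suc n"] True by simp
   show "x = replicate n True @ False # r ==> thesis" for n r
    using Cons.prems(2)[of "Suc n" r] True by simp
  qed
 next
  case False
  then show ?thesis using Cons.prems(2)[of 0 x] by simp
 qed
qed

lemma sfst_ones [simp]: "sfst (replicate n True) = []" and ssnd_ones [simp]: "ssnd (replicate n True) = []"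
 by (simp_all add: sfst_def ssnd_def prest_def)

lemma sfst_split [simp]: "sfst (replicate n True @ False # r) = take n r"
 and ssnd_split [simp]: "ssnd (replicate n True @ False # r) = drop n r"
 by (simp_all add: sfst_def ssnd_def prest_def plen_def takeWhile_pr dropWhile_pr)

text \<open>This covers strings that are not pairs as well, so programs may project arbitrary input
  without checking its format first.\<close>

lemma length_halves: "2 * length (sfst x) + length (ssnd x) \<le> length x"
 by (cases x rule: string_cases) auto

lemma length_sfst: "length (sfst x) \<le> length x" and length_ssnd: "length (ssnd x) \<le> length x"
 using length_halves[of x] by linarith+

lemma length_ssnd_less: "x \<noteq> [] ==> length (ssnd x) < length x"
 by (cases x rule: string_cases) auto

definition tt :: "bool => str" where
 "tt b = (if b then [True] else [])"

lemma tt_eq_Nil [simp]: "tt b = [] \<longleftrightarrow> \<not> b"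
 by (simp add: tt_def)

lemma length_tt: "length (tt b) \<le> 1"
 by (simp add: tt_def)

section \<open>String functions with bounded intermediate results\<close>

text \<open>\<open>Fn f S\<close>: the function \<open>f\<close> is given by a program whose intermediate results on \<open>x\<close>, and
 the number of iterations, are polynomial in \<open>S x\<close>. For \<open>S = length\<close> these are the
 polynomial-time functions.\<close>

inductive Fn :: "(str => str) => (str => nat) => bool" where
 Fn_id: "Fn (%x. x) length"
| Fn_nil: "Fn (%_. []) length"
| Fn_cons: "Fn (%x. b # x) length"
| Fn_tl: "Fn tl length"
| Fn_hd: "Fn (%x. tt (x \<noteq> [] & hd x)) length"
| Fn_fst: "Fn sfst length"
| Fn_snd: "Fn ssnd length"
| Fn_pair: "Fn f S ==> Fn g S ==> Fn (%x. pr (f x) (g x)) S"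
| Fn_cond: "Fn f S ==> Fn g S ==> Fn h S ==> Fn (%x. if f x = [] then g x else h x) S"
| Fn_comp: "Fn f S' ==> Fn g S ==> pb (%x. S' (g x)) S ==> Fn (%x. f (g x)) S"
| Fn_iter: "Fn f S' ==> Fn a S ==> Fn b S ==>
  (\<And>x i. i \<le> length (b x) ==> S' ((f ^^ i) (a x)) \<le> (S x + C) ^ C) ==>
  Fn (%x. (f ^^ length (b x)) (a x)) S"
| Fn_weaken: "Fn f S' ==> pb S' S ==> Fn f S"

text \<open>The first conjunct is carried along for \<open>Fn_iter\<close>: it turns the bound on
  the measure of the iterates into a bound on their length.\<close>

lemma Fn_bound:
 assumes "Fn f S" shows "pb length S & pb (%x. length (f x)) S"
 using assms
proof induction
 case (Fn_pair f S g)
 then show ?case by (auto intro!: pb_intros)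
next
 case (Fn_cond f S g h)
 then have "pb (%x. length (g x) + length (h x)) S" by (auto intro: pb_add)
 then show ?case using Fn_cond by (auto elim: pb_mono)
next
 case (Fn_comp f S' g S)
 then show ?case using pb_trans[OF pb_comp[of "%x. length (f x)" S' g]] by auto
next
 case (Fn_iter f S' a S b C)
 obtain D where D: "\<And>x. length x \<le> (S' x + D) ^ D" using Fn_iter.IH(1) unfolding pb_def by blast
 have "pb (%x. ((S x + C) ^ C + D) ^ D) S" by (intro pb_intros)
 then have "pb (%x. length ((f ^^ length (b x)) (a x))) S"
 proof (rule pb_mono)
  fix x
  show "length ((f ^^ length (b x)) (a x)) \<le> ((S x + C) ^ C + D) ^ D"
   using D[of "(f ^^ length (b x)) (a x)"] Fn_iter.hyps(4)[of "length (b x)" x]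
   by (meson add_le_mono1 le_trans order_refl power_mono zero_le)
 qed
 then show ?case using Fn_iter.IH by blast
next
 case (Fn_weaken f S' S)
 then show ?case using pb_trans by blast
next
 case (Fn_cons b)
 then show ?case using pb_Suc[OF pb_refl] by (auto intro: pb_refl)
next
 case Fn_hd
 have "pb (%x::str. length (tt (x \<noteq> [] & hd x))) length"
  by (rule pb_mono[OF pb_const[of 1]]) (rule length_tt)
 then show ?case using pb_refl by blast
qed (auto intro!: pb_refl pb_const pb_le length_sfst length_ssnd)

abbreviation PF :: "(str => str) => bool" where
 "PF f \<equiv> Fn f length"

lemma PF_bound: "PF f ==> pb (%x. length (f x)) length"
 using Fn_bound by blast

lemma Fn_PF_comp:
 assumes "PF f" "Fn g S" shows "Fn (%x. f (g x)) S"
 using Fn_comp[OF assms] Fn_bound[OF assms(2)] by blast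

lemma PF_const: "PF (%_. c)"
 by (induction c) (auto intro: Fn_nil Fn_PF_comp[OF Fn_cons])

lemma PF_comp: "PF f ==> PF g ==> PF (%x. f (g x))"
 by (rule Fn_PF_comp)

lemmas PF_cons = PF_comp[OF Fn_cons]
lemmas PF_tl = PF_comp[OF Fn_tl]
lemmas PF_sfst = PF_comp[OF Fn_fst]
lemmas PF_ssnd = PF_comp[OF Fn_snd]
lemmas PF_hd = PF_comp[OF Fn_hd]

lemma PF_app_const: "PF f ==> PF (%x. c @ f x)"
 by (induction c) (auto intro: PF_cons)

definition PP :: "(str => bool) => bool" where
 "PP P \<longleftrightarrow> PF (%x. tt (P x))"

lemma PP_neq_Nil: assumes "PF f" shows "PP (%x. f x \<noteq> [])"
proof -
 have "PF (%x. if f x = [] then [] else [True])"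
  by (rule Fn_cond[OF assms PF_const PF_const])
 moreover have "(%x. if f x = [] then [] else [True]) = (%x. tt (f x \<noteq> []))"
  by (auto simp: tt_def)
 ultimately show ?thesis unfolding PP_def by metis
qed

lemma PF_if: assumes "PP P" "PF f" "PF g" shows "PF (%x. if P x then f x else g x)"
proof -
 have "PF (%x. if tt (P x) = [] then g x else f x)"
  using assms unfolding PP_def by (intro Fn_cond)
 moreover have "(%x. if tt (P x) = [] then g x else f x) = (%x. if P x then f x else g x)" by auto
 ultimately show ?thesis by metis
qed

lemma PP_if: assumes "PP P" "PP Q" "PP R" shows "PP (%x. if P x then Q x else R x)"
proof -
 have "PF (%x. if P x then tt (Q x) else tt (R x))"
  using assms by (intro PF_if) (auto simp: PP_def)
 then show ?thesis unfolding PP_def by (simp add: if_distrib[of tt])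
qed

lemma PP_const: "PP (%_. b)"
 unfolding PP_def by (rule PF_const)

lemma PP_cong: "PP P ==> (\<And>x. P x = Q x) ==> PP Q"
 by (drule ext) simp

lemma PP_not: "PP P ==> PP (%x. \<not> P x)"
 by (rule PP_cong[OF PP_if[of P "%_. False" "%_. True"]]) (auto intro: PP_const)

lemma PP_conj: "PP P ==> PP Q ==> PP (%x. P x & Q x)"
 by (rule PP_cong[OF PP_if[of P Q "%_. False"]]) (auto intro: PP_const)

lemma PP_disj: "PP P ==> PP Q ==> PP (%x. P x \<or> Q x)"
 by (rule PP_cong[OF PP_if[of P "%_. True" Q]]) (auto intro: PP_const)

lemma PP_imp: "PP P ==> PP Q ==> PP (%x. P x --> Q x)"
 by (rule PP_cong[OF PP_if[of P Q "%_. True"]]) (auto intro: PP_const)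

lemma PP_iff: "PP P ==> PP Q ==> PP (%x. P x = Q x)"
 by (rule PP_cong[OF PP_if[of P Q "%x. \<not> Q x"]]) (auto intro: PP_not)

lemma PP_eq_Nil: "PF f ==> PP (%x. f x = [])"
 using PP_not[OF PP_neq_Nil] by simp

lemma PP_hd: "PF f ==> PP (%x. f x \<noteq> [] & hd (f x))"
 unfolding PP_def by (rule PF_hd)

lemma PP_comp: "PP P ==> PF f ==> PP (%x. P (f x))"
 unfolding PP_def by (rule PF_comp)

lemma PF_tt: "PP P ==> PF (%x. tt (P x))"
 unfolding PP_def .

lemmas PF_intros = Fn_id PF_const PF_cons PF_tl PF_sfst PF_ssnd Fn_pair PF_if PF_tt PF_app_const
 PP_const PP_not PP_conj PP_disj PP_imp PP_if PP_eq_Nil PP_neq_Nil PP_hd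

section \<open>Unary recursion\<close>

abbreviation U :: "nat => str" where
 "U n \<equiv> replicate n False"

text \<open>Recursion becomes iteration of a step on triples of parameter, counter and value. The
  counter is a string of \<open>False\<close>, so that \<open>H\<close> can inspect it.\<close>

lemma PF_rec:
 assumes r0: "\<And>c. r c 0 = g c" and rS: "\<And>c n. r c (Suc n) = H c (U n) (r c n)"
  and g: "PF g" and H: "PF (%x. H (sfst x) (sfst (ssnd x)) (ssnd (ssnd x)))"
  and bound: "pb (%(c, n). length (r c n)) (%(c, n). length c + n)"
  and a: "PF a" and b: "PF b"
 shows "PF (%x. r (a x) (length (b x)))"
proof -
 define F where "F z = pr (sfst z) (pr (False # sfst (ssnd z))
   (H (sfst z) (sfst (ssnd z)) (ssnd (ssnd z))))" for z
 have F: "PF F" unfolding F_def by (intro PF_intros H)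
 have it: "(F ^^ i) (pr c (pr [] (g c))) = pr c (pr (U i) (r c i))" for c i
  by (induction i) (auto simp: r0 rS F_def)
 obtain C where C: "\<And>c n. length (r c n) \<le> (length c + n + C) ^ C"
  using bound unfolding pb_def by force
 have "pb (%x. 2 * length (a x) + (2 * length (b x) + 2 + (length (a x) + length (b x) + C) ^ C)) length"
  by (intro pb_intros PF_bound a b)
 then obtain D where D: "\<And>x. 2 * length (a x) + (2 * length (b x) + 2 + (length (a x) + length (b x) + C) ^ C)
   \<le> (length x + D) ^ D" unfolding pb_def by blast
 have "PF (%x. (F ^^ length (b x)) (pr (a x) (pr [] (g (a x)))))"
 proof (rule Fn_iter[OF F])
  show "PF (%x. pr (a x) (pr [] (g (a x))))" by (intro PF_intros a PF_comp[OF g])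
  show "PF b" by (rule b)
  fix x i assume i: "i \<le> length (b x)"
  have "length (r (a x) i) \<le> (length (a x) + length (b x) + C) ^ C"
   using C[of "a x" i] i by (meson add_le_mono add_le_mono1 le_trans order_refl power_mono zero_le)
  then have "length ((F ^^ i) (pr (a x) (pr [] (g (a x))))) \<le>
   2 * length (a x) + (2 * length (b x) + 2 + (length (a x) + length (b x) + C) ^ C)"
   using i by (simp add: it)
  then show "length ((F ^^ i) (pr (a x) (pr [] (g (a x))))) \<le> (length x + D) ^ D"
   using D le_trans by blast
 qed
 from PF_ssnd[OF PF_ssnd[OF this]] show ?thesis by (simp add: it)
qed

lemma PF_rec_binary:
 assumes "PF (%x. f (sfst x) (ssnd x))" "PF a" "PF b"
 shows "PF (%x. f (a x) (b x))"
 using PF_comp[OF assms(1) Fn_pair[OF assms(2,3)]] by simp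

section \<open>Compilation of the algebra to deterministic and to guessing Turing machines\<close>

section \<open>A stack language for Turing machines\<close>

text \<open>Every tape is used as a stack growing to the left. A state consists of the stack contents and
 the bases: the base of a tape is the first cell to the right of its stack.\<close>

datatype cmd =
  Skip
 | Push nat bool
 | Pop nat
 | Shift nat move
 | Seq cmd cmd
 | Test nat "nat => bool" cmd cmd
 | While nat "nat => bool" cmd

type_synonym state = "(nat => str) \<times> (nat => int)"

definition top_symbol :: "str => nat" where
 "top_symbol xs = (case xs of [] => 0 | b # _ => bit_symbol b)"

lemma top_symbol_simps [simp]: "top_symbol [] = 0" "top_symbol (b # xs) = bit_symbol b"
 by (simp_all add: top_symbol_def)

lemma bit_symbol_simps [simp]: "bit_symbol True = 2" "bit_symbol False = 1" "bit_symbol b \<noteq> 0" "0 < bit_symbol b"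
 by (simp_all add: bit_symbol_def)

lemma bit_symbol_2 [simp]: "bit_symbol b = 2 \<longleftrightarrow> b" "bit_symbol b = Suc 0 \<longleftrightarrow> \<not> b"
 by (simp_all add: bit_symbol_def)

lemma top_symbol_0 [simp]: "top_symbol xs = 0 \<longleftrightarrow> xs = []" "0 < top_symbol xs \<longleftrightarrow> xs \<noteq> []"
 by (cases xs; simp)+

text \<open>\<open>Shift\<close> is enabled only on an empty stack, where head and base coincide, so
  that moving the head moves the base. \<open>Push\<close> costs two machine steps: move left, then
  write.\<close>

inductive exec :: "cmd => state => nat => state => bool" where
 exec_Skip: "exec Skip s 1 s"
| exec_Push: "exec (Push r b) (sg, bt) 2 (sg(r := b # sg r), bt)"
| exec_Pop: "exec (Pop r) (sg, bt) 1 (sg(r := tl (sg r)), bt)"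
| exec_Shift: "sg r = [] ==> exec (Shift r d) (sg, bt) 1 (sg, bt(r := bt r + offset d))"
| exec_Seq: "exec c1 s t1 s1 ==> exec c2 s1 t2 s2 ==> exec (Seq c1 c2) s (t1 + t2) s2"
| exec_TestT: "P (top_symbol (fst s r)) ==> exec c1 s t s' ==> exec (Test r P c1 c2) s (1 + t) s'"
| exec_TestF: "\<not> P (top_symbol (fst s r)) ==> exec c2 s t s' ==> exec (Test r P c1 c2) s (1 + t) s'"
| exec_WhileT: "P (top_symbol (fst s r)) ==> exec c s t1 s1 ==> exec (While r P c) s1 t2 s2 ==>
  exec (While r P c) s (1 + (t1 + t2)) s2"
| exec_WhileF: "\<not> P (top_symbol (fst s r)) ==> exec (While r P c) s 1 s"

fun regs :: "cmd => nat set" where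
 "regs Skip = {}"
| "regs (Push r b) = {r}"
| "regs (Pop r) = {r}"
| "regs (Shift r d) = {r}"
| "regs (Seq c1 c2) = regs c1 \<union> regs c2"
| "regs (Test r P c1 c2) = insert r (regs c1 \<union> regs c2)"
| "regs (While r P c) = insert r (regs c)"

fun csize :: "cmd => nat" where
 "csize Skip = 1"
| "csize (Push r b) = 2"
| "csize (Pop r) = 1"
| "csize (Shift r d) = 1"
| "csize (Seq c1 c2) = csize c1 + csize c2"
| "csize (Test r P c1 c2) = Suc (csize c1 + csize c2)"
| "csize (While r P c) = Suc (csize c)"

lemma csize_pos: "csize c > 0"
 by (induction c) auto

type_synonym instr = "nat \<times> nat list \<times> nat \<times> (nat \<times> move) list"

text \<open>Only tape \<open>r\<close> is inspected and changed. Instructions mention the symbols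
  under all heads, so a node contains one instruction for every possible reading of the other
  tapes.\<close>

definition node :: "nat => nat => nat => (nat => nat \<times> move \<times> nat) => instr set" where
 "node \<tau> q r f = (%rs. (q, rs, snd (snd (f (rs ! r))),
   (map (%s. (s, MStay)) rs)[r := (fst (f (rs ! r)), fst (snd (f (rs ! r))))])) `
   {rs. set rs \<subseteq> {0, 1, 2} & length rs = \<tau>}"

text \<open>A command occupies the \<open>csize c\<close> consecutive states from \<open>q\<close>
  on, and control leaves it in state \<open>e\<close>; the body of a loop is given the loop head as
  its exit.\<close>

fun code :: "nat => cmd => nat => nat => instr set" where
 "code \<tau> Skip q e = node \<tau> q 0 (%s. (s, MStay, e))"
| "code \<tau> (Push r b) q e = node \<tau> q r (%s. (s, MLeft, Suc q)) \<union>
   node \<tau> (Suc q) r (%_. (bit_symbol b, MStay, e))"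
| "code \<tau> (Pop r) q e = node \<tau> q r (%s. (0, if s = 0 then MStay else MRight, e))"
| "code \<tau> (Shift r d) q e = node \<tau> q r (%s. (s, d, e))"
| "code \<tau> (Seq c1 c2) q e = code \<tau> c1 q (q + csize c1) \<union> code \<tau> c2 (q + csize c1) e"
| "code \<tau> (Test r P c1 c2) q e =
   node \<tau> q r (%s. (s, MStay, if P s then Suc q else Suc q + csize c1)) \<union>
   code \<tau> c1 (Suc q) e \<union> code \<tau> c2 (Suc q + csize c1) e"
| "code \<tau> (While r P c) q e =
   node \<tau> q r (%s. (s, MStay, if P s then Suc q else e)) \<union> code \<tau> c (Suc q) q"

lemma node_state: "i \<in> node \<tau> q r f ==> fst i = q"
 by (auto simp: node_def)

lemma code_range: "i \<in> code \<tau> c q e ==> q \<le> fst i & fst i < q + csize c"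
 by (induction c arbitrary: q e) (force dest: node_state)+

lemma finite_node: "finite (node \<tau> q r f)"
 unfolding node_def by (intro finite_imageI finite_lists_length_eq) auto

definition wf_instrs :: "nat => instr set => bool" where
 "wf_instrs \<tau> I \<longleftrightarrow> finite I & (\<forall>(q, rs, q', as) \<in> I. length rs = \<tau> & length as = \<tau>)"

lemma wf_Un: "wf_instrs \<tau> A ==> wf_instrs \<tau> B ==> wf_instrs \<tau> (A \<union> B)"
 by (auto simp: wf_instrs_def)

lemma wf_node: "wf_instrs \<tau> (node \<tau> q r f)"
 using finite_node by (auto simp: wf_instrs_def node_def)

lemma wf_code: "wf_instrs \<tau> (code \<tau> c q e)"
 by (induction c arbitrary: q e) (auto intro!: wf_Un wf_node)

definition det_instrs :: "instr set => bool" where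
 "det_instrs I \<longleftrightarrow> (\<forall>q rs a b. (q, rs, a) \<in> I & (q, rs, b) \<in> I --> a = b)"

lemma det_Un:
 assumes "det_instrs A" "det_instrs B" "fst ` A \<inter> fst ` B = {}"
 shows "det_instrs (A \<union> B)"
 using assms unfolding det_instrs_def by (fastforce simp: disjoint_iff image_iff)

lemma det_node: "det_instrs (node \<tau> q r f)"
 by (auto simp: det_instrs_def node_def)

lemma node_states: "fst ` node \<tau> q r f \<subseteq> {q}"
 using node_state by blast

lemma code_states: "fst ` code \<tau> c q e \<subseteq> {q..<q + csize c}"
 using code_range by fastforce

text \<open>Subcommands live on disjoint intervals of states, and within one node the reading
  determines the instruction.\<close>

lemma det_code: "det_instrs (code \<tau> c q e)"
proof (induction c arbitrary: q e)
 case (Push r b)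
 show ?case unfolding code.simps
  by (rule det_Un[OF det_node det_node])
   (use node_states[of \<tau> q] node_states[of \<tau> "Suc q"] in fastforce)
next
 case (Seq c1 c2)
 show ?case unfolding code.simps
  by (rule det_Un[OF Seq]) (use code_states[of \<tau> c1] code_states[of \<tau> c2] in fastforce)
next
 case (Test r P c1 c2)
 show ?case unfolding code.simps
 proof (intro det_Un det_node Test)
  show "fst ` node \<tau> q r (%s. (s, MStay, if P s then Suc q else Suc q + csize c1)) \<inter>
    fst ` code \<tau> c1 (Suc q) e = {}"
   using node_states code_states[of \<tau> c1 "Suc q"] by fastforce
  show "fst ` (node \<tau> q r (%s. (s, MStay, if P s then Suc q else Suc q + csize c1)) \<union>
    code \<tau> c1 (Suc q) e) \<inter> fst ` code \<tau> c2 (Suc q + csize c1) e = {}"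
   using node_states[of \<tau> q r "%s. (s, MStay, if P s then Suc q else Suc q + csize c1)"]
    code_states[of \<tau> c1 "Suc q" e] code_states[of \<tau> c2 "Suc q + csize c1" e]
   by (fastforce simp: image_Un)
 qed
next
 case (While r P c)
 show ?case unfolding code.simps
  by (rule det_Un[OF det_node While]) (use node_states code_states[of \<tau> c "Suc q"] in fastforce)
qed (auto simp: det_node)

section \<open>Correctness of the compilation\<close>

definition tape :: "str => int => (int => nat) \<times> int" where
 "tape xs bt = (%i. let k = i - (bt - int (length xs)) in
   if 0 \<le> k & k < int (length xs) then bit_symbol (xs ! nat k) else 0, bt - int (length xs))"

definition conf :: "nat => nat => state => config" where
 "conf \<tau> q s = (q, map (%r. tape (fst s r) (snd s r)) [0..<\<tau>])"

lemma tape_read: "fst (tape xs bt) (snd (tape xs bt)) = top_symbol xs"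
 by (cases xs) (auto simp: tape_def Let_def)

lemma act_stay: "act (fst t (snd t), MStay) t = t"
 by (cases t) auto

lemma nat_pred: "nat (x + (1 + n) - bt) - Suc 0 = nat (x + n - bt)"
 by arith

lemma tape_push: "act (bit_symbol b, MStay) (act (top_symbol xs, MLeft) (tape xs bt)) = tape (b # xs) bt"
proof -
 have "(case tape xs bt of (tp, h) => (tp(h := top_symbol xs, h - 1 := bit_symbol b), h - 1)) = tape (b # xs) bt"
  using tape_read[of xs bt]
  by (auto simp: tape_def Let_def fun_eq_iff nth_Cons' nat_diff_distrib' nat_eq_iff algebra_simps)
    (auto simp: nat_pred)
 then show ?thesis by (cases "tape xs bt") simp
qed

lemma tape_pop: "act (0, if top_symbol xs = 0 then MStay else MRight) (tape xs bt) = tape (tl xs) bt"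
proof (cases xs)
 case (Cons b ys)
 have "(case tape xs bt of (tp, h) => (tp(h := 0), h + 1)) = tape ys bt"
  unfolding Cons by (auto simp: tape_def Let_def fun_eq_iff nth_Cons' algebra_simps nat_pred)
 then show ?thesis using Cons by (cases "tape xs bt") simp
qed (auto simp: tape_def Let_def fun_eq_iff)

lemma tape_shift: "act (0, d) (tape [] bt) = tape [] (bt + offset d)"
 by (auto simp: tape_def Let_def fun_eq_iff)

text \<open>Uniqueness of the successor is recorded stepwise rather than for the whole machine, so
  that deterministic stretches can be recognised inside a machine that also guesses.\<close>

definition dstep :: "machine => config => config => bool" where
 "dstep M c c' \<longleftrightarrow> step M c c' & (\<forall>c''. step M c c'' --> c'' = c')"

definition at_state :: "machine => nat => instr set" where
 "at_state M q = {i \<in> instrs M. fst i = q}"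

definition reads :: "((int => nat) \<times> int) list => nat list" where
 "reads ts = map (%(tp, h). tp h) ts"

lemma map2_act_stay: "map2 act (map (%s. (s, MStay)) (reads ts)) ts = ts"
 by (induction ts) (auto simp: reads_def)

lemma node_apply:
 assumes "r < length ts"
 shows "map2 act ((map (%s. (s, MStay)) (reads ts))[r := (w, d)]) ts = ts[r := act (w, d) (ts ! r)]"
proof (rule nth_equalityI)
 fix i assume i: "i < length (map2 act ((map (%s. (s, MStay)) (reads ts))[r := (w, d)]) ts)"
 then have il: "i < length ts" by (simp add: reads_def)
 have "map2 act (map (%s. (s, MStay)) (reads ts)) ts ! i = ts ! i" by (simp add: map2_act_stay)
 then show "map2 act ((map (%s. (s, MStay)) (reads ts))[r := (w, d)]) ts ! i = ts[r := act (w, d) (ts ! r)] ! i"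
  using il assms by (cases "i = r") (auto simp: reads_def nth_list_update)
qed (simp add: reads_def)

lemma node_step:
 assumes M: "at_state M q = node \<tau> q r f" and ts: "length ts = \<tau>" "r < \<tau>" "set (reads ts) \<subseteq> {0, 1, 2}"
  and f: "f (reads ts ! r) = (w, d, q')"
 shows "dstep M (q, ts) (q', ts[r := act (w, d) (ts ! r)])"
proof -
 have *: "(q, reads ts, q'', as) \<in> instrs M \<longleftrightarrow> q'' = q' & as = (map (%s. (s, MStay)) (reads ts))[r := (w, d)]" for q'' as
 proof -
  have "(q, reads ts, q'', as) \<in> instrs M \<longleftrightarrow> (q, reads ts, q'', as) \<in> at_state M q"
   by (simp add: at_state_def)
  also have "\<dots> \<longleftrightarrow> q'' = q' & as = (map (%s. (s, MStay)) (reads ts))[r := (w, d)]"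
   unfolding M node_def using ts f by (auto simp: image_iff reads_def)
  finally show ?thesis .
 qed
 show ?thesis unfolding dstep_def step_def using * node_apply[of r ts w d] ts
  by (auto simp: reads_def[symmetric])
qed

lemma reads_conf: "reads (snd (conf \<tau> q s)) = map (%r. top_symbol (fst s r)) [0..<\<tau>]"
 using tape_read by (auto simp: reads_def conf_def split_beta)

lemma top_symbol_le: "xs \<noteq> [] ==> top_symbol xs \<noteq> Suc 0 ==> top_symbol xs = 2"
 by (cases xs) (auto simp: bit_symbol_def split: if_splits)

lemma conf_upd: "r < \<tau> ==> (snd (conf \<tau> q (sg, bt)))[r := tape xs b] = snd (conf \<tau> q' (sg(r := xs), bt(r := b)))"
 by (rule nth_equalityI) (auto simp: conf_def nth_list_update)

lemma conf_nth: "r < \<tau> ==> snd (conf \<tau> q s) ! r = tape (fst s r) (snd s r)"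
 by (simp add: conf_def)

lemma conf_surj: "(q', snd (conf \<tau> q s)) = conf \<tau> q' s"
 by (simp add: conf_def)

lemma conf_step:
 assumes M: "at_state M q = node \<tau> q r f" and r: "r < \<tau>" and f: "f (top_symbol (sg r)) = (w, d, q')"
  and w: "act (w, d) (tape (sg r) (bt r)) = tape xs b"
 shows "dstep M (conf \<tau> q (sg, bt)) (conf \<tau> q' (sg(r := xs), bt(r := b)))"
proof -
 have "dstep M (q, snd (conf \<tau> q (sg, bt))) (q', (snd (conf \<tau> q (sg, bt)))[r := act (w, d) (snd (conf \<tau> q (sg, bt)) ! r)])"
  by (rule node_step[OF M]) (use r f top_symbol_le in \<open>auto simp: reads_conf conf_def[of _ _ "(sg, bt)"]\<close>,
   auto simp: reads_def split_beta tape_read)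
 then show ?thesis using r w conf_upd[OF r, of q sg bt xs b q'] by (simp add: conf_nth conf_surj)

qed

lemma conf_goto:
 assumes "at_state M q = node \<tau> q r f" "r < \<tau>" "f (top_symbol (fst s r)) = (top_symbol (fst s r), MStay, q')"
 shows "dstep M (conf \<tau> q s) (conf \<tau> q' s)"
proof -
 obtain sg bt where s: "s = (sg, bt)" by fastforce
 have "act (top_symbol (sg r), MStay) (tape (sg r) (bt r)) = tape (sg r) (bt r)"
  using act_stay[of "tape (sg r) (bt r)"] by (simp add: tape_read)
 from conf_step[where sg = sg and bt = bt and q' = q', OF assms(1,2) _ this] show ?thesis
  using assms(3) s by simp
qed

text \<open>Only the states of the block are compared with the code. The same correctness proof then
  applies to a program placed anywhere in a larger machine.\<close>

definition emb :: "machine => nat => cmd => nat => nat => bool" where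
 "emb M \<tau> c q e \<longleftrightarrow> (\<forall>i. q \<le> fst i & fst i < q + csize c --> i \<in> instrs M \<longleftrightarrow> i \<in> code \<tau> c q e)"

lemma emb_at:
 assumes "emb M \<tau> c q e" "q \<le> q'" "q' < q + csize c"
  "\<And>i. fst i = q' ==> i \<in> code \<tau> c q e \<longleftrightarrow> i \<in> node \<tau> q' r f"
 shows "at_state M q' = node \<tau> q' r f"
proof -
 have "i \<in> instrs M \<longleftrightarrow> i \<in> node \<tau> q' r f" if "fst i = q'" for i
  using assms that unfolding emb_def by blast
 then show ?thesis using node_state unfolding at_state_def by blast
qed

lemma emb_sub:
 assumes "emb M \<tau> c q e" "q \<le> q'" "q' + csize c' \<le> q + csize c"
  "\<And>i. q' \<le> fst i ==> fst i < q' + csize c' ==> i \<in> code \<tau> c q e \<longleftrightarrow> i \<in> code \<tau> c' q' e'"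
 shows "emb M \<tau> c' q' e'"
 unfolding emb_def
proof (intro allI impI)
 fix i :: instr assume i: "q' \<le> fst i & fst i < q' + csize c'"
 then have "q \<le> fst i & fst i < q + csize c" using assms(2,3) by linarith
 then have "i \<in> instrs M \<longleftrightarrow> i \<in> code \<tau> c q e" using assms(1) unfolding emb_def by blast
 with assms(4) i show "i \<in> instrs M \<longleftrightarrow> i \<in> code \<tau> c' q' e'" by blast
qed

lemma not_in_code: "fst i < q \<or> q + csize c \<le> fst i ==> i \<notin> code \<tau> c q e"
 using code_range[of i \<tau> c q e] by linarith

lemma not_in_node: "fst i \<noteq> q ==> i \<notin> node \<tau> q r f"
 using node_state by blast

lemmas emb_simps = not_in_code not_in_node

text \<open>Between the two steps the head stands on the blank cell left of the stack, which in
  general is not a stack configuration. Hence \<open>conf_step\<close> does not apply, and the steps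
  are computed on raw tapes.\<close>

lemma conf_push:
 assumes "at_state M q = node \<tau> q r (%s. (s, MLeft, Suc q))"
  and "at_state M (Suc q) = node \<tau> (Suc q) r f" "r < \<tau>"
  and f: "\<And>s. f s = (bit_symbol b, MStay, e)"
 shows "(dstep M ^^ 2) (conf \<tau> q (sg, bt)) (conf \<tau> e (sg(r := b # sg r), bt))"
proof -
 let ?ts = "snd (conf \<tau> q (sg, bt))"
 let ?ts' = "?ts[r := act (top_symbol (sg r), MLeft) (?ts ! r)]"
 have len: "length ?ts = \<tau>" by (simp add: conf_def)
 have rd: "reads ?ts = map (%r. top_symbol (sg r)) [0..<\<tau>]" by (simp add: reads_conf)
 have 1: "dstep M (q, ?ts) (Suc q, ?ts')"
  by (rule node_step[OF assms(1) len \<open>r < \<tau>\<close>]) (use rd top_symbol_le \<open>r < \<tau>\<close> in auto)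
 have "set (reads ?ts') \<subseteq> {0, 1, 2}"
 proof -
  have "reads ?ts' = (reads ?ts)[r := (case act (top_symbol (sg r), MLeft) (?ts ! r) of (tp, h) => tp h)]"
   by (simp add: reads_def map_update)
  moreover have "(case act (top_symbol (sg r), MLeft) (?ts ! r) of (tp, h) => tp h) \<in> {0, 1, 2}"
   using \<open>r < \<tau>\<close> by (auto simp: conf_nth tape_def Let_def bit_symbol_def)
  ultimately show ?thesis using rd top_symbol_le set_update_subset_insert
   by (smt (verit) image_subset_iff insert_iff insert_subset list.set_map order_trans top_symbol_0(1) One_nat_def)
 qed
 then have 2: "dstep M (Suc q, ?ts') (e, ?ts'[r := act (bit_symbol b, MStay) (?ts' ! r)])"
  by (intro node_step[OF assms(2)]) (use len \<open>r < \<tau>\<close> f in auto)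
 have "?ts'[r := act (bit_symbol b, MStay) (?ts' ! r)] = ?ts[r := tape (b # sg r) (bt r)]"
  using \<open>r < \<tau>\<close> len tape_push[of b "sg r" "bt r"] by (simp add: conf_nth)
 also have "\<dots> = snd (conf \<tau> e (sg(r := b # sg r), bt))" using conf_upd[OF \<open>r < \<tau>\<close>, of q sg bt "b # sg r" "bt r" e] by simp
 finally show ?thesis using 1 2 by (auto simp: numeral_2_eq_2 conf_surj intro!: relcomppI)
qed

lemma exec_correct:
 assumes "exec c s t s'" "regs c \<subseteq> {..<\<tau>}" "\<tau> > 0" "emb M \<tau> c q e"
 shows "(dstep M ^^ t) (conf \<tau> q s) (conf \<tau> e s')"
 using assms
proof (induction arbitrary: q e)
 case (exec_Skip s)
 have "at_state M q = node \<tau> q 0 (%s. (s, MStay, e))"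
  by (rule emb_at[OF exec_Skip.prems(3)]) (auto simp: emb_simps)
 then have "dstep M (conf \<tau> q s) (conf \<tau> e s)" using exec_Skip by (intro conf_goto) auto
 then show ?case by (simp add: eq_OO)
next
 case (exec_Push r b sg bt)
 have 1: "at_state M q = node \<tau> q r (%s. (s, MLeft, Suc q))"
  by (rule emb_at[OF exec_Push.prems(3)]) (auto simp: emb_simps)
 have 2: "at_state M (Suc q) = node \<tau> (Suc q) r (%_. (bit_symbol b, MStay, e))"
  by (rule emb_at[OF exec_Push.prems(3)]) (auto simp: emb_simps)
 show ?case by (rule conf_push[OF 1 2]) (use exec_Push in auto)
next
 case (exec_Pop r sg bt)
 have "at_state M q = node \<tau> q r (%s. (0, if s = 0 then MStay else MRight, e))"
  by (rule emb_at[OF exec_Pop.prems(3)]) (auto simp: emb_simps)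
 from conf_step[OF this, of sg _ _ _ bt, OF _ _ tape_pop] show ?case using exec_Pop by (simp add: eq_OO)
next
 case (exec_Shift sg r d bt)
 have "at_state M q = node \<tau> q r (%s. (s, d, e))"
  by (rule emb_at[OF exec_Shift.prems(3)]) (auto simp: emb_simps)
 from conf_step[OF this, of sg 0 d e bt "[]" "bt r + offset d"] show ?case
  using exec_Shift tape_shift by (simp add: fun_upd_idem eq_OO)
next
 case (exec_Seq c1 s t1 s1 c2 t2 s2)
 have "emb M \<tau> c1 q (q + csize c1)"
  by (rule emb_sub[OF exec_Seq.prems(3)]) (auto simp: emb_simps)
 moreover have "emb M \<tau> c2 (q + csize c1) e"
  by (rule emb_sub[OF exec_Seq.prems(3)]) (auto simp: emb_simps)
 ultimately show ?case using exec_Seq by (intro relpowp_trans) auto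
next
 case (exec_TestT P s r c1 t s' c2)
 have 1: "at_state M q = node \<tau> q r (%s. (s, MStay, if P s then Suc q else Suc q + csize c1))"
  by (rule emb_at[OF exec_TestT.prems(3)]) (auto simp: emb_simps)
 have 2: "emb M \<tau> c1 (Suc q) e"
  by (rule emb_sub[OF exec_TestT.prems(3)]) (auto simp: emb_simps)
 have "dstep M (conf \<tau> q s) (conf \<tau> (Suc q) s)"
  by (rule conf_goto[OF 1]) (use exec_TestT in auto)
 moreover have "(dstep M ^^ t) (conf \<tau> (Suc q) s) (conf \<tau> e s')"
  using exec_TestT.prems by (intro exec_TestT.IH 2) auto
 ultimately show ?case unfolding plus_1_eq_Suc by (rule relpowp_Suc_I2)
next
 case (exec_TestF P s r c2 t s' c1)
 have 1: "at_state M q = node \<tau> q r (%s. (s, MStay, if P s then Suc q else Suc q + csize c1))"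
  by (rule emb_at[OF exec_TestF.prems(3)]) (auto simp: emb_simps)
 have 2: "emb M \<tau> c2 (Suc q + csize c1) e"
  by (rule emb_sub[OF exec_TestF.prems(3)]) (auto simp: emb_simps)
 have "dstep M (conf \<tau> q s) (conf \<tau> (Suc q + csize c1) s)"
  by (rule conf_goto[OF 1]) (use exec_TestF in auto)
 moreover have "(dstep M ^^ t) (conf \<tau> (Suc q + csize c1) s) (conf \<tau> e s')"
  using exec_TestF.prems by (intro exec_TestF.IH 2) auto
 ultimately show ?case unfolding plus_1_eq_Suc by (rule relpowp_Suc_I2)
next
 case (exec_WhileT P s r c t1 s1 t2 s2)
 have 1: "at_state M q = node \<tau> q r (%s. (s, MStay, if P s then Suc q else e))"
  by (rule emb_at[OF exec_WhileT.prems(3)]) (auto simp: emb_simps)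
 have 2: "emb M \<tau> c (Suc q) q"
  by (rule emb_sub[OF exec_WhileT.prems(3)]) (auto simp: emb_simps)
 have "dstep M (conf \<tau> q s) (conf \<tau> (Suc q) s)"
  by (rule conf_goto[OF 1]) (use exec_WhileT in auto)
 moreover have "(dstep M ^^ (t1 + t2)) (conf \<tau> (Suc q) s) (conf \<tau> e s2)"
 proof (rule relpowp_trans)
  show "(dstep M ^^ t1) (conf \<tau> (Suc q) s) (conf \<tau> q s1)"
   using exec_WhileT.prems by (intro exec_WhileT.IH(1) 2) auto
  show "(dstep M ^^ t2) (conf \<tau> q s1) (conf \<tau> e s2)"
   using exec_WhileT.prems by (intro exec_WhileT.IH(2)) auto
 qed
 ultimately show ?case unfolding plus_1_eq_Suc by (rule relpowp_Suc_I2)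
next
 case (exec_WhileF P s r c)
 have 1: "at_state M q = node \<tau> q r (%s. (s, MStay, if P s then Suc q else e))"
  by (rule emb_at[OF exec_WhileF.prems(3)]) (auto simp: emb_simps)
 have "dstep M (conf \<tau> q s) (conf \<tau> e s)"
  by (rule conf_goto[OF 1]) (use exec_WhileF in auto)
 then show ?case by (simp add: eq_OO)
qed

section \<open>Programs for string functions\<close>

definition run :: "cmd => state => nat => state => bool" where
 "run c s n s' \<longleftrightarrow> (\<exists>t \<le> n. exec c s t s')"

lemma run_exec: "exec c s t s' ==> run c s t s'"
 by (auto simp: run_def)

lemma run_weaken: "run c s n s' ==> n \<le> m ==> run c s m s'"
 unfolding run_def by (meson le_trans)

lemma run_conv: "run c s n s' ==> s' = s'' ==> n \<le> m ==> run c s m s''"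
 using run_weaken by blast

lemmas run_Push = run_exec[OF exec_Push]
lemmas run_Pop = run_exec[OF exec_Pop]

lemma run_Seq: "run c1 s n1 s1 ==> run c2 s1 n2 s2 ==> run (Seq c1 c2) s (n1 + n2) s2"
 unfolding run_def by (meson add_mono exec_Seq)

lemma run_TestT: "P (top_symbol (fst s r)) ==> run c1 s n s' ==> run (Test r P c1 c2) s (1 + n) s'"
 unfolding run_def by (meson add_left_mono exec_TestT)

lemma run_TestF: "\<not> P (top_symbol (fst s r)) ==> run c2 s n s' ==> run (Test r P c1 c2) s (1 + n) s'"
 unfolding run_def by (meson add_left_mono exec_TestF)

lemma run_WhileT: "P (top_symbol (fst s r)) ==> run c s n1 s1 ==> run (While r P c) s1 n2 s2 ==>
  run (While r P c) s (1 + (n1 + n2)) s2"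
 unfolding run_def by (meson add_mono add_left_mono exec_WhileT)

lemma run_WhileF: "\<not> P (top_symbol (fst s r)) ==> run (While r P c) s 1 s"
 by (intro run_exec exec_WhileF)

abbreviation nonblank :: "nat => bool" where "nonblank s \<equiv> s \<noteq> 0"

definition clear :: "nat => cmd" where
 "clear a = While a nonblank (Pop a)"

lemma run_clear: "run (clear a) (sg, bt) (2 * length (sg a) + 1) (sg(a := []), bt)"
proof (induction "sg a" arbitrary: sg)
 case Nil
 show ?case unfolding clear_def by (rule run_conv[OF run_WhileF]) (use Nil in auto)
next
 case (Cons b xs)
 have *: "xs = (sg(a := tl (sg a))) a" using Cons(2)[symmetric] by simp
 show ?case unfolding clear_def
  by (rule run_conv[OF run_WhileT[OF _ run_Pop Cons(1)[of "sg(a := tl (sg a))", OF *, unfolded clear_def]]])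
   (use Cons(2)[symmetric] in auto)
qed

definition mv1 :: "nat => nat => cmd" where
 "mv1 a b = Test a (%s. s = 2) (Seq (Pop a) (Push b True)) (Seq (Pop a) (Push b False))"

lemma run_mv1:
 assumes "sg a = x # xs" "a \<noteq> b"
 shows "run (mv1 a b) (sg, bt) 4 (sg(a := xs, b := x # sg b), bt)"
proof (cases x)
 case True
 show ?thesis unfolding mv1_def
  by (rule run_conv[OF run_TestT[OF _ run_Seq[OF run_Pop run_Push]]]) (use assms True in auto)
next
 case False
 show ?thesis unfolding mv1_def
  by (rule run_conv[OF run_TestF[OF _ run_Seq[OF run_Pop run_Push]]]) (use assms False in auto)
qed

definition mv :: "nat => nat => cmd" where
 "mv a b = While a nonblank (mv1 a b)"

lemma run_mv:
 assumes "a \<noteq> b"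
 shows "run (mv a b) (sg, bt) (5 * length (sg a) + 1) (sg(a := [], b := rev (sg a) @ sg b), bt)"
proof (induction "sg a" arbitrary: sg)
 case Nil
 show ?case unfolding mv_def by (rule run_conv[OF run_WhileF]) (use Nil in auto)
next
 case (Cons x xs)
 have *: "xs = (sg(a := xs, b := x # sg b)) a" using assms by simp
 show ?case unfolding mv_def
  by (rule run_conv[OF run_WhileT[OF _ run_mv1 Cons(1)[of "sg(a := xs, b := x # sg b)", OF *, unfolded mv_def]]])
   (use Cons(2)[symmetric] assms in auto)
qed

definition mv2 :: "nat => nat => nat => cmd" where
 "mv2 a b c = While a nonblank (Test a (%s. s = 2)
   (Seq (Push c True) (mv1 a b)) (Seq (Push c False) (mv1 a b)))"

lemma run_mv2:
 assumes "a \<noteq> b" "a \<noteq> c" "b \<noteq> c"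
 shows "run (mv2 a b c) (sg, bt) (8 * length (sg a) + 1)
   (sg(a := [], b := rev (sg a) @ sg b, c := rev (sg a) @ sg c), bt)"
proof (induction "sg a" arbitrary: sg)
 case Nil
 show ?case unfolding mv2_def by (rule run_conv[OF run_WhileF]) (use Nil in auto)
next
 case (Cons x xs)
 have *: "xs = (sg(a := xs, b := x # sg b, c := x # sg c)) a" using assms by simp
 have body: "run (Test a (%s. s = 2) (Seq (Push c True) (mv1 a b)) (Seq (Push c False) (mv1 a b)))
   (sg, bt) 7 (sg(a := xs, b := x # sg b, c := x # sg c), bt)"
 proof (cases x)
  case True
  show ?thesis by (rule run_conv[OF run_TestT[OF _ run_Seq[OF run_Push run_mv1]]])
    (use Cons(2)[symmetric] assms True in auto)
 next
  case False
  show ?thesis by (rule run_conv[OF run_TestF[OF _ run_Seq[OF run_Push run_mv1]]])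
    (use Cons(2)[symmetric] assms False in auto)
 qed
 show ?case unfolding mv2_def
  by (rule run_conv[OF run_WhileT[OF _ body Cons(1)[of "sg(a := xs, b := x # sg b, c := x # sg c)", OF *, unfolded mv2_def]]])
   (use Cons(2)[symmetric] assms in \<open>auto simp: fun_eq_iff\<close>)
qed

text \<open>A stack can be read only by emptying it, and moving it reverses it. The detour through
  \<open>c\<close> restores the order while two copies are written.\<close>

definition copy :: "nat => nat => nat => cmd" where
 "copy a b c = Seq (mv a c) (mv2 c a b)"

lemma run_copy:
 assumes "a \<noteq> b" "a \<noteq> c" "b \<noteq> c" "sg b = []" "sg c = []"
 shows "run (copy a b c) (sg, bt) (13 * length (sg a) + 2) (sg(b := sg a), bt)"
 unfolding copy_def
 by (rule run_conv[OF run_Seq[OF run_mv run_mv2]]) (use assms in \<open>auto simp: fun_eq_iff\<close>)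

definition transfer :: "nat => nat => nat => cmd" where
 "transfer a b c = Seq (mv a c) (mv c b)"

lemma run_transfer:
 assumes "a \<noteq> b" "a \<noteq> c" "b \<noteq> c" "sg c = []"
 shows "run (transfer a b c) (sg, bt) (10 * length (sg a) + 2) (sg(a := [], b := sg a @ sg b), bt)"
 unfolding transfer_def
 by (rule run_conv[OF run_Seq[OF run_mv run_mv]]) (use assms in \<open>auto simp: fun_eq_iff\<close>)

text \<open>Registers \<open>j + 1\<close> and \<open>j + 2\<close> hold the components,
  \<open>j\<close> receives the pair, \<open>j + 3\<close> and \<open>j + 4\<close> are scratch.
  Since stacks grow at the front, the pair is built from its end: second component, first component,
  separator, and finally one \<open>True\<close> per symbol of a copy of the first
  component.\<close>

definition mkpair :: "nat => cmd" where
 "mkpair j = Seq (transfer (j + 2) j (j + 3)) (Seq (mv2 (j + 1) (j + 3) (j + 4)) (Seq (mv (j + 3) j)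
   (Seq (Push j False) (While (j + 4) nonblank (Seq (Pop (j + 4)) (Push j True))))))"

lemma run_unary:
 assumes "a \<noteq> b"
 shows "run (While a nonblank (Seq (Pop a) (Push b True))) (sg, bt) (4 * length (sg a) + 1)
   (sg(a := [], b := replicate (length (sg a)) True @ sg b), bt)"
proof (induction "sg a" arbitrary: sg)
 case Nil
 show ?case by (rule run_conv[OF run_WhileF]) (use Nil in auto)
next
 case (Cons x xs)
 have *: "xs = (sg(a := tl (sg a), b := True # (sg(a := tl (sg a))) b)) a" using assms Cons(2)[symmetric] by simp
 show ?case
  by (rule run_conv[OF run_WhileT[OF _ run_Seq[OF run_Pop run_Push]
    Cons(1)[of "sg(a := tl (sg a), b := True # (sg(a := tl (sg a))) b)", OF *]]])
   (use Cons(2)[symmetric] assms in \<open>auto simp: fun_eq_iff replicate_app_Cons_same\<close>)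
qed

lemma run_mkpair:
 assumes "sg j = []" "sg (j + 3) = []" "sg (j + 4) = []"
 shows "run (mkpair j) (sg, bt) (17 * length (sg (j + 1)) + 10 * length (sg (j + 2)) + 7)
  (sg(j := pr (sg (j + 1)) (sg (j + 2)), j + 1 := [], j + 2 := []), bt)"
 unfolding mkpair_def
 by (rule run_conv[OF run_Seq[OF run_transfer run_Seq[OF run_mv2 run_Seq[OF run_mv run_Seq[OF run_Push run_unary]]]]])
  (use assms in \<open>auto simp: fun_eq_iff pr_def\<close>)

text \<open>Register \<open>j\<close> is split at the end of its unary prefix: the first component arrives reversed in
 register \<open>j + 2\<close>, the second stays.\<close>

definition split :: "nat => cmd" where
 "split j = Seq (While j (%s. s = 2) (Seq (Pop j) (Push (j + 1) True))) (Seq (Pop j)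
   (While (j + 1) nonblank (Seq (Pop (j + 1)) (Test j nonblank (mv1 j (j + 2)) Skip))))"

lemma run_ones:
 assumes "a \<noteq> b"
 shows "run (While a (%s. s = 2) (Seq (Pop a) (Push b True))) (sg, bt) (4 * length (sg a) + 1)
   (sg(a := dropWhile id (sg a), b := replicate (plen (sg a)) True @ sg b), bt)"
proof (induction "sg a" arbitrary: sg)
 case Nil
 show ?case by (rule run_conv[OF run_WhileF]) (use Nil[symmetric] in \<open>auto simp: plen_def fun_eq_iff\<close>)
next
 case (Cons x xs)
 show ?case
 proof (cases x)
  case True
  have *: "xs = (sg(a := tl (sg a), b := True # (sg(a := tl (sg a))) b)) a" using assms Cons(2)[symmetric] by simp
  show ?thesis
   by (rule run_conv[OF run_WhileT[OF _ run_Seq[OF run_Pop run_Push]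
    Cons(1)[of "sg(a := tl (sg a), b := True # (sg(a := tl (sg a))) b)", OF *]]])
    (use Cons(2)[symmetric] assms True in \<open>auto simp: fun_eq_iff replicate_app_Cons_same plen_def\<close>)
 next
  case False
  show ?thesis by (rule run_conv[OF run_WhileF])
    (use Cons(2)[symmetric] assms False in \<open>auto simp: plen_def fun_eq_iff\<close>)
 qed
qed

lemma run_take:
 assumes "a \<noteq> b" "a \<noteq> c" "b \<noteq> c"
 shows "run (While a nonblank (Seq (Pop a) (Test b nonblank (mv1 b c) Skip))) (sg, bt) (7 * length (sg a) + 1)
   (sg(a := [], b := drop (length (sg a)) (sg b), c := rev (take (length (sg a)) (sg b)) @ sg c), bt)"
proof (induction "sg a" arbitrary: sg)
 case Nil
 show ?case by (rule run_conv[OF run_WhileF]) (use Nil in auto)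
next
 case (Cons x xs)
 show ?case
 proof (cases "sg b")
  case Nil
  have *: "xs = (sg(a := tl (sg a))) a" using Cons(2)[symmetric] by simp
  show ?thesis
   by (rule run_conv[OF run_WhileT[OF _ run_Seq[OF run_Pop run_TestF[OF _ run_exec[OF exec_Skip]]]
    Cons(1)[of "sg(a := tl (sg a))", OF *]]])
    (use Cons(2)[symmetric] assms Nil in \<open>auto simp: fun_eq_iff\<close>)
 next
  case (Cons y ys)
  have *: "xs = (sg(a := tl (sg a), b := ys, c := y # (sg(a := tl (sg a))) c)) a"
   using \<open>_ = sg a\<close>[symmetric] assms by simp
  show ?thesis
   by (rule run_conv[OF run_WhileT[OF _ run_Seq[OF run_Pop run_TestT[OF _ run_mv1]] 
    Cons.hyps(1)[of "sg(a := tl (sg a), b := ys, c := y # (sg(a := tl (sg a))) c)", OF *]]])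
    (use \<open>_ = sg a\<close>[symmetric] assms Cons in \<open>auto simp: fun_eq_iff\<close>)
 qed
qed

lemma length_dropWhile_le': "plen x + length (dropWhile id x) = length x"
 unfolding plen_def by (metis length_append takeWhile_dropWhile_id)

lemma run_split:
 assumes "sg (j + 1) = []" "sg (j + 2) = []"
 shows "run (split j) (sg, bt) (11 * length (sg j) + 3) (sg(j := ssnd (sg j), j + 2 := rev (sfst (sg j))), bt)"
 unfolding split_def
 by (rule run_conv[OF run_Seq[OF run_ones run_Seq[OF run_Pop run_take]]])
  (use assms length_dropWhile_le'[of "sg j"] in \<open>auto simp: fun_eq_iff ssnd_def sfst_def prest_def\<close>)

text \<open>A command can be placed at any register \<open>j\<close>. It borrows a fixed number of
  empty registers above \<open>j\<close> and returns them empty, and its time bound is the same for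
  all \<open>j\<close>; this is what makes commands composable.\<close>

definition impl :: "(str => str) => (str => nat) => bool" where
 "impl f S \<longleftrightarrow> (\<exists>k T. pb T S & (\<forall>j. \<exists>c. regs c \<subseteq> {..j + k} &
   (\<forall>sg bt. (\<forall>i. j < i & i \<le> j + k --> sg i = []) --> run c (sg, bt) (T (sg j)) (sg(j := f (sg j)), bt))))"

lemma implI:
 assumes "pb T S" "\<And>j. regs (c j) \<subseteq> {..j + k}"
  "\<And>j sg bt. (\<And>i. j < i ==> i \<le> j + k ==> sg i = []) ==> run (c j) (sg, bt) (T (sg j)) (sg(j := f (sg j)), bt)"
 shows "impl f S"
 unfolding impl_def
proof (intro exI[of _ k] exI[of _ T] conjI allI assms(1))
 fix j
 show "\<exists>c. regs c \<subseteq> {..j + k} & (\<forall>sg bt. (\<forall>i. j < i & i \<le> j + k --> sg i = []) -->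
   run c (sg, bt) (T (sg j)) (sg(j := f (sg j)), bt))"
  by (intro exI[of _ "c j"] conjI allI impI assms(2,3)) simp
qed

lemma implE:
 assumes "impl f S"
 obtains k T c where "pb T S" "\<And>j. regs (c j) \<subseteq> {..j + k}"
  "\<And>j sg bt. (\<And>i. j < i ==> i \<le> j + k ==> sg i = []) ==> run (c j) (sg, bt) (T (sg j)) (sg(j := f (sg j)), bt)"
proof -
 obtain k T where k: "pb T S" "\<forall>j. \<exists>c. regs c \<subseteq> {..j + k} &
   (\<forall>sg bt. (\<forall>i. j < i & i \<le> j + k --> sg i = []) --> run c (sg, bt) (T (sg j)) (sg(j := f (sg j)), bt))"
  using assms unfolding impl_def by blast
 from choice[OF k(2)] obtain c where "\<forall>j. regs (c j) \<subseteq> {..j + k} &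
   (\<forall>sg bt. (\<forall>i. j < i & i \<le> j + k --> sg i = []) --> run (c j) (sg, bt) (T (sg j)) (sg(j := f (sg j)), bt))" ..
 then show ?thesis by (intro that[OF k(1), of c k]) simp_all
qed

lemma regs_simps [simp]:
 "regs (clear a) = {a}" "regs (mv a b) = {a, b}" "regs (mv2 a b c) = {a, b, c}"
 "regs (copy a b c) = {a, b, c}" "regs (transfer a b c) = {a, b, c}"
 "regs (mkpair j) = {j, j + 1, j + 2, j + 3, j + 4}" "regs (split j) = {j, j + 1, j + 2}"
 by (auto simp: clear_def mv_def mv1_def mv2_def copy_def transfer_def mkpair_def split_def)

lemma impl_basic:
 "impl (%x. x) length" "impl (%_. []) length" "impl (%x. b # x) length" "impl tl length"
 "impl (%x. tt (x \<noteq> [] & hd x)) length" "impl sfst length" "impl ssnd length"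
proof -
 show "impl (%x. x) length"
  by (rule implI[where c = "%_. Skip" and k = 0 and T = "%_. 1"])
   (auto intro!: pb_intros run_conv[OF run_exec[OF exec_Skip]])
 show "impl (%_. []) length"
  by (rule implI[where c = clear and k = 0 and T = "%x. 2 * length x + 1"])
   (auto intro!: pb_intros run_conv[OF run_clear])
 show "impl (%x. b # x) length"
  by (rule implI[where c = "%j. Push j b" and k = 0 and T = "%x. 2"])
   (auto intro!: pb_intros run_conv[OF run_Push])
 show "impl tl length"
  by (rule implI[where c = Pop and k = 0 and T = "%x. 1"])
   (auto intro!: pb_intros run_conv[OF run_Pop])
 show "impl (%x. tt (x \<noteq> [] & hd x)) length"
 proof (rule implI[where c = "%j. Test j (%s. s = 2) (Seq (clear j) (Push j True)) (clear j)" and k = 0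
    and T = "%x. 2 * length x + 4"])
  fix j sg bt
  show "run (Test j (%s. s = 2) (Seq (clear j) (Push j True)) (clear j)) (sg, bt) (2 * length (sg j) + 4)
   (sg(j := tt (sg j \<noteq> [] & hd (sg j))), bt)"
  proof (cases "sg j \<noteq> [] & hd (sg j)")
   case True
   then show ?thesis by (intro run_conv[OF run_TestT[OF _ run_Seq[OF run_clear run_Push]]])
     (cases "sg j"; auto simp: tt_def)+
  next
   case False
   then show ?thesis by (intro run_conv[OF run_TestF[OF _ run_clear]])
     (cases "sg j"; auto simp: tt_def)+
  qed
 qed (auto intro!: pb_intros)
 show "impl sfst length"
 proof (rule implI[where c = "%j. Seq (split j) (Seq (clear j) (mv (j + 2) j))" and k = 2
    and T = "%x. 20 * length x + 10"])
  fix j :: nat and sg :: "nat => str" and bt :: "nat => int" assume *: "\<And>i. j < i ==> i \<le> j + 2 ==> sg i = []"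
  show "run (Seq (split j) (Seq (clear j) (mv (j + 2) j))) (sg, bt) (20 * length (sg j) + 10)
    (sg(j := sfst (sg j)), bt)"
   by (rule run_conv[OF run_Seq[OF run_split run_Seq[OF run_clear run_mv]]])
    (use * length_sfst[of "sg j"] length_ssnd[of "sg j"] in \<open>auto simp: fun_eq_iff\<close>)
 qed (auto intro!: pb_intros)
 show "impl ssnd length"
 proof (rule implI[where c = "%j. Seq (split j) (clear (j + 2))" and k = 2
    and T = "%x. 20 * length x + 10"])
  fix j :: nat and sg :: "nat => str" and bt :: "nat => int" assume *: "\<And>i. j < i ==> i \<le> j + 2 ==> sg i = []"
  show "run (Seq (split j) (clear (j + 2))) (sg, bt) (20 * length (sg j) + 10) (sg(j := ssnd (sg j)), bt)"
   by (rule run_conv[OF run_Seq[OF run_split run_clear]])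
    (use * length_sfst[of "sg j"] length_ssnd[of "sg j"] in \<open>auto simp: fun_eq_iff\<close>)
 qed (auto intro!: pb_intros)
qed

lemma impl_weaken: "impl f S' ==> pb S' S ==> impl f S"
 unfolding impl_def using pb_trans by meson

lemma impl_comp:
 assumes "impl f S'" "impl g S" "pb (%x. S' (g x)) S"
 shows "impl (%x. f (g x)) S"
proof -
 obtain k T c where f: "pb T S'" "\<And>j. regs (c j) \<subseteq> {..j + k}"
  "\<And>j sg bt. (\<And>i. j < i ==> i \<le> j + k ==> sg i = []) ==> run (c j) (sg, bt) (T (sg j)) (sg(j := f (sg j)), bt)"
  using implE[OF assms(1)] by metis
 obtain k' T' c' where g: "pb T' S" "\<And>j. regs (c' j) \<subseteq> {..j + k'}"
  "\<And>j sg bt. (\<And>i. j < i ==> i \<le> j + k' ==> sg i = []) ==> run (c' j) (sg, bt) (T' (sg j)) (sg(j := g (sg j)), bt)"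
  using implE[OF assms(2)] by metis
 show ?thesis
 proof (rule implI[where c = "%j. Seq (c' j) (c j)" and k = "k + k'" and T = "%x. T' x + T (g x)"])
  show "pb (%x. T' x + T (g x)) S"
   by (intro pb_add g pb_trans[OF pb_comp[OF f(1)] assms(3)])
  show "regs (Seq (c' j) (c j)) \<subseteq> {..j + (k + k')}" for j using f(2)[of j] g(2)[of j] by auto
  show "run (Seq (c' j) (c j)) (sg, bt) (T' (sg j) + T (g (sg j))) (sg(j := f (g (sg j))), bt)"
   if "\<And>i. j < i ==> i \<le> j + (k + k') ==> sg i = []" for j sg bt
   by (rule run_conv[OF run_Seq[OF g(3) f(3)]]) (use that in auto)
 qed
qed

lemma impl_cond:
 assumes "impl f S" "impl g S" "impl h S" "pb length S"
 shows "impl (%x. if f x = [] then g x else h x) S"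
proof -
 obtain k1 T1 c1 where f: "pb T1 S" "\<And>j. regs (c1 j) \<subseteq> {..j + k1}"
  "\<And>j sg bt. (\<And>i. j < i ==> i \<le> j + k1 ==> sg i = []) ==> run (c1 j) (sg, bt) (T1 (sg j)) (sg(j := f (sg j)), bt)"
  using implE[OF assms(1)] by metis
 obtain k2 T2 c2 where g: "pb T2 S" "\<And>j. regs (c2 j) \<subseteq> {..j + k2}"
  "\<And>j sg bt. (\<And>i. j < i ==> i \<le> j + k2 ==> sg i = []) ==> run (c2 j) (sg, bt) (T2 (sg j)) (sg(j := g (sg j)), bt)"
  using implE[OF assms(2)] by metis
 obtain k3 T3 c3 where h: "pb T3 S" "\<And>j. regs (c3 j) \<subseteq> {..j + k3}"
  "\<And>j sg bt. (\<And>i. j < i ==> i \<le> j + k3 ==> sg i = []) ==> run (c3 j) (sg, bt) (T3 (sg j)) (sg(j := h (sg j)), bt)"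
  using implE[OF assms(3)] by metis
 \<comment> \<open>The cost of clearing the test value depends on its length. That is bounded by the
   running time, because \<open>t\<close> steps add at most \<open>t\<close> symbols to a
   register.\<close>
 have lf: "length (f x) \<le> T1 x + length x" for x
 proof -
  have "run (c1 0) ((%_. [])(0 := x), %_. 0) (T1 x) (((%_. [])(0 := x))(0 := f x), %_. 0)"
   using f(3)[of 0 "(%_. [])(0 := x)" "%_. 0"] by simp
  then obtain t where t: "t \<le> T1 x" "exec (c1 0) ((%_. [])(0 := x), %_. 0) t (((%_. [])(0 := x))(0 := f x), %_. 0)"
   unfolding run_def by blast
  have "length (fst s' r) \<le> t + length (fst s r)" if "exec c s t s'" for c s t s' r
   using that by (induction) (force intro: le_trans)+
  from this[OF t(2), of 0] t(1) show ?thesis by simp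
 qed
 show ?thesis
 proof (rule implI[where c = "%j. Seq (copy j (j + 1) (j + 2)) (Seq (c1 (j + 1))
   (Test (j + 1) nonblank (Seq (clear (j + 1)) (c3 j)) (c2 j)))" and k = "k1 + k2 + k3 + 2"
   and T = "%x. 15 * length x + 2 * T1 x + T1 x + T2 x + T3 x + 10"])
  show "pb (%x. 15 * length x + 2 * T1 x + T1 x + T2 x + T3 x + 10) S"
   by (intro pb_intros assms f g h)
  show "regs (Seq (copy j (j + 1) (j + 2)) (Seq (c1 (j + 1))
   (Test (j + 1) nonblank (Seq (clear (j + 1)) (c3 j)) (c2 j)))) \<subseteq> {..j + (k1 + k2 + k3 + 2)}" for j
   using f(2)[of "j + 1"] g(2)[of j] h(2)[of j] by auto
  fix j :: nat and sg :: "nat => str" and bt :: "nat => int" assume e: "\<And>i. j < i ==> i \<le> j + (k1 + k2 + k3 + 2) ==> sg i = []"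
  show "run (Seq (copy j (j + 1) (j + 2)) (Seq (c1 (j + 1))
   (Test (j + 1) nonblank (Seq (clear (j + 1)) (c3 j)) (c2 j)))) (sg, bt)
   (15 * length (sg j) + 2 * T1 (sg j) + T1 (sg j) + T2 (sg j) + T3 (sg j) + 10)
   (sg(j := if f (sg j) = [] then g (sg j) else h (sg j)), bt)"
  proof (cases "f (sg j) = []")
   case True
   show ?thesis
    by (rule run_conv[OF run_Seq[OF run_copy run_Seq[OF f(3) run_TestF[OF _ g(3)]]]])
     (use e True in \<open>auto simp: fun_eq_iff\<close>)
  next
   case False
   show ?thesis
    by (rule run_conv[OF run_Seq[OF run_copy run_Seq[OF f(3) run_TestT[OF _ run_Seq[OF run_clear h(3)]]]]])
     (use e False lf[of "sg j"] in \<open>auto simp: fun_eq_iff\<close>)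
  qed
 qed
qed

lemma impl_pair:
 assumes "impl f S" "impl g S" "pb length S" "pb (%x. length (f x)) S" "pb (%x. length (g x)) S"
 shows "impl (%x. pr (f x) (g x)) S"
proof -
 obtain k1 T1 c1 where f: "pb T1 S" "\<And>j. regs (c1 j) \<subseteq> {..j + k1}"
  "\<And>j sg bt. (\<And>i. j < i ==> i \<le> j + k1 ==> sg i = []) ==> run (c1 j) (sg, bt) (T1 (sg j)) (sg(j := f (sg j)), bt)"
  using implE[OF assms(1)] by metis
 obtain k2 T2 c2 where g: "pb T2 S" "\<And>j. regs (c2 j) \<subseteq> {..j + k2}"
  "\<And>j sg bt. (\<And>i. j < i ==> i \<le> j + k2 ==> sg i = []) ==> run (c2 j) (sg, bt) (T2 (sg j)) (sg(j := g (sg j)), bt)"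
  using implE[OF assms(2)] by metis
 let ?c = "%j. Seq (copy j (j + 1) (j + 2)) (Seq (c1 (j + 1)) (Seq (copy j (j + 2) (j + 3))
   (Seq (c2 (j + 2)) (Seq (clear j) (mkpair j)))))"
 let ?T = "%x. 28 * length x + T1 x + T2 x + 17 * length (f x) + 10 * length (g x) + 12"
 show ?thesis
 proof (rule implI[where c = ?c and k = "k1 + k2 + 4" and T = ?T])
  show "pb ?T S" by (intro pb_intros assms f g)
  show "regs (?c j) \<subseteq> {..j + (k1 + k2 + 4)}" for j
   using f(2)[of "j + 1"] g(2)[of "j + 2"] by auto
  fix j :: nat and sg :: "nat => str" and bt :: "nat => int" assume e: "\<And>i. j < i ==> i \<le> j + (k1 + k2 + 4) ==> sg i = []"
  show "run (?c j) (sg, bt) (?T (sg j)) (sg(j := pr (f (sg j)) (g (sg j))), bt)"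
   by (rule run_conv[OF run_Seq[OF run_copy run_Seq[OF f(3) run_Seq[OF run_copy run_Seq[OF g(3)
    run_Seq[OF run_clear run_mkpair]]]]]]) (use e in \<open>auto simp: fun_eq_iff\<close>)
 qed
qed

lemma run_loop:
 assumes "\<And>sg. P sg ==> run c (sg, bt) (T (sg b)) (sg(b := f (sg b)), bt)"
  and P: "\<And>sg x y. P sg ==> P (sg(a := x, b := y))" and "a \<noteq> b" and "P sg"
  and "\<And>i. i < length (sg a) ==> T ((f ^^ i) (sg b)) \<le> N"
 shows "run (While a nonblank (Seq (Pop a) c)) (sg, bt) ((N + 2) * length (sg a) + 1)
   (sg(a := [], b := (f ^^ length (sg a)) (sg b)), bt)"
 using assms(4,5)
proof (induction "sg a" arbitrary: sg)
 case Nil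
 show ?case by (rule run_conv[OF run_WhileF]) (use Nil(1)[symmetric] in auto)
next
 case (Cons x xs)
 let ?sg = "sg(a := xs, b := f (sg b))"
 have la: "sg a = x # xs" using Cons(2) by simp
 have it: "(f ^^ i) (f y) = (f ^^ Suc i) y" for i y by (simp add: funpow_swap1)
 have IH: "run (While a nonblank (Seq (Pop a) c)) (?sg, bt) ((N + 2) * length (?sg a) + 1)
   (?sg(a := [], b := (f ^^ length (?sg a)) (?sg b)), bt)"
 proof (rule Cons.hyps(1))
  show "xs = ?sg a" using \<open>a \<noteq> b\<close> by simp
  show "P ?sg" by (rule P[OF Cons.prems(1)])
  fix i assume "i < length (?sg a)"
  then have "Suc i < length (sg a)" using la \<open>a \<noteq> b\<close> by simp
  from Cons.prems(2)[OF this] show "T ((f ^^ i) (?sg b)) \<le> N" by (simp only: it fun_upd_same)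
 qed
 have "run c (sg(a := xs), bt) (T ((sg(a := xs)) b)) ((sg(a := xs))(b := f ((sg(a := xs)) b)), bt)"
  by (rule assms(1)) (use P[OF Cons.prems(1), of xs "sg b"] \<open>a \<noteq> b\<close> in \<open>simp add: fun_upd_idem\<close>)
 then have body: "run c (sg(a := tl (sg a)), bt) N (?sg, bt)"
  using Cons.prems(2)[of 0] la \<open>a \<noteq> b\<close> by (auto elim!: run_weaken)
 show ?case
  by (rule run_conv[OF run_WhileT[OF _ run_Seq[OF run_Pop body] IH]])
   (use la \<open>a \<noteq> b\<close> in \<open>auto simp: fun_eq_iff it simp del: funpow.simps\<close>)
qed

lemma impl_iter:
 assumes "impl f S'" "impl a S" "impl b S" "pb length S" "pb (%x. length (a x)) S" "pb (%x. length (b x)) S"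
  and S': "\<And>x i. i \<le> length (b x) ==> S' ((f ^^ i) (a x)) \<le> (S x + C) ^ C"
  and len: "pb (%x. length ((f ^^ length (b x)) (a x))) S"
 shows "impl (%x. (f ^^ length (b x)) (a x)) S"
proof -
 obtain k T c where f: "pb T S'" "\<And>j. regs (c j) \<subseteq> {..j + k}"
  "\<And>j sg bt. (\<And>i. j < i ==> i \<le> j + k ==> sg i = []) ==> run (c j) (sg, bt) (T (sg j)) (sg(j := f (sg j)), bt)"
  using implE[OF assms(1)] by metis
 obtain k1 T1 c1 where a: "pb T1 S" "\<And>j. regs (c1 j) \<subseteq> {..j + k1}"
  "\<And>j sg bt. (\<And>i. j < i ==> i \<le> j + k1 ==> sg i = []) ==> run (c1 j) (sg, bt) (T1 (sg j)) (sg(j := a (sg j)), bt)"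
  using implE[OF assms(2)] by metis
 obtain k2 T2 c2 where b: "pb T2 S" "\<And>j. regs (c2 j) \<subseteq> {..j + k2}"
  "\<And>j sg bt. (\<And>i. j < i ==> i \<le> j + k2 ==> sg i = []) ==> run (c2 j) (sg, bt) (T2 (sg j)) (sg(j := b (sg j)), bt)"
  using implE[OF assms(3)] by metis
 obtain D where D: "\<And>x. T x \<le> (S' x + D) ^ D" using f(1) unfolding pb_def by blast
 define N where "N x = ((S x + C) ^ C + D) ^ D" for x
 have N: "T ((f ^^ i) (a x)) \<le> N x" if "i \<le> length (b x)" for x i
  using D[of "(f ^^ i) (a x)"] S'[OF that] unfolding N_def
  by (meson add_le_mono1 le_trans power_mono zero_le)
 have pN: "pb N S" unfolding N_def by (intro pb_intros)
 let ?L = "%j. While j nonblank (Seq (Pop j) (c (j + 1)))"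
 let ?B = "%j. Seq (copy j (j + 1) (j + 2)) (Seq (c1 (j + 1)) (Seq (copy j (j + 2) (j + 3))
   (Seq (c2 (j + 2)) (Seq (clear j) (transfer (j + 2) j (j + 3))))))"
 let ?c = "%j. Seq (Seq (?B j) (?L j)) (transfer (j + 1) j (j + 2))"
 let ?T = "%x. 28 * length x + T1 x + T2 x + 10 * length (b x) +
   ((N x + 2) * length (b x) + 10 * length ((f ^^ length (b x)) (a x))) + 20"
 show ?thesis
 proof (rule implI[where c = ?c and k = "k1 + k2 + k + 4" and T = ?T])
  show "pb ?T S" by (intro pb_intros assms a b pN len)
  show "regs (?c j) \<subseteq> {..j + (k1 + k2 + k + 4)}" for j
   using a(2)[of "j + 1"] b(2)[of "j + 2"] f(2)[of "j + 1"] by auto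
  fix j :: nat and sg :: "nat => str" and bt :: "nat => int" assume e: "\<And>i. j < i ==> i \<le> j + (k1 + k2 + k + 4) ==> sg i = []"
  define sg' where "sg' = sg(j := b (sg j), j + 1 := a (sg j))"
  define y where "y = (f ^^ length (b (sg j))) (a (sg j))"
  have sg': "sg' j = b (sg j)" "sg' (j + 1) = a (sg j)" by (simp_all add: sg'_def)
  have loop: "run (?L j) (sg', bt) ((N (sg j) + 2) * length (sg' j) + 1)
    (sg'(j := [], j + 1 := (f ^^ length (sg' j)) (sg' (j + 1))), bt)"
   by (rule run_loop[where P = "%sg. \<forall>i. j + 1 < i & i \<le> j + 1 + k --> sg i = []" and T = T])
    (use e f(3) N in \<open>auto simp: sg'_def\<close>)
  have before: "run (?B j) (sg, bt)
    (28 * length (sg j) + T1 (sg j) + T2 (sg j) + 10 * length (b (sg j)) + 8) (sg', bt)"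
   by (rule run_conv[OF run_Seq[OF run_copy run_Seq[OF a(3) run_Seq[OF run_copy run_Seq[OF b(3)
    run_Seq[OF run_clear run_transfer]]]]]]) (use e in \<open>auto simp: fun_eq_iff sg'_def\<close>)
  have after: "run (transfer (j + 1) j (j + 2)) (sg'(j := [], j + 1 := y), bt) (10 * length y + 2)
   (sg(j := y), bt)"
   by (rule run_conv[OF run_transfer]) (use e in \<open>auto simp: fun_eq_iff sg'_def\<close>)
  show "run (?c j) (sg, bt) (?T (sg j)) (sg(j := (f ^^ length (b (sg j))) (a (sg j))), bt)"
   unfolding y_def[symmetric]
   by (rule run_weaken[OF run_Seq[OF run_Seq[OF before loop[unfolded sg' y_def[symmetric]]] after]]) linarith
 qed
qed

lemma impl_Fn: "Fn f S ==> impl f S"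
proof (induction rule: Fn.induct)
 case (Fn_pair f S g)
 show ?case
  by (rule impl_pair[OF Fn_pair.IH]) (use Fn_bound[OF Fn_pair.hyps(1)] Fn_bound[OF Fn_pair.hyps(2)] in blast)+
next
 case (Fn_cond f S g h)
 show ?case by (rule impl_cond[OF Fn_cond.IH]) (use Fn_bound[OF Fn_cond.hyps(1)] in blast)
next
 case (Fn_comp f S' g S)
 show ?case by (rule impl_comp[OF Fn_comp.IH Fn_comp.hyps(3)])
next
 case (Fn_iter f S' a S b C)
 have "Fn (%x. (f ^^ length (b x)) (a x)) S" by (rule Fn.Fn_iter[OF Fn_iter.hyps])
 note bounds = Fn_bound[OF this] Fn_bound[OF Fn_iter.hyps(2)] Fn_bound[OF Fn_iter.hyps(3)]
 show ?case
  by (rule impl_iter[where C = C, OF Fn_iter.IH])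
   (use bounds in blast, use bounds in blast, use bounds in blast, erule Fn_iter.hyps(4), use bounds in blast)
next
 case (Fn_weaken f S' S)
 show ?case by (rule impl_weaken[OF Fn_weaken.IH Fn_weaken.hyps(2)])
qed (rule impl_basic)+

section \<open>Turing machines for string functions\<close>

text \<open>Output is read from cell 0 on, whereas a stack ends at its base. The base of tape 0
  therefore first goes back by the input length, which tape 2 remembers, and then forward by the
  output length (\<open>run_forward\<close>); pushed from there, the output fills the cells from 0
  on.\<close>

lemma run_rewind:
 assumes "sg 0 = []"
 shows "run (While 2 nonblank (Seq (Pop 2) (Shift 0 MLeft))) (sg, bt) (3 * length (sg 2) + 1)
   (sg(2 := []), bt(0 := bt 0 - int (length (sg 2))))"
 using assms
proof (induction "sg 2" arbitrary: sg bt)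
 case Nil
 show ?case by (rule run_conv[OF run_WhileF]) (use Nil(1)[symmetric] in auto)
next
 case (Cons x xs)
 have *: "xs = (sg(2 := tl (sg 2))) 2" using Cons(2)[symmetric] by simp
 show ?case
  by (rule run_conv[OF run_WhileT[OF _ run_Seq[OF run_Pop run_exec[OF exec_Shift]]
    Cons(1)[of "sg(2 := tl (sg 2))", OF *]]])
   (use Cons(2)[symmetric] Cons(3) in \<open>auto simp: fun_eq_iff\<close>)
qed

lemma run_forward:
 assumes "sg 0 = []"
 shows "run (While 3 nonblank (Seq (Shift 0 MRight) (mv1 3 1))) (sg, bt) (6 * length (sg 3) + 1)
   (sg(3 := [], 1 := rev (sg 3) @ sg 1), bt(0 := bt 0 + int (length (sg 3))))"
 using assms
proof (induction "sg 3" arbitrary: sg bt)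
 case Nil
 show ?case by (rule run_conv[OF run_WhileF]) (use Nil(1)[symmetric] in \<open>auto simp: fun_eq_iff\<close>)
next
 case (Cons x xs)
 have *: "xs = (sg(3 := xs, 1 := x # sg 1)) 3" by simp
 show ?case
  by (rule run_conv[OF run_WhileT[OF _ run_Seq[OF run_exec[OF exec_Shift] run_mv1]
    Cons(1)[of "sg(3 := xs, 1 := x # sg 1)", OF *]]])
   (use Cons(2)[symmetric] Cons(3) in \<open>auto simp: fun_eq_iff\<close>)
qed

definition start_state :: "str => state" where
 "start_state x = ((%_. [])(0 := x), (%_. 0)(0 := int (length x)))"

lemma start_config_conf:
 assumes "num_tapes M = \<tau>" "\<tau> > 0"
 shows "start_config M x = conf \<tau> 0 (start_state x)"
proof -
 have "[0..<\<tau>] = 0 # [1..<\<tau>]" using assms(2) by (simp add: upt_conv_Cons)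
 moreover have "map (%r. tape (fst (start_state x) r) (snd (start_state x) r)) [1..<\<tau>] = replicate (\<tau> - 1) (%_. 0, 0)"
  by (rule nth_equalityI) (auto simp: start_state_def tape_def Let_def)
 moreover have "tape x (int (length x)) = (input_tape x, 0)"
  by (auto simp: tape_def Let_def input_tape_def)
 ultimately show ?thesis using assms by (simp add: start_config_def conf_def start_state_def)
qed

lemma relpowp_dstep: "(dstep M ^^ n) c c' ==> (step M ^^ n) c c'"
 by (rule relpowp_mono) (auto simp: dstep_def)

theorem Fn_TM:
 assumes "Fn f S"
 shows "\<exists>M T. pb T S & TM M & deterministic M &
  (\<forall>x. \<exists>n \<le> T x. \<exists>c. (step M ^^ n) (start_config M x) c & halted M c & has_output c (f x))"
proof -
 obtain k T c where f: "pb T S" "\<And>j. regs (c j) \<subseteq> {..j + k}"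
  "\<And>j sg bt. (\<And>i. j < i ==> i \<le> j + k ==> sg i = []) ==> run (c j) (sg, bt) (T (sg j)) (sg(j := f (sg j)), bt)"
  using implE[OF impl_Fn[OF assms]] by metis
 define prog where "prog = Seq (mv 0 1) (Seq (mv2 1 3 2) (Seq (c 3)
  (Seq (While 2 nonblank (Seq (Pop 2) (Shift 0 MLeft)))
  (Seq (While 3 nonblank (Seq (Shift 0 MRight) (mv1 3 1))) (mv 1 0)))))"
 let ?T = "%x. 16 * length x + T x + 11 * length (f x) + 5"
 define \<tau> where "\<tau> = k + 4"
 define M where "M = \<lparr>num_tapes = \<tau>, instrs = code \<tau> prog 0 (csize prog)\<rparr>"
 have regs: "regs prog \<subseteq> {..<\<tau>}" using f(2)[of 3] by (auto simp: prog_def \<tau>_def mv1_def)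
 have TM: "TM M" using wf_code[of \<tau> prog 0 "csize prog"] by (auto simp: TM_def M_def wf_instrs_def \<tau>_def)
 have det: "deterministic M" using det_code[of \<tau> prog 0 "csize prog"] by (simp add: deterministic_def M_def det_instrs_def)
 have emb: "emb M \<tau> prog 0 (csize prog)" by (simp add: emb_def M_def)
 have run: "run prog (start_state x) (?T x) ((%_. [])(0 := f x), (%_. 0)(0 := int (length (f x))))" for x
  unfolding start_state_def prog_def
  by (rule run_conv[OF run_Seq[OF run_mv run_Seq[OF run_mv2 run_Seq[OF f(3) run_Seq[OF run_rewind
   run_Seq[OF run_forward run_mv]]]]]]) (auto simp: fun_eq_iff)
 have "\<exists>n \<le> ?T x. \<exists>c. (step M ^^ n) (start_config M x) c & halted M c & has_output c (f x)" for x
 proof -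
  let ?s = "((%_. [])(0 := f x), (%_. 0)(0 := int (length (f x)))) :: state"
  obtain t where t: "t \<le> ?T x" "exec prog (start_state x) t ?s" using run[of x] unfolding run_def by blast
  have "(dstep M ^^ t) (conf \<tau> 0 (start_state x)) (conf \<tau> (csize prog) ?s)"
   by (rule exec_correct[OF t(2) regs _ emb]) (simp add: \<tau>_def)
  then have 1: "(step M ^^ t) (start_config M x) (conf \<tau> (csize prog) ?s)"
   using relpowp_dstep start_config_conf[of M \<tau> x] by (simp add: M_def \<tau>_def)
  have 2: "halted M (conf \<tau> (csize prog) ?s)"
   using code_range[of _ \<tau> prog 0 "csize prog"] by (fastforce simp: halted_def step_def conf_def M_def)
  have "[0..<\<tau>] = 0 # [1..<\<tau>]" by (simp add: \<tau>_def upt_conv_Cons)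
  then have 3: "has_output (conf \<tau> (csize prog) ?s) (f x)"
   by (simp add: has_output_def conf_def tape_def Let_def)
  show ?thesis using t(1) 1 2 3 by blast
 qed
 moreover have "pb ?T S" using Fn_bound[OF assms] by (intro pb_intros f) auto
 ultimately show ?thesis using TM det by blast
qed

text \<open>\<open>E\<close> is the exact set of leaves of a computation tree from \<open>c\<close>
  of depth at most \<open>n\<close>, cut off at arbitrary places. Since \<open>outcomes_step\<close>
  demands a successor, a halted configuration can only be a leaf.\<close>

inductive outcomes :: "machine => config => nat => config set => bool" for M where
 outcomes_here: "outcomes M c n {c}"
| outcomes_step: "step M c c0 ==> (\<And>c'. step M c c' ==> outcomes M c' n (E c')) ==>
  outcomes M c (Suc n) (\<Union>c' \<in> {c'. step M c c'}. E c')"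

lemma outcomes_weaken: "outcomes M c n E ==> n \<le> m ==> outcomes M c m E"
proof (induction arbitrary: m rule: outcomes.induct)
 case (outcomes_step c c0 n E)
 then obtain k where "m = Suc k" "n \<le> k" by (cases m) auto
 then show ?case using outcomes_step.hyps(1) outcomes_step.IH by (metis outcomes.outcomes_step)
qed (rule outcomes_here)

lemma outcomes_trans:
 assumes "outcomes M c n E" "\<And>e. e \<in> E ==> outcomes M e m (F e)"
 shows "outcomes M c (n + m) (\<Union>e \<in> E. F e)"
 using assms
proof (induction rule: outcomes.induct)
 case (outcomes_here c n)
 then show ?case using outcomes_weaken[of M c m "F c" "n + m"] by simp
next
 case (outcomes_step c c0 n E)
 have "outcomes M c (Suc (n + m)) (\<Union>c' \<in> {c'. step M c c'}. \<Union>e \<in> E c'. F e)"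
 proof (rule outcomes.outcomes_step[OF outcomes_step(1)])
  fix c' assume s: "step M c c'"
  show "outcomes M c' (n + m) (\<Union>e \<in> E c'. F e)"
   by (rule outcomes_step.IH[OF s]) (use s in \<open>blast intro: outcomes_step.prems\<close>)
 qed
 then show ?case by simp
qed

lemma outcomes_det: "(dstep M ^^ n) c c' ==> outcomes M c n {c'}"
proof (induction n arbitrary: c)
 case 0
 then show ?case by (auto intro: outcomes_here)
next
 case (Suc n)
 then obtain d where d: "dstep M c d" "(dstep M ^^ n) d c'" by (meson relpowp_Suc_D2)
 have s: "step M c e \<longleftrightarrow> e = d" for e using d(1) unfolding dstep_def by blast
 have "outcomes M c (Suc n) (\<Union>c'' \<in> {c''. step M c c''}. {c'})"
 proof (rule outcomes_step)
  show "step M c d" using s by blast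
  show "outcomes M e n {c'}" if "step M c e" for e using that s[of e] Suc.IH[OF d(2)] by simp
 qed
 then show ?case using s by simp
qed

lemma outcomes_seq: "outcomes M c n {d} ==> outcomes M d m E ==> outcomes M c (n + m) E"
 using outcomes_trans[of M c n "{d}" m "%_. E"] by auto

text \<open>Halted leaves cannot be extended, so the tree comprises all computation paths.\<close>

lemma outcomes_final:
 assumes "outcomes M c n E" "\<And>e. e \<in> E ==> halted M e"
 shows "(\<forall>m c'. (step M ^^ m) c c' --> m \<le> n) & (\<forall>c'. (step M)\<^sup>*\<^sup>* c c' & halted M c' \<longleftrightarrow> c' \<in> E)"
 using assms
proof (induction rule: outcomes.induct)
 case (outcomes_here c n)
 then have h: "\<not> step M c c'" for c' unfolding halted_def by blast
 have "m = 0" if "(step M ^^ m) c c'" for m c'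
 proof (cases m)
  case (Suc k)
  show ?thesis using relpowp_Suc_D2[OF that[unfolded Suc]] h by blast
 qed
 moreover have "(step M)\<^sup>*\<^sup>* c c' \<longleftrightarrow> c' = c" for c'
 proof
  assume "(step M)\<^sup>*\<^sup>* c c'"
  then show "c' = c"
  proof (cases rule: converse_rtranclpE)
   case (step d)
   then show ?thesis using h by simp
  qed simp
 qed simp
 moreover have "halted M c" using outcomes_here.prems by blast
 ultimately show ?case by blast
next
 case (outcomes_step c c0 n E)
 have IH: "(\<forall>m c''. (step M ^^ m) c' c'' --> m \<le> n) & (\<forall>c''. (step M)\<^sup>*\<^sup>* c' c'' & halted M c'' \<longleftrightarrow> c'' \<in> E c')"
  if s: "step M c c'" for c'
  by (rule outcomes_step.IH[OF s]) (use s in \<open>blast intro: outcomes_step.prems\<close>)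
 have "m \<le> Suc n" if st: "(step M ^^ m) c c'" for m c'
 proof (cases m)
  case (Suc k)
  obtain d where "step M c d" "(step M ^^ k) d c'" using relpowp_Suc_D2[OF st[unfolded Suc]] by blast
  then show ?thesis using IH Suc by blast
 qed simp
 moreover have "(step M)\<^sup>*\<^sup>* c c' & halted M c' \<longleftrightarrow> (\<exists>d. step M c d & c' \<in> E d)" for c'
 proof
  assume r: "(step M)\<^sup>*\<^sup>* c c' & halted M c'"
  have "c' \<noteq> c" using outcomes_step(1) r unfolding halted_def by blast
  from r have "(step M)\<^sup>*\<^sup>* c c'" by simp
  then show "\<exists>d. step M c d & c' \<in> E d"
  proof (cases rule: converse_rtranclpE)
   case (step d)
   then show ?thesis using IH[OF step(1)] r by blast
  qed (use \<open>c' \<noteq> c\<close> in simp)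
 next
  assume "\<exists>d. step M c d & c' \<in> E d"
  then obtain d where d: "step M c d" "c' \<in> E d" by blast
  then have "(step M)\<^sup>*\<^sup>* d c'" "halted M c'" using IH[OF d(1)] by blast+
  then show "(step M)\<^sup>*\<^sup>* c c' & halted M c'" using d(1) by (simp add: converse_rtranclp_into_rtranclp[of "step M"])
 qed
 ultimately show ?case by simp
qed

lemma outcomes_run:
 assumes "run c s n s'" "regs c \<subseteq> {..<\<tau>}" "\<tau> > 0" "emb M \<tau> c q e"
 shows "outcomes M (conf \<tau> q s) n {conf \<tau> e s'}"
 using assms outcomes_det[OF exec_correct] outcomes_weaken unfolding run_def by metis

text \<open>The only nondeterministic instructions are those of state \<open>g\<close>, which chooses between pushing
 \<open>False\<close> and pushing \<open>True\<close>.\<close>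

lemma guess_loop:
 assumes M: "at_state M q = node \<tau> q 5 (%s. (s, MStay, if s \<noteq> 0 then Suc q else e))"
  "emb M \<tau> (Pop 5) (Suc q) g"
  "at_state M g = node \<tau> g 4 (%s. (s, MStay, g1)) \<union> node \<tau> g 4 (%s. (s, MStay, g2))"
  "emb M \<tau> (Push 4 False) g1 q" "emb M \<tau> (Push 4 True) g2 q" and \<tau>: "5 < \<tau>"
 shows "outcomes M (conf \<tau> q (sg, bt)) (6 * length (sg 5) + 1)
  {conf \<tau> e (sg(5 := [], 4 := w @ sg 4), bt) | w. length w = length (sg 5)}"
proof (induction "sg 5" arbitrary: sg)
 case Nil
 have "dstep M (conf \<tau> q (sg, bt)) (conf \<tau> e (sg, bt))"
  by (rule conf_goto[OF M(1)]) (use Nil \<tau> in auto)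
 then have o: "outcomes M (conf \<tau> q (sg, bt)) 1 {conf \<tau> e (sg, bt)}"
  by (intro outcomes_det) (simp add: eq_OO)
 have "sg(5 := [], 4 := w @ sg 4) = sg" if "length w = length (sg 5)" for w
  using Nil[symmetric] that by (auto simp: fun_eq_iff)
 then have "{conf \<tau> e (sg(5 := [], 4 := w @ sg 4), bt) | w. length w = length (sg 5)} = {conf \<tau> e (sg, bt)}"
  using Nil[symmetric] by auto
 with o show ?case using Nil[symmetric] by (simp only: list.size mult_0_right add_0)
next
 case (Cons x xs)
 let ?sg = "sg(5 := xs)"
 have "dstep M (conf \<tau> q (sg, bt)) (conf \<tau> (Suc q) (sg, bt))"
  by (rule conf_goto[OF M(1)]) (use Cons(2)[symmetric] \<tau> in auto)
 then have 1: "outcomes M (conf \<tau> q (sg, bt)) 1 {conf \<tau> (Suc q) (sg, bt)}"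
  by (intro outcomes_det) (simp add: eq_OO)
 have "run (Pop 5) (sg, bt) 1 (?sg, bt)" by (rule run_conv[OF run_Pop]) (use Cons(2)[symmetric] in auto)
 then have 2: "outcomes M (conf \<tau> (Suc q) (sg, bt)) 1 {conf \<tau> g (?sg, bt)}"
  by (rule outcomes_run) (use M(2) \<tau> in auto)
 have succ: "step M (conf \<tau> g (?sg, bt)) c' \<longleftrightarrow> c' = conf \<tau> g1 (?sg, bt) \<or> c' = conf \<tau> g2 (?sg, bt)" for c'
 proof -
  define ts where "ts = snd (conf \<tau> g (?sg, bt))"
  have ts: "conf \<tau> p (?sg, bt) = (p, ts)" for p by (simp add: ts_def conf_def)
  have len: "length ts = \<tau>" "set (reads ts) \<subseteq> {0, 1, 2}"
   using reads_conf[of \<tau> g "(?sg, bt)"] top_symbol_le by (auto simp: ts_def conf_def)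
  have "(g, reads ts, q', as) \<in> instrs M \<longleftrightarrow> (q' = g1 \<or> q' = g2) & as = map (%s. (s, MStay)) (reads ts)" for q' as
  proof -
   have "(g, reads ts, q', as) \<in> instrs M \<longleftrightarrow> (g, reads ts, q', as) \<in> at_state M g"
    by (simp add: at_state_def)
   also have "\<dots> \<longleftrightarrow> (q' = g1 \<or> q' = g2) & as = (map (%s. (s, MStay)) (reads ts))[4 := (reads ts ! 4, MStay)]"
    unfolding M(3) node_def using len by (auto simp: image_iff reads_def)
   also have "(map (%s. (s, MStay)) (reads ts))[4 := (reads ts ! 4, MStay)] = map (%s. (s, MStay)) (reads ts)"
    by (metis (no_types, lifting) list_update_beyond list_update_id map_update linorder_not_le nth_map length_map)
   finally show ?thesis .
  qed
  then show ?thesis unfolding ts step_def using map2_act_stay[of ts] by (auto simp: reads_def[symmetric])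
 qed
 define W where "W \<tau>' = {conf \<tau> e (sg(5 := [], 4 := w @ \<tau>' # sg 4), bt) | w. length w = length xs}" for \<tau>'
 have branch: "outcomes M (conf \<tau> g' (?sg, bt)) (2 + (6 * length xs + 1)) (W b)"
  if "emb M \<tau> (Push 4 b) g' q" for g' b
 proof (rule outcomes_seq)
  show "outcomes M (conf \<tau> g' (?sg, bt)) 2 {conf \<tau> q (?sg(4 := b # sg 4), bt)}"
   by (rule outcomes_run[OF run_conv[OF run_Push]]) (use that \<tau> in auto)
  have "outcomes M (conf \<tau> q (?sg(4 := b # sg 4), bt)) (6 * length ((?sg(4 := b # sg 4)) 5) + 1)
    {conf \<tau> e ((?sg(4 := b # sg 4))(5 := [], 4 := w @ (?sg(4 := b # sg 4)) 4), bt) | w. length w = length ((?sg(4 := b # sg 4)) 5)}"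
   by (rule Cons(1)) simp
  moreover have "(?sg(4 := b # sg 4))(5 := [], 4 := w @ (?sg(4 := b # sg 4)) 4) = sg(5 := [], 4 := w @ b # sg 4)" for w
   by (auto simp: fun_eq_iff)
  ultimately show "outcomes M (conf \<tau> q (?sg(4 := b # sg 4), bt)) (6 * length xs + 1) (W b)"
   by (simp add: W_def)
 qed
 have gg: "conf \<tau> g1 (?sg, bt) = conf \<tau> g2 (?sg, bt) \<longleftrightarrow> g1 = g2" by (simp add: conf_def)
 \<comment> \<open>If the two continuations were one state, the state after it would have to write
   both bits. Distinctness lets \<open>E\<close> below tell the two branches apart.\<close>
 have "g1 \<noteq> g2"
 proof
  assume eq: "g1 = g2"
  have "node \<tau> (Suc g1) 4 (%_. (bit_symbol False, MStay, q)) = at_state M (Suc g1)"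
   by (rule emb_at[OF M(4), symmetric]) (auto simp: emb_simps)
  also have "\<dots> = node \<tau> (Suc g1) 4 (%_. (bit_symbol True, MStay, q))"
   unfolding eq by (rule emb_at[OF M(5)]) (auto simp: emb_simps)
  finally have n: "node \<tau> (Suc g1) 4 (%_. (bit_symbol False, MStay, q)) = node \<tau> (Suc g1) 4 (%_. (bit_symbol True, MStay, q))" .
  have "(Suc g1, replicate \<tau> 0, q, (map (%s. (s, MStay)) (replicate \<tau> 0))[4 := (1, MStay)]) \<in>
    node \<tau> (Suc g1) 4 (%_. (bit_symbol False, MStay, q))"
   by (auto simp: node_def image_iff intro!: exI[of _ "replicate \<tau> 0"])
  then have "(map (%s. (s, MStay)) (replicate \<tau> (0::nat)))[4 := (1, MStay)] = (map (%s. (s, MStay)) (replicate \<tau> 0))[4 := (2, MStay)]"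
   unfolding n by (auto simp: node_def) (metis map_replicate)
  from arg_cong[OF this, of "%l. l ! 4"] show False using \<tau> by simp
 qed
 then have ne: "conf \<tau> g1 (?sg, bt) \<noteq> conf \<tau> g2 (?sg, bt)" using gg by blast
 define E where "E c' = (if c' = conf \<tau> g1 (?sg, bt) then W False else W True)" for c'
 have "outcomes M (conf \<tau> g (?sg, bt)) (Suc (2 + (6 * length xs + 1))) (\<Union>c' \<in> {c'. step M (conf \<tau> g (?sg, bt)) c'}. E c')"
  by (rule outcomes_step[of _ _ "conf \<tau> g1 (?sg, bt)"])
   (use succ branch[OF M(4)] branch[OF M(5)] ne in \<open>auto simp: E_def\<close>)
 moreover have "(\<Union>c' \<in> {c'. step M (conf \<tau> g (?sg, bt)) c'}. E c') =
   {conf \<tau> e (sg(5 := [], 4 := w @ sg 4), bt) | w. length w = length (sg 5)}"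
 proof -
  have "(\<Union>c' \<in> {c'. step M (conf \<tau> g (?sg, bt)) c'}. E c') = W False \<union> W True"
   using succ ne by (auto simp: E_def)
  also have "\<dots> = {conf \<tau> e (sg(5 := [], 4 := w @ sg 4), bt) | w. length w = length (sg 5)}"
  proof (intro equalityI subsetI)
   fix c assume "c \<in> W False \<union> W True"
   then obtain b w where "c = conf \<tau> e (sg(5 := [], 4 := (w @ [b]) @ sg 4), bt)" "length w = length xs"
    unfolding W_def by auto
   then show "c \<in> {conf \<tau> e (sg(5 := [], 4 := w @ sg 4), bt) | w. length w = length (sg 5)}"
    using Cons(2)[symmetric] by (intro CollectI exI[of _ "w @ [b]"]) simp
  next
   fix c assume "c \<in> {conf \<tau> e (sg(5 := [], 4 := w @ sg 4), bt) | w. length w = length (sg 5)}"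
   then obtain v where v: "c = conf \<tau> e (sg(5 := [], 4 := v @ sg 4), bt)" "length v = Suc (length xs)"
    using Cons(2)[symmetric] by auto
   then obtain w b where "v = w @ [b]" "length w = length xs" by (cases v rule: rev_cases) auto
   then show "c \<in> W False \<union> W True" using v unfolding W_def by (cases b) auto
  qed
  finally show ?thesis .
 qed
 ultimately have 3: "outcomes M (conf \<tau> g (?sg, bt)) (6 * length xs + 4)
   {conf \<tau> e (sg(5 := [], 4 := w @ sg 4), bt) | w. length w = length (sg 5)}"
  by (simp only:) (erule outcomes_weaken, simp)
 show ?case using outcomes_weaken[OF outcomes_seq[OF 1 outcomes_seq[OF 2 3]]] Cons(2)[symmetric] by simp
qed

theorem Fn_NTM:
 assumes "Fn g S" "PF chk"
 shows "\<exists>M T. pb T S & TM M & (\<forall>x. (\<forall>n c. (step M ^^ n) (start_config M x) c --> n \<le> T x) &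
  ((\<exists>w. length w = length (g x) & chk (pr x w) \<noteq> []) \<longleftrightarrow>
   (\<exists>c. (step M)\<^sup>*\<^sup>* (start_config M x) c & halted M c & fst c = 1)))"
proof -
 obtain k1 T1 c1 where g: "pb T1 S" "\<And>j. regs (c1 j) \<subseteq> {..j + k1}"
  "\<And>j sg bt. (\<And>i. j < i ==> i \<le> j + k1 ==> sg i = []) ==> run (c1 j) (sg, bt) (T1 (sg j)) (sg(j := g (sg j)), bt)"
  using implE[OF impl_Fn[OF assms(1)]] by metis
 obtain k2 T2 c2 where h: "pb T2 length" "\<And>j. regs (c2 j) \<subseteq> {..j + k2}"
  "\<And>j sg bt. (\<And>i. j < i ==> i \<le> j + k2 ==> sg i = []) ==> run (c2 j) (sg, bt) (T2 (sg j)) (sg(j := chk (sg j)), bt)"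
  using implE[OF impl_Fn[OF assms(2)]] by metis
 obtain C where C: "\<And>x. T2 x \<le> (length x + C) ^ C" using h(1) unfolding pb_def by blast
 define A where "A = Seq (mv 0 1) (Seq (mv 1 3) (Seq (copy 3 5 4) (c1 5)))"
 define B where "B = Seq (mkpair 2) (c2 2)"
 define \<tau> where "\<tau> = k1 + k2 + 7"
 \<comment> \<open>States 0 and 1 are reserved as initial and accepting. The guessing loop takes
   seven states: test \<open>q\<close>, pop \<open>q + 1\<close>, choice \<open>q + 2\<close>, and
   two pushes of two states each. After \<open>B\<close>, state \<open>r\<close> tests the result,
   and \<open>r + 1\<close> has no instructions and rejects.\<close>
 define q where "q = 2 + csize A"
 define r where "r = q + 7 + csize B"
 define I where "I = node \<tau> 0 0 (%s. (s, MStay, 2)) \<union> code \<tau> A 2 q \<union>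
   node \<tau> q 5 (%s. (s, MStay, if s \<noteq> 0 then Suc q else q + 7)) \<union> code \<tau> (Pop 5) (Suc q) (q + 2) \<union>
   (node \<tau> (q + 2) 4 (%s. (s, MStay, q + 3)) \<union> node \<tau> (q + 2) 4 (%s. (s, MStay, q + 5))) \<union>
   code \<tau> (Push 4 False) (q + 3) q \<union> code \<tau> (Push 4 True) (q + 5) q \<union>
   code \<tau> B (q + 7) r \<union> node \<tau> r 2 (%s. (s, MStay, if s \<noteq> 0 then 1 else r + 1))"
 define M where "M = \<lparr>num_tapes = \<tau>, instrs = I\<rparr>"
 have TM: "TM M"
 proof -
  have "wf_instrs \<tau> I" unfolding I_def by (intro wf_Un wf_node wf_code)
  then show ?thesis by (auto simp: TM_def M_def wf_instrs_def \<tau>_def)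
 qed
 have pos: "csize A > 0" "csize B > 0" by (rule csize_pos)+
 have inM: "i \<in> instrs M \<longleftrightarrow> i \<in> I" for i by (simp add: M_def)
 have at0: "at_state M 0 = node \<tau> 0 0 (%s. (s, MStay, 2))"
  unfolding at_state_def inM I_def q_def r_def by (auto simp: emb_simps dest: node_state)
 have embA: "emb M \<tau> A 2 q"
  unfolding emb_def inM I_def q_def r_def by (auto simp: emb_simps)
 have atq: "at_state M q = node \<tau> q 5 (%s. (s, MStay, if s \<noteq> 0 then Suc q else q + 7))"
  unfolding at_state_def inM I_def r_def by (auto simp: emb_simps q_def dest: node_state)
 have embP: "emb M \<tau> (Pop 5) (Suc q) (q + 2)"
  unfolding emb_def inM I_def r_def by (auto simp: emb_simps q_def simp del: code.simps)
 have atg: "at_state M (q + 2) = node \<tau> (q + 2) 4 (%s. (s, MStay, q + 3)) \<union> node \<tau> (q + 2) 4 (%s. (s, MStay, q + 5))"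
  unfolding at_state_def inM I_def r_def by (auto simp: emb_simps q_def simp del: code.simps dest: node_state)
 have emb0: "emb M \<tau> (Push 4 False) (q + 3) q"
  unfolding emb_def inM I_def r_def by (auto simp: emb_simps q_def simp del: code.simps)
 have emb1: "emb M \<tau> (Push 4 True) (q + 5) q"
  unfolding emb_def inM I_def r_def by (auto simp: emb_simps q_def simp del: code.simps)
 have embB: "emb M \<tau> B (q + 7) r"
  unfolding emb_def inM I_def by (auto simp: emb_simps q_def r_def simp del: code.simps)
 have atr: "at_state M r = node \<tau> r 2 (%s. (s, MStay, if s \<noteq> 0 then 1 else r + 1))"
  unfolding at_state_def inM I_def using pos
  by (auto simp: emb_simps q_def r_def simp del: code.simps dest: node_state)
 have halt: "at_state M 1 = {}" "at_state M (r + 1) = {}"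
  unfolding at_state_def inM I_def using pos
  by (auto simp: emb_simps q_def r_def simp del: code.simps dest!: node_state)
 have regsA: "regs A \<subseteq> {..<\<tau>}" using g(2)[of 5] by (auto simp: A_def \<tau>_def)
 have regsB: "regs B \<subseteq> {..<\<tau>}" using h(2)[of 2] by (auto simp: B_def \<tau>_def)
 have \<tau>0: "\<tau> > 0" "5 < \<tau>" by (simp_all add: \<tau>_def)
 define T where "T x = 1 + (23 * length x + T1 x + 6) + (6 * length (g x) + 1) +
   (17 * length x + 10 * length (g x) + 7 + (2 * length x + length (g x) + 1 + C) ^ C) + 1" for x
 define bt where "bt x = (%_ :: nat. 0 :: int)(0 := int (length x))" for x :: str
 define sg where "sg x w = (%_ :: nat. [] :: str)(3 := x, 4 := w)" for x w :: str
 define sg' where "sg' x w = (%_ :: nat. [] :: str)(2 := chk (pr x w))" for x w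
 have runA: "run A (start_state x) (23 * length x + T1 x + 6) ((sg x [])(5 := g x), bt x)" for x
  unfolding start_state_def A_def bt_def sg_def
  by (rule run_conv[OF run_Seq[OF run_mv run_Seq[OF run_mv run_Seq[OF run_copy g(3)]]]])
   (auto simp: fun_eq_iff)
 have runB: "run B (sg x w, bt x) (17 * length x + 10 * length (g x) + 7 + (2 * length x + length (g x) + 1 + C) ^ C) (sg' x w, bt x)"
  if "length w = length (g x)" for x w
  unfolding B_def sg'_def sg_def
  by (rule run_conv[OF run_Seq[OF run_mkpair h(3)]])
   (use C[of "pr x w"] that in \<open>auto simp: fun_eq_iff\<close>)
 define E where "E x = (%w. conf \<tau> (if chk (pr x w) \<noteq> [] then 1 else r + 1) (sg' x w, bt x)) ` {w. length w = length (g x)}" for x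
 have out: "outcomes M (start_config M x) (T x) (E x)" for x
 proof -
  let ?x = "start_state x"
  have sc: "start_config M x = conf \<tau> 0 ?x" by (rule start_config_conf) (simp_all add: M_def \<tau>0)
  have 1: "outcomes M (conf \<tau> 0 ?x) 1 {conf \<tau> 2 ?x}"
   using conf_goto[OF at0, of ?x] \<tau>0 by (intro outcomes_det) (simp add: eq_OO)
  have 2: "outcomes M (conf \<tau> 2 ?x) (23 * length x + T1 x + 6) {conf \<tau> q ((sg x [])(5 := g x), bt x)}"
   by (rule outcomes_run[OF runA regsA \<tau>0(1) embA])
  let ?F = "{conf \<tau> (q + 7) (((sg x [])(5 := g x))(5 := [], 4 := w @ ((sg x [])(5 := g x)) 4), bt x) | w.
    length w = length (((sg x [])(5 := g x)) 5)}"
  have 3: "outcomes M (conf \<tau> q ((sg x [])(5 := g x), bt x)) (6 * length (((sg x [])(5 := g x)) 5) + 1) ?F"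
   by (rule guess_loop[OF atq embP atg emb0 emb1 \<tau>0(2)])
  have "((sg x [])(5 := g x))(5 := [], 4 := w @ ((sg x [])(5 := g x)) 4) = sg x w" for w
   by (auto simp: sg_def fun_eq_iff)
  then have F: "?F = (%w. conf \<tau> (q + 7) (sg x w, bt x)) ` {w. length w = length (g x)}"
   by (auto simp: image_iff)
  have 4: "outcomes M (conf \<tau> (q + 7) (sg x w, bt x))
   ((17 * length x + 10 * length (g x) + 7 + (2 * length x + length (g x) + 1 + C) ^ C) + 1)
   {conf \<tau> (if chk (pr x w) \<noteq> [] then 1 else r + 1) (sg' x w, bt x)}" if "length w = length (g x)" for w
  proof (rule outcomes_seq[OF outcomes_run[OF runB[OF that] regsB \<tau>0(1) embB]])
   have "dstep M (conf \<tau> r (sg' x w, bt x)) (conf \<tau> (if chk (pr x w) \<noteq> [] then 1 else r + 1) (sg' x w, bt x))"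
    by (rule conf_goto[OF atr]) (use \<tau>0 in \<open>auto simp: sg'_def\<close>)
   then show "outcomes M (conf \<tau> r (sg' x w, bt x)) 1
     {conf \<tau> (if chk (pr x w) \<noteq> [] then 1 else r + 1) (sg' x w, bt x)}"
    by (intro outcomes_det) (simp add: eq_OO)
  qed
  \<comment> \<open>\<open>G\<close> sends a leaf of the guessing phase to the leaf reached after
    the check. It is single-valued because the guess can be read off tape 4.\<close>
  define G where "G e = (\<Union>w \<in> {w. length w = length (g x) & e = conf \<tau> (q + 7) (sg x w, bt x)}.
    {conf \<tau> (if chk (pr x w) \<noteq> [] then 1 else r + 1) (sg' x w, bt x)})" for e
  have inj: "w = v" if "conf \<tau> (q + 7) (sg x w, bt x) = conf \<tau> (q + 7) (sg x v, bt x)" "length w = length v" for w v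
  proof -
   have "tape w 0 = tape v 0"
    using that(1) \<tau>0(2) conf_nth[of 4 \<tau> "q + 7" "(sg x w, bt x)"] conf_nth[of 4 \<tau> "q + 7" "(sg x v, bt x)"]
    by (simp add: sg_def bt_def)
   then have eq: "fst (tape w 0) i = fst (tape v 0) i" for i by simp
   show ?thesis
   proof (rule nth_equalityI[OF that(2)])
    fix i assume "i < length w"
    then show "w ! i = v ! i" using eq[of "int i - int (length w)"] that(2)
     by (auto simp: tape_def Let_def bit_symbol_def split: if_splits)
   qed
  qed
  have 5: "outcomes M e ((17 * length x + 10 * length (g x) + 7 + (2 * length x + length (g x) + 1 + C) ^ C) + 1) (G e)"
   if e: "e \<in> ?F" for e
  proof -
   obtain w where w: "length w = length (g x)" "e = conf \<tau> (q + 7) (sg x w, bt x)" using e unfolding F by blast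
   have "{v. length v = length (g x) & e = conf \<tau> (q + 7) (sg x v, bt x)} = {w}"
   proof -
    have "v = w" if "length v = length (g x)" "e = conf \<tau> (q + 7) (sg x v, bt x)" for v
     by (rule inj) (use w that in simp_all)
    then show ?thesis using w by blast
   qed
   then have "G e = {conf \<tau> (if chk (pr x w) \<noteq> [] then 1 else r + 1) (sg' x w, bt x)}" unfolding G_def by simp
   then show ?thesis using 4[OF w(1)] w(2) by simp
  qed
  have "outcomes M (conf \<tau> 0 ?x) (1 + ((23 * length x + T1 x + 6) + ((6 * length (((sg x [])(5 := g x)) 5) + 1) +
   ((17 * length x + 10 * length (g x) + 7 + (2 * length x + length (g x) + 1 + C) ^ C) + 1)))) (\<Union>e \<in> ?F. G e)"
   by (rule outcomes_seq[OF 1 outcomes_seq[OF 2 outcomes_trans[OF 3 5]]])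
  moreover have "(\<Union>e \<in> ?F. G e) = E x" unfolding F G_def E_def by auto
  ultimately show ?thesis unfolding sc by (auto simp: T_def algebra_simps elim!: outcomes_weaken)
 qed
 have hE: "halted M e" if "e \<in> E x" for e x
 proof -
  have "\<not> step M e e'" for e'
   using that halt unfolding E_def step_def at_state_def conf_def by (fastforce split: if_splits)
  then show ?thesis unfolding halted_def by blast
 qed
 have acc: "(\<exists>w. length w = length (g x) & chk (pr x w) \<noteq> []) \<longleftrightarrow> (\<exists>e \<in> E x. fst e = 1)" for x
 proof -
  have "fst (conf \<tau> (if chk (pr x w) \<noteq> [] then 1 else r + 1) (sg' x w, bt x)) = 1 \<longleftrightarrow> chk (pr x w) \<noteq> []" for w
   using pos by (auto simp: conf_def r_def)
  then show ?thesis unfolding E_def by auto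
 qed
 have "pb T S" unfolding T_def using Fn_bound[OF assms(1)] by (intro pb_intros g) auto
 moreover have "(\<forall>n c. (step M ^^ n) (start_config M x) c --> n \<le> T x) &
  ((\<exists>w. length w = length (g x) & chk (pr x w) \<noteq> []) \<longleftrightarrow>
   (\<exists>c. (step M)\<^sup>*\<^sup>* (start_config M x) c & halted M c & fst c = 1))" for x
 proof -
  have "(\<forall>m c'. (step M ^^ m) (start_config M x) c' --> m \<le> T x) &
    (\<forall>c'. (step M)\<^sup>*\<^sup>* (start_config M x) c' & halted M c' \<longleftrightarrow> c' \<in> E x)"
   by (rule outcomes_final[OF out]) (rule hE)
  with acc[of x] show ?thesis by blast
 qed
 ultimately show ?thesis using TM by blast
qed

section \<open>NP sets are definable by Sigma^b_1 formulas\<close>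

section \<open>Substitution\<close>

lemma eval_subst: "eval e (subst_trm sg t) = eval (%i. eval e (sg i)) t"
 by (induction t) auto

lemma eval_under_binder: "(%i. eval (case_nat n e) (under_binder sg i)) = case_nat n (%i. eval e (sg i))"
 by (auto simp: fun_eq_iff under_binder_def eval_subst split: nat.splits)

lemma sat_subst: "sat e (subst sg \<phi>) \<longleftrightarrow> sat (%i. eval e (sg i)) \<phi>"
 by (induction \<phi> arbitrary: e sg) (auto simp: eval_subst eval_under_binder)

lemma subst_trm_comp: "subst_trm sg (subst_trm \<tau> t) = subst_trm (%i. subst_trm sg (\<tau> i)) t"
 by (induction t) auto

lemma subst_under_binder_lift: "subst_trm (under_binder sg) (lift_trm t) = lift_trm (subst_trm sg t)"
 by (simp add: subst_trm_comp under_binder_def)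

lemma subst_bAll: "subst sg (bAll t \<phi>) = bAll (subst_trm sg t) (subst (under_binder sg) \<phi>)"
 and subst_bEx: "subst sg (bEx t \<phi>) = bEx (subst_trm sg t) (subst (under_binder sg) \<phi>)"
 by (simp_all add: bAll_def bEx_def subst_under_binder_lift) (simp_all add: under_binder_def)

lemma sharply_bounded_subst: "sharply_bounded \<phi> ==> sharply_bounded (subst sg \<phi>)"
 by (induction arbitrary: sg rule: sharply_bounded.induct)
  (auto simp: subst_bAll subst_bEx intro: sharply_bounded.intros)

lemma Sigma_b1_subst: "Sigma_b1 \<phi> ==> Sigma_b1 (subst sg \<phi>)"
 and Pi_b1_subst: "Pi_b1 \<psi> ==> Pi_b1 (subst sg \<psi>)"
 by (induction arbitrary: sg and sg rule: Sigma_b1_Pi_b1.inducts)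
  (auto simp: subst_bAll subst_bEx sharply_bounded_subst intro: Sigma_b1_Pi_b1.intros)

lemma fv_subst_trm: "fv_trm (subst_trm sg t) = (\<Union>i \<in> fv_trm t. fv_trm (sg i))"
 by (induction t) auto

lemma fv_under_binder:
 "{i. Suc i \<in> (\<Union>j \<in> A. fv_trm (under_binder sg j))} \<subseteq> (\<Union>j \<in> {i. Suc i \<in> A}. fv_trm (sg j))"
proof clarify
 fix i j assume "j \<in> A" "Suc i \<in> fv_trm (under_binder sg j)"
 then show "i \<in> (\<Union>j \<in> {i. Suc i \<in> A}. fv_trm (sg j))"
  by (cases j) (auto simp: under_binder_def fv_subst_trm)
qed

lemma fv_subst: "fv (subst sg \<phi>) \<subseteq> (\<Union>i \<in> fv \<phi>. fv_trm (sg i))"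
proof (induction \<phi> arbitrary: sg)
 case (All \<phi>)
 have "{i. Suc i \<in> fv (subst (under_binder sg) \<phi>)} \<subseteq> {i. Suc i \<in> (\<Union>j \<in> fv \<phi>. fv_trm (under_binder sg j))}"
  using All[of "under_binder sg"] by blast
 then show ?case using fv_under_binder[of sg "fv \<phi>"] unfolding subst.simps fv.simps by (rule order_trans)
next
 case (Ex \<phi>)
 have "{i. Suc i \<in> fv (subst (under_binder sg) \<phi>)} \<subseteq> {i. Suc i \<in> (\<Union>j \<in> fv \<phi>. fv_trm (under_binder sg j))}"
  using Ex[of "under_binder sg"] by blast
 then show ?case using fv_under_binder[of sg "fv \<phi>"] unfolding subst.simps fv.simps by (rule order_trans)
qed (simp_all add: fv_subst_trm le_supI1 le_supI2)

lemma eval_fv: "(\<And>i. i \<in> fv_trm t ==> e i = e' i) ==> eval e t = eval e' t"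
 by (induction t) auto

lemma sat_fv: "(\<And>i. i \<in> fv \<phi> ==> e i = e' i) ==> sat e \<phi> = sat e' \<phi>"
proof (induction \<phi> arbitrary: e e')
 case (All \<phi>)
 have "sat (case_nat n e) \<phi> = sat (case_nat n e') \<phi>" for n
  by (rule All.IH) (use All.prems in \<open>auto split: nat.splits\<close>)
 then show ?case by simp
next
 case (Ex \<phi>)
 have "sat (case_nat n e) \<phi> = sat (case_nat n e') \<phi>" for n
  by (rule Ex.IH) (use Ex.prems in \<open>auto split: nat.splits\<close>)
 then show ?case by simp
next
 case (Eq s t)
 have "eval e s = eval e' s" "eval e t = eval e' t" by (rule eval_fv, rule Eq, simp)+
 then show ?case by simp
next
 case (Le s t)
 have "eval e s = eval e' s" "eval e t = eval e' t" by (rule eval_fv, rule Le, simp)+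
 then show ?case by simp
next
 case (Neg \<phi>)
 have "sat e \<phi> = sat e' \<phi>" by (rule Neg.IH, rule Neg.prems, simp)
 then show ?case by simp
next
 case (And \<phi> \<psi>)
 have "sat e \<phi> = sat e' \<phi>" by (rule And.IH(1), rule And.prems, simp)
 moreover have "sat e \<psi> = sat e' \<psi>" by (rule And.IH(2), rule And.prems, simp)
 ultimately show ?case by simp
next
 case (Or \<phi> \<psi>)
 have "sat e \<phi> = sat e' \<phi>" by (rule Or.IH(1), rule Or.prems, simp)
 moreover have "sat e \<psi> = sat e' \<psi>" by (rule Or.IH(2), rule Or.prems, simp)
 ultimately show ?case by simp
next
 case (Imp \<phi> \<psi>)
 have "sat e \<phi> = sat e' \<phi>" by (rule Imp.IH(1), rule Imp.prems, simp)
 moreover have "sat e \<psi> = sat e' \<psi>" by (rule Imp.IH(2), rule Imp.prems, simp)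
 ultimately show ?case by simp
qed

lemma sat_bAll [simp]: "sat e (bAll t \<phi>) \<longleftrightarrow> (\<forall>n \<le> eval e t. sat (case_nat n e) \<phi>)"
 and sat_bEx [simp]: "sat e (bEx t \<phi>) \<longleftrightarrow> (\<exists>n \<le> eval e t. sat (case_nat n e) \<phi>)"
 by (auto simp: bAll_def bEx_def eval_subst)

section \<open>Definability by \<open>\<Sigma>\<^sup>b\<^sub>1\<close> formulas\<close>

definition TD :: "((nat => nat) => nat) => bool" where
 "TD t \<longleftrightarrow> (\<exists>s. \<forall>e. eval e s = t e)"

text \<open>Membership in \<open>NE_class\<close> only concerns truth in the standard model.
  Formulas are therefore replaced by the relations that they define, and closure rules take the
  place of writing formulas down.\<close>

definition SD :: "((nat => nat) => bool) => bool" where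
 "SD R \<longleftrightarrow> (\<exists>\<phi>. Sigma_b1 \<phi> & (\<forall>e. sat e \<phi> \<longleftrightarrow> R e))"

lemma floorlog_small [simp]: "floorlog 2 0 = 0" "floorlog 2 (Suc 0) = 1"
 by (simp_all add: compute_floorlog[of 2 0] compute_floorlog[of 2 "Suc 0"])

lemma TD_var: "TD (%e. e i)"
 unfolding TD_def by (rule exI[of _ "Var i"]) simp

lemma TD_zero: "TD (%e. 0)"
 unfolding TD_def by (rule exI[of _ Zero]) simp

lemma TD_Suc: "TD t ==> TD (%e. Suc (t e))"
 unfolding TD_def by (metis eval.simps(3))

lemma TD_const: "TD (%e. n)"
 by (induction n) (auto intro: TD_zero TD_Suc)

lemma TD_ops:
 assumes "TD s" "TD t"
 shows "TD (%e. s e + t e)" "TD (%e. s e * t e)" "TD (%e. 2 ^ (floorlog 2 (s e) * floorlog 2 (t e)))"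
proof -
 obtain u v where "\<forall>e. eval e u = s e" "\<forall>e. eval e v = t e" using assms unfolding TD_def by blast
 then have "\<forall>e. eval e (u \<^bold>+ v) = s e + t e" "\<forall>e. eval e (u \<^bold>* v) = s e * t e"
  "\<forall>e. eval e (u \<^bold># v) = 2 ^ (floorlog 2 (s e) * floorlog 2 (t e))" by simp_all
 then show "TD (%e. s e + t e)" "TD (%e. s e * t e)" "TD (%e. 2 ^ (floorlog 2 (s e) * floorlog 2 (t e)))"
  unfolding TD_def by blast+
qed

lemma TD_len: "TD t ==> TD (%e. floorlog 2 (t e))"
 unfolding TD_def by (metis eval.simps(6))

lemma TD_half: "TD t ==> TD (%e. t e div 2)"
 unfolding TD_def by (metis eval.simps(7))

lemma TD_pow: "TD t ==> TD (%e. 2 ^ floorlog 2 (t e))"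
 using TD_ops(3)[OF TD_const[of 1], of t] by simp

lemma TD_if: "TD s ==> TD t ==> TD (%e. if P then s e else t e)"
 by (cases P) auto

lemma TD_subst:
 assumes "TD t" "\<And>i. TD (%e. u e i)" shows "TD (%e. t (u e))"
proof -
 obtain s where s: "\<forall>e. eval e s = t e" using assms(1) unfolding TD_def by blast
 obtain sg where "\<forall>i e. eval e (sg i) = u e i" using assms(2) unfolding TD_def by metis
 then have "(%i. eval e (sg i)) = u e" for e by auto
 then have "eval e (subst_trm sg s) = t (u e)" for e using s by (simp add: eval_subst)
 then show ?thesis unfolding TD_def by blast
qed

lemma SD_subst:
 assumes "SD R" "\<And>i. TD (%e. u e i)" shows "SD (%e. R (u e))"
proof -
 obtain \<phi> where s: "Sigma_b1 \<phi>" "\<forall>e. sat e \<phi> \<longleftrightarrow> R e" using assms(1) unfolding SD_def by blast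
 obtain sg where "\<forall>i e. eval e (sg i) = u e i" using assms(2) unfolding TD_def by metis
 then have "(%i. eval e (sg i)) = u e" for e by auto
 then have "sat e (subst sg \<phi>) \<longleftrightarrow> R (u e)" for e using s by (simp add: sat_subst)
 then show ?thesis using s Sigma_b1_subst unfolding SD_def by blast
qed

lemma SD_atomic:
 assumes "TD s" "TD t"
 shows "SD (%e. s e = t e)" "SD (%e. s e \<le> t e)" "SD (%e. s e \<noteq> t e)" "SD (%e. s e < t e)"
proof -
 obtain u v where uv: "\<forall>e. eval e u = s e" "\<forall>e. eval e v = t e" using assms unfolding TD_def by blast
 have sb: "sharply_bounded (u \<^bold>= v)" "sharply_bounded (u \<^bold>\<le> v)" "sharply_bounded (\<^bold>\<not> (u \<^bold>= v))"
  "sharply_bounded (\<^bold>\<not> (v \<^bold>\<le> u))" by (intro sharply_bounded.intros)+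
 show "SD (%e. s e = t e)" unfolding SD_def
  by (rule exI[of _ "u \<^bold>= v"]) (use sb uv in \<open>auto intro: Sigma_b1_Pi_b1.intros\<close>)
 show "SD (%e. s e \<le> t e)" unfolding SD_def
  by (rule exI[of _ "u \<^bold>\<le> v"]) (use sb uv in \<open>auto intro: Sigma_b1_Pi_b1.intros\<close>)
 show "SD (%e. s e \<noteq> t e)" unfolding SD_def
  by (rule exI[of _ "\<^bold>\<not> (u \<^bold>= v)"]) (use sb uv in \<open>auto intro: Sigma_b1_Pi_b1.intros\<close>)
 show "SD (%e. s e < t e)" unfolding SD_def
  by (rule exI[of _ "\<^bold>\<not> (v \<^bold>\<le> u)"]) (use sb uv in \<open>auto intro: Sigma_b1_Pi_b1.intros\<close>)
qed

lemma SD_connectives: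
 assumes "SD P" "SD Q"
 shows "SD (%e. P e & Q e)" "SD (%e. P e \<or> Q e)"
 using assms unfolding SD_def by (metis Sigma_b1_Pi_b1.intros(3) sat.simps(4), metis Sigma_b1_Pi_b1.intros(4) sat.simps(5))

lemma SD_bex:
 assumes "TD t" "SD (%e. R (e 0) (%i. e (Suc i)))"
 shows "SD (%e. \<exists>n \<le> t e. R n e)"
proof -
 obtain \<phi> where \<phi>: "Sigma_b1 \<phi>" "\<forall>e. sat e \<phi> \<longleftrightarrow> R (e 0) (%i. e (Suc i))" using assms(2) unfolding SD_def by blast
 obtain s where s: "\<forall>e. eval e s = t e" using assms(1) unfolding TD_def by blast
 have "sat e (bEx s \<phi>) \<longleftrightarrow> (\<exists>n \<le> t e. R n e)" for e using \<phi> s by simp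
 then show ?thesis unfolding SD_def using \<phi> Sigma_b1_Pi_b1.intros(7) by blast
qed

lemma SD_ball:
 assumes "TD t" "SD (%e. R (e 0) (%i. e (Suc i)))"
 shows "SD (%e. \<forall>n \<le> floorlog 2 (t e). R n e)"
proof -
 obtain \<phi> where \<phi>: "Sigma_b1 \<phi>" "\<forall>e. sat e \<phi> \<longleftrightarrow> R (e 0) (%i. e (Suc i))" using assms(2) unfolding SD_def by blast
 obtain s where s: "\<forall>e. eval e s = t e" using assms(1) unfolding TD_def by blast
 have "sat e (bAll (Len s) \<phi>) \<longleftrightarrow> (\<forall>n \<le> floorlog 2 (t e). R n e)" for e using \<phi> s by simp
 then show ?thesis unfolding SD_def using \<phi> Sigma_b1_Pi_b1.intros(6) by blast
qed

lemma SD3: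
 assumes "SD (%e. G (e 0) (e 1) (e 2))" "TD a" "TD b" "TD c"
 shows "SD (%e. G (a e) (b e) (c e))"
proof -
 have "SD (%e. (%e :: nat => nat. G (e 0) (e 1) (e 2)) (%i. if i = 0 then a e else if i = 1 then b e else c e))"
  by (rule SD_subst[OF assms(1)]) (intro TD_if assms(2-4))
 then show ?thesis by simp
qed

lemmas TD_intros = TD_var TD_const TD_Suc TD_ops TD_len TD_half TD_pow
lemmas SD_intros = SD_bex SD_ball SD_connectives SD_atomic TD_intros

section \<open>Graphs of string functions\<close>

text \<open>Strings are coded by numbers with a leading one, first symbol in the lowest position.\<close>

fun num :: "str => nat" where
 "num [] = 1"
| "num (b # xs) = 2 * num xs + (if b then 1 else 0)"

lemma num_pos [simp]: "num xs > 0" "num xs \<noteq> 0"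
 by (induction xs) auto

lemma floorlog_double: "floorlog 2 (Suc (2 * x)) = Suc (floorlog 2 x)" "x > 0 ==> floorlog 2 (2 * x) = Suc (floorlog 2 x)"
 by (simp_all add: compute_floorlog[of 2 "Suc (2 * x)"] compute_floorlog[of 2 "2 * x"])

lemma floorlog_num [simp]: "floorlog 2 (num xs) = Suc (length xs)"
 by (induction xs) (auto simp: floorlog_double)

lemma floorlog_power2 [simp]: "floorlog 2 (2 ^ n) = Suc n"
 using floorlog_power[of 1 2 n] by simp

lemma less_floorlog: "x < 2 ^ w \<longleftrightarrow> floorlog 2 x \<le> w"
 by (simp add: floorlog_le_iff)

lemma num_surj: "x > 0 ==> \<exists>xs. x = num xs"
proof (induction x rule: less_induct)
 case (less x)
 show ?case
 proof (cases "x = 1")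
  case True
  then show ?thesis by (intro exI[of _ "[]"]) simp
 next
  case False
  then obtain ys where "x div 2 = num ys" using less by (metis One_nat_def Suc_1 div_less_dividend lessI
    less_2_cases_iff nat_neq_iff div_greater_zero_iff not_less not_less_zero gr0I)
  then have "x = num (odd x # ys)" by (simp add: odd_two_times_div_two_succ) presburger
  then show ?thesis by blast
 qed
qed

lemma num_inj [simp]: "num xs = num ys \<longleftrightarrow> xs = ys"
proof (induction xs arbitrary: ys)
 case Nil
 show ?case by (cases ys) auto
next
 case (Cons b xs)
 show ?case
 proof (cases ys)
  case Nil
  then show ?thesis by simp
 next
  case (Cons c zs)
  have "num (b # xs) = num (c # zs) \<longleftrightarrow> b = c & num xs = num zs"
   by (cases b; cases c) (auto, presburger+)
  then show ?thesis using Cons Cons.IH by simp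
 qed
qed

lemma num_append: "num (xs @ ys) + 2 ^ length xs = num xs + 2 ^ length xs * num ys"
 by (induction xs) auto

lemma num_False [simp]: "num (replicate n False) = 2 ^ n"
 by (induction n) auto

lemma num_True: "num (replicate n True) + 1 = 2 * 2 ^ n"
 by (induction n) auto

lemma num_less: "num xs < 2 ^ n \<longleftrightarrow> length xs < n"
 by (simp add: less_floorlog Suc_le_eq)

lemma num_le: assumes "Suc (length y) < floorlog 2 b" shows "num y \<le> b"
proof (rule ccontr)
 assume "\<not> num y \<le> b"
 then have "floorlog 2 b \<le> floorlog 2 (num y)" by (intro floorlog_mono) simp
 then show False using assms by simp
qed

lemma num_split: "num (replicate n True @ False # r) + 1 = 2 ^ n + 2 * 2 ^ n * num r"
 using num_append[of "replicate n True" "False # r"] num_True[of n] by simp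

lemma num_pr: "num (pr a b) + 1 + 2 * 2 ^ length a * 2 ^ length a =
  2 ^ length a + 2 * 2 ^ length a * (num a + 2 ^ length a * num b)"
proof -
 have "num (pr a b) + 1 = 2 ^ length a + 2 * 2 ^ length a * num (a @ b)"
  unfolding pr_def by (rule num_split)
 then have "num (pr a b) + 1 + 2 * 2 ^ length a * 2 ^ length a =
   2 ^ length a + 2 * 2 ^ length a * (num (a @ b) + 2 ^ length a)" by (simp add: algebra_simps)
 then show ?thesis unfolding num_append .
qed

text \<open>Powers of two are recognised without a quantifier, because
  \<open>2 ^ floorlog 2 p\<close> is the value of the smash of 1 and \<open>p\<close>.\<close>

definition pow2 :: "nat => bool" where
 "pow2 p \<longleftrightarrow> 2 * p = 2 ^ floorlog 2 p"

lemma pow2_iff: "pow2 p \<longleftrightarrow> (\<exists>n. p = 2 ^ n)"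
proof
 assume "pow2 p"
 then have p: "2 * p = 2 ^ floorlog 2 p" unfolding pow2_def .
 then have "floorlog 2 p \<noteq> 0" by (metis One_nat_def even_numeral even_mult_iff odd_one power_0)
 then obtain n where "floorlog 2 p = Suc n" by (cases "floorlog 2 p") auto
 with p show "\<exists>n. p = 2 ^ n" by auto
qed (auto simp: pow2_def)

text \<open>For \<open>x = num a\<close> the number \<open>p\<close> is \<open>2 ^ length a\<close>,
  the power of two with the bit length of \<open>x\<close>. The equation is \<open>num_pr\<close>,
  arranged so that nothing is subtracted; \<open>1 \<le> y\<close> excludes 0, which codes no
  string.\<close>

definition prG :: "nat => nat => nat => bool" where
 "prG x y z \<longleftrightarrow> 1 \<le> y & (\<exists>p \<le> x. 2 * p = 2 ^ floorlog 2 p & floorlog 2 p = floorlog 2 x &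
   z + 1 + 2 * p * p = p + 2 * p * (x + p * y))"

lemma prG_num: "prG (num a) (num b) z \<longleftrightarrow> z = num (pr a b)"
proof -
 have le: "2 ^ length a \<le> num a" using num_less[of a "length a"] by simp
 have "prG (num a) (num b) z \<longleftrightarrow> z + 1 + 2 * 2 ^ length a * 2 ^ length a =
  2 ^ length a + 2 * 2 ^ length a * (num a + 2 ^ length a * num b)"
  unfolding prG_def pow2_def[symmetric] pow2_iff using le by (auto simp: Suc_le_eq)
 then show ?thesis using num_pr[of a b] by linarith
qed

lemma prG_num': "prG x y (num c) \<longleftrightarrow> (\<exists>a b. x = num a & y = num b & c = pr a b)"
proof
 assume G: "prG x y (num c)"
 then have "y > 0" "x > 0"
  unfolding prG_def by (auto intro!: gr0I)
 then obtain a b where "x = num a" "y = num b" using num_surj by blast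
 with G show "\<exists>a b. x = num a & y = num b & c = pr a b" using prG_num by auto
qed (auto simp: prG_num)

lemma SD_prG: "TD a ==> TD b ==> TD c ==> SD (%e. prG (a e) (b e) (c e))"
 by (rule SD3) (unfold prG_def, intro SD_intros)

text \<open>The strings that are not pairs: either all symbols are \<open>True\<close>, or the remainder after the
 unary prefix is shorter than the prefix.\<close>

definition onesG :: "nat => bool" where
 "onesG x \<longleftrightarrow> 2 * (x + 1) = 2 ^ floorlog 2 (x + 1)"

definition shortG :: "nat => nat => bool" where
 "shortG x z \<longleftrightarrow> 1 \<le> z & (\<exists>p \<le> x. 2 * p = 2 ^ floorlog 2 p & x + 1 = p + 2 * p * z & z < p)"

lemma onesG_num: "onesG (num c) \<longleftrightarrow> (\<exists>n. c = replicate n True)"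
proof
 assume "onesG (num c)"
 then obtain n where n: "num c + 1 = 2 ^ n" unfolding onesG_def pow2_def[symmetric] pow2_iff by blast
 then have "n \<noteq> 0" by (intro notI) simp
 then obtain m where "n = Suc m" by (cases n) auto
 with n have "num c + 1 = 2 * 2 ^ m" by simp
 with num_True[of m] have "num c = num (replicate m True)" by linarith
 then show "\<exists>n. c = replicate n True" by auto
next
 assume "\<exists>n. c = replicate n True"
 then obtain n where "c = replicate n True" ..
 then have "num c + 1 = 2 ^ Suc n" using num_True[of n] by simp
 then show "onesG (num c)" unfolding onesG_def pow2_def[symmetric] pow2_iff by blast
qed

lemma shortG_num: "shortG (num c) z \<longleftrightarrow> (\<exists>n r. c = replicate n True @ False # r & length r < n & z = num r)"
proof
 assume "shortG (num c) z"
 then obtain n where n: "1 \<le> z" "num c + 1 = 2 ^ n + 2 * 2 ^ n * z" "z < 2 ^ n"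
  unfolding shortG_def pow2_def[symmetric] pow2_iff by blast
 then obtain r where r: "z = num r" using num_surj[of z] by auto
 have "num c = num (replicate n True @ False # r)" using n(2) num_split[of n r] unfolding r by linarith
 then show "\<exists>n r. c = replicate n True @ False # r & length r < n & z = num r"
  using n r by (auto simp: num_less)
next
 assume "\<exists>n r. c = replicate n True @ False # r & length r < n & z = num r"
 then obtain n r where c: "c = replicate n True @ False # r" "length r < n" "z = num r" by blast
 then have eq: "num c + 1 = 2 ^ n + 2 * 2 ^ n * z" using num_split[of n r] by simp
 have "2 ^ n \<le> num c"
 proof -
  have "1 \<le> 2 * 2 ^ n * z" using c by (simp add: Suc_le_eq)
  then show ?thesis using eq by linarith
 qed
 then show "shortG (num c) z"
  unfolding shortG_def pow2_def[symmetric] pow2_iff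
 proof (intro conjI)
  show "\<exists>p \<le> num c. (\<exists>n. p = 2 ^ n) & num c + 1 = p + 2 * p * z & z < p"
   by (rule exI[of _ "2 ^ n"]) (use c eq \<open>2 ^ n \<le> num c\<close> in \<open>auto simp: num_less\<close>)
 qed (use c in \<open>simp add: Suc_le_eq\<close>)
qed

lemma sfst_graph: "z = num (sfst c) \<longleftrightarrow>
  (\<exists>y \<le> num c. prG z y (num c)) \<or> onesG (num c) & z = 1 \<or> shortG (num c) z" (is "_ \<longleftrightarrow> ?R z")
 and ssnd_graph: "z = num (ssnd c) \<longleftrightarrow>
  (\<exists>y \<le> num c. prG y z (num c)) \<or> onesG (num c) & z = 1 \<or> (\<exists>y \<le> num c. shortG (num c) y) & z = 1" (is "_ \<longleftrightarrow> ?Q z")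
proof -
 have le: "num a \<le> num c" if "length a \<le> length c" "a = c \<or> length a < length c" for a c
 proof (cases "a = c")
  case False
  then have "num a < 2 ^ length c" using that by (simp add: num_less)
  also have "\<dots> \<le> num c" using num_less[of c "length c"] by simp
  finally show ?thesis by simp
 qed simp
 have 1: "?R (num (sfst c))" "?Q (num (ssnd c))"
 proof -
  have "?R (num (sfst c)) & ?Q (num (ssnd c))"
  proof (cases c rule: string_cases)
   case (ones n)
   then have "onesG (num c)" unfolding onesG_num by blast
   then show ?thesis using ones by simp
  next
   case (split n r)
   show ?thesis
   proof (cases "length r < n")
    case True
    then have s: "shortG (num c) (num r)" unfolding shortG_num using split by blast
    have "num r \<le> num c" by (rule le) (use split in auto)
    then show ?thesis using s split True by auto
   next
    case False
    then have c: "c = pr (take n r) (drop n r)" unfolding split by (simp add: pr_def min_absorb2)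
    have "num (take n r) \<le> num c" "num (drop n r) \<le> num c" by (rule le; use split in auto)+
    moreover have "prG (num (take n r)) (num (drop n r)) (num c)" unfolding prG_num' using c by blast
    ultimately show ?thesis using split by auto
   qed
  qed
  then show "?R (num (sfst c))" "?Q (num (ssnd c))" by simp_all
 qed
 have "z = num (sfst c)" if "?R z" for z
  using that unfolding prG_num' onesG_num shortG_num by auto
 then show "z = num (sfst c) \<longleftrightarrow> ?R z" using 1 by blast
 have "z = num (ssnd c)" if "?Q z" for z
  using that unfolding prG_num' onesG_num shortG_num by auto
 then show "z = num (ssnd c) \<longleftrightarrow> ?Q z" using 1 by blast
qed

lemma SD_onesG: "TD a ==> SD (%e. onesG (a e))"
 unfolding onesG_def by (intro SD_intros)

lemma SD_shortG: "TD a ==> TD b ==> SD (%e. shortG (a e) (b e))"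
 by (rule SD3[where G = "%a b _. shortG a b" and c = "%_. 0"])
  (unfold shortG_def, intro SD_intros, assumption+, rule TD_const)

text \<open>This extracts a digit in base \<open>2 ^ floorlog 2 b\<close>. The power
  \<open>p\<close> of the base is pinned down by its bit length instead of by exponentiation; for
  \<open>i \<le> floorlog 2 b\<close> it lies below the smash of \<open>b\<close> with itself, which
  bounds the quantifier.\<close>

definition digit :: "nat => nat => nat => nat => bool" where
 "digit b W i u \<longleftrightarrow> (\<exists>p \<le> 2 ^ (floorlog 2 b * floorlog 2 b). \<exists>h \<le> W. \<exists>l \<le> W.
   2 * p = 2 ^ floorlog 2 p & floorlog 2 p = i * floorlog 2 b + 1 &
   W = (h * 2 ^ floorlog 2 b + u) * p + l & u < 2 ^ floorlog 2 b & l < p)"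

lemma digit_iff:
 assumes "i \<le> floorlog 2 b"
 shows "digit b W i u \<longleftrightarrow> u = W div (2 ^ floorlog 2 b) ^ i mod 2 ^ floorlog 2 b"
proof
 let ?B = "2 ^ floorlog 2 b :: nat"
 assume "digit b W i u"
 then obtain p h l where d: "2 * p = 2 ^ floorlog 2 p" "floorlog 2 p = i * floorlog 2 b + 1"
   "W = (h * ?B + u) * p + l" "u < ?B" "l < p" unfolding digit_def by blast
 then have p: "p = ?B ^ i" by (simp add: power_mult[symmetric] mult.commute)
 then have "W div p = h * ?B + u" using d by simp
 then show "u = W div ?B ^ i mod ?B" using d p by simp
next
 let ?B = "2 ^ floorlog 2 b :: nat"
 assume u: "u = W div ?B ^ i mod ?B"
 have p: "?B ^ i = 2 ^ (i * floorlog 2 b)" by (simp add: power_mult[symmetric] mult.commute)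
 show "digit b W i u" unfolding digit_def
 proof (intro exI conjI)
  show "?B ^ i \<le> 2 ^ (floorlog 2 b * floorlog 2 b)" unfolding p using assms by (simp add: mult_right_mono)
  show "W div ?B ^ i div ?B \<le> W" by (meson div_le_dividend le_trans)
  show "W mod ?B ^ i \<le> W" by simp
  show "2 * ?B ^ i = 2 ^ floorlog 2 (?B ^ i)" "floorlog 2 (?B ^ i) = i * floorlog 2 b + 1" unfolding p by simp_all
  show "W = (W div ?B ^ i div ?B * ?B + u) * ?B ^ i + W mod ?B ^ i" unfolding u div_mult_mod_eq ..
  show "u < ?B" unfolding u by simp
  show "W mod ?B ^ i < ?B ^ i" by simp
 qed
qed

fun encode_seq :: "nat => nat => (nat => nat) => nat" where
 "encode_seq B 0 d = 0"
| "encode_seq B (Suc n) d = d 0 + B * encode_seq B n (%i. d (Suc i))"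

lemma encode_seq_less: "(\<And>i. i < n ==> d i < B) ==> encode_seq B n d < B ^ n"
proof (induction n arbitrary: d)
 case (Suc n)
 have "encode_seq B n (%i. d (Suc i)) < B ^ n" using Suc by simp
 then have "B * encode_seq B n (%i. d (Suc i)) + B \<le> B * B ^ n"
  by (metis Suc_leI mult_Suc_right mult_le_mono2 add.commute)
 then show ?case using Suc.prems[of 0] by simp
qed simp

lemma encode_seq_digit: "(\<And>i. i < n ==> d i < B) ==> j < n ==> encode_seq B n d div B ^ j mod B = d j"
proof (induction n arbitrary: d j)
 case (Suc n)
 show ?case
 proof (cases j)
  case 0
  then show ?thesis using Suc.prems(1)[of 0] by simp
 next
  case (Suc k)
  have "encode_seq B (Suc n) d div B ^ j = encode_seq B (Suc n) d div B div B ^ k"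
   unfolding Suc by (simp add: div_mult2_eq)
  also have "encode_seq B (Suc n) d div B = encode_seq B n (%i. d (Suc i))"
   using Suc.prems(1)[of 0] by simp
  finally show ?thesis using Suc.IH[of "%i. d (Suc i)" k] Suc.prems Suc by simp
 qed
qed simp

lemma SD_digit: "TD b ==> TD W ==> TD i ==> TD u ==> SD (%e. digit (b e) (W e) (i e) (u e))"
proof -
 assume t: "TD b" "TD W" "TD i" "TD u"
 have "SD (%e. digit (e 0) (e 1) (e 2) (e 3))" unfolding digit_def by (intro SD_intros)
 then have "SD (%e. (%e :: nat => nat. digit (e 0) (e 1) (e 2) (e 3))
   (%j. if j = 0 then b e else if j = 1 then W e else if j = 2 then i e else u e))"
  by (rule SD_subst) (intro TD_if t)
 then show ?thesis by simp
qed

text \<open>The third argument of \<open>G\<close> bounds all its quantifiers, and correctness is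
  required only once that number has \<open>B x\<close> bits. The choice of a bounding term is
  thereby postponed to \<open>TD_large\<close>, outside the induction over
  \<open>Fn\<close>.\<close>

definition graph_of :: "(str => str) => (str => nat) => (nat => nat => nat => bool) => (str => nat) => bool" where
 "graph_of f S G B \<longleftrightarrow> SD (%e. G (e 0) (e 1) (e 2)) & pb B S &
   (\<forall>x z b. B x \<le> floorlog 2 b --> (G (num x) z b \<longleftrightarrow> z = num (f x)))"

definition graph :: "(str => str) => (str => nat) => bool" where
 "graph f S \<longleftrightarrow> (\<exists>G B. graph_of f S G B)"

lemma graphI:
 assumes "SD (%e. G (e 0) (e 1) (e 2))" "pb B S"
  "\<And>x z b. B x \<le> floorlog 2 b ==> G (num x) z b \<longleftrightarrow> z = num (f x)"
 shows "graph f S"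
 unfolding graph_def graph_of_def using assms by blast

lemma graph_ofD:
 assumes "graph_of f S G B"
 shows "TD a ==> TD b ==> TD c ==> SD (%e. G (a e) (b e) (c e))" "pb B S"
  "B x \<le> floorlog 2 b' ==> G (num x) z b' \<longleftrightarrow> z = num (f x)"
 using assms SD3[of G] unfolding graph_of_def by blast+

lemma graph_basic:
 "graph (%x. x) length" "graph (%_. []) length" "graph (%x. b # x) length" "graph tl length"
 "graph (%x. tt (x \<noteq> [] & hd x)) length" "graph sfst length" "graph ssnd length"
proof -
 have num1: "num x = Suc 0 \<longleftrightarrow> x = []" for x using num_inj[of x "[]"] by (simp del: num_inj)
 show "graph (%x. x) length"
  by (rule graphI[where G = "%x z _. z = x" and B = "%_. 0"]) (intro SD_intros, rule pb_const, simp)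
 show "graph (%_. []) length"
  by (rule graphI[where G = "%x z _. z = 1" and B = "%_. 0"]) (intro SD_intros, rule pb_const, simp)
 show "graph (%x. b # x) length"
  by (rule graphI[where G = "%x z _. z = 2 * x + (if b then 1 else 0)" and B = "%_. 0"]) (intro SD_intros, rule pb_const, simp)
 show "graph tl length"
 proof (rule graphI[where G = "%x z _. x = 1 & z = 1 \<or> x \<noteq> 1 & z = x div 2" and B = "%_. 0"])
  show "num x = 1 & z = 1 \<or> num x \<noteq> 1 & z = num x div 2 \<longleftrightarrow> z = num (tl x)" for x z
   by (cases x) (auto simp: num1)
 qed (intro SD_intros pb_const)+
 show "graph (%x. tt (x \<noteq> [] & hd x)) length"
 proof (rule graphI[where G = "%x z _. x \<noteq> 1 & x = 2 * (x div 2) + 1 & z = 3 \<or> (x = 1 \<or> x = 2 * (x div 2)) & z = 1" and B = "%_. 0"])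
  show "num x \<noteq> 1 & num x = 2 * (num x div 2) + 1 & z = 3 \<or> (num x = 1 \<or> num x = 2 * (num x div 2)) & z = 1
    \<longleftrightarrow> z = num (tt (x \<noteq> [] & hd x))" for x z
   by (cases x) (auto simp: num1 tt_def)
 qed (intro SD_intros pb_const)+
 show "graph sfst length"
  by (rule graphI[where G = "%x z _. (\<exists>y \<le> x. prG z y x) \<or> onesG x & z = 1 \<or> shortG x z" and B = "%_. 0"])
   (intro SD_intros SD_prG SD_onesG SD_shortG, rule pb_const, rule sfst_graph[symmetric])
 show "graph ssnd length"
  by (rule graphI[where G = "%x z _. (\<exists>y \<le> x. prG y z x) \<or> onesG x & z = 1 \<or> (\<exists>y \<le> x. shortG x y) & z = 1" and B = "%_. 0"])
   (intro SD_intros SD_prG SD_onesG SD_shortG, rule pb_const, rule ssnd_graph[symmetric])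
qed

lemma graph_weaken: "graph f S' ==> pb S' S ==> graph f S"
 unfolding graph_def graph_of_def using pb_trans by meson

lemma graph_comp:
 assumes "graph f S'" "graph g S" "pb (%x. S' (g x)) S" "pb (%x. length (g x)) S"
 shows "graph (%x. f (g x)) S"
proof -
 obtain G B where fG: "graph_of f S' G B"
  using assms(1) unfolding graph_def by blast
 note f = graph_ofD[OF fG]
 obtain H D where gG: "graph_of g S H D"
  using assms(2) unfolding graph_def by blast
 note g = graph_ofD[OF gG]
 show ?thesis
 proof (rule graphI[where G = "%x z b. \<exists>y \<le> b. H x y b & G y z b" and B = "%x. D x + B (g x) + (length (g x) + 2)"])
  show "SD (%e. \<exists>y \<le> e 2. H (e 0) y (e 2) & G y (e 1) (e 2))" by (intro SD_intros f(1) g(1))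
  show "pb (%x. D x + B (g x) + (length (g x) + 2)) S"
   by (intro pb_add pb_const g(2) assms(4) pb_trans[OF pb_comp[OF f(2)] assms(3)])
  fix x z b assume b: "D x + B (g x) + (length (g x) + 2) \<le> floorlog 2 b"
  then have "num (g x) \<le> b" by (intro num_le) simp
  then show "(\<exists>y \<le> b. H (num x) y b & G y z b) \<longleftrightarrow> z = num (f (g x))" using f(3) g(3) b by auto
 qed
qed

lemma graph_pair:
 assumes "graph f S" "graph g S" "pb (%x. length (f x)) S" "pb (%x. length (g x)) S"
 shows "graph (%x. pr (f x) (g x)) S"
proof -
 obtain G B where fG: "graph_of f S G B"
  using assms(1) unfolding graph_def by blast
 note f = graph_ofD[OF fG]
 obtain H D where gG: "graph_of g S H D"
  using assms(2) unfolding graph_def by blast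
 note g = graph_ofD[OF gG]
 show ?thesis
 proof (rule graphI[where G = "%x z b. \<exists>u \<le> b. \<exists>v \<le> b. G x u b & H x v b & prG u v z"
    and B = "%x. B x + D x + (length (f x) + length (g x) + 2)"])
  show "SD (%e. \<exists>u \<le> e 2. \<exists>v \<le> e 2. G (e 0) u (e 2) & H (e 0) v (e 2) & prG u v (e 1))"
   by (intro SD_intros f(1) g(1) SD_prG)
  show "pb (%x. B x + D x + (length (f x) + length (g x) + 2)) S" by (intro pb_add pb_const f g assms)
  fix x z b assume b: "B x + D x + (length (f x) + length (g x) + 2) \<le> floorlog 2 b"
  then have "num (f x) \<le> b" "num (g x) \<le> b" by (intro num_le; simp)+
  then show "(\<exists>u \<le> b. \<exists>v \<le> b. G (num x) u b & H (num x) v b & prG u v z) \<longleftrightarrow> z = num (pr (f x) (g x))"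
   using f(3) g(3) b by (auto simp: prG_num)
 qed
qed

lemma graph_cond:
 assumes "graph f S" "graph g S" "graph h S" "pb (%x. length (f x)) S"
 shows "graph (%x. if f x = [] then g x else h x) S"
proof -
 obtain G B where fG: "graph_of f S G B"
  using assms(1) unfolding graph_def by blast
 note f = graph_ofD[OF fG]
 obtain H D where gG: "graph_of g S H D"
  using assms(2) unfolding graph_def by blast
 note g = graph_ofD[OF gG]
 obtain K E where hG: "graph_of h S K E"
  using assms(3) unfolding graph_def by blast
 note h = graph_ofD[OF hG]
 show ?thesis
 proof (rule graphI[where G = "%x z b. (G x 1 b & H x z b) \<or> (\<exists>u \<le> b. G x u b & u \<noteq> 1 & K x z b)"
    and B = "%x. B x + D x + E x + (length (f x) + 2)"])
  show "SD (%e. (G (e 0) 1 (e 2) & H (e 0) (e 1) (e 2)) \<or> (\<exists>u \<le> e 2. G (e 0) u (e 2) & u \<noteq> 1 & K (e 0) (e 1) (e 2)))"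
   by (intro SD_intros f(1) g(1) h(1))
  show "pb (%x. B x + D x + E x + (length (f x) + 2)) S" by (intro pb_add pb_const f g h assms)
  fix x z b assume b: "B x + D x + E x + (length (f x) + 2) \<le> floorlog 2 b"
  then have "num (f x) \<le> b" by (intro num_le; simp)
  moreover have "num (f x) = Suc 0 \<longleftrightarrow> f x = []" using num_inj[of "f x" "[]"] by (simp del: num_inj)
  ultimately show "(G (num x) 1 b & H (num x) z b) \<or> (\<exists>u \<le> b. G (num x) u b & u \<noteq> 1 & K (num x) z b)
    \<longleftrightarrow> z = num (if f x = [] then g x else h x)"
   using f(3)[of x] g(3)[of x] h(3)[of x] b by auto
 qed
qed

text \<open>The sequence of iterates is guessed as one number \<open>W\<close> in base
  \<open>2 ^ floorlog 2 b\<close>, and successive digits are compared by the graph of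
  \<open>f\<close>. The bit length of \<open>b\<close> exceeds both the number of iterates and the
  size of each.\<close>

lemma graph_iter:
 assumes "graph f S'" "graph a S" "graph c S" "pb (%x. length (a x)) S" "pb (%x. length (c x)) S"
  and S': "\<And>x i. i \<le> length (c x) ==> S' ((f ^^ i) (a x)) \<le> (S x + C) ^ C"
  and len: "pb length S'"
 shows "graph (%x. (f ^^ length (c x)) (a x)) S"
proof -
 obtain G B where fG: "graph_of f S' G B"
  using assms(1) unfolding graph_def by blast
 note f = graph_ofD[OF fG]
 obtain H D where gG: "graph_of a S H D"
  using assms(2) unfolding graph_def by blast
 note g = graph_ofD[OF gG]
 obtain K E where hG: "graph_of c S K E"
  using assms(3) unfolding graph_def by blast
 note h = graph_ofD[OF hG]
 obtain A where A: "\<And>x. B x \<le> (S' x + A) ^ A" "\<And>x. length x \<le> (S' x + A) ^ A"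
  using pb_two[OF f(2) len] by metis
 define N where "N x = ((S x + C) ^ C + A) ^ A" for x
 have N: "B ((f ^^ i) (a x)) \<le> N x" "length ((f ^^ i) (a x)) \<le> N x" if "i \<le> length (c x)" for x i
  using A[of "(f ^^ i) (a x)"] S'[OF that] unfolding N_def by (meson add_le_mono1 le_trans power_mono zero_le)+
 \<comment> \<open>The number \<open>v\<close> has one bit more than the string it codes. Hence the
   step condition concerns the \<open>i\<close> with \<open>i + 1 < floorlog 2 v\<close>, and the
   last digit sits at \<open>i + 1 = floorlog 2 v\<close>.\<close>
 define Gi where "Gi = (%x z b. \<exists>u \<le> b. \<exists>v \<le> b. H x u b & K x v b &
   (\<exists>W \<le> 2 ^ (floorlog 2 b * floorlog 2 b). digit b W 0 u &
    (\<forall>i \<le> floorlog 2 v. floorlog 2 v \<le> i + 1 \<or>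
      (\<exists>r \<le> b. \<exists>s \<le> b. digit b W i r & digit b W (i + 1) s & G r s b)) &
    (\<exists>i \<le> b. i + 1 = floorlog 2 v & digit b W i z)))"
 show ?thesis
 proof (rule graphI[where G = Gi and B = "%x. D x + E x + (length (a x) + length (c x) + 2) + (N x + 2)"])
  show "SD (%e. Gi (e 0) (e 1) (e 2))" unfolding Gi_def by (intro SD_intros f(1) g(1) h(1) SD_digit)
  have "pb N S" unfolding N_def by (intro pb_intros)
  then show "pb (%x. D x + E x + (length (a x) + length (c x) + 2) + (N x + 2)) S"
   by (intro pb_add pb_const g h assms)
  fix x z b assume b: "D x + E x + (length (a x) + length (c x) + 2) + (N x + 2) \<le> floorlog 2 b"
  let ?B = "2 ^ floorlog 2 b :: nat" and ?n = "length (c x)"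
  let ?a = "%i. num ((f ^^ i) (a x))"
  have leb: "?a i \<le> b" if "i \<le> ?n" for i using N(2)[OF that] b by (intro num_le) simp
  have bB: "b < ?B" by (simp add: less_floorlog)
  have nb: "num (a x) \<le> b" "num (c x) \<le> b" using b by (intro num_le; simp)+
  have fstep: "G (?a i) s b \<longleftrightarrow> s = ?a (Suc i)" if "i \<le> ?n" for i s
   using f(3)[of "(f ^^ i) (a x)" b s] N(1)[OF that] b by simp
  have cn: "Suc ?n \<le> floorlog 2 b" using b by simp
  show "Gi (num x) z b \<longleftrightarrow> z = num ((f ^^ ?n) (a x))"
  proof
   assume "Gi (num x) z b"
   then obtain W where W: "digit b W 0 (num (a x))"
     "\<forall>i \<le> Suc ?n. Suc ?n \<le> i + 1 \<or> (\<exists>r \<le> b. \<exists>s \<le> b. digit b W i r & digit b W (i + 1) s & G r s b)"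
     "digit b W ?n z"
    unfolding Gi_def using g(3)[of x b] h(3)[of x b] b by auto
   have "digit b W i (?a i)" if "i \<le> ?n" for i
    using that
   proof (induction i)
    case 0
    then show ?case using W(1) by simp
   next
    case (Suc i)
    then obtain r s where rs: "digit b W i r" "digit b W (i + 1) s" "G r s b" using W(2)[rule_format, of i] by auto
    have "r = ?a i" using rs(1) Suc digit_iff[of i b W] cn by simp
    then have "s = ?a (Suc i)" using rs(3) fstep[of i s] Suc.prems by simp
    then show ?case using rs(2) by simp
   qed
   from this[of ?n] show "z = ?a ?n" using W(3) digit_iff[of ?n b W] cn by simp
  next
   assume z: "z = ?a ?n"
   define W where "W = encode_seq ?B (Suc ?n) ?a"
   have lt: "?a i < ?B" if "i < Suc ?n" for i using leb[of i] bB that by simp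
   have dig: "digit b W i (?a i)" if "i \<le> ?n" for i
    using encode_seq_digit[of "Suc ?n" ?a ?B i, OF lt] that cn by (simp add: digit_iff W_def)
   have "W < ?B ^ Suc ?n" unfolding W_def by (rule encode_seq_less[OF lt])
   also have "\<dots> \<le> ?B ^ floorlog 2 b" by (rule power_increasing[OF cn]) simp
   also have "\<dots> = 2 ^ (floorlog 2 b * floorlog 2 b)" by (simp add: power_mult[symmetric])
   finally have "W \<le> 2 ^ (floorlog 2 b * floorlog 2 b)" by simp
   moreover have "digit b W 0 (num (a x))" using dig[of 0] by simp
   moreover have "\<forall>i \<le> Suc ?n. Suc ?n \<le> i + 1 \<or> (\<exists>r \<le> b. \<exists>s \<le> b. digit b W i r & digit b W (i + 1) s & G r s b)"
   proof (intro allI impI)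
    fix i assume "i \<le> Suc ?n"
    show "Suc ?n \<le> i + 1 \<or> (\<exists>r \<le> b. \<exists>s \<le> b. digit b W i r & digit b W (i + 1) s & G r s b)"
    proof (cases "Suc ?n \<le> i + 1")
     case False
     then have "i \<le> ?n" "Suc i \<le> ?n" by simp_all
     then show ?thesis using dig[of i] dig[of "Suc i"] leb[of i] leb[of "Suc i"] fstep[of i] by auto
    qed simp
   qed
   moreover have "?n \<le> b"
   proof -
    have "2 ^ ?n \<le> num (c x)" using num_less[of "c x" ?n] by simp
    then have "?n < num (c x)" by (rule less_le_trans[OF less_exp])
    then show ?thesis using nb by simp
   qed
   ultimately have "\<exists>W \<le> 2 ^ (floorlog 2 b * floorlog 2 b). digit b W 0 (num (a x)) &
    (\<forall>i \<le> floorlog 2 (num (c x)). floorlog 2 (num (c x)) \<le> i + 1 \<or>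
      (\<exists>r \<le> b. \<exists>s \<le> b. digit b W i r & digit b W (i + 1) s & G r s b)) &
    (\<exists>i \<le> b. i + 1 = floorlog 2 (num (c x)) & digit b W i z)"
    using dig[of ?n] z by auto
   then show "Gi (num x) z b" unfolding Gi_def using nb g(3)[of x b] h(3)[of x b] b by auto
  qed
 qed
qed

lemma graph_Fn: "Fn f S ==> graph f S"
proof (induction rule: Fn.induct)
 case (Fn_pair f S g)
 show ?case
  by (rule graph_pair[OF Fn_pair.IH]) (use Fn_bound[OF Fn_pair.hyps(1)] Fn_bound[OF Fn_pair.hyps(2)] in blast)+
next
 case (Fn_cond f S g h)
 show ?case by (rule graph_cond[OF Fn_cond.IH]) (use Fn_bound[OF Fn_cond.hyps(1)] in blast)
next
 case (Fn_comp f S' g S)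
 show ?case by (rule graph_comp[OF Fn_comp.IH Fn_comp.hyps(3)]) (use Fn_bound[OF Fn_comp.hyps(2)] in blast)
next
 case (Fn_iter f S' a S b C)
 note bounds = Fn_bound[OF Fn_iter.hyps(1)] Fn_bound[OF Fn_iter.hyps(2)] Fn_bound[OF Fn_iter.hyps(3)]
 show ?case
  by (rule graph_iter[where C = C, OF Fn_iter.IH])
   (use bounds in blast, use bounds in blast, erule Fn_iter.hyps(4), use bounds in blast)
next
 case (Fn_weaken f S' S)
 show ?case by (rule graph_weaken[OF Fn_weaken.IH Fn_weaken.hyps(2)])
qed (rule graph_basic)+

text \<open>The number \<open>e 0 * 2 ^ C\<close> has \<open>floorlog 2 (e 0) + C\<close> bits, and
  each smash of a term with itself at least squares the bit length. After \<open>C\<close> rounds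
  the exponent is \<open>2 ^ C\<close>, which is at least \<open>C\<close>.\<close>

lemma TD_large: "\<exists>t. TD t & (\<forall>e. e 0 > 0 --> (floorlog 2 (e 0) + C) ^ C \<le> floorlog 2 (t e))"
proof -
 have "\<exists>t. TD t & (\<forall>e. e 0 > 0 --> (floorlog 2 (e 0) + C) ^ (2 ^ j) \<le> floorlog 2 (t e))" for j
 proof (induction j)
  case 0
  show ?case
   by (rule exI[of _ "%e. e 0 * 2 ^ C"]) (auto intro!: TD_intros)
 next
  case (Suc j)
  then obtain t where t: "TD t" "\<forall>e. e 0 > 0 --> (floorlog 2 (e 0) + C) ^ (2 ^ j) \<le> floorlog 2 (t e)" by blast
  show ?case
  proof (intro exI[of _ "%e. 2 ^ (floorlog 2 (t e) * floorlog 2 (t e))"] conjI allI impI)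
   show "TD (%e. 2 ^ (floorlog 2 (t e) * floorlog 2 (t e)))" by (intro TD_intros t)
   fix e :: "nat => nat" assume "e 0 > 0"
   with t have "((floorlog 2 (e 0) + C) ^ (2 ^ j)) * ((floorlog 2 (e 0) + C) ^ (2 ^ j)) \<le> floorlog 2 (t e) * floorlog 2 (t e)"
    by (intro mult_mono) auto
   then show "(floorlog 2 (e 0) + C) ^ (2 ^ Suc j) \<le> floorlog 2 (2 ^ (floorlog 2 (t e) * floorlog 2 (t e)))"
    by (simp add: power_add[symmetric] mult_2)
  qed
 qed
 then obtain t where t: "TD t" "\<forall>e. e 0 > 0 --> (floorlog 2 (e 0) + C) ^ (2 ^ C) \<le> floorlog 2 (t e)" by blast
 have "(floorlog 2 x + C) ^ C \<le> (floorlog 2 x + C) ^ (2 ^ C)" if "x > 0" for x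
  using that floorlog_eq_zero_iff[of 2 x] by (intro power_increasing) (auto simp: Suc_le_eq)
 with t show ?thesis by (meson le_trans)
qed

text \<open>All quantifiers share one bounding term that is long enough for both graphs and all
  intermediate strings. The length of the witness is fixed by comparing bit lengths, as
  \<open>num\<close> adds exactly one bit.\<close>

theorem NP_definable:
 assumes "PF f" "PF g"
 shows "\<exists>\<phi>. Sigma_b1 \<phi> & fv \<phi> \<subseteq> {0} &
  (\<forall>s. holds_at \<phi> (num s) \<longleftrightarrow> (\<exists>w. length w = length (g s) & f (pr s w) \<noteq> []))"
proof -
 obtain G B where fG: "graph_of f length G B"
  using graph_Fn[OF assms(1)] unfolding graph_def by blast
 note f = graph_ofD[OF fG]
 obtain H D where gG: "graph_of g length H D"
  using graph_Fn[OF assms(2)] unfolding graph_def by blast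
 note g = graph_ofD[OF gG]
 obtain A where A: "\<And>x. B x \<le> (length x + A) ^ A" "\<And>x. length (f x) \<le> (length x + A) ^ A"
  using pb_two[OF f(2) PF_bound[OF assms(1)]] by metis
 define L where "L s = 2 * length s + length (g s) + 1" for s :: str
 define N where "N s = D s + (length (g s) + 2) + (L s + 2) + ((L s + A) ^ A + 2)" for s
 have "pb N length" unfolding N_def L_def by (intro pb_intros PF_bound assms g)
 then obtain C where C: "\<And>s. N s \<le> (length s + C) ^ C" unfolding pb_def by blast
 obtain t where t: "TD t" "\<And>e. e 0 > 0 ==> (floorlog 2 (e 0) + C) ^ C \<le> floorlog 2 (t e)"
  using TD_large[of C] by blast
 let ?R = "%e. \<exists>u \<le> t e. \<exists>w \<le> t e. \<exists>v \<le> t e. \<exists>y \<le> t e. H (e 0) u (t e) & floorlog 2 w = floorlog 2 u &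
   1 \<le> w & prG (e 0) w v & G v y (t e) & y \<noteq> 1"
 have shift: "TD (%e. t (%i. e (Suc i)))" "TD (%e. t (%i. e (Suc (Suc i))))" "TD (%e. t (%i. e (Suc (Suc (Suc i)))))"
   "TD (%e. t (%i. e (Suc (Suc (Suc (Suc i))))))"
  by (rule TD_subst[OF t(1)], rule TD_var)+
 have "SD ?R" by (intro SD_intros f(1) g(1) SD_prG t(1) shift)
 then obtain \<phi> where \<phi>: "Sigma_b1 \<phi>" "\<And>e. sat e \<phi> \<longleftrightarrow> ?R e" unfolding SD_def by blast
 \<comment> \<open>\<open>SD\<close> does not control free variables; zero is substituted for all
   but index 0.\<close>
 let ?\<phi> = "subst (%i. if i = 0 then Var 0 else Zero) \<phi>"
 have "fv ?\<phi> \<subseteq> {0}" using fv_subst[of "%i. if i = 0 then Var 0 else Zero" \<phi>] by (auto split: if_splits)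
 moreover have "holds_at ?\<phi> (num s) \<longleftrightarrow> (\<exists>w. length w = length (g s) & f (pr s w) \<noteq> [])" for s
 proof -
  define e where "e = (%i :: nat. if i = 0 then num s else 0)"
  have env: "(%i. eval (%_. num s) (if i = 0 then Var 0 else Zero)) = e" by (auto simp: e_def)
  define b where "b = t e"
  have e0: "e 0 = num s" by (simp add: e_def)
  have "N s \<le> (length s + C) ^ C" by (rule C)
  also have "\<dots> \<le> (floorlog 2 (e 0) + C) ^ C" by (intro power_mono) (auto simp: e0)
  also have "\<dots> \<le> floorlog 2 b" unfolding b_def by (rule t(2)) (simp add: e0)
  finally have b: "N s \<le> floorlog 2 b" .
  have H: "H (num s) u b \<longleftrightarrow> u = num (g s)" for u using g(3) b by (simp add: N_def)
  have ub: "num (g s) \<le> b" using b by (intro num_le) (simp add: N_def)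
  have v: "num (pr s w) \<le> b" "G (num (pr s w)) y b \<longleftrightarrow> y = num (f (pr s w))" "num (f (pr s w)) \<le> b" "num w \<le> b"
   if "length w = length (g s)" for w y
  proof -
   have l: "length (pr s w) = L s" using that by (simp add: L_def)
   have A1: "B (pr s w) \<le> (L s + A) ^ A" using A(1)[of "pr s w"] unfolding l .
   have A2: "length (f (pr s w)) \<le> (L s + A) ^ A" using A(2)[of "pr s w"] unfolding l .
   have "Suc (length (pr s w)) < floorlog 2 b" unfolding l using b by (simp add: N_def)
   then show "num (pr s w) \<le> b" by (rule num_le)
   show "G (num (pr s w)) y b \<longleftrightarrow> y = num (f (pr s w))"
    using f(3)[of "pr s w" b y] A1 b by (simp add: N_def)
   show "num (f (pr s w)) \<le> b" using b A2 by (intro num_le) (simp add: N_def)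
   show "num w \<le> b" using b that by (intro num_le) (simp add: N_def)
  qed
  have n1: "num xs = Suc 0 \<longleftrightarrow> xs = []" for xs using num_inj[of xs "[]"] by (simp del: num_inj)
  have "holds_at ?\<phi> (num s) \<longleftrightarrow> ?R e" unfolding holds_at_def sat_subst env \<phi>(2) ..
  also have "\<dots> \<longleftrightarrow> (\<exists>w \<le> b. \<exists>v \<le> b. \<exists>y \<le> b. floorlog 2 w = floorlog 2 (num (g s)) & 1 \<le> w & prG (num s) w v & G v y b & y \<noteq> 1)"
   unfolding b_def[symmetric] e0 H using ub by blast
  also have "\<dots> \<longleftrightarrow> (\<exists>w \<le> b. \<exists>v \<le> b. \<exists>y \<le> b. floorlog 2 w = Suc (length (g s)) & 1 \<le> w & prG (num s) w v & G v y b & y \<noteq> 1)"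
   unfolding floorlog_num ..
  also have "\<dots> \<longleftrightarrow> (\<exists>w. length w = length (g s) & f (pr s w) \<noteq> [])"
  proof
   assume "\<exists>w \<le> b. \<exists>v \<le> b. \<exists>y \<le> b. floorlog 2 w = Suc (length (g s)) & 1 \<le> w & prG (num s) w v & G v y b & y \<noteq> 1"
   then obtain w' v' y where w: "floorlog 2 w' = Suc (length (g s))" "1 \<le> w'" "prG (num s) w' v'" "G v' y b" "y \<noteq> 1" by blast
   obtain w where "w' = num w" using num_surj[of w'] w(2) by auto
   then have "length w = length (g s)" "v' = num (pr s w)" using w by (auto simp: prG_num)
   then show "\<exists>w. length w = length (g s) & f (pr s w) \<noteq> []" using v(2)[of w y] w n1 by auto
  next
   assume "\<exists>w. length w = length (g s) & f (pr s w) \<noteq> []"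
   then obtain w where w: "length w = length (g s)" "f (pr s w) \<noteq> []" by blast
   show "\<exists>w \<le> b. \<exists>v \<le> b. \<exists>y \<le> b. floorlog 2 w = Suc (length (g s)) & 1 \<le> w & prG (num s) w v & G v y b & y \<noteq> 1"
    by (intro exI[of _ "num w"] exI[of _ "num (pr s w)"] exI[of _ "num (f (pr s w))"])
     (use v[OF w(1)] w n1 in \<open>auto simp: prG_num Suc_le_eq\<close>)
  qed
  finally show ?thesis .
 qed
 moreover have "Sigma_b1 ?\<phi>" by (rule Sigma_b1_subst[OF \<phi>(1)])
 ultimately show ?thesis by blast
qed

section \<open>Lists, binary arithmetic and truth of sharply bounded formulas inside the
  algebra\<close>

section \<open>Polynomial-time string processing\<close>

lemma PF_rec_linear:
 assumes "\<And>c. r c 0 = g c" "\<And>c n. r c (Suc n) = H c (U n) (r c n)"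
  "PF g" "PF (%x. H (sfst x) (sfst (ssnd x)) (ssnd (ssnd x)))"
  "\<And>c n. length (r c n) \<le> K * (length c + n) + K" "PF a" "PF b"
 shows "PF (%x. r (a x) (length (b x)))"
proof (rule PF_rec[OF assms(1-4) _ assms(6,7)])
 have "pb (%(c, n). K * (length c + n) + K) (%(c :: str, n). length c + n)"
  unfolding case_prod_unfold by (intro pb_add pb_mult pb_const pb_refl)
 then show "pb (%(c, n). length (r c n)) (%(c, n). length c + n)"
  by (rule pb_mono) (auto simp: assms(5))
qed

lemma PF_cong: "PF f ==> (\<And>x. f x = g x) ==> PF g"
 by (drule ext) simp

lemma tl_funpow: "(tl ^^ n) xs = drop n xs"
 by (induction n arbitrary: xs) (auto simp: drop_Suc funpow_swap1 drop_tl)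

lemma PF_drop:
 assumes "PF a" "PF b" shows "PF (%x. drop (length (b x)) (a x))"
proof -
 obtain C where C: "\<And>x. length (a x) \<le> (length x + C) ^ C" using PF_bound[OF assms(1)] unfolding pb_def by blast
 have "PF (%x. (tl ^^ length (b x)) (a x))"
 proof (rule Fn_iter[OF Fn_tl assms])
  show "length ((tl ^^ i) (a x)) \<le> (length x + C) ^ C" for x i
   using C[of x] by (simp add: tl_funpow)
 qed
 then show ?thesis by (simp add: tl_funpow)
qed

lemma length_ssnd_funpow: "length ((ssnd ^^ i) s) \<le> length s"
 by (induction i) (auto intro: le_trans[OF length_ssnd])

lemma PF_item:
 assumes "PF a" "PF b" shows "PF (%x. (ssnd ^^ length (b x)) (a x))"
proof -
 obtain C where C: "\<And>x. length (a x) \<le> (length x + C) ^ C" using PF_bound[OF assms(1)] unfolding pb_def by blast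
 show ?thesis
 proof (rule Fn_iter[OF Fn_snd assms])
  show "length ((ssnd ^^ i) (a x)) \<le> (length x + C) ^ C" for x i
   using C[of x] length_ssnd_funpow le_trans by blast
 qed
qed

text \<open>Positions past the end read as \<open>False\<close>, which for binary numbers supplies
  the missing leading zeros.\<close>

definition sbit :: "str => nat => bool" where
 "sbit s n \<longleftrightarrow> n < length s & s ! n"

lemma PP_bit: "PF a ==> PF b ==> PP (%x. sbit (a x) (length (b x)))"
 by (rule PP_cong[OF PP_hd[OF PF_drop]], assumption+)
  (simp add: sbit_def hd_drop_conv_nth not_le cong: conj_cong)

lemma PP_length_le: assumes "PF f" "PF g" shows "PP (%x. length (f x) \<le> length (g x))"
 by (rule PP_cong[OF PP_eq_Nil[OF PF_drop[OF assms]]]) simp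

lemma PF_U: assumes "PF f" shows "PF (%x. U (length (f x)))"
 by (rule PF_rec_linear[where r = "%_ n. U n" and g = "%_. []" and H = "%_ _ r. False # r" and K = 1 and a = "%x. x"])
  (auto intro!: PF_intros assms)

lemma PF_rev: assumes "PF f" shows "PF (%x. rev (f x))"
proof -
 have "PF (%x. rev (take (length (f x)) (f x)))"
 proof (rule PF_rec_linear[where r = "%c n. rev (take n c)" and g = "%_. []" and K = 1 and a = f and b = f
   and H = "%c i r. if drop (length i) c = [] then r else if sbit c (length i) then True # r else False # r"])
  show "rev (take (Suc n) c) = (if drop (length (U n)) c = [] then rev (take n c)
    else if sbit c (length (U n)) then True # rev (take n c) else False # rev (take n c))" for c n
   by (cases "n < length c") (auto simp: sbit_def take_Suc_conv_app_nth)
 qed (auto intro!: PF_intros PF_drop PP_length_le PP_bit assms)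
 then show ?thesis by simp
qed

lemma PF_append: assumes "PF f" "PF g" shows "PF (%x. f x @ g x)"
proof -
 have "PF (%x. (%c n. rev (take n (sfst c)) @ ssnd c) (pr (rev (f x)) (g x)) (length (f x)))"
 proof (rule PF_rec_linear[where r = "%c n. rev (take n (sfst c)) @ ssnd c" and g = ssnd and K = 1
   and H = "%c i r. if drop (length i) (sfst c) = [] then r else if sbit (sfst c) (length i) then True # r else False # r"])
  show "rev (take (Suc n) (sfst c)) @ ssnd c = (if drop (length (U n)) (sfst c) = [] then rev (take n (sfst c)) @ ssnd c
    else if sbit (sfst c) (length (U n)) then True # rev (take n (sfst c)) @ ssnd c else False # rev (take n (sfst c)) @ ssnd c)" for c n
   by (cases "n < length (sfst c)") (auto simp: sbit_def take_Suc_conv_app_nth)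
  show "length (rev (take n (sfst c)) @ ssnd c) \<le> 1 * (length c + n) + 1" for c n
   using length_ssnd[of c] by simp
 qed (auto intro!: PF_intros PF_drop PP_length_le PP_bit PF_rev assms Fn_snd)
 then show ?thesis by simp
qed

lemma PP_bex_less:
 assumes "PP (%x. P (sfst x) (ssnd x))" "PF a" "PF b"
 shows "PP (%x. \<exists>i < length (b x). P (a x) (U i))"
 unfolding PP_def
proof (rule PF_rec_linear[where r = "%c n. tt (\<exists>i < n. P c (U i))" and g = "%_. []" and K = 1
  and H = "%c i r. tt (r \<noteq> [] \<or> P c i)"])
 show "tt (\<exists>i < Suc n. P c (U i)) = tt (tt (\<exists>i < n. P c (U i)) \<noteq> [] \<or> P c (U n))" for c n
  by (simp add: less_Suc_eq ex_disj_distrib conj_disj_distribR disj_commute)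
 have "PP (%x. P (sfst x) (sfst (ssnd x)))"
  using PP_comp[OF assms(1), of "%x. pr (sfst x) (sfst (ssnd x))"] by (simp add: PF_intros Fn_fst Fn_snd)
 then show "PF (%x. tt (ssnd (ssnd x) \<noteq> [] \<or> P (sfst x) (sfst (ssnd x))))"
  by (intro PF_intros)
 show "length (tt (\<exists>i < n. P c (U i))) \<le> 1 * (length c + n) + 1" for c n
  using length_tt[of "\<exists>i < n. P c (U i)"] by linarith
qed (auto intro: PF_intros assms simp: tt_def)

lemma PP_ball_less:
 assumes "PP (%x. P (sfst x) (ssnd x))" "PF a" "PF b"
 shows "PP (%x. \<forall>i < length (b x). P (a x) (U i))"
 using PP_not[OF PP_bex_less[OF PP_not[OF assms(1)] assms(2,3)]] by simp

text \<open>Success is marked by a leading \<open>True\<close>; otherwise index 0, coded by the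
  empty string, could not be told from failure.\<close>

lemma PF_least:
 assumes "PP (%x. P (sfst x) (ssnd x))" "PF a" "PF b"
 shows "PF (%x. if \<exists>i < length (b x). P (a x) (U i) then True # U (LEAST i. P (a x) (U i)) else [])"
proof (rule PF_rec_linear[where r = "%c n. if \<exists>i < n. P c (U i) then True # U (LEAST i. P c (U i)) else []"
  and g = "%_. []" and K = 1 and H = "%c i r. if r \<noteq> [] then r else if P c i then True # i else []"])
 show "(if \<exists>i < Suc n. P c (U i) then True # U (LEAST i. P c (U i)) else []) =
  (if (if \<exists>i < n. P c (U i) then True # U (LEAST i. P c (U i)) else []) \<noteq> []
   then if \<exists>i < n. P c (U i) then True # U (LEAST i. P c (U i)) else []
   else if P c (U n) then True # U n else [])" for c n
 proof (cases "\<exists>i < n. P c (U i)")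
  case True
  then have "\<exists>i < Suc n. P c (U i)" using less_SucI by blast
  then show ?thesis using True by simp
 next
  case False
  have "(\<exists>i < Suc n. P c (U i)) \<longleftrightarrow> P c (U n)" using False less_Suc_eq by auto
  moreover have "(LEAST i. P c (U i)) = n" if "P c (U n)"
   by (rule Least_equality[of "%i. P c (U i)", OF that]) (use False in \<open>meson not_less\<close>)
  ultimately show ?thesis using False by auto
 qed
 have "PP (%x. P (sfst x) (sfst (ssnd x)))"
  using PP_comp[OF assms(1), of "%x. pr (sfst x) (sfst (ssnd x))"] by (simp add: PF_intros Fn_fst Fn_snd)
 then show "PF (%x. if ssnd (ssnd x) \<noteq> [] then ssnd (ssnd x) else if P (sfst x) (sfst (ssnd x)) then True # sfst (ssnd x) else [])"
  by (intro PF_intros)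
 show "length (if \<exists>i < n. P c (U i) then True # U (LEAST i. P c (U i)) else []) \<le> 1 * (length c + n) + 1" for c n
 proof (cases "\<exists>i < n. P c (U i)")
  case True
  then obtain i where "i < n" "P c (U i)" by blast
  then have "(LEAST i. P c (U i)) \<le> n" using Least_le[of "%i. P c (U i)" i] by simp
  then show ?thesis using True by simp
 qed auto
qed (auto intro: PF_intros assms)

lemma PP_eq: assumes "PF f" "PF g" shows "PP (%x. f x = g x)"
proof -
 let ?P = "%c i. (drop (length i) (sfst c) = [] \<longleftrightarrow> drop (length i) (ssnd c) = []) &
   sbit (sfst c) (length i) = sbit (ssnd c) (length i)"
 have "PP (%x. \<forall>i < length (False # f x). ?P (pr (f x) (g x)) (U i))"
  by (rule PP_ball_less) (intro PF_intros PP_iff PP_bit PF_drop assms Fn_fst Fn_snd)+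
 moreover have "(\<forall>i < length (False # x). ?P (pr x y) (U i)) \<longleftrightarrow> x = y" for x y
 proof
  assume "\<forall>i < length (False # x). ?P (pr x y) (U i)"
  then have *: "(length x \<le> i \<longleftrightarrow> length y \<le> i) & sbit x i = sbit y i" if "i \<le> length x" for i
   using that by simp
  have "length y \<le> length x" using *[of "length x"] by simp
  moreover have "length x \<le> length y"
  proof (cases "length x")
   case (Suc n)
   then show ?thesis using *[of n] by simp
  qed simp
  ultimately have len: "length x = length y" by simp
  show "x = y"
  proof (rule nth_equalityI[OF len])
   fix i assume "i < length x"
   then show "x ! i = y ! i" using *[of i] len by (simp add: sbit_def)
  qed
 qed simp
 ultimately show ?thesis by simp
qed

fun lst :: "str list => str" where
 "lst [] = []"
| "lst (x # xs) = pr x (lst xs)"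

lemma ssnd_funpow_Nil: "(ssnd ^^ i) [] = []"
 by (induction i) auto

lemma ssnd_lst: "(ssnd ^^ i) (lst xs) = lst (drop i xs)"
proof (induction i arbitrary: xs)
 case (Suc i)
 show ?case
  by (cases xs) (simp_all add: Suc ssnd_funpow_Nil funpow_Suc_right del: funpow.simps)
qed simp

lemma sfst_lst: "i < length xs ==> sfst ((ssnd ^^ i) (lst xs)) = xs ! i"
 by (simp add: ssnd_lst Cons_nth_drop_Suc[symmetric])

lemma length_lst: "length (lst xs) = (\<Sum>x\<leftarrow>xs. 2 * length x + 1)"
 by (induction xs) auto

text \<open>A list grows at its front, so the recursion has to produce the items from the last index
  down. Stage \<open>n\<close> converts its counter into the index
  \<open>length (b x) - Suc n\<close> by dropping.\<close>

lemma PF_collect: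
 assumes f: "PF (%x. f (sfst x) (ssnd x))" and a: "PF a" and b: "PF b"
 shows "PF (%x. lst (map (%i. f (a x) (U i)) [0..<length (b x)]))"
proof -
 define r where "r c n = rec_nat [] (%n s. pr (f (sfst c) (drop (Suc n) (U (length (ssnd c))))) s) n" for c n
 obtain A where A: "\<And>c i. length (f c i) \<le> (2 * length c + length i + 1 + A) ^ A"
 proof -
  obtain A where "\<And>x. length (f (sfst x) (ssnd x)) \<le> (length x + A) ^ A"
   using PF_bound[OF f] unfolding pb_def by blast
  from this[of "pr _ _"] show ?thesis using that[of A] by simp
 qed
 have len: "length (r c n) \<le> n * (2 * (2 * length c + length c + 1 + A) ^ A + 1)" for c n
 proof (induction n)
  case (Suc n)
  let ?i = "drop (Suc n) (U (length (ssnd c)))"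
  have "length (f (sfst c) ?i) \<le> (2 * length (sfst c) + length ?i + 1 + A) ^ A" by (rule A)
  also have "\<dots> \<le> (2 * length c + length c + 1 + A) ^ A"
   using length_sfst[of c] length_ssnd[of c] by (intro power_mono) auto
  finally show ?case using Suc by (simp add: r_def)
 qed (simp add: r_def)
 have "PF (%x. r (pr (a x) (b x)) (length (b x)))"
 proof (rule PF_rec[where r = r and g = "%_. []" and H = "%c i s. pr (f (sfst c) (drop (length (False # i)) (U (length (ssnd c))))) s"])
  have "PF (%x. f (sfst (sfst x)) (drop (length (False # sfst (ssnd x))) (U (length (ssnd (sfst x))))))"
   by (rule PF_rec_binary[OF f]) (intro PF_intros PF_drop PF_U Fn_fst Fn_snd)+
  then show "PF (%x. pr (f (sfst (sfst x)) (drop (length (False # sfst (ssnd x))) (U (length (ssnd (sfst x)))))) (ssnd (ssnd x)))"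
   by (intro PF_intros)
  have "pb (%(c :: str, n). n * (2 * (2 * length c + length c + 1 + A) ^ A + 1)) (%(c, n). length c + n)"
   unfolding case_prod_unfold
   by (intro pb_add pb_mult pb_power pb_const) (auto intro: pb_le)
  then show "pb (%(c, n). length (r c n)) (%(c, n). length c + n)"
   by (rule pb_mono) (use len in auto)
 qed (auto simp: r_def intro!: PF_intros a b)
 moreover have "r (pr c d) (length d) = lst (map (%i. f c (U i)) [0..<length d])" for c d
 proof -
  have "n \<le> length d ==> r (pr c d) n = lst (map (%i. f c (U i)) [length d - n..<length d])" for n
  proof (induction n)
   case (Suc n)
   then have "[length d - Suc n..<length d] = (length d - Suc n) # [length d - n..<length d]"
    by (simp add: upt_conv_Cons Suc_diff_Suc)
   then show ?case using Suc by (simp add: r_def)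
  qed (simp add: r_def)
  from this[of "length d"] show ?thesis by simp
 qed
 ultimately show ?thesis by simp
qed

section \<open>Binary arithmetic\<close>

fun val :: "str => nat" where
 "val [] = 0"
| "val (b # xs) = (if b then 1 else 0) + 2 * val xs"

lemma bits_0 [simp]: "bits 0 = []"
 by (simp add: bits.simps)

lemma val_bits [simp]: "val (bits n) = n"
proof (induction n rule: less_induct)
 case (less n)
 show ?case
 proof (cases "n = 0")
  case False
  then have "val (bits (n div 2)) = n div 2" using less by simp
  then show ?thesis using False by (auto simp: bits.simps[of n])
 qed simp
qed

lemma bits_Cons: "bits ((if b then 1 else 0) + 2 * n) = (if \<not> b & n = 0 then [] else b # bits n)"
 by (subst bits.simps) auto

lemma bits_eq_Nil [simp]: "bits n = [] \<longleftrightarrow> n = 0"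
 by (subst bits.simps) simp

lemma bits_inj [simp]: "bits m = bits n \<longleftrightarrow> m = n"
 by (metis val_bits)

lemma length_bits: "length (bits n) = floorlog 2 n"
proof (induction n rule: less_induct)
 case (less n)
 show ?case
 proof (cases "n = 0")
  case False
  then have "length (bits n) = Suc (length (bits (n div 2)))" by (subst bits.simps) simp
  then show ?thesis using less False by (simp add: compute_floorlog[of 2 n])
 qed simp
qed

lemma val_append: "val (xs @ ys) = val xs + 2 ^ length xs * val ys"
 by (induction xs) auto

lemma val_U [simp]: "val (U n) = 0"
 by (induction n) auto

lemma val_less: "val xs < 2 ^ length xs"
 by (induction xs) auto

lemma length_bits_val: "length (bits (val xs)) \<le> length xs"
 using val_less[of xs] by (simp add: length_bits less_floorlog)

lemma val_take_Suc: "val (take (Suc n) x) = val (take n x) + (if sbit x n then 2 ^ n else 0)"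
proof (cases "n < length x")
 case True
 then show ?thesis by (simp add: take_Suc_conv_app_nth val_append sbit_def)
qed (simp add: sbit_def)

lemma bits_pow2: "bits (2 ^ n) = U n @ [True]"
proof -
 have "bits (val (U n @ [True])) = U n @ [True]"
 proof (induction n)
  case 0
  show ?case by (subst bits.simps) simp
 next
  case (Suc n)
  have "val (U n @ [True]) > 0" by (simp add: val_append)
  then show ?case using Suc bits_Cons[of False "val (U n @ [True])"] by simp
 qed
 then show ?thesis by (simp add: val_append)
qed

lemma PF_norm: assumes "PF f" shows "PF (%x. bits (val (f x)))"
proof -
 have "PF (%x. (%c n. bits (val (rev (take n c)))) (rev (f x)) (length (f x)))"
 proof (rule PF_rec_linear[where r = "%c n. bits (val (rev (take n c)))" and g = "%_. []" and K = 1
   and H = "%c i r. if drop (length i) c = [] then r else if sbit c (length i) then True # r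
     else if r = [] then [] else False # r"])
  show "bits (val (rev (take (Suc n) c))) = (if drop (length (U n)) c = [] then bits (val (rev (take n c)))
    else if sbit c (length (U n)) then True # bits (val (rev (take n c)))
    else if bits (val (rev (take n c))) = [] then [] else False # bits (val (rev (take n c))))" for c n
  proof (cases "n < length c")
   case True
   then have "val (rev (take (Suc n) c)) = (if c ! n then 1 else 0) + 2 * val (rev (take n c))"
    by (simp add: take_Suc_conv_app_nth)
   then show ?thesis using True by (simp only: bits_Cons) (simp add: sbit_def)
  qed simp
  show "length (bits (val (rev (take n c)))) \<le> 1 * (length c + n) + 1" for c n
   using length_bits_val[of "rev (take n c)"] by simp
 qed (auto intro!: PF_intros PF_drop PP_length_le PP_bit PF_rev assms)
 then show ?thesis by simp
qed

primrec adder :: "str => str => nat => bool \<times> str" where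
 "adder x y 0 = (False, [])"
| "adder x y (Suc n) = (let (c, out) = adder x y n; p = sbit x n; q = sbit y n
   in (p & q \<or> c & (p \<or> q), ((p \<noteq> q) \<noteq> c) # out))"

lemma adder_length: "length (snd (adder x y n)) = n"
 by (induction n) (auto simp: Let_def case_prod_unfold)

lemma adder_val: "val (rev (snd (adder x y n))) + (if fst (adder x y n) then 2 ^ n else 0) =
  val (take n x) + val (take n y)"
proof (induction n)
 case (Suc n)
 obtain c out where co: "adder x y n = (c, out)" by fastforce
 have l: "length out = n" using adder_length[of x y n] co by simp
 have IH: "val (rev out) + (if c then 2 ^ n else 0) = val (take n x) + val (take n y)" using Suc co by simp
 show ?case using IH l unfolding val_take_Suc adder.simps co Let_def case_prod_conv fst_conv snd_conv rev.simps val_append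
  by (cases c; cases "sbit x n"; cases "sbit y n") simp_all
qed simp

text \<open>The full adder is written as a case distinction with constant heads, which is the shape
  covered by \<open>PF_if\<close> and \<open>PF_cons\<close>.\<close>

definition addbit :: "bool => bool => bool => str => str" where
 "addbit p q b t = (if p & q \<or> b & (p \<or> q) then if (p \<noteq> q) \<noteq> b then True # True # t else True # False # t
   else if (p \<noteq> q) \<noteq> b then False # True # t else False # False # t)"

lemma addbit_eq: "addbit p q b t = (p & q \<or> b & (p \<or> q)) # ((p \<noteq> q) \<noteq> b) # t"
 by (cases p; cases q; cases b) (simp_all add: addbit_def)

lemma PF_addbit: "PP P ==> PP Q ==> PP R ==> PF f ==> PF (%x. addbit (P x) (Q x) (R x) (f x))"
 unfolding addbit_def by (intro PF_if PF_cons PP_conj PP_disj PP_not PP_iff) assumption+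

lemma PF_add: assumes "PF f" "PF g" shows "PF (%x. bits (val (f x) + val (g x)))"
proof -
 define r where "r c n = (case adder (sfst c) (ssnd c) n of (b, out) => b # out)" for c n
 define H where "H c i r = addbit (sbit (sfst c) (length i)) (sbit (ssnd c) (length i)) (r \<noteq> [] & hd r) (tl r)" for c i r :: str
 have "PF (%x. r (pr (f x) (g x)) (length (f x @ g x)))"
 proof (rule PF_rec_linear[where r = r and g = "%_. [False]" and K = 1 and H = H])
  show "r c (Suc n) = H c (U n) (r c n)" for c n
  proof -
   obtain b out where co: "adder (sfst c) (ssnd c) n = (b, out)" by fastforce
   have "r c n = b # out" by (simp add: r_def co)
   moreover have "r c (Suc n) = addbit (sbit (sfst c) n) (sbit (ssnd c) n) b out"
    unfolding r_def adder.simps co Let_def case_prod_conv addbit_eq ..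
   ultimately show ?thesis by (simp only: H_def list.sel length_replicate list.distinct simp_thms)
  qed
  show "PF (%x. H (sfst x) (sfst (ssnd x)) (ssnd (ssnd x)))"
   unfolding H_def by (intro PF_addbit PP_hd PF_tl PP_bit PF_sfst PF_ssnd Fn_id)
  show "length (r c n) \<le> 1 * (length c + n) + 1" for c n
   using adder_length[of "sfst c" "ssnd c" n] by (simp add: r_def case_prod_unfold)
 qed (auto simp: r_def intro!: PF_intros PF_append assms)
 then have "PF (%x. bits (val (rev (r (pr (f x) (g x)) (length (f x @ g x))))))"
  by (intro PF_norm PF_rev)
 moreover have "val (rev (r (pr x y) (length (x @ y)))) = val x + val y" for x y
  using adder_val[of x y "length x + length y"] adder_length[of x y "length x + length y"]
  by (cases "fst (adder x y (length x + length y))") (simp_all add: r_def case_prod_unfold val_append)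
 ultimately show ?thesis by simp
qed

lemma PF_count: assumes "PF f" shows "PF (%x. bits (length (f x)))"
proof (rule PF_rec_linear[where r = "%_ n. bits n" and g = "%_. []" and H = "%_ _ r. bits (val r + val [True])" and K = 1 and a = "%x. x"])
 show "length (bits n) \<le> 1 * (length c + n) + 1" for c :: str and n
 proof -
  have "floorlog 2 n \<le> n" using less_floorlog[of n n] less_exp[of n] by blast
  then show ?thesis by (simp add: length_bits)
 qed
qed (auto intro!: PF_intros PF_add[of _ "%_. [True]", simplified] assms)

lemma PF_mult: assumes "PF f" "PF g" shows "PF (%x. bits (val (f x) * val (g x)))"
proof -
 have "PF (%x. (%c n. bits (val (sfst c) * val (take n (ssnd c)))) (pr (f x) (g x)) (length (g x)))"
 proof (rule PF_rec_linear[where r = "%c n. bits (val (sfst c) * val (take n (ssnd c)))" and g = "%_. []" and K = 1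
   and H = "%c i r. if sbit (ssnd c) (length i) then bits (val r + val (U (length i) @ sfst c)) else r"])
  show "bits (val (sfst c) * val (take (Suc n) (ssnd c))) =
   (if sbit (ssnd c) (length (U n)) then bits (val (bits (val (sfst c) * val (take n (ssnd c)))) + val (U (length (U n)) @ sfst c))
    else bits (val (sfst c) * val (take n (ssnd c))))" for c n
   by (simp add: val_take_Suc val_append algebra_simps del: take_Suc)
  show "PF (%x. if sbit (ssnd (sfst x)) (length (sfst (ssnd x)))
    then bits (val (ssnd (ssnd x)) + val (U (length (sfst (ssnd x))) @ sfst (sfst x))) else ssnd (ssnd x))"
   by (intro PF_intros PP_bit PF_add PF_append PF_U Fn_fst Fn_snd)
  show "length (bits (val (sfst c) * val (take n (ssnd c)))) \<le> 1 * (length c + n) + 1" for c n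
  proof -
   have "val (sfst c) * val (take n (ssnd c)) < 2 ^ length (sfst c) * 2 ^ length (take n (ssnd c))"
    by (intro mult_strict_mono val_less) auto
   then have "length (bits (val (sfst c) * val (take n (ssnd c)))) \<le> length (sfst c) + length (take n (ssnd c))"
    by (simp add: length_bits less_floorlog[symmetric] power_add)
   then show ?thesis using length_sfst[of c] by simp
  qed
 qed (auto intro!: PF_intros assms)
 then show ?thesis by simp
qed

text \<open>The scan starts at the least significant bit: a difference at a higher position
  overrules the verdict so far, and equal bits keep it.\<close>

lemma PP_le: assumes "PF f" "PF g" shows "PP (%x. val (f x) \<le> val (g x))"
proof -
 have "PF (%x. (%c n. tt (val (take n (sfst c)) \<le> val (take n (ssnd c)))) (pr (f x) (g x)) (length (f x @ g x)))"
 proof (rule PF_rec_linear[where r = "%c n. tt (val (take n (sfst c)) \<le> val (take n (ssnd c)))" and g = "%_. [True]" and K = 1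
   and H = "%c i r. tt (if sbit (sfst c) (length i) then sbit (ssnd c) (length i) & r \<noteq> [] else sbit (ssnd c) (length i) \<or> r \<noteq> [])"])
  show "tt (val (take (Suc n) (sfst c)) \<le> val (take (Suc n) (ssnd c))) =
   tt (if sbit (sfst c) (length (U n))
     then sbit (ssnd c) (length (U n)) & tt (val (take n (sfst c)) \<le> val (take n (ssnd c))) \<noteq> []
     else sbit (ssnd c) (length (U n)) \<or> tt (val (take n (sfst c)) \<le> val (take n (ssnd c))) \<noteq> [])" for c n
  proof -
   have l: "val (take n s) < 2 ^ n" for s
    using val_less[of "take n s"] by (rule less_le_trans) (simp add: power_increasing)
   show ?thesis using l[of "sfst c"] l[of "ssnd c"] by (auto simp: val_take_Suc simp del: take_Suc)
  qed
  show "length (tt (val (take n (sfst c)) \<le> val (take n (ssnd c)))) \<le> 1 * (length c + n) + 1" for c n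
   using length_tt[of "val (take n (sfst c)) \<le> val (take n (ssnd c))"] by linarith
 qed (auto simp: tt_def intro!: PF_intros PF_append PP_bit assms)
 then show ?thesis unfolding PP_def by simp
qed

lemma PP_val_eq: assumes "PF f" "PF g" shows "PP (%x. val (f x) = val (g x))"
 by (rule PP_cong[OF PP_eq[OF PF_norm[OF assms(1)] PF_norm[OF assms(2)]]]) simp

lemma PF_umult: assumes "PF f" "PF g" shows "PF (%x. U (length (f x) * length (g x)))"
proof (rule PF_rec[where r = "%c n. U (length c * n)" and g = "%_. []" and H = "%c _ r. U (length c) @ r"])
 have "pb (%(c :: str, n). length c * n) (%(c, n). length c + n)"
  unfolding case_prod_unfold by (intro pb_mult pb_le) auto
 then show "pb (%(c, n). length (U (length c * n))) (%(c :: str, n). length c + n)"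
  by (simp add: case_prod_unfold)
qed (auto simp: replicate_add intro!: PF_intros PF_append PF_U assms)

lemma PF_smash: assumes "PF f" "PF g"
 shows "PF (%x. bits (2 ^ (floorlog 2 (val (f x)) * floorlog 2 (val (g x)))))"
 unfolding bits_pow2 length_bits[symmetric] by (intro PF_append PF_umult PF_norm PF_const assms)

lemma PF_len: assumes "PF f" shows "PF (%x. bits (floorlog 2 (val (f x))))"
 unfolding length_bits[symmetric] by (intro PF_count PF_norm assms)

lemma val_tl: "val (tl x) = val x div 2"
 by (cases x) auto

lemma PF_half: assumes "PF f" shows "PF (%x. bits (val (f x) div 2))"
 unfolding val_tl[symmetric] by (intro PF_norm PF_tl assms)

lemma PF_succ: assumes "PF f" shows "PF (%x. bits (Suc (val (f x))))"
 using PF_add[OF assms PF_const[of "[True]"]] by simp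

section \<open>Evaluation of terms and sharply bounded formulas\<close>

text \<open>A string is read as a list of binary numbers. Past its end the value is 0, so that every
  string is a total assignment.\<close>

definition env :: "str => nat => nat" where
 "env l i = val (sfst ((ssnd ^^ i) l))"

lemma env_pr: "env (pr x l) = case_nat (val x) (env l)"
 by (auto simp: fun_eq_iff env_def funpow_Suc_right simp del: funpow.simps split: nat.splits)

lemma env_Suc: "env l (Suc i) = env (ssnd l) i"
 by (simp add: env_def funpow_Suc_right del: funpow.simps)

lemma PF_eval: "PF f ==> PF (%x. bits (eval (env (f x)) t))"
proof (induction t)
 case (Var i)
 have "PF (%x. bits (val (sfst ((ssnd ^^ length (U i)) (f x)))))"
  by (intro PF_norm PF_sfst PF_item Var PF_const)
 then show ?case by (simp add: env_def)
next
 case (Sc t)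
 then show ?case using PF_succ[OF Sc.IH[OF Sc.prems]] by simp
next
 case (Add s t)
 then show ?case using PF_add[OF Add.IH(1)[OF Add.prems] Add.IH(2)[OF Add.prems]] by simp
next
 case (Mul s t)
 then show ?case using PF_mult[OF Mul.IH(1)[OF Mul.prems] Mul.IH(2)[OF Mul.prems]] by simp
next
 case (Len t)
 then show ?case using PF_len[OF Len.IH[OF Len.prems]] by simp
next
 case (Half t)
 then show ?case using PF_half[OF Half.IH[OF Half.prems]] by simp
next
 case (Smash s t)
 then show ?case using PF_smash[OF Smash.IH(1)[OF Smash.prems] Smash.IH(2)[OF Smash.prems]] by simp
qed (simp add: PF_const)

lemma sharply_ball:
 assumes "PP (%l. P (env l))" "PF f"
 shows "PP (%x. \<forall>n \<le> floorlog 2 (eval (env (f x)) t). P (case_nat n (env (f x))))"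
proof -
 have "PP (%x. \<forall>i < length (False # bits (eval (env (f x)) t)). P (env (pr (bits (length (U i))) (f x))))"
 proof (rule PP_ball_less[where P = "%c u. P (env (pr (bits (length u)) c))"])
  show "PP (%x. P (env (pr (bits (length (ssnd x))) (sfst x))))"
   by (rule PP_comp[OF assms(1)]) (intro PF_intros PF_count Fn_fst Fn_snd)
 qed (intro PF_intros PF_eval assms)+
 then show ?thesis by (simp add: env_pr length_bits less_Suc_eq_le)
qed

lemma PP_sharply: "sharply_bounded \<phi> ==> PP (%l. sat (env l) \<phi>)"
proof (induction rule: sharply_bounded.induct)
 case (1 s t)
 then show ?case using PP_eq[OF PF_eval[OF Fn_id] PF_eval[OF Fn_id]] by simp
next
 case (2 s t)
 then show ?case using PP_le[OF PF_eval[OF Fn_id] PF_eval[OF Fn_id]] by simp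
next
 case (7 \<phi> t)
 then show ?case using sharply_ball[of "%e. sat e \<phi>", OF _ Fn_id] by simp
next
 case (8 \<phi> t)
 have "PP (%l. \<not> (\<forall>n \<le> floorlog 2 (eval (env l) t). \<not> sat (case_nat n (env l)) \<phi>))"
  by (rule PP_not[OF sharply_ball[of "%e. \<not> sat e \<phi>", OF PP_not[OF 8(2)] Fn_id]])
 then show ?case by simp
qed (auto intro: PP_not PP_conj PP_disj PP_imp)

section \<open>Truth of S^1_2 and witnessing of its Delta^b_1 formulas by forcing\<close>

section \<open>Soundness\<close>

lemma eval_inst: "(%i. eval e (case_nat t Var i)) = case_nat (eval e t) e"
 by (auto simp: fun_eq_iff split: nat.splits)

lemma prov_sound:
 assumes "prov T \<Gamma> \<phi>" "\<And>\<psi> e. \<psi> \<in> T ==> sat e \<psi>" "\<And>\<psi>. \<psi> \<in> \<Gamma> ==> sat e \<psi>"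
 shows "sat e \<phi>"
 using assms(1,3)
proof (induction arbitrary: e rule: prov.induct)
 case (AllI \<Gamma> \<phi>)
 have "sat (case_nat n e) \<phi>" for n
  by (rule AllI.IH) (use AllI.prems in \<open>auto simp: sat_subst\<close>)
 then show ?case by simp
next
 case (AllE \<Gamma> \<phi> t)
 then have "sat e (All \<phi>)" by blast
 then show ?case by (simp add: sat_subst eval_inst)
next
 case (ExI \<Gamma> \<phi> t)
 then have "sat e (inst \<phi> t)" by blast
 then show ?case by (auto simp: sat_subst eval_inst)
next
 case (ExE \<Gamma> \<phi> \<psi>)
 then obtain n where n: "sat (case_nat n e) \<phi>" by fastforce
 have "sat (case_nat n e) (lift_fm \<psi>)"
  by (rule ExE.IH(2)) (use ExE.prems n in \<open>auto simp: sat_subst\<close>)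
 then show ?case by (simp add: sat_subst)
next
 case (EqSubst \<Gamma> s t \<phi>)
 have "sat e (s \<^bold>= t)" "sat e (inst \<phi> s)" using EqSubst by blast+
 then show ?case by (simp add: sat_subst eval_inst)
next
 case (Classical \<phi> \<Gamma> \<psi>)
 show ?case
 proof (rule ccontr)
  assume "\<not> sat e \<phi>"
  then have "\<And>\<chi>. \<chi> \<in> insert (\<^bold>\<not> \<phi>) \<Gamma> ==> sat e \<chi>" using Classical.prems by auto
  then have "sat e \<psi>" "sat e (\<^bold>\<not> \<psi>)" using Classical.IH by blast+
  then show False by simp
 qed
next
 case (NegI \<phi> \<Gamma> \<psi>)
 show ?case
 proof (simp, rule notI)
  assume "sat e \<phi>"
  then have "\<And>\<chi>. \<chi> \<in> insert \<phi> \<Gamma> ==> sat e \<chi>" using NegI.prems by auto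
  then have "sat e \<psi>" "sat e (\<^bold>\<not> \<psi>)" using NegI.IH by blast+
  then show False by simp
 qed
next
 case (OrE \<Gamma> \<phi> \<psi> \<chi>)
 have "sat e (\<phi> \<^bold>\<or> \<psi>)" using OrE by blast
 then consider "sat e \<phi>" | "sat e \<psi>" by auto
 then show ?case
 proof cases
  case 1
  then show ?thesis using OrE.prems by (intro OrE.IH(2)) auto
 next
  case 2
  then show ?thesis using OrE.prems by (intro OrE.IH(3)) auto
 qed
next
 case (ImpI \<phi> \<Gamma> \<psi>)
 have "sat e \<psi>" if "sat e \<phi>" using that ImpI.prems by (intro ImpI.IH) auto
 then show ?case by simp
next
 case (ImpE \<Gamma> \<phi> \<psi>)
 have "sat e (\<phi> \<^bold>\<longrightarrow> \<psi>)" "sat e \<phi>" using ImpE by blast+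
 then show ?case by simp
next
 case (AndE1 \<Gamma> \<phi> \<psi>)
 have "sat e (\<phi> \<^bold>\<and> \<psi>)" using AndE1 by blast
 then show ?case by simp
next
 case (AndE2 \<Gamma> \<phi> \<psi>)
 have "sat e (\<phi> \<^bold>\<and> \<psi>)" using AndE2 by blast
 then show ?case by simp
qed (simp_all add: assms(2))

lemma floorlog_mono': "x \<le> y ==> floorlog 2 x \<le> floorlog 2 y"
 by (rule floorlog_mono)

lemma BASIC_true: "\<phi> \<in> BASIC ==> sat e \<phi>"
proof -
 have half: "x = y div 2 \<longleftrightarrow> 2 * x = y \<or> Suc (2 * x) = y" for x y :: nat by presburger
 have len: "x \<noteq> 0 ==> floorlog 2 x = Suc (floorlog 2 (x div 2))" for x
  using compute_floorlog[of 2 x] by simp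
 show "\<phi> \<in> BASIC ==> sat e \<phi>"
  unfolding BASIC_def Let_def
  by (elim insertE emptyE; simp add: floorlog_double floorlog_mono' len[symmetric] power_add[symmetric]
    algebra_simps del: One_nat_def)
   (auto simp: half len floorlog_double algebra_simps numeral_2_eq_2[symmetric])
qed

lemma BASIC_sharply: "\<phi> \<in> BASIC ==> sharply_bounded \<phi>"
 unfolding BASIC_def Let_def by (elim insertE emptyE; hypsubst; intro sharply_bounded.intros)

lemma PIND_true: "sat e (PIND \<phi>)"
proof -
 have half: "(%i. eval (case_nat n e) (case_nat (Half (Var 0)) (%i. Var (Suc i)) i)) = case_nat (n div 2) e" for n
  by (auto simp: fun_eq_iff split: nat.splits)
 have "sat (case_nat n e) \<phi>" if "sat (case_nat 0 e) \<phi>" "\<And>n. sat (case_nat (n div 2) e) \<phi> ==> sat (case_nat n e) \<phi>" for n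
 proof (induction n rule: less_induct)
  case (less n)
  show ?case
  proof (cases "n = 0")
   case False
   then have "n div 2 < n" by simp
   then show ?thesis using less that(2) by blast
  qed (use that(1) in auto)
 qed
 then show ?thesis unfolding PIND_def by (simp only: sat.simps sat_subst eval_inst half eval.simps) blast
qed

lemma S12_sound: "prov S12 {} \<phi> ==> sat e \<phi>"
 by (rule prov_sound[of S12 "{}"]) (auto simp: S12_def BASIC_true PIND_true)

section \<open>Forcing with filters\<close>

text \<open>The elements of the generic model are polynomial-time functions of finitely many generic strings.\<close>

type_synonym point = "nat => str"

inductive_set elem :: "(point => str) set" where
 elem_coord: "(%pt. pt i) \<in> elem"
| elem_pr: "a \<in> elem ==> b \<in> elem ==> (%pt. pr (a pt) (b pt)) \<in> elem"
| elem_PF: "PF f ==> a \<in> elem ==> (%pt. f (a pt)) \<in> elem"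

lemma elem_const: "(%_. c) \<in> elem"
 using elem_PF[OF PF_const elem_coord] .

lemma elem_PF2: "PF (%x. f (sfst x) (ssnd x)) ==> a \<in> elem ==> b \<in> elem ==> (%pt. f (a pt) (b pt)) \<in> elem"
 using elem_PF[OF _ elem_pr, of "%x. f (sfst x) (ssnd x)" a b] by simp

lemmas elem_sfst = elem_PF[OF Fn_fst] and elem_ssnd = elem_PF[OF Fn_snd] and elem_norm = elem_PF[OF PF_norm[OF Fn_id]]

text \<open>Finite support guarantees that fresh coordinates remain for any given element.\<close>

lemma elem_support: "a \<in> elem ==> \<exists>n. \<forall>pt pt'. (\<forall>i < n. pt i = pt' i) --> a pt = a pt'"
proof (induction rule: elem.induct)
 case (elem_coord i)
 show ?case by (rule exI[of _ "Suc i"]) simp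
next
 case (elem_pr a b)
 then obtain m n where "\<forall>pt pt'. (\<forall>i < m. pt i = pt' i) --> a pt = a pt'" "\<forall>pt pt'. (\<forall>i < n. pt i = pt' i) --> b pt = b pt'"
  by blast
 then have "\<forall>pt pt'. (\<forall>i < max m n. pt i = pt' i) --> pr (a pt) (b pt) = pr (a pt') (b pt')"
  by (simp add: less_max_iff_disj)
 then show ?case by blast
next
 case (elem_PF f a)
 then obtain n where n: "\<forall>pt pt'. (\<forall>i < n. pt i = pt' i) --> a pt = a pt'" by blast
 show ?case by (rule exI[of _ n]) (use n in metis)
qed

lemma elem_subst:
 assumes "a \<in> elem" "\<And>i. (%pt. sg pt i) \<in> elem" shows "(%pt. a (sg pt)) \<in> elem"
 using assms(1) by induction (auto intro: elem.intros assms(2))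

text \<open>One coordinate is separated from the rest: as a function of it, an element is a
  polynomial-time function with a fixed parameter \<open>r\<close>. In \<open>saturation\<close>
  this turns a witness for a generic argument into a function of the argument.\<close>

lemma elem_abstract:
 "t \<in> elem ==> \<exists>h r. PF h & r \<in> elem & (\<forall>pt s. t (fun_upd pt m s) = h (pr s (r pt)))"
proof (induction rule: elem.induct)
 case (elem_coord i)
 show ?case
 proof (cases "i = m")
  case True
  then show ?thesis by (intro exI[of _ sfst] exI[of _ "%_. []"]) (simp add: Fn_fst elem_const)
 next
  case False
  then show ?thesis by (intro exI[of _ ssnd] exI[of _ "%pt. pt i"]) (simp add: Fn_snd elem.elem_coord)
 qed
next
 case (elem_pr a b)
 then obtain h r h' r' where h: "PF h" "r \<in> elem" "\<forall>pt s. a (fun_upd pt m s) = h (pr s (r pt))"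
   "PF h'" "r' \<in> elem" "\<forall>pt s. b (fun_upd pt m s) = h' (pr s (r' pt))" by blast
 have "PF (%x. pr (h (pr (sfst x) (sfst (ssnd x)))) (h' (pr (sfst x) (ssnd (ssnd x)))))"
  by (intro Fn_pair PF_comp[OF h(1)] PF_comp[OF h(4)] PF_intros Fn_fst Fn_snd)
 moreover have "(%pt. pr (r pt) (r' pt)) \<in> elem" by (rule elem.elem_pr[OF h(2,5)])
 moreover have "\<forall>pt s. pr (a (fun_upd pt m s)) (b (fun_upd pt m s)) =
   pr (h (pr (sfst (pr s (pr (r pt) (r' pt)))) (sfst (ssnd (pr s (pr (r pt) (r' pt)))))))
    (h' (pr (sfst (pr s (pr (r pt) (r' pt)))) (ssnd (ssnd (pr s (pr (r pt) (r' pt)))))))"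
  unfolding sfst_pr ssnd_pr using h(3,6) by metis
 ultimately show ?case by blast
next
 case (elem_PF f a)
 then obtain h r where h: "PF h" "r \<in> elem" "\<forall>pt s. a (fun_upd pt m s) = h (pr s (r pt))" by blast
 have "\<forall>pt s. f (a (fun_upd pt m s)) = f (h (pr s (r pt)))" using h(3) by metis
 then show ?case using PF_comp[OF elem_PF.hyps(1) h(1)] h(2) by blast
qed

text \<open>A condition is a proper filter that is invariant under substitutions of elements for all but
 finitely many coordinates; the remaining coordinates are generic over it.\<close>

definition invariant :: "nat => point set set => bool" where
 "invariant n F \<longleftrightarrow> (\<forall>sg. (\<forall>i. (%pt. sg pt i) \<in> elem) & (\<forall>pt. \<forall>i < n. sg pt i = pt i) --> (\<forall>X \<in> F. sg -` X \<in> F))"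

definition cond :: "point set set => bool" where
 "cond F \<longleftrightarrow> UNIV \<in> F & {} \<notin> F & (\<forall>X \<in> F. \<forall>Y \<in> F. X \<inter> Y \<in> F) & (\<forall>X \<in> F. \<forall>Y. X \<subseteq> Y --> Y \<in> F) &
   (\<exists>n. invariant n F)"

lemma cond_UNIV: "cond F ==> UNIV \<in> F"
 and cond_empty: "cond F ==> {} \<notin> F"
 and cond_Int: "cond F ==> X \<in> F ==> Y \<in> F ==> X \<inter> Y \<in> F"
 and cond_mono: "cond F ==> X \<in> F ==> X \<subseteq> Y ==> Y \<in> F"
 unfolding cond_def by blast+

lemma cond_disjoint: "cond F ==> X \<in> F ==> Y \<in> F ==> X \<inter> Y \<noteq> {}"
 using cond_Int[of F X Y] cond_empty[of F] by auto

lemma cond_trivial: "cond {UNIV}"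
 unfolding cond_def invariant_def by auto

lemma invariantD:
 assumes "invariant n F" "\<And>i. (%pt. sg pt i) \<in> elem" "\<And>pt i. i < n ==> sg pt i = pt i" "X \<in> F"
 shows "sg -` X \<in> F"
 using assms unfolding invariant_def by simp

lemma invariant_mono: "invariant n F ==> n \<le> m ==> invariant m F"
 unfolding invariant_def by (meson less_le_trans)

text \<open>This is the filter generated by \<open>F\<close> and the failure of \<open>A\<close> at
  every element of \<open>E\<close>. It is improper only if finitely many elements of
  \<open>E\<close> already cover a member of \<open>F\<close>; \<open>cond_avoid\<close> rests on
  this compactness.\<close>

definition avoid :: "point set set => (point => str => bool) => (point => str) set => point set set" where
 "avoid F A E = {Y. \<exists>X \<in> F. \<exists>T. finite T & T \<subseteq> E & X \<inter> {pt. \<forall>t \<in> T. \<not> A pt (t pt)} \<subseteq> Y}"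

lemma avoid_filter:
 assumes "cond F"
 shows "F \<subseteq> avoid F A E" "t \<in> E ==> {pt. \<not> A pt (t pt)} \<in> avoid F A E"
  "X \<in> avoid F A E ==> Y \<in> avoid F A E ==> X \<inter> Y \<in> avoid F A E"
  "X \<in> avoid F A E ==> X \<subseteq> Y ==> Y \<in> avoid F A E"
proof -
 show "F \<subseteq> avoid F A E" unfolding avoid_def by (auto intro!: bexI exI[of _ "{}"])
 show "{pt. \<not> A pt (t pt)} \<in> avoid F A E" if "t \<in> E"
  unfolding avoid_def using that cond_UNIV[OF assms] by (auto intro!: bexI[of _ UNIV] exI[of _ "{t}"])
 show "X \<inter> Y \<in> avoid F A E" if X: "X \<in> avoid F A E" and Y: "Y \<in> avoid F A E"
 proof -
  obtain X' T where 1: "X' \<in> F" "finite T" "T \<subseteq> E" "X' \<inter> {pt. \<forall>t \<in> T. \<not> A pt (t pt)} \<subseteq> X" using X unfolding avoid_def by blast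
  obtain Y' S where 2: "Y' \<in> F" "finite S" "S \<subseteq> E" "Y' \<inter> {pt. \<forall>t \<in> S. \<not> A pt (t pt)} \<subseteq> Y" using Y unfolding avoid_def by blast
  have "X' \<inter> Y' \<in> F" using 1 2 cond_Int[OF assms] by blast
  moreover have "X' \<inter> Y' \<inter> {pt. \<forall>t \<in> T \<union> S. \<not> A pt (t pt)} \<subseteq> X \<inter> Y" using 1(4) 2(4) by blast
  moreover have "finite (T \<union> S)" "T \<union> S \<subseteq> E" using 1 2 by auto
  ultimately show ?thesis unfolding avoid_def by blast
 qed
 show "Y \<in> avoid F A E" if "X \<in> avoid F A E" "X \<subseteq> Y" using that unfolding avoid_def by blast
qed

lemma avoid_invariant:
 assumes "invariant n F" "\<And>pt pt' y. (\<forall>i < n. pt i = pt' i) ==> A pt y = A pt' y"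
  "\<And>t sg. t \<in> E ==> (\<And>i. (%pt. sg pt i) \<in> elem) ==> (\<And>pt i. i < n ==> sg pt i = pt i) ==> (%pt. t (sg pt)) \<in> E"
 shows "invariant n (avoid F A E)"
 unfolding invariant_def
proof (intro allI impI ballI)
 fix sg Y assume sg: "(\<forall>i. (%pt. sg pt i) \<in> elem) & (\<forall>pt. \<forall>i < n. sg pt i = pt i)" and "Y \<in> avoid F A E"
 then obtain X T where X: "X \<in> F" "finite T" "T \<subseteq> E" "X \<inter> {pt. \<forall>t \<in> T. \<not> A pt (t pt)} \<subseteq> Y" unfolding avoid_def by blast
 have A: "A (sg pt) y = A pt y" for pt y by (rule assms(2)) (use sg in simp)
 let ?T = "(%t pt. t (sg pt)) ` T"
 have "sg -` X \<in> F" using assms(1) sg X(1) unfolding invariant_def by blast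
 moreover have "finite ?T" "?T \<subseteq> E" using X(2,3) sg assms(3) by blast+
 moreover have "sg -` X \<inter> {pt. \<forall>t \<in> ?T. \<not> A pt (t pt)} \<subseteq> sg -` Y" using X(4) A by auto
 ultimately show "sg -` Y \<in> avoid F A E" unfolding avoid_def by blast
qed

text \<open>These are the sets that a condition can be extended to decide: membership depends on
  finitely many coordinates, so that the extension stays invariant from some index on.\<close>

definition dec :: "point set => bool" where
 "dec X \<longleftrightarrow> (\<exists>a \<in> elem. \<exists>P. PP P & X = {pt. P (a pt)})"

lemma decI: "a \<in> elem ==> PP P ==> dec {pt. P (a pt)}"
 unfolding dec_def by blast

lemma dec_Compl: "dec X ==> dec (- X)"
proof -
 assume "dec X"
 then obtain a P where a: "a \<in> elem" "PP P" "X = {pt. P (a pt)}" unfolding dec_def by blast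
 have "- X = {pt. \<not> P (a pt)}" unfolding a(3) by blast
 then show ?thesis unfolding dec_def using a(1) PP_not[OF a(2)] by blast
qed

lemma dec2: "a \<in> elem ==> b \<in> elem ==> PP (%x. P (sfst x) (ssnd x)) ==> dec {pt. P (a pt) (b pt)}"
 using decI[OF elem_pr, of a b "%x. P (sfst x) (ssnd x)"] by simp

text \<open>With a relation that ignores its string argument and a single dummy element,
  \<open>avoid\<close> adjoins just the set \<open>X\<close>. The new invariance index also covers
  the support of \<open>a\<close>.\<close>

lemma cond_extend:
 assumes "cond F" "dec X" "- X \<notin> F"
 shows "\<exists>G. cond G & F \<subseteq> G & X \<in> G"
proof -
 obtain a P where X: "a \<in> elem" "X = {pt. P (a pt)}" using assms(2) unfolding dec_def by blast
 obtain m where m: "\<forall>pt pt'. (\<forall>i < m. pt i = pt' i) --> a pt = a pt'" using elem_support[OF X(1)] by blast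
 obtain n where n: "invariant n F" using assms(1) unfolding cond_def by blast
 let ?G = "avoid F (%pt _. \<not> P (a pt)) {%_. []}"
 have "invariant (max m n) ?G"
 proof (rule avoid_invariant)
  show "invariant (max m n) F" by (rule invariant_mono[OF n]) simp
  show "(\<not> P (a pt)) = (\<not> P (a pt'))" if "\<forall>i < max m n. pt i = pt' i" for pt pt'
  proof -
   have "a pt = a pt'" using m that by (simp add: less_max_iff_disj)
   then show ?thesis by simp
  qed
 qed simp
 moreover have "{} \<notin> ?G"
 proof
  assume "{} \<in> ?G"
  then obtain Z T where Z: "Z \<in> F" "T \<subseteq> {%_. []}" "Z \<inter> {pt. \<forall>t \<in> T. \<not> \<not> P (a pt)} \<subseteq> {}" unfolding avoid_def by blast
  then have "Z \<subseteq> - X" unfolding X(2) by auto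
  then show False using cond_mono[OF assms(1) Z(1)] assms(3) by blast
 qed
 moreover have "X \<in> ?G" using avoid_filter(2)[OF assms(1), where t = "%_. []" and E = "{%_. []}" and A = "%pt _. \<not> P (a pt)"] X(2) by simp
 ultimately have "cond ?G" unfolding cond_def
  using avoid_filter[OF assms(1), where E = "{%_. []}" and A = "%pt _. \<not> P (a pt)"] cond_UNIV[OF assms(1)] by blast
 then show ?thesis using avoid_filter(1)[OF assms(1)] \<open>X \<in> ?G\<close> by blast
qed

lemma cond_decide:
 assumes "cond F" "dec X"
 obtains G where "cond G" "F \<subseteq> G" "X \<in> G \<or> - X \<in> G"
proof (cases "- X \<in> F")
 case True
 then show ?thesis using assms that by blast
next
 case False
 then show ?thesis using cond_extend[OF assms False] that by blast
qed

text \<open>Since \<open>\<chi>\<close> is decidable in polynomial time, finitely many candidates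
  are merged by definition by cases.\<close>

lemma elem_combine:
 assumes "finite T" "T \<subseteq> elem" "d \<in> elem" "PP (%x. \<chi> (sfst x) (ssnd x))"
 shows "\<exists>t \<in> elem. \<forall>pt. (\<exists>t' \<in> T. \<chi> (d pt) (t' pt)) --> \<chi> (d pt) (t pt)"
 using assms(1,2)
proof induction
 case empty
 then show ?case using elem_const by blast
next
 case (insert s T)
 then obtain t where t: "t \<in> elem" "\<forall>pt. (\<exists>t' \<in> T. \<chi> (d pt) (t' pt)) --> \<chi> (d pt) (t pt)" by blast
 have "PF (%x. if \<chi> (sfst x) (sfst (ssnd x)) then sfst (ssnd x) else ssnd (ssnd x))"
  using PP_comp[OF assms(4), of "%x. pr (sfst x) (sfst (ssnd x))"]
  by (intro PF_intros) (simp add: PF_intros Fn_fst Fn_snd)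
 moreover have "s \<in> elem" using insert.prems by blast
 ultimately have "(%pt. if \<chi> (sfst (pr (d pt) (pr (s pt) (t pt)))) (sfst (ssnd (pr (d pt) (pr (s pt) (t pt)))))
   then sfst (ssnd (pr (d pt) (pr (s pt) (t pt)))) else ssnd (ssnd (pr (d pt) (pr (s pt) (t pt))))) \<in> elem"
  by (rule elem_PF[OF _ elem_pr[OF assms(3) elem_pr[OF _ t(1)]]])
 then have 1: "(%pt. if \<chi> (d pt) (s pt) then s pt else t pt) \<in> elem" unfolding sfst_pr ssnd_pr .
 have 2: "\<forall>pt. (\<exists>t' \<in> insert s T. \<chi> (d pt) (t' pt)) --> \<chi> (d pt) (if \<chi> (d pt) (s pt) then s pt else t pt)"
 proof (intro allI impI)
  fix pt assume h: "\<exists>t' \<in> insert s T. \<chi> (d pt) (t' pt)"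
  show "\<chi> (d pt) (if \<chi> (d pt) (s pt) then s pt else t pt)"
  proof (cases "\<chi> (d pt) (s pt)")
   case False
   then have "\<exists>t' \<in> T. \<chi> (d pt) (t' pt)" using h by blast
   then show ?thesis using False t(2) by simp
  qed simp
 qed
 show ?case by (rule bexI[where x = "%pt. if \<chi> (d pt) (s pt) then s pt else t pt"]) (rule 2, rule 1)
qed

text \<open>Try to refute all candidate witnesses at once. If the resulting filter is improper,
  finitely many candidates suffice on a member of \<open>F\<close>, and \<open>elem_combine\<close>
  merges them into one element that succeeds there.\<close>

lemma cond_avoid:
 assumes "cond F" "d \<in> elem" "PP (%x. \<chi> (sfst x) (ssnd x))"
 obtains t where "t \<in> elem" "{pt. \<chi> (d pt) (t pt)} \<in> F"
 | G where "cond G" "F \<subseteq> G" "\<And>t. t \<in> elem ==> {pt. \<not> \<chi> (d pt) (t pt)} \<in> G"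
proof -
 obtain m where m: "\<forall>pt pt'. (\<forall>i < m. pt i = pt' i) --> d pt = d pt'" using elem_support[OF assms(2)] by blast
 obtain n where n: "invariant n F" using assms(1) unfolding cond_def by blast
 let ?A = "%pt. \<chi> (d pt)"
 let ?G = "avoid F ?A elem"
 have inv: "invariant (max m n) ?G"
 proof (rule avoid_invariant)
  show "invariant (max m n) F" by (rule invariant_mono[OF n]) simp
  show "\<chi> (d pt) y = \<chi> (d pt') y" if "\<forall>i < max m n. pt i = pt' i" for pt pt' y
  proof -
   have "d pt = d pt'" using m that by (simp add: less_max_iff_disj)
   then show ?thesis by simp
  qed
  show "(%pt. t (sg pt)) \<in> elem" if "t \<in> elem" "\<And>i. (%pt. sg pt i) \<in> elem" for t sg
   by (rule elem_subst[OF that])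
 qed
 note G = avoid_filter[OF assms(1), where A = ?A and E = elem]
 show ?thesis
 proof (cases "{} \<in> ?G")
  case True
  then obtain X T where X: "X \<in> F" "finite T" "T \<subseteq> elem" "X \<inter> {pt. \<forall>t \<in> T. \<not> \<chi> (d pt) (t pt)} \<subseteq> {}"
   unfolding avoid_def by blast
  obtain t where t: "t \<in> elem" "\<forall>pt. (\<exists>t' \<in> T. \<chi> (d pt) (t' pt)) --> \<chi> (d pt) (t pt)"
   using elem_combine[OF X(2,3) assms(2,3)] by blast
  have "X \<subseteq> {pt. \<chi> (d pt) (t pt)}" using X(4) t(2) by blast
  then show ?thesis using that(1)[OF t(1)] cond_mono[OF assms(1) X(1)] by blast
 next
  case False
  then have "cond ?G" unfolding cond_def using G inv cond_UNIV[OF assms(1)] by blast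
  then show ?thesis by (rule that(2)) (use G in blast)+
 qed
qed

text \<open>Herbrand saturation.\<close>

lemma saturation:
 assumes F: "cond F" and p: "p \<in> elem" and \<chi>: "PP (%x. \<chi> (sfst x) (sfst (ssnd x)) (ssnd (ssnd x)))"
  and ex: "\<And>x G. x \<in> elem ==> cond G ==> F \<subseteq> G ==>
   \<exists>H. cond H & G \<subseteq> H & (\<exists>y \<in> elem. {pt. \<chi> (p pt) (x pt) (y pt)} \<in> H)"
 shows "\<exists>h r. PF h & r \<in> elem & (\<forall>x \<in> elem. {pt. \<chi> (p pt) (x pt) (h (pr (x pt) (r pt)))} \<in> F)"
proof -
 obtain m where m: "\<forall>pt pt'. (\<forall>i < m. pt i = pt' i) --> p pt = p pt'" using elem_support[OF p] by blast
 obtain n where n: "invariant n F" using F unfolding cond_def by blast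
 \<comment> \<open>Coordinate \<open>k\<close> lies outside the support of \<open>p\<close> and
   beyond the invariance index of \<open>F\<close>. It serves as a generic argument.\<close>
 define k where "k = max m n"
 let ?d = "%pt :: point. pr (p pt) (pt k)"
 have d: "?d \<in> elem" by (rule elem_pr[OF p elem_coord])
 have "PP (%x. \<chi> (sfst (sfst x)) (ssnd (sfst x)) (ssnd x))"
  using PP_comp[OF \<chi>, of "%x. pr (sfst (sfst x)) (pr (ssnd (sfst x)) (ssnd x))"] by (simp add: PF_intros Fn_fst Fn_snd)
 then show ?thesis
 proof (rule cond_avoid[OF F d, of "%d y. \<chi> (sfst d) (ssnd d) y"])
  fix t assume t: "t \<in> elem" "{pt. \<chi> (sfst (?d pt)) (ssnd (?d pt)) (t pt)} \<in> F"
  obtain h r where h: "PF h" "r \<in> elem" "\<forall>pt s. t (fun_upd pt k s) = h (pr s (r pt))" using elem_abstract[OF t(1)] by blast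
  have "{pt. \<chi> (p pt) (x pt) (h (pr (x pt) (r pt)))} \<in> F" if x: "x \<in> elem" for x
  proof -
   \<comment> \<open>Since \<open>F\<close> is invariant under replacing coordinate \<open>k\<close>
     by an element, what it says about the generic argument carries over to every
     \<open>x\<close>.\<close>
   let ?sg = "%pt :: point. fun_upd pt k (x pt)"
   have "?sg -` {pt. \<chi> (sfst (?d pt)) (ssnd (?d pt)) (t pt)} \<in> F"
   proof (rule invariantD[OF n _ _ t(2)])
    show "(%pt. ?sg pt i) \<in> elem" for i using x elem_coord by (cases "i = k") auto
    show "?sg pt i = pt i" if "i < n" for pt i
    proof -
     have "i \<noteq> k" using that unfolding k_def by linarith
     then show ?thesis by simp
    qed
   qed
   moreover have "?sg -` {pt. \<chi> (sfst (?d pt)) (ssnd (?d pt)) (t pt)} = {pt. \<chi> (p pt) (x pt) (h (pr (x pt) (r pt)))}"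
   proof -
    have "p (?sg pt) = p pt" for pt
    proof (rule m[rule_format])
     fix i assume "i < m"
     then have "i \<noteq> k" unfolding k_def by linarith
     then show "?sg pt i = pt i" by simp
    qed
    moreover have "t (?sg pt) = h (pr (x pt) (r pt))" for pt using h(3) by blast
    ultimately show ?thesis unfolding vimage_def mem_Collect_eq sfst_pr ssnd_pr fun_upd_same by simp
   qed
   ultimately show ?thesis by simp
  qed
  then show ?thesis using h by blast
 next
  fix G assume G: "cond G" "F \<subseteq> G" "\<And>t. t \<in> elem ==> {pt. \<not> \<chi> (sfst (?d pt)) (ssnd (?d pt)) (t pt)} \<in> G"
  \<comment> \<open>Refuting all candidates contradicts \<open>ex\<close> at the generic argument
    itself.\<close>
  obtain H y where H: "cond H" "G \<subseteq> H" "y \<in> elem" "{pt. \<chi> (p pt) (pt k) (y pt)} \<in> H"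
   using ex[OF elem_coord G(1,2)] by blast
  have "{pt. \<not> \<chi> (p pt) (pt k) (y pt)} \<in> H" using G(3)[OF H(3)] H(2) by auto
  from cond_disjoint[OF H(1) this H(4)] show ?thesis by blast
 qed
qed

definition dense :: "point set set => (point set set => bool) => bool" where
 "dense F P \<longleftrightarrow> (\<forall>G. cond G & F \<subseteq> G --> (\<exists>H. cond H & G \<subseteq> H & P H))"

text \<open>Disjunction and existence are required only densely, as in the double negation
  translation; this makes the classical rule sound. Quantifiers range over \<open>elem\<close>, so
  the values are polynomial-time functions of the generic strings.\<close>

fun frc :: "point set set => (nat => point => nat) => fm => bool" where
 "frc F e (s \<^bold>= t) \<longleftrightarrow> {pt. eval (%i. e i pt) s = eval (%i. e i pt) t} \<in> F"
| "frc F e (s \<^bold>\<le> t) \<longleftrightarrow> {pt. eval (%i. e i pt) s \<le> eval (%i. e i pt) t} \<in> F"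
| "frc F e (\<^bold>\<not> \<phi>) \<longleftrightarrow> (\<forall>G. cond G & F \<subseteq> G --> \<not> frc G e \<phi>)"
| "frc F e (\<phi> \<^bold>\<and> \<psi>) \<longleftrightarrow> frc F e \<phi> & frc F e \<psi>"
| "frc F e (\<phi> \<^bold>\<or> \<psi>) \<longleftrightarrow> dense F (%H. frc H e \<phi> \<or> frc H e \<psi>)"
| "frc F e (\<phi> \<^bold>\<longrightarrow> \<psi>) \<longleftrightarrow> (\<forall>G. cond G & F \<subseteq> G --> frc G e \<phi> --> frc G e \<psi>)"
| "frc F e (All \<phi>) \<longleftrightarrow> (\<forall>x \<in> elem. frc F (case_nat (%pt. val (x pt)) e) \<phi>)"
| "frc F e (Ex \<phi>) \<longleftrightarrow> dense F (%H. \<exists>x \<in> elem. frc H (case_nat (%pt. val (x pt)) e) \<phi>)"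

text \<open>A whole assignment is packed into one element. Witnesses can then be treated as
  functions of a single argument, and binding a variable is pairing.\<close>

definition ea :: "(point => str) => nat => point => nat" where
 "ea a i pt = env (a pt) i"

lemma ea_pr: "case_nat (%pt. val (x pt)) (ea a) = ea (%pt. pr (x pt) (a pt))"
 by (auto simp: fun_eq_iff ea_def env_pr split: nat.splits)

lemma ea_norm: "ea (%pt. pr (bits (val (x pt))) (a pt)) = ea (%pt. pr (x pt) (a pt))"
 by (simp add: ea_pr[symmetric])

lemma ea_at: "(%i. ea a i pt) = env (a pt)"
 by (simp add: ea_def)

lemma dense_mono: "dense F P ==> F \<subseteq> G ==> dense G P"
 unfolding dense_def by (meson order_trans)

lemma frc_mono: "frc F e \<phi> ==> F \<subseteq> G ==> frc G e \<phi>"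
 by (induction \<phi> arbitrary: e) (auto intro: dense_mono order_trans)

lemma dense_dec:
 assumes "cond F" "dec X" "dense F (%H. X \<in> H)" shows "X \<in> F"
proof (rule ccontr)
 assume "X \<notin> F"
 then obtain G where G: "cond G" "F \<subseteq> G" "- X \<in> G" using cond_extend[OF assms(1) dec_Compl[OF assms(2)]] by auto
 then obtain H where H: "cond H" "G \<subseteq> H" "X \<in> H" using assms(3) unfolding dense_def by blast
 then show False using cond_disjoint[OF H(1,3), of "- X"] G(3) by blast
qed

lemma dec_sharply: "sharply_bounded \<phi> ==> a \<in> elem ==> dec {pt. sat (env (a pt)) \<phi>}"
 by (rule decI[of a "%l. sat (env l) \<phi>"]) (auto intro: PP_sharply)

text \<open>Conditions that force densely already force. The atomic cases hold because an atom
  defines a decidable set, whose complement could be adjoined if the set were missing from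
  \<open>F\<close>.\<close>

lemma frc_dense: "cond F ==> a \<in> elem ==> dense F (%H. frc H (ea a) \<phi>) ==> frc F (ea a) \<phi>"
proof (induction \<phi> arbitrary: F a)
 case (Eq s t)
 show ?case
  using dense_dec[OF Eq(1) dec_sharply[OF sharply_bounded.intros(1) Eq(2)], of s t] Eq(3) by (simp add: ea_at)
next
 case (Le s t)
 show ?case
  using dense_dec[OF Le(1) dec_sharply[OF sharply_bounded.intros(2) Le(2)], of s t] Le(3) by (simp add: ea_at)
next
 case (Neg \<phi>)
 show ?case unfolding frc.simps
 proof (intro allI impI notI)
  fix G assume G: "cond G & F \<subseteq> G" "frc G (ea a) \<phi>"
  then obtain H where "cond H" "G \<subseteq> H" "frc H (ea a) (\<^bold>\<not> \<phi>)" using Neg(4) unfolding dense_def by blast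
  then show False using frc_mono[OF G(2)] by auto
 qed
next
 case (And \<phi> \<psi>)
 have "dense F (%H. frc H (ea a) \<phi>)" "dense F (%H. frc H (ea a) \<psi>)" using And(5) unfolding dense_def by auto
 then show ?case using And by simp
next
 case (Or \<phi> \<psi>)
 show ?case unfolding frc.simps dense_def
 proof (intro allI impI)
  fix G assume "cond G & F \<subseteq> G"
  then obtain H where H: "cond H" "G \<subseteq> H" "frc H (ea a) (\<phi> \<^bold>\<or> \<psi>)" using Or(5) unfolding dense_def by blast
  then obtain H' where "cond H'" "H \<subseteq> H'" "frc H' (ea a) \<phi> \<or> frc H' (ea a) \<psi>" unfolding frc.simps dense_def by blast
  then show "\<exists>H. cond H & G \<subseteq> H & (frc H (ea a) \<phi> \<or> frc H (ea a) \<psi>)" using H(2) by blast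
 qed
next
 case (Imp \<phi> \<psi>)
 show ?case unfolding frc.simps
 proof (intro allI impI)
  fix G assume G: "cond G & F \<subseteq> G" "frc G (ea a) \<phi>"
  show "frc G (ea a) \<psi>"
  proof (rule Imp.IH(2))
   show "dense G (%H. frc H (ea a) \<psi>)" unfolding dense_def
   proof (intro allI impI)
    fix G' assume G': "cond G' & G \<subseteq> G'"
    then obtain H where H: "cond H" "G' \<subseteq> H" "frc H (ea a) (\<phi> \<^bold>\<longrightarrow> \<psi>)" using Imp(5) G(1) unfolding dense_def by blast
    then have "frc H (ea a) \<psi>" using frc_mono[OF G(2), of H] G' by auto
    then show "\<exists>H. cond H & G' \<subseteq> H & frc H (ea a) \<psi>" using H by blast
   qed
  qed (use G Imp in auto)
 qed
next
 case (All \<phi>)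
 show ?case unfolding frc.simps
 proof
  fix x assume x: "x \<in> elem"
  show "frc F (case_nat (%pt. val (x pt)) (ea a)) \<phi>" unfolding ea_pr
  proof (rule All.IH[OF All.prems(1) elem_pr[OF x All.prems(2)]])
   show "dense F (%H. frc H (ea (%pt. pr (x pt) (a pt))) \<phi>)"
    using All.prems(3) x unfolding dense_def frc.simps ea_pr by blast
  qed
 qed
next
 case (Ex \<phi>)
 show ?case unfolding frc.simps dense_def
 proof (intro allI impI)
  fix G assume "cond G & F \<subseteq> G"
  then obtain H where H: "cond H" "G \<subseteq> H" "frc H (ea a) (Ex \<phi>)" using Ex(4) unfolding dense_def by blast
  then obtain H' where "cond H'" "H \<subseteq> H'" "\<exists>x \<in> elem. frc H' (case_nat (%pt. val (x pt)) (ea a)) \<phi>"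
   unfolding frc.simps dense_def by blast
  then show "\<exists>H. cond H & G \<subseteq> H & (\<exists>x \<in> elem. frc H (case_nat (%pt. val (x pt)) (ea a)) \<phi>)" using H(2) by blast
 qed
qed

lemma case_nat_at: "(%i. case_nat x e i pt) = case_nat (x pt) (%i. e i pt)"
 by (auto simp: fun_eq_iff split: nat.splits)

lemma frc_subst: "frc F e (subst sg \<phi>) \<longleftrightarrow> frc F (%i pt. eval (%j. e j pt) (sg i)) \<phi>"
proof (induction \<phi> arbitrary: F e sg)
 have *: "(%i pt. eval (%j. case_nat x e j pt) (under_binder sg i)) = case_nat x (%i pt. eval (%j. e j pt) (sg i))" for x e sg
  by (auto simp: fun_eq_iff case_nat_at under_binder_def eval_subst split: nat.splits)
 {
  case (All \<phi>)
  show ?case by (simp add: All *)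
 next
  case (Ex \<phi>)
  show ?case by (simp add: Ex *)
 }
qed (simp_all add: eval_subst)

lemma ea_inst: "(%i pt. eval (%j. ea a j pt) (case_nat t Var i)) = ea (%pt. pr (bits (eval (env (a pt)) t)) (a pt))"
 by (auto simp: fun_eq_iff ea_at env_pr ea_def split: nat.splits)

lemma ea_lift': "(%i. ea (%pt. pr (x pt) (a pt)) (Suc i)) = ea a"
 by (auto simp: fun_eq_iff ea_def env_pr)

text \<open>Equality in the generic model is agreement on a member of the filter; this is the
  congruence behind rule \<open>EqSubst\<close>.\<close>

lemma frc_cong:
 assumes "cond F" "\<And>i. {pt. e i pt = e' i pt} \<in> F" "frc F e \<phi>" shows "frc F e' \<phi>"
proof -
 have ev: "{pt. eval (%i. e i pt) t = eval (%i. e' i pt) t} \<in> F" if "cond F" "\<And>i. {pt. e i pt = e' i pt} \<in> F" for F e e' t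
 proof (induction t)
  case (Add s t)
  show ?case by (rule cond_mono[OF that(1) cond_Int[OF that(1) Add]]) auto
 next
  case (Mul s t)
  show ?case by (rule cond_mono[OF that(1) cond_Int[OF that(1) Mul]]) auto
 next
  case (Smash s t)
  show ?case by (rule cond_mono[OF that(1) cond_Int[OF that(1) Smash]]) auto
 next
  case Zero
  show ?case using cond_UNIV[OF that(1)] by simp
 next
  case (Sc t)
  show ?case by (rule cond_mono[OF that(1) Sc]) auto
 next
  case (Len t)
  show ?case by (rule cond_mono[OF that(1) Len]) auto
 next
  case (Half t)
  show ?case by (rule cond_mono[OF that(1) Half]) auto
 qed (use that(2) in simp)
 have ext: "{pt. case_nat x e i pt = case_nat x e' i pt} \<in> F" if "cond F" "\<And>i. {pt. e i pt = e' i pt} \<in> F" for F x i and e e' :: "nat => point => nat"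
  using that(2) cond_UNIV[OF that(1)] by (cases i) auto
 have "frc F e \<phi> = frc F e' \<phi>" if "cond F" "\<And>i. {pt. e i pt = e' i pt} \<in> F" for F e e' \<phi>
  using that
 proof (induction \<phi> arbitrary: F e e')
  case (Eq s t)
  have i: "{pt. eval (%i. e i pt) s = eval (%i. e' i pt) s} \<inter> {pt. eval (%i. e i pt) t = eval (%i. e' i pt) t} \<in> F"
   by (rule cond_Int[OF Eq(1) ev[OF Eq] ev[OF Eq]])
  show ?case unfolding frc.simps
  proof
   assume "{pt. eval (%i. e i pt) s = eval (%i. e i pt) t} \<in> F"
   from cond_Int[OF Eq(1) i this] show "{pt. eval (%i. e' i pt) s = eval (%i. e' i pt) t} \<in> F"
    by (rule cond_mono[OF Eq(1)]) auto
  next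
   assume "{pt. eval (%i. e' i pt) s = eval (%i. e' i pt) t} \<in> F"
   from cond_Int[OF Eq(1) i this] show "{pt. eval (%i. e i pt) s = eval (%i. e i pt) t} \<in> F"
    by (rule cond_mono[OF Eq(1)]) auto
  qed
 next
  case (Le s t)
  have i: "{pt. eval (%i. e i pt) s = eval (%i. e' i pt) s} \<inter> {pt. eval (%i. e i pt) t = eval (%i. e' i pt) t} \<in> F"
   by (rule cond_Int[OF Le(1) ev[OF Le] ev[OF Le]])
  show ?case unfolding frc.simps
  proof
   assume "{pt. eval (%i. e i pt) s \<le> eval (%i. e i pt) t} \<in> F"
   from cond_Int[OF Le(1) i this] show "{pt. eval (%i. e' i pt) s \<le> eval (%i. e' i pt) t} \<in> F"
    by (rule cond_mono[OF Le(1)]) auto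
  next
   assume "{pt. eval (%i. e' i pt) s \<le> eval (%i. e' i pt) t} \<in> F"
   from cond_Int[OF Le(1) i this] show "{pt. eval (%i. e i pt) s \<le> eval (%i. e i pt) t} \<in> F"
    by (rule cond_mono[OF Le(1)]) auto
  qed
 next
  case (Neg \<phi>)
  have "frc G e \<phi> = frc G e' \<phi>" if "cond G & F \<subseteq> G" for G by (rule Neg.IH) (use that Neg.prems in blast)+
  then show ?case unfolding frc.simps by blast
 next
  case (And \<phi> \<psi>)
  show ?case using And.IH(1)[OF And.prems] And.IH(2)[OF And.prems] by simp
 next
  case (Or \<phi> \<psi>)
  have "frc G e \<phi> = frc G e' \<phi>" "frc G e \<psi> = frc G e' \<psi>" if "cond G & F \<subseteq> G" for G
   by (rule Or.IH; use that Or.prems in blast)+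
  then show ?case unfolding frc.simps dense_def by (metis order_trans)
 next
  case (Imp \<phi> \<psi>)
  have "frc G e \<phi> = frc G e' \<phi>" "frc G e \<psi> = frc G e' \<psi>" if "cond G & F \<subseteq> G" for G
   by (rule Imp.IH; use that Imp.prems in blast)+
  then show ?case unfolding frc.simps by blast
 next
  case (All \<phi>)
  have "frc F (case_nat x e) \<phi> = frc F (case_nat x e') \<phi>" for x
   by (rule All.IH[OF All.prems(1)]) (rule ext[OF All.prems])
  then show ?case by simp
 next
  case (Ex \<phi>)
  have "frc G (case_nat x e) \<phi> = frc G (case_nat x e') \<phi>" if "cond G & F \<subseteq> G" for G x
   by (rule Ex.IH) (use that in blast, rule ext, use that Ex.prems in blast, use that Ex.prems in blast)
  then show ?case unfolding frc.simps dense_def by (metis order_trans)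
 qed
 then show ?thesis using assms by blast
qed

text \<open>The theory is forced for all assignments. Lifting over a binder thus concerns only the
  hypotheses in \<open>\<Gamma>\<close>, just as in \<open>AllI\<close> and
  \<open>ExE\<close>.\<close>

lemma frc_sound:
 assumes "prov T \<Gamma> \<phi>" and T: "\<And>\<psi> F a. \<psi> \<in> T ==> cond F ==> a \<in> elem ==> frc F (ea a) \<psi>"
  and "cond F" "a \<in> elem" "\<And>\<psi>. \<psi> \<in> \<Gamma> ==> frc F (ea a) \<psi>"
 shows "frc F (ea a) \<phi>"
 using assms(1,3-5)
proof (induction arbitrary: F a rule: prov.induct)
 case (NegI \<phi> \<Gamma> \<psi>)
 show ?case unfolding frc.simps
 proof (intro allI impI notI)
  fix G assume G: "cond G & F \<subseteq> G" "frc G (ea a) \<phi>"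
  have pre: "frc G (ea a) \<chi>" if "\<chi> \<in> insert \<phi> \<Gamma>" for \<chi>
   using that G NegI.prems(3) frc_mono by blast
  have "frc G (ea a) \<psi>" "frc G (ea a) (\<^bold>\<not> \<psi>)" using NegI.IH G NegI.prems(2) pre by blast+
  then show False using G(1) by auto
 qed
next
 case (Classical \<phi> \<Gamma> \<psi>)
 show ?case
 proof (rule frc_dense[OF Classical.prems(1,2)], unfold dense_def, intro allI impI, rule ccontr)
  fix G assume G: "cond G & F \<subseteq> G" and n: "\<nexists>H. cond H & G \<subseteq> H & frc H (ea a) \<phi>"
  then have "frc G (ea a) (\<^bold>\<not> \<phi>)" by auto
  then have pre: "frc G (ea a) \<chi>" if "\<chi> \<in> insert (\<^bold>\<not> \<phi>) \<Gamma>" for \<chi>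
   using that G Classical.prems(3) frc_mono by blast
  have "frc G (ea a) \<psi>" "frc G (ea a) (\<^bold>\<not> \<psi>)" using Classical.IH G Classical.prems(2) pre by blast+
  then show False using G(1) by auto
 qed
next
 case (OrE \<Gamma> \<phi> \<psi> \<chi>)
 have o: "frc F (ea a) (\<phi> \<^bold>\<or> \<psi>)" using OrE by blast
 show ?case
 proof (rule frc_dense[OF OrE.prems(1,2)], unfold dense_def, intro allI impI)
  fix G assume G: "cond G & F \<subseteq> G"
  then obtain H where H: "cond H" "G \<subseteq> H" "frc H (ea a) \<phi> \<or> frc H (ea a) \<psi>" using o unfolding frc.simps dense_def by blast
  have "frc H (ea a) \<gamma>" if "\<gamma> \<in> \<Gamma>" for \<gamma> using OrE.prems(3)[OF that] frc_mono G H(2) by blast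
  then have "frc H (ea a) \<chi>" using H OrE.IH(2)[OF H(1) OrE.prems(2)] OrE.IH(3)[OF H(1) OrE.prems(2)] by blast
  then show "\<exists>H. cond H & G \<subseteq> H & frc H (ea a) \<chi>" using H by blast
 qed
next
 case (ImpI \<phi> \<Gamma> \<psi>)
 show ?case unfolding frc.simps
 proof (intro allI impI)
  fix G assume G: "cond G & F \<subseteq> G" "frc G (ea a) \<phi>"
  have pre: "frc G (ea a) \<chi>" if "\<chi> \<in> insert \<phi> \<Gamma>" for \<chi>
   using that G ImpI.prems(3) frc_mono by blast
  show "frc G (ea a) \<psi>" using ImpI.IH G ImpI.prems(2) pre by blast
 qed
next
 case (ImpE \<Gamma> \<phi> \<psi>)
 have "frc F (ea a) (\<phi> \<^bold>\<longrightarrow> \<psi>)" "frc F (ea a) \<phi>" using ImpE by blast+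
 then show ?case using ImpE.prems(1) by auto
next
 case (AndE1 \<Gamma> \<phi> \<psi>)
 have "frc F (ea a) (\<phi> \<^bold>\<and> \<psi>)" using AndE1 by blast
 then show ?case by simp
next
 case (AndE2 \<Gamma> \<phi> \<psi>)
 have "frc F (ea a) (\<phi> \<^bold>\<and> \<psi>)" using AndE2 by blast
 then show ?case by simp
next
 case (OrI1 \<Gamma> \<phi> \<psi>)
 have "frc F (ea a) \<phi>" using OrI1 by blast
 then show ?case unfolding frc.simps dense_def using frc_mono by blast
next
 case (OrI2 \<Gamma> \<psi> \<phi>)
 have "frc F (ea a) \<psi>" using OrI2 by blast
 then show ?case unfolding frc.simps dense_def using frc_mono by blast
next
 case (AllI \<Gamma> \<phi>)
 show ?case unfolding frc.simps ea_pr
 proof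
  fix x assume x: "x \<in> elem"
  show "frc F (ea (%pt. pr (x pt) (a pt))) \<phi>"
   by (rule AllI.IH[OF AllI.prems(1) elem_pr[OF x AllI.prems(2)]])
    (use AllI.prems(3) in \<open>auto simp: frc_subst ea_lift'\<close>)
 qed
next
 case (AllE \<Gamma> \<phi> t)
 have "frc F (ea a) (All \<phi>)" using AllE by blast
 then have all: "\<forall>x \<in> elem. frc F (case_nat (%pt. val (x pt)) (ea a)) \<phi>" by simp
 have e: "(%pt. bits (eval (env (a pt)) t)) \<in> elem"
  by (rule elem_PF[OF PF_eval[OF Fn_id] AllE.prems(2)])
 from bspec[OF all e] show ?case unfolding frc_subst ea_inst ea_pr .
next
 case (ExI \<Gamma> \<phi> t)
 have "frc F (ea a) (inst \<phi> t)" using ExI by blast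
 then have 1: "frc F (case_nat (%pt. val (bits (eval (env (a pt)) t))) (ea a)) \<phi>"
  unfolding frc_subst ea_inst ea_pr .
 have 2: "(%pt. bits (eval (env (a pt)) t)) \<in> elem"
  by (rule elem_PF[OF PF_eval[OF Fn_id] ExI.prems(2)])
 show ?case unfolding frc.simps dense_def
 proof (intro allI impI)
  fix G assume G: "cond G & F \<subseteq> G"
  then have "frc G (case_nat (%pt. val (bits (eval (env (a pt)) t))) (ea a)) \<phi>" using frc_mono[OF 1] by simp
  then show "\<exists>H. cond H & G \<subseteq> H & (\<exists>x \<in> elem. frc H (case_nat (%pt. val (x pt)) (ea a)) \<phi>)"
   using G 2 by (intro exI[of _ G] conjI bexI[where x = "%pt. bits (eval (env (a pt)) t)"]) simp_all
 qed
next
 case (ExE \<Gamma> \<phi> \<psi>)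
 have o: "frc F (ea a) (Ex \<phi>)" using ExE by blast
 show ?case
 proof (rule frc_dense[OF ExE.prems(1,2)], unfold dense_def, intro allI impI)
  fix G assume G: "cond G & F \<subseteq> G"
  then obtain H x where H: "cond H" "G \<subseteq> H" "x \<in> elem" "frc H (ea (%pt. pr (x pt) (a pt))) \<phi>"
   using o unfolding frc.simps dense_def ea_pr by blast
  have "frc H (ea (%pt. pr (x pt) (a pt))) (lift_fm \<psi>)"
  proof (rule ExE.IH(2)[OF H(1) elem_pr[OF H(3) ExE.prems(2)]])
   fix \<chi> assume "\<chi> \<in> insert \<phi> (lift_fm ` \<Gamma>)"
   then show "frc H (ea (%pt. pr (x pt) (a pt))) \<chi>"
    using H(4) ExE.prems(3) frc_mono[of F _ _ H] G H(2) by (auto simp: frc_subst ea_lift')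
  qed
  then show "\<exists>H. cond H & G \<subseteq> H & frc H (ea a) \<psi>" using H by (auto simp: frc_subst ea_lift')
 qed
next
 case (EqRefl \<Gamma> t)
 then show ?case using cond_UNIV by simp
next
 case (EqSubst \<Gamma> s t \<phi>)
 have 1: "frc F (ea a) (s \<^bold>= t)" "frc F (ea a) (inst \<phi> s)" using EqSubst by blast+
 show ?case unfolding frc_subst
 proof (rule frc_cong[OF EqSubst.prems(1) _ 1(2)[unfolded frc_subst]])
  fix i
  show "{pt. eval (%j. ea a j pt) (case_nat s Var i) = eval (%j. ea a j pt) (case_nat t Var i)} \<in> F"
   using 1(1) cond_UNIV[OF EqSubst.prems(1)] by (cases i) auto
 qed
qed (auto intro: T)

section \<open>Witnesses for \<open>\<Sigma>\<^sup>b\<^sub>1\<close> formulas\<close>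

lemma denseI: "(\<And>G. cond G ==> F \<subseteq> G ==> \<exists>H. cond H & G \<subseteq> H & P H) ==> dense F P"
 unfolding dense_def by blast

lemma denseE: "dense F P ==> cond G ==> F \<subseteq> G ==> (\<And>H. cond H ==> G \<subseteq> H ==> P H ==> thesis) ==> thesis"
 unfolding dense_def by blast

lemma frc_bound: "frc G (case_nat (%pt. val (x pt)) (ea a)) (Var 0 \<^bold>\<le> lift_trm t) \<longleftrightarrow>
  {pt. val (x pt) \<le> eval (env (a pt)) t} \<in> G"
 by (simp add: case_nat_at ea_at eval_subst)

lemma frc_bAll: "frc F (ea a) (bAll t \<phi>) \<longleftrightarrow> (\<forall>x \<in> elem. \<forall>G. cond G & F \<subseteq> G -->
  {pt. val (x pt) \<le> eval (env (a pt)) t} \<in> G --> frc G (ea (%pt. pr (x pt) (a pt))) \<phi>)"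
 by (simp only: bAll_def frc.simps(6,7) frc_bound) (simp only: ea_pr)

lemma frc_bEx: "frc F (ea a) (bEx t \<phi>) \<longleftrightarrow> dense F (%H. \<exists>x \<in> elem.
  {pt. val (x pt) \<le> eval (env (a pt)) t} \<in> H & frc H (ea (%pt. pr (x pt) (a pt))) \<phi>)"
 by (simp only: bEx_def frc.simps(4,8) frc_bound) (simp only: ea_pr)

text \<open>The search takes the least solution. Without a solution it returns 0, so the result
  respects the bound in every case.\<close>

lemma PF_search:
 assumes "PP (%x. P (sfst x) (ssnd x))" "PF f"
 shows "\<exists>g. PF g & (\<forall>l. val (g l) \<le> length (f l) & bits (val (g l)) = g l &
  ((\<exists>i \<le> length (f l). P l (bits i)) --> P l (g l)))"
proof -
 define Q where "Q l u = P l (bits (length u))" for l u :: str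
 have Q: "PP (%x. Q (sfst x) (ssnd x))"
  using PP_comp[OF assms(1), of "%x. pr (sfst x) (bits (length (ssnd x)))"] unfolding Q_def
  by (simp add: Fn_pair Fn_fst Fn_snd PF_count)
 define r where "r l = (if \<exists>i < length (False # f l). Q l (U i) then True # U (LEAST i. Q l (U i)) else [])" for l
 have "PF r" unfolding r_def by (rule PF_least[OF Q Fn_id]) (intro PF_intros assms(2))
 then have "PF (%l. bits (length (tl (r l))))" by (intro PF_count PF_tl)
 moreover have "length (tl (r l)) \<le> length (f l) & ((\<exists>i \<le> length (f l). P l (bits i)) --> P l (bits (length (tl (r l)))))" for l
 proof (cases "\<exists>i < length (False # f l). Q l (U i)")
  case True
  then obtain i where i: "i < length (False # f l)" "Q l (U i)" by blast
  have "(LEAST i. Q l (U i)) \<le> i" by (rule Least_le[of "%i. Q l (U i)", OF i(2)])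
  moreover have "Q l (U (LEAST i. Q l (U i)))" by (rule LeastI[of "%i. Q l (U i)", OF i(2)])
  moreover have "r l = True # U (LEAST i. Q l (U i))" unfolding r_def using True by (rule if_P)
  ultimately show ?thesis using i(1) by (simp add: Q_def)
 next
  case False
  then have "r l = []" unfolding r_def by (rule if_not_P)
  then have 1: "length (tl (r l)) \<le> length (f l)" by simp
  have "\<not> (\<exists>i \<le> length (f l). P l (bits i))" using False by (simp add: Q_def less_Suc_eq_le)
  with 1 show ?thesis by blast
 qed
 ultimately show ?thesis by (intro exI[of _ "%l. bits (length (tl (r l)))"]) simp
qed

lemma elem_search:
 assumes "PP (%x. P (sfst x) (ssnd x))" "PF f" "a \<in> elem"
 obtains x where "x \<in> elem" "\<And>pt. val (x pt) \<le> length (f (a pt))" "\<And>pt. bits (val (x pt)) = x pt"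
  "\<And>pt i. i \<le> length (f (a pt)) ==> P (a pt) (bits i) ==> P (a pt) (x pt)"
proof -
 obtain g where g: "PF g" "\<forall>l. val (g l) \<le> length (f l) & bits (val (g l)) = g l &
  ((\<exists>i \<le> length (f l). P l (bits i)) --> P l (g l))" using PF_search[OF assms(1,2)] by blast
 show ?thesis by (rule that[of "%pt. g (a pt)"]) (use g(2) elem_PF[OF g(1) assms(3)] in blast)+
qed

text \<open>Los's theorem for sharply bounded formulas.\<close>

lemma frc_sharply:
 "sharply_bounded \<phi> ==> cond F ==> a \<in> elem ==> frc F (ea a) \<phi> \<longleftrightarrow> {pt. sat (env (a pt)) \<phi>} \<in> F"
proof (induction arbitrary: F a rule: sharply_bounded.induct)
 case (1 s t)
 show ?case by (simp add: ea_at)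
next
 case (2 s t)
 show ?case by (simp add: ea_at)
next
 case (3 \<phi>)
 let ?X = "{pt. sat (env (a pt)) \<phi>}"
 have dec: "dec ?X" by (rule dec_sharply[OF 3(1) 3(4)])
 have eq: "{pt. sat (env (a pt)) (\<^bold>\<not> \<phi>)} = - ?X" by auto
 have IH: "frc G (ea a) \<phi> \<longleftrightarrow> ?X \<in> G" if "cond G" for G using 3(2)[OF that 3(4)] .
 show ?case unfolding eq frc.simps
 proof
  assume "\<forall>G. cond G & F \<subseteq> G --> \<not> frc G (ea a) \<phi>"
  then show "- ?X \<in> F" using cond_extend[OF 3(3) dec] IH by blast
 next
  assume X: "- ?X \<in> F"
  show "\<forall>G. cond G & F \<subseteq> G --> \<not> frc G (ea a) \<phi>"
  proof (intro allI impI notI)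
   fix G assume G: "cond G & F \<subseteq> G" "frc G (ea a) \<phi>"
   then have "?X \<in> G" "- ?X \<in> G" using IH X by blast+
   then show False using cond_disjoint[of G ?X "- ?X"] G by blast
  qed
 qed
next
 case (4 \<phi> \<psi>)
 let ?X = "{pt. sat (env (a pt)) \<phi>}" and ?Y = "{pt. sat (env (a pt)) \<psi>}"
 have eq: "{pt. sat (env (a pt)) (\<phi> \<^bold>\<and> \<psi>)} = ?X \<inter> ?Y" by auto
 have "?X \<in> F & ?Y \<in> F \<longleftrightarrow> ?X \<inter> ?Y \<in> F" using cond_Int[OF 4(5)] cond_mono[OF 4(5)] by blast
 then show ?case unfolding eq frc.simps using 4(3)[OF 4(5,6)] 4(4)[OF 4(5,6)] by blast
next
 case (5 \<phi> \<psi>)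
 let ?X = "{pt. sat (env (a pt)) \<phi>}" and ?Y = "{pt. sat (env (a pt)) \<psi>}"
 have eq: "{pt. sat (env (a pt)) (\<phi> \<^bold>\<or> \<psi>)} = ?X \<union> ?Y" by auto
 have IH: "frc G (ea a) \<phi> \<longleftrightarrow> ?X \<in> G" "frc G (ea a) \<psi> \<longleftrightarrow> ?Y \<in> G" if "cond G" for G
  using 5(3)[OF that 5(6)] 5(4)[OF that 5(6)] .
 have decu: "dec (?X \<union> ?Y)" unfolding eq[symmetric] by (rule dec_sharply[OF _ 5(6)]) (intro sharply_bounded.intros 5)
 show ?case unfolding eq frc.simps
 proof
  assume d: "dense F (%H. frc H (ea a) \<phi> \<or> frc H (ea a) \<psi>)"
  show "?X \<union> ?Y \<in> F"
  proof (rule dense_dec[OF 5(5) decu], rule denseI)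
   fix G assume "cond G" "F \<subseteq> G"
   with d obtain H where H: "cond H" "G \<subseteq> H" "frc H (ea a) \<phi> \<or> frc H (ea a) \<psi>" by (rule denseE)
   then have "?X \<in> H \<or> ?Y \<in> H" using IH by blast
   then have "?X \<union> ?Y \<in> H" using cond_mono[OF H(1)] by blast
   then show "\<exists>H. cond H & G \<subseteq> H & ?X \<union> ?Y \<in> H" using H by blast
  qed
 next
  assume X: "?X \<union> ?Y \<in> F"
  show "dense F (%H. frc H (ea a) \<phi> \<or> frc H (ea a) \<psi>)"
  proof (rule denseI)
   fix G assume G: "cond G" "F \<subseteq> G"
   obtain H where H: "cond H" "G \<subseteq> H" "?X \<in> H \<or> - ?X \<in> H"
    by (rule cond_decide[OF G(1) dec_sharply[OF 5(1) 5(6)]])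
   have "?X \<in> H \<or> ?Y \<in> H"
   proof (rule disjE[OF H(3)])
    assume "- ?X \<in> H"
    then have "- ?X \<inter> (?X \<union> ?Y) \<in> H" using X G H cond_Int[OF H(1)] by blast
    then show ?thesis using cond_mono[OF H(1), of "- ?X \<inter> (?X \<union> ?Y)" ?Y] by blast
   qed blast
   then show "\<exists>H. cond H & G \<subseteq> H & (frc H (ea a) \<phi> \<or> frc H (ea a) \<psi>)" using H IH by blast
  qed
 qed
next
 case (6 \<phi> \<psi>)
 let ?X = "{pt. sat (env (a pt)) \<phi>}" and ?Y = "{pt. sat (env (a pt)) \<psi>}"
 have eq: "{pt. sat (env (a pt)) (\<phi> \<^bold>\<longrightarrow> \<psi>)} = - ?X \<union> ?Y" by auto
 have IH: "frc G (ea a) \<phi> \<longleftrightarrow> ?X \<in> G" "frc G (ea a) \<psi> \<longleftrightarrow> ?Y \<in> G" if "cond G" for G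
  using 6(3)[OF that 6(6)] 6(4)[OF that 6(6)] .
 have decu: "dec (- ?X \<union> ?Y)" unfolding eq[symmetric] by (rule dec_sharply[OF _ 6(6)]) (intro sharply_bounded.intros 6)
 show ?case unfolding eq frc.simps
 proof
  assume d: "\<forall>G. cond G & F \<subseteq> G --> frc G (ea a) \<phi> --> frc G (ea a) \<psi>"
  show "- ?X \<union> ?Y \<in> F"
  proof (rule dense_dec[OF 6(5) decu], rule denseI)
   fix G assume G: "cond G" "F \<subseteq> G"
   obtain H where H: "cond H" "G \<subseteq> H" "?X \<in> H \<or> - ?X \<in> H"
    by (rule cond_decide[OF G(1) dec_sharply[OF 6(1) 6(6)]])
   then have "?Y \<in> H \<or> - ?X \<in> H" using d IH G by blast
   then have "- ?X \<union> ?Y \<in> H" using cond_mono[OF H(1)] by blast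
   then show "\<exists>H. cond H & G \<subseteq> H & - ?X \<union> ?Y \<in> H" using H by blast
  qed
 next
  assume X: "- ?X \<union> ?Y \<in> F"
  show "\<forall>G. cond G & F \<subseteq> G --> frc G (ea a) \<phi> --> frc G (ea a) \<psi>"
  proof (intro allI impI)
   fix G assume G: "cond G & F \<subseteq> G" "frc G (ea a) \<phi>"
   then have "?X \<inter> (- ?X \<union> ?Y) \<in> G" using X IH cond_Int by blast
   then have "?Y \<in> G" using cond_mono[of G "?X \<inter> (- ?X \<union> ?Y)" ?Y] G by blast
   then show "frc G (ea a) \<psi>" using IH G by blast
  qed
 qed
next
 case (7 \<phi> t)
 let ?f = "%l. bits (eval (env l) t)"
 have len: "length (?f l) = floorlog 2 (eval (env l) t)" for l by (rule length_bits)
 have P: "PP (%x. \<not> sat (env (pr (ssnd x) (sfst x))) \<phi>)"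
  by (intro PP_not PP_comp[OF PP_sharply[OF 7(1)]] Fn_pair Fn_fst Fn_snd)
 have IH: "frc G (ea (%pt. pr (x pt) (a pt))) \<phi> \<longleftrightarrow> {pt. sat (env (pr (x pt) (a pt))) \<phi>} \<in> G"
  if "cond G" "x \<in> elem" for G x by (rule 7(2)[OF that(1) elem_pr[OF that(2) 7(4)]])
 have eq: "{pt. sat (env (a pt)) (bAll (Len t) \<phi>)} = {pt. \<forall>n \<le> floorlog 2 (eval (env (a pt)) t). sat (case_nat n (env (a pt))) \<phi>}"
  by simp
 show ?case unfolding eq
 proof
  assume f: "frc F (ea a) (bAll (Len t) \<phi>)"
  \<comment> \<open>\<open>x\<close> is a counterexample at every point that has one, so the
    instance at this single element decides the universal statement.\<close>
  obtain x where x: "x \<in> elem" "\<And>pt. val (x pt) \<le> length (?f (a pt))"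
    "\<And>pt i. i \<le> length (?f (a pt)) ==> \<not> sat (env (pr (bits i) (a pt))) \<phi> ==> \<not> sat (env (pr (x pt) (a pt))) \<phi>"
   by (rule elem_search[where P = "%l i. \<not> sat (env (pr i l)) \<phi>", OF P PF_eval[OF Fn_id, of t] 7(4)]) blast
  have U: "{pt. val (x pt) \<le> eval (env (a pt)) (Len t)} = UNIV" using x(2) by (auto simp: len)
  have "{pt. val (x pt) \<le> eval (env (a pt)) (Len t)} \<in> F" unfolding U by (rule cond_UNIV[OF 7(3)])
  then have "frc F (ea (%pt. pr (x pt) (a pt))) \<phi>"
   using f[unfolded frc_bAll] x(1) 7(3) by blast
  then have "{pt. sat (env (pr (x pt) (a pt))) \<phi>} \<in> F" using IH[OF 7(3) x(1)] by blast
  then show "{pt. \<forall>n \<le> floorlog 2 (eval (env (a pt)) t). sat (case_nat n (env (a pt))) \<phi>} \<in> F"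
  proof (rule cond_mono[OF 7(3)], intro subsetI CollectI allI impI)
   fix pt n assume "pt \<in> {pt. sat (env (pr (x pt) (a pt))) \<phi>}" and n: "n \<le> floorlog 2 (eval (env (a pt)) t)"
   then have "sat (env (pr (bits n) (a pt))) \<phi>" using x(3)[of n pt] unfolding len by blast
   then show "sat (case_nat n (env (a pt))) \<phi>" unfolding env_pr val_bits .
  qed
 next
  assume X: "{pt. \<forall>n \<le> floorlog 2 (eval (env (a pt)) t). sat (case_nat n (env (a pt))) \<phi>} \<in> F" (is "?X \<in> F")
  show "frc F (ea a) (bAll (Len t) \<phi>)" unfolding frc_bAll
  proof (intro ballI allI impI)
   fix x G assume x: "x \<in> elem" and G: "cond G & F \<subseteq> G" and b: "{pt. val (x pt) \<le> eval (env (a pt)) (Len t)} \<in> G"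
   have "?X \<inter> {pt. val (x pt) \<le> eval (env (a pt)) (Len t)} \<in> G" using cond_Int X G b by blast
   then have "{pt. sat (env (pr (x pt) (a pt))) \<phi>} \<in> G"
    by (rule cond_mono[OF conjunct1[OF G]]) (auto simp: env_pr)
   then show "frc G (ea (%pt. pr (x pt) (a pt))) \<phi>" using IH x G by blast
  qed
 qed
next
 case (8 \<phi> t)
 let ?f = "%l. bits (eval (env l) t)"
 have len: "length (?f l) = floorlog 2 (eval (env l) t)" for l by (rule length_bits)
 have P: "PP (%x. sat (env (pr (ssnd x) (sfst x))) \<phi>)"
  by (intro PP_comp[OF PP_sharply[OF 8(1)]] Fn_pair Fn_fst Fn_snd)
 have IH: "frc G (ea (%pt. pr (x pt) (a pt))) \<phi> \<longleftrightarrow> {pt. sat (env (pr (x pt) (a pt))) \<phi>} \<in> G"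
  if "cond G" "x \<in> elem" for G x by (rule 8(2)[OF that(1) elem_pr[OF that(2) 8(4)]])
 have eq: "{pt. sat (env (a pt)) (bEx (Len t) \<phi>)} = {pt. \<exists>n \<le> floorlog 2 (eval (env (a pt)) t). sat (case_nat n (env (a pt))) \<phi>}" (is "_ = ?X")
  by simp
 have decX: "dec ?X" unfolding eq[symmetric] by (rule dec_sharply[OF _ 8(4)]) (intro sharply_bounded.intros 8)
 show ?case unfolding eq frc_bEx
 proof
  assume d: "dense F (%H. \<exists>x \<in> elem. {pt. val (x pt) \<le> eval (env (a pt)) (Len t)} \<in> H &
    frc H (ea (%pt. pr (x pt) (a pt))) \<phi>)"
  show "?X \<in> F"
  proof (rule dense_dec[OF 8(3) decX], rule denseI)
   fix G assume "cond G" "F \<subseteq> G"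
   with d obtain H where H: "cond H" "G \<subseteq> H" "\<exists>x \<in> elem. {pt. val (x pt) \<le> eval (env (a pt)) (Len t)} \<in> H &
    frc H (ea (%pt. pr (x pt) (a pt))) \<phi>" by (rule denseE)
   then obtain x where x: "x \<in> elem" "{pt. val (x pt) \<le> eval (env (a pt)) (Len t)} \<in> H"
     "{pt. sat (env (pr (x pt) (a pt))) \<phi>} \<in> H" using IH by blast
   have "?X \<in> H" by (rule cond_mono[OF H(1) cond_Int[OF H(1) x(2,3)]]) (auto simp: env_pr)
   then show "\<exists>H. cond H & G \<subseteq> H & ?X \<in> H" using H by blast
  qed
 next
  assume X: "?X \<in> F"
  obtain x where x: "x \<in> elem" "\<And>pt. val (x pt) \<le> length (?f (a pt))"
    "\<And>pt i. i \<le> length (?f (a pt)) ==> sat (env (pr (bits i) (a pt))) \<phi> ==> sat (env (pr (x pt) (a pt))) \<phi>"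
   by (rule elem_search[where P = "%l i. sat (env (pr i l)) \<phi>", OF P PF_eval[OF Fn_id, of t] 8(4)]) blast
  have U: "{pt. val (x pt) \<le> eval (env (a pt)) (Len t)} = UNIV" using x(2) by (auto simp: len)
  have sub: "?X \<subseteq> {pt. sat (env (pr (x pt) (a pt))) \<phi>}"
  proof (intro subsetI CollectI)
   fix pt assume "pt \<in> ?X"
   then obtain n where n: "n \<le> floorlog 2 (eval (env (a pt)) t)" "sat (case_nat n (env (a pt))) \<phi>" by blast
   then have "sat (env (pr (bits n) (a pt))) \<phi>" unfolding env_pr val_bits by blast
   then show "sat (env (pr (x pt) (a pt))) \<phi>" using x(3)[of n pt] n(1) unfolding len by blast
  qed
  show "dense F (%H. \<exists>x \<in> elem. {pt. val (x pt) \<le> eval (env (a pt)) (Len t)} \<in> H &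
    frc H (ea (%pt. pr (x pt) (a pt))) \<phi>)"
  proof (rule denseI)
   fix G assume G: "cond G" "F \<subseteq> G"
   have "{pt. sat (env (pr (x pt) (a pt))) \<phi>} \<in> G" using cond_mono[OF G(1) _ sub] X G(2) by blast
   then have "frc G (ea (%pt. pr (x pt) (a pt))) \<phi>" using IH[OF G(1) x(1)] by blast
   moreover have "{pt. val (x pt) \<le> eval (env (a pt)) (Len t)} \<in> G" unfolding U by (rule cond_UNIV[OF G(1)])
   ultimately show "\<exists>H. cond H & G \<subseteq> H & (\<exists>x \<in> elem. {pt. val (x pt) \<le> eval (env (a pt)) (Len t)} \<in> H &
    frc H (ea (%pt. pr (x pt) (a pt))) \<phi>)" using G x(1) by blast
  qed
 qed
qed

text \<open>The same relation \<open>R\<close> describes truth in the standard model and forcing.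
  That link allows a witness found generically to be read at an actual input.\<close>

definition wit :: "(str => str => bool) => nat => fm => bool" where
 "wit R C \<phi> \<longleftrightarrow> PP (%x. R (sfst x) (ssnd x)) & (\<forall>l w. R l w --> length w \<le> (length l + C) ^ C) &
  (\<forall>l. sat (env l) \<phi> \<longleftrightarrow> (\<exists>w. R l w)) &
  (\<forall>F a. cond F --> a \<in> elem -->
    (frc F (ea a) \<phi> \<longleftrightarrow> dense F (%H. \<exists>w \<in> elem. {pt. R (a pt) (w pt)} \<in> H)))"

definition SW :: "fm => bool" where
 "SW \<phi> \<longleftrightarrow> (\<exists>R C. wit R C \<phi>)"

lemma witD:
 assumes "wit R C \<phi>"
 shows "PP (%x. R (sfst x) (ssnd x))" "R l w ==> length w \<le> (length l + C) ^ C"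
  "sat (env l) \<phi> \<longleftrightarrow> (\<exists>w. R l w)"
  "cond F ==> a \<in> elem ==> frc F (ea a) \<phi> \<longleftrightarrow> dense F (%H. \<exists>w \<in> elem. {pt. R (a pt) (w pt)} \<in> H)"
 using assms unfolding wit_def by blast+

lemma SWI:
 assumes "PP (%x. R (sfst x) (ssnd x))" "pb (%x. B x) length" "\<And>l w. R l w ==> length w \<le> B l"
  "\<And>l. sat (env l) \<phi> \<longleftrightarrow> (\<exists>w. R l w)"
  "\<And>F a. cond F ==> a \<in> elem ==> frc F (ea a) \<phi> ==> \<exists>H. cond H & F \<subseteq> H & (\<exists>w \<in> elem. {pt. R (a pt) (w pt)} \<in> H)"
  "\<And>F a w. cond F ==> a \<in> elem ==> w \<in> elem ==> {pt. R (a pt) (w pt)} \<in> F ==> frc F (ea a) \<phi>"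
 shows "SW \<phi>"
proof -
 obtain C where C: "\<And>x. B x \<le> (length x + C) ^ C" using assms(2) unfolding pb_def by blast
 have "wit R C \<phi>" unfolding wit_def
 proof (intro conjI allI impI)
  show "PP (%x. R (sfst x) (ssnd x))" by (rule assms(1))
  show "length w \<le> (length l + C) ^ C" if "R l w" for l w using assms(3)[OF that] C[of l] by linarith
  show "sat (env l) \<phi> \<longleftrightarrow> (\<exists>w. R l w)" for l by (rule assms(4))
  fix F a assume F: "cond F" and a: "a \<in> elem"
  show "frc F (ea a) \<phi> \<longleftrightarrow> dense F (%H. \<exists>w \<in> elem. {pt. R (a pt) (w pt)} \<in> H)"
  proof
   assume f: "frc F (ea a) \<phi>"
   show "dense F (%H. \<exists>w \<in> elem. {pt. R (a pt) (w pt)} \<in> H)"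
    by (rule denseI) (rule assms(5)[OF _ a frc_mono[OF f]])
  next
   assume d: "dense F (%H. \<exists>w \<in> elem. {pt. R (a pt) (w pt)} \<in> H)"
   show "frc F (ea a) \<phi>"
   proof (rule frc_dense[OF F a], rule denseI)
    fix G assume "cond G" "F \<subseteq> G"
    with d obtain H where H: "cond H" "G \<subseteq> H" "\<exists>w \<in> elem. {pt. R (a pt) (w pt)} \<in> H" by (rule denseE)
    then have "frc H (ea a) \<phi>" using assms(6)[OF H(1) a] by blast
    then show "\<exists>H. cond H & G \<subseteq> H & frc H (ea a) \<phi>" using H by blast
   qed
  qed
 qed
 then show ?thesis unfolding SW_def by blast
qed

lemma wit_frc:
 assumes "wit R C \<phi>" "cond F" "a \<in> elem"
 shows "frc F (ea a) \<phi> ==> \<exists>H w. cond H & F \<subseteq> H & w \<in> elem & {pt. R (a pt) (w pt)} \<in> H"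
  "w \<in> elem ==> {pt. R (a pt) (w pt)} \<in> F ==> frc F (ea a) \<phi>"
proof -
 show "\<exists>H w. cond H & F \<subseteq> H & w \<in> elem & {pt. R (a pt) (w pt)} \<in> H" if "frc F (ea a) \<phi>"
  using that assms(2) unfolding witD(4)[OF assms] dense_def by blast
 show "frc F (ea a) \<phi>" if "w \<in> elem" "{pt. R (a pt) (w pt)} \<in> F"
  using that unfolding witD(4)[OF assms] dense_def by blast
qed

lemma SW_equiv:
 assumes "SW \<phi>" "\<And>e. sat e \<phi> = sat e \<psi>" "\<And>F a. cond F ==> a \<in> elem ==> frc F (ea a) \<phi> = frc F (ea a) \<psi>"
 shows "SW \<psi>"
proof -
 obtain R C where "wit R C \<phi>" using assms(1) unfolding SW_def by blast
 then have "wit R C \<psi>" unfolding wit_def using assms(2,3) by simp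
 then show ?thesis unfolding SW_def by blast
qed

lemma SW_sharply: assumes "sharply_bounded \<phi>" shows "SW \<phi>"
proof (rule SWI[where R = "%l w. sat (env l) \<phi> & w = []" and B = "%_. 0"])
 show "PP (%x. sat (env (sfst x)) \<phi> & ssnd x = [])"
  by (intro PP_conj PP_comp[OF PP_sharply[OF assms]] PP_eq_Nil Fn_fst Fn_snd)
next
 fix F a assume F: "cond F" "a \<in> elem" "frc F (ea a) \<phi>"
 then have "{pt. sat (env (a pt)) \<phi> & [] = []} \<in> F" using frc_sharply[OF assms F(1,2)] by simp
 then show "\<exists>H. cond H & F \<subseteq> H & (\<exists>w \<in> elem. {pt. sat (env (a pt)) \<phi> & w pt = []} \<in> H)"
  using F(1) by (intro exI[of _ F] conjI bexI[where x = "%_. []"] elem_const) simp_all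
next
 fix F a w assume F: "cond F" "a \<in> elem" "{pt. sat (env (a pt)) \<phi> & w pt = []} \<in> F"
 have "{pt. sat (env (a pt)) \<phi>} \<in> F" by (rule cond_mono[OF F(1,3)]) blast
 then show "frc F (ea a) \<phi>" using frc_sharply[OF assms F(1,2)] by blast
qed (auto intro: pb_const)

lemma PP_sub: "PP (%x. R (sfst x) (ssnd x)) ==> PF f ==> PF g ==> PP (%x. R (f x) (g x))"
 using PP_comp[OF _ Fn_pair, of "%x. R (sfst x) (ssnd x)" f g] by simp

lemma SW_And: assumes "SW \<phi>" "SW \<psi>" shows "SW (\<phi> \<^bold>\<and> \<psi>)"
proof -
 obtain R C where R: "wit R C \<phi>" using assms(1) unfolding SW_def by blast
 obtain S D where S: "wit S D \<psi>" using assms(2) unfolding SW_def by blast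
 let ?Q = "%l w. R l (sfst w) & S l (ssnd w) & w = pr (sfst w) (ssnd w)"
 show ?thesis
 proof (rule SWI[where R = ?Q and B = "%l. 2 * (length l + C) ^ C + (length l + D) ^ D + 1"])
  show "PP (%x. R (sfst x) (sfst (ssnd x)) & S (sfst x) (ssnd (ssnd x)) & ssnd x = pr (sfst (ssnd x)) (ssnd (ssnd x)))"
   by (intro PP_conj PP_sub[OF witD(1)[OF R]] PP_sub[OF witD(1)[OF S]] PP_eq PF_intros Fn_fst Fn_snd)
  show "pb (%l :: str. 2 * (length l + C) ^ C + (length l + D) ^ D + 1) length" by (intro pb_intros)
  show "length w \<le> 2 * (length l + C) ^ C + (length l + D) ^ D + 1" if "?Q l w" for l w
  proof -
   have "length w = 2 * length (sfst w) + length (ssnd w) + 1" using that length_pr by metis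
   then show ?thesis using witD(2)[OF R, of l "sfst w"] witD(2)[OF S, of l "ssnd w"] that by linarith
  qed
  show "sat (env l) (\<phi> \<^bold>\<and> \<psi>) \<longleftrightarrow> (\<exists>w. ?Q l w)" for l
  proof
   assume "sat (env l) (\<phi> \<^bold>\<and> \<psi>)"
   then obtain u v where "R l u" "S l v" using witD(3)[OF R] witD(3)[OF S] by auto
   then have "?Q l (pr u v)" by simp
   then show "\<exists>w. ?Q l w" by blast
  next
   assume "\<exists>w. ?Q l w"
   then show "sat (env l) (\<phi> \<^bold>\<and> \<psi>)" using witD(3)[OF R] witD(3)[OF S] by auto
  qed
 next
  fix F a assume F: "cond F" "a \<in> elem" "frc F (ea a) (\<phi> \<^bold>\<and> \<psi>)"
  then obtain H u where H: "cond H" "F \<subseteq> H" "u \<in> elem" "{pt. R (a pt) (u pt)} \<in> H"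
   using wit_frc(1)[OF R F(1,2)] by auto
  have "frc H (ea a) \<psi>" using F(3) frc_mono H(2) by auto
  then obtain K v where K: "cond K" "H \<subseteq> K" "v \<in> elem" "{pt. S (a pt) (v pt)} \<in> K"
   using wit_frc(1)[OF S H(1) F(2)] by blast
  have "{pt. R (a pt) (u pt)} \<inter> {pt. S (a pt) (v pt)} \<in> K" using cond_Int[OF K(1)] H(4) K by blast
  then have "{pt. ?Q (a pt) (pr (u pt) (v pt))} \<in> K" by (rule cond_mono[OF K(1)]) auto
  then show "\<exists>H. cond H & F \<subseteq> H & (\<exists>w \<in> elem. {pt. ?Q (a pt) (w pt)} \<in> H)"
   using K H elem_pr[OF H(3) K(3)] by (intro exI[of _ K] conjI bexI[where x = "%pt. pr (u pt) (v pt)"]) auto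
 next
  fix F a w assume F: "cond F" "a \<in> elem" "w \<in> elem" "{pt. ?Q (a pt) (w pt)} \<in> F"
  have "{pt. R (a pt) (sfst (w pt))} \<in> F" "{pt. S (a pt) (ssnd (w pt))} \<in> F"
   by (rule cond_mono[OF F(1,4)], blast)+
  then show "frc F (ea a) (\<phi> \<^bold>\<and> \<psi>)"
   using wit_frc(2)[OF R F(1,2) elem_sfst[OF F(3)]] wit_frc(2)[OF S F(1,2) elem_ssnd[OF F(3)]] by simp
 qed
qed

lemma SW_Or: assumes "SW \<phi>" "SW \<psi>" shows "SW (\<phi> \<^bold>\<or> \<psi>)"
proof -
 obtain R C where R: "wit R C \<phi>" using assms(1) unfolding SW_def by blast
 obtain S D where S: "wit S D \<psi>" using assms(2) unfolding SW_def by blast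
 let ?Q = "%l w. w \<noteq> [] & (if w \<noteq> [] & hd w then R l (tl w) else S l (tl w))"
 have Q: "?Q l (True # u) \<longleftrightarrow> R l u" "?Q l (False # u) \<longleftrightarrow> S l u" for l u by simp_all
 show ?thesis
 proof (rule SWI[where R = ?Q and B = "%l. (length l + C) ^ C + (length l + D) ^ D + 1"])
  show "PP (%x. ssnd x \<noteq> [] & (if ssnd x \<noteq> [] & hd (ssnd x) then R (sfst x) (tl (ssnd x)) else S (sfst x) (tl (ssnd x))))"
   by (intro PP_conj PP_if PP_sub[OF witD(1)[OF R]] PP_sub[OF witD(1)[OF S]] PP_neq_Nil PP_hd PF_intros Fn_fst Fn_snd)
  show "pb (%l :: str. (length l + C) ^ C + (length l + D) ^ D + 1) length" by (intro pb_intros)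
  show "length w \<le> (length l + C) ^ C + (length l + D) ^ D + 1" if "?Q l w" for l w
  proof -
   have "length (tl w) \<le> (length l + C) ^ C \<or> length (tl w) \<le> (length l + D) ^ D"
    using witD(2)[OF R, of l "tl w"] witD(2)[OF S, of l "tl w"] that by (auto split: if_splits)
   then show ?thesis by (cases w) auto
  qed
  show "sat (env l) (\<phi> \<^bold>\<or> \<psi>) \<longleftrightarrow> (\<exists>w. ?Q l w)" for l
  proof
   assume "sat (env l) (\<phi> \<^bold>\<or> \<psi>)"
   then have "(\<exists>u. R l u) \<or> (\<exists>u. S l u)" using witD(3)[OF R] witD(3)[OF S] by auto
   then show "\<exists>w. ?Q l w" using Q by blast
  next
   assume "\<exists>w. ?Q l w"
   then have "(\<exists>u. R l u) \<or> (\<exists>u. S l u)" by (auto split: if_splits)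
   then show "sat (env l) (\<phi> \<^bold>\<or> \<psi>)" using witD(3)[OF R] witD(3)[OF S] by auto
  qed
 next
  fix F a assume F: "cond F" "a \<in> elem" "frc F (ea a) (\<phi> \<^bold>\<or> \<psi>)"
  obtain G where G: "cond G" "F \<subseteq> G" "frc G (ea a) \<phi> \<or> frc G (ea a) \<psi>"
   using F(1,3) unfolding frc.simps dense_def by blast
  from G(3) show "\<exists>H. cond H & F \<subseteq> H & (\<exists>w \<in> elem. {pt. ?Q (a pt) (w pt)} \<in> H)"
  proof
   assume "frc G (ea a) \<phi>"
   then obtain H u where H: "cond H" "G \<subseteq> H" "u \<in> elem" "{pt. R (a pt) (u pt)} \<in> H"
    using wit_frc(1)[OF R G(1) F(2)] by blast
   have "{pt. ?Q (a pt) (True # u pt)} \<in> H" unfolding Q by (rule H(4))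
   then show ?thesis
    by (intro exI[of _ H] conjI bexI[where x = "%pt. True # u pt"] H(1) order_trans[OF G(2) H(2)] elem_PF[OF Fn_cons H(3)])
  next
   assume "frc G (ea a) \<psi>"
   then obtain H u where H: "cond H" "G \<subseteq> H" "u \<in> elem" "{pt. S (a pt) (u pt)} \<in> H"
    using wit_frc(1)[OF S G(1) F(2)] by blast
   have "{pt. ?Q (a pt) (False # u pt)} \<in> H" unfolding Q by (rule H(4))
   then show ?thesis
    by (intro exI[of _ H] conjI bexI[where x = "%pt. False # u pt"] H(1) order_trans[OF G(2) H(2)] elem_PF[OF Fn_cons H(3)])
  qed
 next
  fix F a w assume F: "cond F" "a \<in> elem" "w \<in> elem" "{pt. ?Q (a pt) (w pt)} \<in> F"
  have tl: "(%pt. tl (w pt)) \<in> elem" by (rule elem_PF[OF Fn_tl F(3)])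
  let ?X = "{pt. w pt \<noteq> [] & hd (w pt)}"
  show "frc F (ea a) (\<phi> \<^bold>\<or> \<psi>)" unfolding frc.simps
  proof (rule denseI)
   fix G assume G: "cond G" "F \<subseteq> G"
   \<comment> \<open>The tag of \<open>w\<close> may vary from point to point; a stronger condition
     decides which disjunct it selects.\<close>
   obtain H where H: "cond H" "G \<subseteq> H" "?X \<in> H \<or> - ?X \<in> H"
    by (rule cond_decide[OF G(1) decI[OF F(3) PP_hd[OF Fn_id]]])
   have QH: "{pt. ?Q (a pt) (w pt)} \<in> H" using F(4) G(2) H(2) by blast
   from H(3) have "frc H (ea a) \<phi> \<or> frc H (ea a) \<psi>"
   proof
    assume "?X \<in> H"
    then have "{pt. R (a pt) (tl (w pt))} \<in> H"
     by (rule cond_mono[OF H(1) cond_Int[OF H(1) QH]]) auto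
    then show ?thesis using wit_frc(2)[OF R H(1) F(2) tl] by blast
   next
    assume "- ?X \<in> H"
    then have "{pt. S (a pt) (tl (w pt))} \<in> H"
     by (rule cond_mono[OF H(1) cond_Int[OF H(1) QH]]) auto
    then show ?thesis using wit_frc(2)[OF S H(1) F(2) tl] by blast
   qed
   then show "\<exists>H. cond H & G \<subseteq> H & (frc H (ea a) \<phi> \<or> frc H (ea a) \<psi>)" using H by blast
  qed
 qed
qed

text \<open>A witness consists of the value of the variable and a witness for the body. The value is
  required in canonical form, since leading zeros would make witnesses arbitrarily long.\<close>

lemma SW_bEx: assumes "SW \<phi>" shows "SW (bEx t \<phi>)"
proof -
 obtain R C where R: "wit R C \<phi>" using assms unfolding SW_def by blast
 let ?Q = "%l w. val (sfst w) \<le> val (bits (eval (env l) t)) & sfst w = bits (val (sfst w)) & w = pr (sfst w) (ssnd w) &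
   R (pr (sfst w) l) (ssnd w)"
 let ?L = "%l. length (bits (eval (env l) t))"
 have Q: "?Q l (pr (bits n) v) \<longleftrightarrow> n \<le> eval (env l) t & R (pr (bits n) l) v" for l n v by simp
 show ?thesis
 proof (rule SWI[where R = ?Q and B = "%l. 2 * ?L l + (2 * ?L l + length l + 1 + C) ^ C + 1"])
  show "PP (%x. val (sfst (ssnd x)) \<le> val (bits (eval (env (sfst x)) t)) & sfst (ssnd x) = bits (val (sfst (ssnd x))) &
    ssnd x = pr (sfst (ssnd x)) (ssnd (ssnd x)) & R (pr (sfst (ssnd x)) (sfst x)) (ssnd (ssnd x)))"
   by (intro PP_conj PP_sub[OF witD(1)[OF R]] PP_le PP_eq PF_norm PF_eval PF_intros Fn_fst Fn_snd)
  show "pb (%l. 2 * ?L l + (2 * ?L l + length l + 1 + C) ^ C + 1) length"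
   by (intro pb_intros PF_bound PF_eval Fn_id)
  show "length w \<le> 2 * ?L l + (2 * ?L l + length l + 1 + C) ^ C + 1" if q: "?Q l w" for l w
  proof -
   have w: "length w = 2 * length (sfst w) + length (ssnd w) + 1" using q length_pr by metis
   have "length (bits (val (sfst w))) \<le> ?L l" unfolding length_bits using q by (intro floorlog_mono) simp
   then have s: "length (sfst w) \<le> ?L l" using q by metis
   have "length (ssnd w) \<le> (length (pr (sfst w) l) + C) ^ C" using witD(2)[OF R] q by blast
   also have "\<dots> \<le> (2 * ?L l + length l + 1 + C) ^ C" using s by (intro power_mono) auto
   finally show ?thesis using w s by linarith
  qed
  show "sat (env l) (bEx t \<phi>) \<longleftrightarrow> (\<exists>w. ?Q l w)" for l
  proof
   assume "sat (env l) (bEx t \<phi>)"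
   then obtain n where n: "n \<le> eval (env l) t" "sat (env (pr (bits n) l)) \<phi>" by (auto simp: env_pr)
   then obtain v where "R (pr (bits n) l) v" using witD(3)[OF R] by blast
   then show "\<exists>w. ?Q l w" using n(1) Q by blast
  next
   assume "\<exists>w. ?Q l w"
   then obtain w where q: "?Q l w" by blast
   then have "sat (env (pr (sfst w) l)) \<phi>" using witD(3)[OF R] by blast
   then show "sat (env l) (bEx t \<phi>)" using q by (auto simp: env_pr)
  qed
 next
  fix F a assume F: "cond F" "a \<in> elem" "frc F (ea a) (bEx t \<phi>)"
  obtain G x where G: "cond G" "F \<subseteq> G" "x \<in> elem" "{pt. val (x pt) \<le> eval (env (a pt)) t} \<in> G"
    "frc G (ea (%pt. pr (x pt) (a pt))) \<phi>"
   using F(1,3) unfolding frc_bEx dense_def by blast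
  let ?x = "%pt. bits (val (x pt))"
  have e: "(%pt. pr (?x pt) (a pt)) \<in> elem" by (intro elem_pr elem_norm G F)
  have "frc G (ea (%pt. pr (?x pt) (a pt))) \<phi>" using G(5) unfolding ea_norm .
  then obtain H v where H: "cond H" "G \<subseteq> H" "v \<in> elem" "{pt. R (pr (?x pt) (a pt)) (v pt)} \<in> H"
   using wit_frc(1)[OF R G(1) e] by blast
  have "{pt. val (x pt) \<le> eval (env (a pt)) t} \<in> H" using G(4) H(2) by blast
  from cond_Int[OF H(1) this H(4)] have "{pt. ?Q (a pt) (pr (?x pt) (v pt))} \<in> H" unfolding Q
   by (rule cond_mono[OF H(1)]) auto
  then show "\<exists>H. cond H & F \<subseteq> H & (\<exists>w \<in> elem. {pt. ?Q (a pt) (w pt)} \<in> H)"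
   by (intro exI[of _ H] conjI bexI[where x = "%pt. pr (?x pt) (v pt)"] H(1) order_trans[OF G(2) H(2)]
    elem_pr[OF elem_norm[OF G(3)] H(3)])
 next
  fix F a w assume F: "cond F" "a \<in> elem" "w \<in> elem" "{pt. ?Q (a pt) (w pt)} \<in> F"
  have 1: "{pt. val (sfst (w pt)) \<le> eval (env (a pt)) t} \<in> F" by (rule cond_mono[OF F(1,4)]) auto
  have 2: "{pt. R (pr (sfst (w pt)) (a pt)) (ssnd (w pt))} \<in> F" by (rule cond_mono[OF F(1,4)]) blast
  have f: "frc F (ea (%pt. pr (sfst (w pt)) (a pt))) \<phi>"
   by (rule wit_frc(2)[OF R F(1) elem_pr[OF elem_sfst[OF F(3)] F(2)] elem_ssnd[OF F(3)] 2])
  show "frc F (ea a) (bEx t \<phi>)" unfolding frc_bEx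
  proof (rule denseI)
   fix G assume G: "cond G" "F \<subseteq> G"
   show "\<exists>H. cond H & G \<subseteq> H & (\<exists>x \<in> elem. {pt. val (x pt) \<le> eval (env (a pt)) t} \<in> H &
     frc H (ea (%pt. pr (x pt) (a pt))) \<phi>)"
    using G(2) 1 by (intro exI[of _ G] conjI bexI[where x = "%pt. sfst (w pt)"] G(1) order_refl frc_mono[OF f G(2)] elem_sfst[OF F(3)]) blast
  qed
 qed
qed

lemma floorlog_self: "floorlog 2 i \<le> i"
 using less_floorlog[of i i] less_exp[of i] by blast

text \<open>Passing from binary to unary is exponential in general. A string \<open>g x\<close> of
  sufficient length makes it a bounded search.\<close>

lemma PF_unary:
 assumes "PF f" "PF g"
 shows "\<exists>u. PF u & (\<forall>x. val (f x) \<le> length (g x) --> u x = U (val (f x)))"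
proof -
 let ?r = "%x. if \<exists>i < length (False # g x). val (bits (length (U i))) = val (f x)
  then True # U (LEAST i. val (bits (length (U i))) = val (f x)) else []"
 have "PF ?r"
  by (rule PF_least[where P = "%x u. val (bits (length u)) = val (f x)" and a = "%x. x" and b = "%x. False # g x"])
   (intro PP_val_eq PF_count PF_comp[OF assms(1)] PF_comp[OF assms(2)] PF_intros Fn_fst Fn_snd)+
 then have "PF (%x. tl (?r x))" by (rule PF_tl)
 moreover have "tl (?r x) = U (val (f x))" if h: "val (f x) \<le> length (g x)" for x
 proof -
  have "\<exists>i < length (False # g x). val (bits (length (U i))) = val (f x)"
   using h by (intro exI[of _ "val (f x)"]) simp
  moreover have "(LEAST i. val (bits (length (U i))) = val (f x)) = val (f x)"
   by (rule Least_equality) simp_all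
  ultimately show ?thesis by (simp only: if_True list.sel)
 qed
 ultimately show ?thesis by (intro exI[of _ "%x. tl (?r x)"]) blast
qed

definition item :: "str => str => str" where
 "item w u = sfst ((ssnd ^^ length u) w)"

lemma PF_itemf: "PF f ==> PF g ==> PF (%x. item (f x) (g x))"
 unfolding item_def by (intro PF_sfst PF_item)

lemma item_lst: "i < length xs ==> item (lst xs) (U i) = xs ! i"
 by (simp add: item_def sfst_lst)

lemma length_lst_le: "(\<And>x. x \<in> set xs ==> length x \<le> M) ==> length (lst xs) \<le> length xs * (2 * M + 1)"
proof (induction xs)
 case (Cons x xs)
 have "length x \<le> M" "length (lst xs) \<le> length xs * (2 * M + 1)" using Cons by simp_all
 then show ?case by simp
qed simp

text \<open>This is the collection principle: a witness is the list of the witnesses for all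
  instances. Under forcing the instances are first witnessed one by one, and
  \<open>saturation\<close> supplies one function that yields them uniformly.\<close>

lemma SW_bAll_Len: assumes "SW \<phi>" shows "SW (bAll (Len t) \<phi>)"
proof -
 obtain R C where R: "wit R C \<phi>" using assms unfolding SW_def by blast
 \<comment> \<open>The extra symbol accounts for the inclusive bound:
   \<open>i \<le> floorlog 2 v\<close> admits \<open>floorlog 2 v + 1\<close> values.\<close>
 define f where "f l = False # bits (eval (env l) t)" for l
 have f: "PF f" unfolding f_def by (intro PF_cons PF_eval Fn_id)
 have len: "length (f l) = Suc (floorlog 2 (eval (env l) t))" for l by (simp add: f_def length_bits)
 define RR where "RR p u = R (pr (bits (length u)) (sfst p)) (item (ssnd p) u)" for p u
 define Q where "Q l w \<longleftrightarrow> w = lst (map (%i. item w (U i)) [0..<length (f l)]) & (\<forall>i < length (f l). RR (pr l w) (U i))" for l w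
 have RR: "PP (%x. RR (sfst x) (ssnd x))" unfolding RR_def
  by (intro PP_sub[OF witD(1)[OF R]] PF_itemf PF_count PF_intros Fn_fst Fn_snd)
 have Rlen: "length v \<le> (2 * length (f l) + length l + 1 + C) ^ C" if "R (pr (bits i) l) v" "i < length (f l)" for l i v
 proof -
  have "length (bits i) \<le> length (f l)" using floorlog_self[of i] that(2) by (simp add: length_bits)
  then have "(length (pr (bits i) l) + C) ^ C \<le> (2 * length (f l) + length l + 1 + C) ^ C" by (intro power_mono) auto
  then show ?thesis using witD(2)[OF R that(1)] by linarith
 qed
 have QI: "Q l (lst (map g [0..<length (f l)]))" if "\<And>i. i < length (f l) ==> R (pr (bits i) l) (g i)" for l g
 proof -
  have it: "item (lst (map g [0..<length (f l)])) (U i) = g i" if "i < length (f l)" for i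
   using that by (simp add: item_lst)
  have m: "map (%i. item (lst (map g [0..<length (f l)])) (U i)) [0..<length (f l)] = map g [0..<length (f l)]"
   by (intro map_cong) (simp_all add: it)
  have "\<forall>i < length (f l). R (pr (bits i) l) (item (lst (map g [0..<length (f l)])) (U i))"
   using it that by simp
  then show ?thesis unfolding Q_def RR_def m by (simp only: sfst_pr ssnd_pr length_replicate simp_thms)
 qed
 have QD: "R (pr (bits i) l) (item w (U i))" if "Q l w" "i < length (f l)" for l w i
  using that unfolding Q_def RR_def by simp
 have sat: "sat (env l) (bAll (Len t) \<phi>) \<longleftrightarrow> (\<forall>i < length (f l). sat (env (pr (bits i) l)) \<phi>)" for l
  by (auto simp: len env_pr less_Suc_eq_le)
 show ?thesis
 proof (rule SWI[where R = Q and B = "%l. length (f l) * (2 * (2 * length (f l) + length l + 1 + C) ^ C + 1)"])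
  show "PP (%x. Q (sfst x) (ssnd x))" unfolding Q_def
   by (intro PP_conj PP_eq PF_collect PP_ball_less RR PF_itemf PF_comp[OF f] PF_intros Fn_fst Fn_snd)
  show "pb (%l. length (f l) * (2 * (2 * length (f l) + length l + 1 + C) ^ C + 1)) length"
   by (intro pb_intros PF_bound f)
  show "length w \<le> length (f l) * (2 * (2 * length (f l) + length l + 1 + C) ^ C + 1)" if q: "Q l w" for l w
  proof -
   have "length (lst (map (%i. item w (U i)) [0..<length (f l)])) \<le> length (map (%i. item w (U i)) [0..<length (f l)]) * (2 * (2 * length (f l) + length l + 1 + C) ^ C + 1)"
    proof (rule length_lst_le)
     fix y assume "y \<in> set (map (%i. item w (U i)) [0..<length (f l)])"
     then obtain i where i: "i < length (f l)" "y = item w (U i)" by auto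
     show "length y \<le> (2 * length (f l) + length l + 1 + C) ^ C" unfolding i(2) by (rule Rlen[OF QD[OF q i(1)] i(1)])
    qed
   moreover have "w = lst (map (%i. item w (U i)) [0..<length (f l)])" using q unfolding Q_def by blast
   ultimately show ?thesis by simp
  qed
  show "sat (env l) (bAll (Len t) \<phi>) \<longleftrightarrow> (\<exists>w. Q l w)" for l
  proof
   assume "sat (env l) (bAll (Len t) \<phi>)"
   then have "\<forall>i. \<exists>v. i < length (f l) --> R (pr (bits i) l) v" unfolding sat witD(3)[OF R] by blast
   then obtain g where "\<forall>i. i < length (f l) --> R (pr (bits i) l) (g i)" by metis
   then have "Q l (lst (map g [0..<length (f l)]))" by (intro QI) blast
   then show "\<exists>w. Q l w" by blast
  next
   assume "\<exists>w. Q l w"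
   then show "sat (env l) (bAll (Len t) \<phi>)" unfolding sat witD(3)[OF R] using QD by blast
  qed
 next
  fix F a assume F: "cond F" "a \<in> elem" "frc F (ea a) (bAll (Len t) \<phi>)"
  \<comment> \<open>The guard makes the statement witnessable for every \<open>x\<close>, as
    \<open>saturation\<close> requires; out of range \<open>[]\<close> serves as witness.\<close>
  define \<chi> where "\<chi> l x y \<longleftrightarrow> (val x \<le> val (bits (floorlog 2 (val (bits (eval (env l) t))))) --> R (pr (bits (val x)) l) y)" for l x y
  have \<chi>: "\<chi> l x y \<longleftrightarrow> (val x < length (f l) --> R (pr (bits (val x)) l) y)" for l x y
   unfolding \<chi>_def len by (simp add: less_Suc_eq_le)
  have PX: "PP (%x. val (ssnd x) \<le> val (bits (floorlog 2 (val (bits (eval (env (sfst x)) t))))))"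
   by (intro PP_le PF_len PF_eval Fn_fst Fn_snd)
  have P\<chi>: "PP (%x. \<chi> (sfst x) (sfst (ssnd x)) (ssnd (ssnd x)))" unfolding \<chi>_def
   by (intro PP_imp PP_le PP_sub[OF witD(1)[OF R]] PF_norm PF_len PF_eval PF_intros Fn_fst Fn_snd)
  have "\<exists>H. cond H & G \<subseteq> H & (\<exists>y \<in> elem. {pt. \<chi> (a pt) (x pt) (y pt)} \<in> H)"
   if x: "x \<in> elem" and G: "cond G" "F \<subseteq> G" for x G
  proof -
   let ?X = "{pt. val (x pt) \<le> val (bits (floorlog 2 (val (bits (eval (env (a pt)) t)))))}"
   obtain K where K: "cond K" "G \<subseteq> K" "?X \<in> K \<or> - ?X \<in> K"
    by (rule cond_decide[OF G(1) dec2[OF F(2) x PX]])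
   from K(3) show ?thesis
   proof
    assume X: "?X \<in> K"
    have "{pt. val (x pt) \<le> eval (env (a pt)) (Len t)} \<in> K" using X by simp
    then have "frc K (ea (%pt. pr (x pt) (a pt))) \<phi>" using F(3)[unfolded frc_bAll] x K(1,2) G(2) by blast
    then have "frc K (ea (%pt. pr (bits (val (x pt))) (a pt))) \<phi>" unfolding ea_norm .
    then obtain H y where H: "cond H" "K \<subseteq> H" "y \<in> elem" "{pt. R (pr (bits (val (x pt))) (a pt)) (y pt)} \<in> H"
     using wit_frc(1)[OF R K(1) elem_pr[OF elem_norm[OF x] F(2)]] by blast
    have "{pt. \<chi> (a pt) (x pt) (y pt)} \<in> H" by (rule cond_mono[OF H(1,4)]) (auto simp: \<chi>_def)
    then show ?thesis using H K(2) by (meson order_trans)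
   next
    assume X: "- ?X \<in> K"
    have "{pt. \<chi> (a pt) (x pt) []} \<in> K" by (rule cond_mono[OF K(1) X]) (auto simp: \<chi>_def)
    then show ?thesis using K by (intro exI[of _ K] conjI bexI[where x = "%_. []"] elem_const)
   qed
  qed
  from saturation[OF F(1,2) P\<chi> this] obtain h r where h: "PF h" "r \<in> elem"
   "\<forall>x \<in> elem. {pt. \<chi> (a pt) (x pt) (h (pr (x pt) (r pt)))} \<in> F" by blast
  \<comment> \<open>\<open>saturation\<close> speaks of each element separately, while the list
    needs all indices on one member of \<open>F\<close>. Choosing for \<open>x\<close> an index
    where \<open>h\<close> fails, if any, reduces this to a single instance.\<close>
  define B where "B c i \<longleftrightarrow> \<not> R (pr i (sfst c)) (h (pr i (ssnd c)))" for c i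
  have PB: "PP (%x. B (sfst x) (ssnd x))" unfolding B_def
   by (intro PP_not PP_sub[OF witD(1)[OF R]] PF_comp[OF h(1)] PF_intros Fn_fst Fn_snd)
  obtain x where x: "x \<in> elem" "\<And>pt. val (x pt) \<le> length (tl (f (sfst (pr (a pt) (r pt)))))"
   "\<And>pt. bits (val (x pt)) = x pt"
   "\<And>pt i. i \<le> length (tl (f (sfst (pr (a pt) (r pt))))) ==> B (pr (a pt) (r pt)) (bits i) ==> B (pr (a pt) (r pt)) (x pt)"
   by (rule elem_search[OF PB PF_tl[OF PF_comp[OF f Fn_fst]] elem_pr[OF F(2) h(2)]]) blast
  let ?w = "%pt. lst (map (%i. h (pr (bits i) (r pt))) [0..<length (f (a pt))])"
  have "PF (%z. lst (map (%i. h (pr (bits (length (U i))) (ssnd z))) [0..<length (f (sfst z))]))"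
   by (rule PF_collect[where f = "%l u. h (pr (bits (length u)) l)"]) (intro PF_comp[OF h(1)] PF_comp[OF f] Fn_pair PF_count Fn_fst Fn_snd)+
  from elem_PF[OF this elem_pr[OF F(2) h(2)]] have w: "?w \<in> elem" by simp
  have "{pt. Q (a pt) (?w pt)} \<in> F"
  proof (rule cond_mono[OF F(1) h(3)[rule_format, OF x(1)]], intro subsetI CollectI QI)
   fix pt i assume "pt \<in> {pt. \<chi> (a pt) (x pt) (h (pr (x pt) (r pt)))}" and i: "i < length (f (a pt))"
   then have "\<not> B (pr (a pt) (r pt)) (x pt)" using x(2)[of pt] x(3)[of pt] by (simp add: \<chi> B_def len)
   then have "\<not> B (pr (a pt) (r pt)) (bits i)" using x(4)[of i pt] i by (auto simp: len)
   then show "R (pr (bits i) (a pt)) (h (pr (bits i) (r pt)))" by (simp add: B_def)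
  qed
  then show "\<exists>H. cond H & F \<subseteq> H & (\<exists>w \<in> elem. {pt. Q (a pt) (w pt)} \<in> H)"
   by (intro exI[of _ F] conjI bexI[where x = ?w] F(1) order_refl w)
 next
  fix F a w assume F: "cond F" "a \<in> elem" "w \<in> elem" "{pt. Q (a pt) (w pt)} \<in> F"
  obtain u where u: "PF u" "\<forall>z. val (sfst z) \<le> length (f (ssnd z)) --> u z = U (val (sfst z))"
   using PF_unary[OF Fn_fst PF_comp[OF f Fn_snd]] by blast
  show "frc F (ea a) (bAll (Len t) \<phi>)" unfolding frc_bAll
  proof (intro ballI allI impI)
   fix x G assume x: "x \<in> elem" and G: "cond G & F \<subseteq> G" and b: "{pt. val (x pt) \<le> eval (env (a pt)) (Len t)} \<in> G"
   let ?v = "%pt. item (w pt) (u (pr (x pt) (a pt)))"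
   have ux: "(%pt. u (pr (x pt) (a pt))) \<in> elem" by (rule elem_PF[OF u(1) elem_pr[OF x F(2)]])
   have v: "?v \<in> elem" by (rule elem_PF2[OF _ F(3) ux]) (intro PF_itemf Fn_fst Fn_snd)
   have "{pt. Q (a pt) (w pt)} \<inter> {pt. val (x pt) \<le> eval (env (a pt)) (Len t)} \<in> G"
    using cond_Int[OF conjunct1[OF G] _ b] F(4) G by blast
   then have "{pt. R (pr (bits (val (x pt))) (a pt)) (?v pt)} \<in> G"
   proof (rule cond_mono[OF conjunct1[OF G]], intro subsetI CollectI)
    fix pt assume o: "pt \<in> {pt. Q (a pt) (w pt)} \<inter> {pt. val (x pt) \<le> eval (env (a pt)) (Len t)}"
    then have l: "val (x pt) < length (f (a pt))" by (simp add: len less_Suc_eq_le)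
    then have "u (pr (x pt) (a pt)) = U (val (x pt))" using u(2) by simp
    then show "R (pr (bits (val (x pt))) (a pt)) (?v pt)" using QD[of "a pt" "w pt", OF _ l] o by simp
   qed
   then have "frc G (ea (%pt. pr (bits (val (x pt))) (a pt))) \<phi>"
    by (rule wit_frc(2)[OF R conjunct1[OF G] elem_pr[OF elem_norm[OF x] F(2)] v])
   then show "frc G (ea (%pt. pr (x pt) (a pt))) \<phi>" unfolding ea_norm .
  qed
 qed
qed

lemma frc_Neg_extend:
 assumes "cond F" "a \<in> elem" "\<not> frc F (ea a) \<phi>"
 obtains G where "cond G" "F \<subseteq> G" "frc G (ea a) (\<^bold>\<not> \<phi>)"
proof -
 have "\<not> dense F (%H. frc H (ea a) \<phi>)" using frc_dense[OF assms(1,2)] assms(3) by blast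
 then obtain G where G: "cond G" "F \<subseteq> G" "\<And>H. cond H ==> G \<subseteq> H ==> \<not> frc H (ea a) \<phi>"
  unfolding dense_def by blast
 then have "frc G (ea a) (\<^bold>\<not> \<phi>)" unfolding frc.simps by blast
 with G(1,2) show ?thesis by (rule that)
qed

text \<open>This and the next five lemmas are forced dualities. They reduce implications and negated
  Pi^b_1 formulas to conjunctions, disjunctions and bounded quantifiers.\<close>

lemma frc_Neg_Neg: assumes "cond F" "a \<in> elem" shows "frc F (ea a) \<phi> = frc F (ea a) (\<^bold>\<not> (\<^bold>\<not> \<phi>))"
proof
 assume "frc F (ea a) \<phi>"
 then show "frc F (ea a) (\<^bold>\<not> (\<^bold>\<not> \<phi>))" unfolding frc.simps using frc_mono by blast
next
 assume n: "frc F (ea a) (\<^bold>\<not> (\<^bold>\<not> \<phi>))"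
 show "frc F (ea a) \<phi>"
 proof (rule ccontr)
  assume "\<not> frc F (ea a) \<phi>"
  then obtain G where "cond G" "F \<subseteq> G" "frc G (ea a) (\<^bold>\<not> \<phi>)" by (rule frc_Neg_extend[OF assms])
  then show False using n unfolding frc.simps(3)[of F _ "\<^bold>\<not> \<phi>"] by blast
 qed
qed

lemma frc_Imp_Or: assumes "cond F" "a \<in> elem" shows "frc F (ea a) (\<^bold>\<not> \<phi> \<^bold>\<or> \<psi>) = frc F (ea a) (\<phi> \<^bold>\<longrightarrow> \<psi>)"
proof
 assume l: "frc F (ea a) (\<^bold>\<not> \<phi> \<^bold>\<or> \<psi>)"
 show "frc F (ea a) (\<phi> \<^bold>\<longrightarrow> \<psi>)" unfolding frc.simps(6)
 proof (intro allI impI)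
  fix G assume G: "cond G & F \<subseteq> G" "frc G (ea a) \<phi>"
  show "frc G (ea a) \<psi>"
  proof (rule frc_dense[OF conjunct1[OF G(1)] assms(2)], rule denseI)
   fix K assume K: "cond K" "G \<subseteq> K"
   have FK: "F \<subseteq> K" using G K by blast
   obtain H where H: "cond H" "K \<subseteq> H" "frc H (ea a) (\<^bold>\<not> \<phi>) \<or> frc H (ea a) \<psi>"
    by (rule denseE[OF l[unfolded frc.simps(5)] K(1) FK])
   have "frc H (ea a) \<phi>" using frc_mono[OF G(2)] K H by blast
   then have "\<not> frc H (ea a) (\<^bold>\<not> \<phi>)" unfolding frc.simps using H(1) by blast
   then show "\<exists>H. cond H & K \<subseteq> H & frc H (ea a) \<psi>" using H by blast
  qed
 qed
next
 assume r: "frc F (ea a) (\<phi> \<^bold>\<longrightarrow> \<psi>)"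
 show "frc F (ea a) (\<^bold>\<not> \<phi> \<^bold>\<or> \<psi>)" unfolding frc.simps(5)
 proof (rule denseI)
  fix G assume G: "cond G" "F \<subseteq> G"
  show "\<exists>H. cond H & G \<subseteq> H & (frc H (ea a) (\<^bold>\<not> \<phi>) \<or> frc H (ea a) \<psi>)"
  proof (cases "frc G (ea a) \<phi>")
   case True
   then show ?thesis using r G unfolding frc.simps(6) by blast
  next
   case False
   obtain H where "cond H" "G \<subseteq> H" "frc H (ea a) (\<^bold>\<not> \<phi>)" by (rule frc_Neg_extend[OF G(1) assms(2) False])
   then show ?thesis by blast
  qed
 qed
qed

lemma frc_Neg_Imp: assumes "cond F" "a \<in> elem" shows "frc F (ea a) (\<phi> \<^bold>\<and> \<^bold>\<not> \<psi>) = frc F (ea a) (\<^bold>\<not> (\<phi> \<^bold>\<longrightarrow> \<psi>))"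
proof
 assume "frc F (ea a) (\<phi> \<^bold>\<and> \<^bold>\<not> \<psi>)"
 then show "frc F (ea a) (\<^bold>\<not> (\<phi> \<^bold>\<longrightarrow> \<psi>))" unfolding frc.simps using frc_mono by blast
next
 assume r: "frc F (ea a) (\<^bold>\<not> (\<phi> \<^bold>\<longrightarrow> \<psi>))"
 have "frc F (ea a) \<phi>"
 proof (rule ccontr)
  assume "\<not> frc F (ea a) \<phi>"
  then obtain G where G: "cond G" "F \<subseteq> G" "frc G (ea a) (\<^bold>\<not> \<phi>)" by (rule frc_Neg_extend[OF assms])
  then have "frc G (ea a) (\<phi> \<^bold>\<longrightarrow> \<psi>)" unfolding frc.simps by blast
  then show False using r G unfolding frc.simps(3) by blast
 qed
 moreover have "frc F (ea a) (\<^bold>\<not> \<psi>)" unfolding frc.simps(3)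
 proof (intro allI impI notI)
  fix G assume G: "cond G & F \<subseteq> G" "frc G (ea a) \<psi>"
  then have "frc G (ea a) (\<phi> \<^bold>\<longrightarrow> \<psi>)" unfolding frc.simps using frc_mono by blast
  then show False using r G unfolding frc.simps(3) by blast
 qed
 ultimately show "frc F (ea a) (\<phi> \<^bold>\<and> \<^bold>\<not> \<psi>)" unfolding frc.simps(4) by blast
qed

lemma frc_Neg_And: assumes "cond F" "a \<in> elem" shows "frc F (ea a) (\<^bold>\<not> \<phi> \<^bold>\<or> \<^bold>\<not> \<psi>) = frc F (ea a) (\<^bold>\<not> (\<phi> \<^bold>\<and> \<psi>))"
proof
 assume l: "frc F (ea a) (\<^bold>\<not> \<phi> \<^bold>\<or> \<^bold>\<not> \<psi>)"
 show "frc F (ea a) (\<^bold>\<not> (\<phi> \<^bold>\<and> \<psi>))" unfolding frc.simps(3)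
 proof (intro allI impI notI)
  fix G assume G: "cond G & F \<subseteq> G" "frc G (ea a) (\<phi> \<^bold>\<and> \<psi>)"
  then obtain H where H: "cond H" "G \<subseteq> H" "frc H (ea a) (\<^bold>\<not> \<phi>) \<or> frc H (ea a) (\<^bold>\<not> \<psi>)"
   using l unfolding frc.simps(5) dense_def by blast
  have "frc H (ea a) \<phi>" "frc H (ea a) \<psi>" using frc_mono[OF _ H(2)] G(2) by auto
  then show False using H unfolding frc.simps(3) by blast
 qed
next
 assume r: "frc F (ea a) (\<^bold>\<not> (\<phi> \<^bold>\<and> \<psi>))"
 show "frc F (ea a) (\<^bold>\<not> \<phi> \<^bold>\<or> \<^bold>\<not> \<psi>)" unfolding frc.simps(5)
 proof (rule denseI)
  fix G assume G: "cond G" "F \<subseteq> G"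
  have "\<not> frc G (ea a) \<phi> \<or> \<not> frc G (ea a) \<psi>" using r G unfolding frc.simps(3,4) by blast
  then show "\<exists>H. cond H & G \<subseteq> H & (frc H (ea a) (\<^bold>\<not> \<phi>) \<or> frc H (ea a) (\<^bold>\<not> \<psi>))"
  proof
   assume "\<not> frc G (ea a) \<phi>"
   then obtain H where "cond H" "G \<subseteq> H" "frc H (ea a) (\<^bold>\<not> \<phi>)" by (rule frc_Neg_extend[OF G(1) assms(2)])
   then show ?thesis by blast
  next
   assume "\<not> frc G (ea a) \<psi>"
   then obtain H where "cond H" "G \<subseteq> H" "frc H (ea a) (\<^bold>\<not> \<psi>)" by (rule frc_Neg_extend[OF G(1) assms(2)])
   then show ?thesis by blast
  qed
 qed
qed

lemma frc_Neg_Or: "frc F (ea a) (\<^bold>\<not> \<phi> \<^bold>\<and> \<^bold>\<not> \<psi>) = frc F (ea a) (\<^bold>\<not> (\<phi> \<^bold>\<or> \<psi>))"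
proof
 assume l: "frc F (ea a) (\<^bold>\<not> \<phi> \<^bold>\<and> \<^bold>\<not> \<psi>)"
 show "frc F (ea a) (\<^bold>\<not> (\<phi> \<^bold>\<or> \<psi>))" unfolding frc.simps(3)
 proof (intro allI impI notI)
  fix G assume G: "cond G & F \<subseteq> G" "frc G (ea a) (\<phi> \<^bold>\<or> \<psi>)"
  then obtain H where H: "cond H" "G \<subseteq> H" "frc H (ea a) \<phi> \<or> frc H (ea a) \<psi>"
   unfolding frc.simps(5) dense_def by blast
  then show False using l G unfolding frc.simps(3,4) by blast
 qed
next
 assume r: "frc F (ea a) (\<^bold>\<not> (\<phi> \<^bold>\<or> \<psi>))"
 have "frc G (ea a) (\<phi> \<^bold>\<or> \<psi>)" if "frc G (ea a) \<phi> \<or> frc G (ea a) \<psi>" for G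
  unfolding frc.simps(5) by (rule denseI) (use that frc_mono in blast)
 then show "frc F (ea a) (\<^bold>\<not> \<phi> \<^bold>\<and> \<^bold>\<not> \<psi>)" using r unfolding frc.simps(3,4) by blast
qed

lemma frc_Neg_bAll: assumes "cond F" "a \<in> elem" shows "frc F (ea a) (bEx t (\<^bold>\<not> \<phi>)) = frc F (ea a) (\<^bold>\<not> (bAll t \<phi>))"
proof
 assume l: "frc F (ea a) (bEx t (\<^bold>\<not> \<phi>))"
 show "frc F (ea a) (\<^bold>\<not> (bAll t \<phi>))" unfolding frc.simps(3)
 proof (intro allI impI notI)
  fix G assume G: "cond G & F \<subseteq> G" "frc G (ea a) (bAll t \<phi>)"
  then obtain H x where H: "cond H" "G \<subseteq> H" "x \<in> elem" "{pt. val (x pt) \<le> eval (env (a pt)) t} \<in> H"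
    "frc H (ea (%pt. pr (x pt) (a pt))) (\<^bold>\<not> \<phi>)" using l unfolding frc_bEx dense_def by blast
  then have "frc H (ea (%pt. pr (x pt) (a pt))) \<phi>" using G(2) unfolding frc_bAll by blast
  then show False using H unfolding frc.simps(3) by blast
 qed
next
 assume r: "frc F (ea a) (\<^bold>\<not> (bAll t \<phi>))"
 show "frc F (ea a) (bEx t (\<^bold>\<not> \<phi>))" unfolding frc_bEx
 proof (rule denseI)
  fix G assume G: "cond G" "F \<subseteq> G"
  then have "\<not> frc G (ea a) (bAll t \<phi>)" using r unfolding frc.simps(3) by blast
  then obtain x K where K: "x \<in> elem" "cond K" "G \<subseteq> K" "{pt. val (x pt) \<le> eval (env (a pt)) t} \<in> K"
   "\<not> frc K (ea (%pt. pr (x pt) (a pt))) \<phi>" unfolding frc_bAll by blast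
  obtain H where H: "cond H" "K \<subseteq> H" "frc H (ea (%pt. pr (x pt) (a pt))) (\<^bold>\<not> \<phi>)"
   by (rule frc_Neg_extend[OF K(2) elem_pr[OF K(1) assms(2)] K(5)])
  have "{pt. val (x pt) \<le> eval (env (a pt)) t} \<in> H" "G \<subseteq> H" using H(2) K(3,4) by blast+
  then show "\<exists>H. cond H & G \<subseteq> H & (\<exists>x \<in> elem. {pt. val (x pt) \<le> eval (env (a pt)) t} \<in> H &
    frc H (ea (%pt. pr (x pt) (a pt))) (\<^bold>\<not> \<phi>))" using H(1,3) K(1) by blast
 qed
qed

lemma frc_Neg_bEx: "frc F (ea a) (bAll t (\<^bold>\<not> \<phi>)) = frc F (ea a) (\<^bold>\<not> (bEx t \<phi>))"
proof
 assume l: "frc F (ea a) (bAll t (\<^bold>\<not> \<phi>))"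
 show "frc F (ea a) (\<^bold>\<not> (bEx t \<phi>))" unfolding frc.simps(3)
 proof (intro allI impI notI)
  fix G assume G: "cond G & F \<subseteq> G" "frc G (ea a) (bEx t \<phi>)"
  then obtain H x where H: "cond H" "G \<subseteq> H" "x \<in> elem" "{pt. val (x pt) \<le> eval (env (a pt)) t} \<in> H"
    "frc H (ea (%pt. pr (x pt) (a pt))) \<phi>" unfolding frc_bEx dense_def by blast
  have "F \<subseteq> H" using G H by blast
  then have "frc H (ea (%pt. pr (x pt) (a pt))) (\<^bold>\<not> \<phi>)" using l H unfolding frc_bAll by blast
  then show False using H unfolding frc.simps(3) by blast
 qed
next
 assume r: "frc F (ea a) (\<^bold>\<not> (bEx t \<phi>))"
 show "frc F (ea a) (bAll t (\<^bold>\<not> \<phi>))" unfolding frc_bAll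
 proof (intro ballI allI impI)
  fix x G assume x: "x \<in> elem" and G: "cond G & F \<subseteq> G" and b: "{pt. val (x pt) \<le> eval (env (a pt)) t} \<in> G"
  show "frc G (ea (%pt. pr (x pt) (a pt))) (\<^bold>\<not> \<phi>)" unfolding frc.simps(3)
  proof (intro allI impI notI)
   fix H assume H: "cond H & G \<subseteq> H" "frc H (ea (%pt. pr (x pt) (a pt))) \<phi>"
   have "frc H (ea a) (bEx t \<phi>)" unfolding frc_bEx
   proof (rule denseI)
    fix K assume K: "cond K" "H \<subseteq> K"
    have "{pt. val (x pt) \<le> eval (env (a pt)) t} \<in> K" using b H(1) K(2) by blast
    then show "\<exists>L. cond L & K \<subseteq> L & (\<exists>x \<in> elem. {pt. val (x pt) \<le> eval (env (a pt)) t} \<in> L &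
     frc L (ea (%pt. pr (x pt) (a pt))) \<phi>)" using K(1) x frc_mono[OF H(2) K(2)] by blast
   qed
   moreover have "cond H & F \<subseteq> H" using H(1) G by blast
   ultimately show False using r unfolding frc.simps(3) by blast
  qed
 qed
qed

lemma Sigma_b1_SW: "Sigma_b1 \<phi> ==> SW \<phi>"
 and Pi_b1_SW: "Pi_b1 \<psi> ==> SW (\<^bold>\<not> \<psi>)"
proof (induction rule: Sigma_b1_Pi_b1.inducts)
 case (1 \<phi>)
 then show ?case by (rule SW_sharply)
next
 case (2 \<phi>)
 show ?case by fact
next
 case (3 \<phi> \<psi>)
 show ?case by (intro SW_And 3)
next
 case (4 \<phi> \<psi>)
 show ?case by (intro SW_Or 4)
next
 case (5 \<phi> \<psi>)
 show ?case by (rule SW_equiv[OF SW_Or[OF 5(3,4)] _ frc_Imp_Or]) auto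
next
 case (6 \<phi> t)
 show ?case by (intro SW_bAll_Len 6)
next
 case (7 \<phi> t)
 show ?case by (intro SW_bEx 7)
next
 case (8 \<phi>)
 show ?case by (intro SW_sharply sharply_bounded.intros 8)
next
 case (9 \<phi>)
 show ?case by (rule SW_equiv[OF 9(2) _ frc_Neg_Neg]) auto
next
 case (10 \<phi> \<psi>)
 show ?case by (rule SW_equiv[OF SW_Or[OF 10(3,4)] _ frc_Neg_And]) auto
next
 case (11 \<phi> \<psi>)
 show ?case by (rule SW_equiv[OF SW_And[OF 11(3,4)] _ frc_Neg_Or]) auto
next
 case (12 \<phi> \<psi>)
 show ?case by (rule SW_equiv[OF SW_And[OF 12(3,4)] _ frc_Neg_Imp]) auto
next
 case (13 \<phi> t)
 show ?case by (rule SW_equiv[OF SW_bEx[OF 13(2)] _ frc_Neg_bAll]) auto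
next
 case (14 \<phi> t)
 show ?case by (rule SW_equiv[OF SW_bAll_Len[OF 14(2)] _ frc_Neg_bEx]) auto
qed

lemma val_drop: "val (drop n x) = val x div 2 ^ n"
proof (induction n arbitrary: x)
 case (Suc n)
 show ?case by (simp add: drop_Suc Suc val_tl div_mult2_eq)
qed simp

text \<open>The size of the iterated witnesses stays bounded because \<open>R\<close> bounds every witness that it
 accepts.\<close>

lemma frc_PIND:
 assumes "SW \<phi>" "cond F" "a \<in> elem" shows "frc F (ea a) (PIND \<phi>)"
proof -
 obtain R C where R: "wit R C \<phi>" using assms(1) unfolding SW_def by blast
 have half: "(%i pt. eval (%j. ea (%pt. pr (x pt) (a pt)) j pt) (case_nat (Half (Var 0)) (%i. Var (Suc i)) i)) =
   ea (%pt. pr (bits (val (x pt) div 2)) (a pt))" for x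
  by (intro ext) (simp add: ea_def env_pr split: nat.splits)
 have "frc G (ea (%pt. pr (x pt) (a pt))) \<phi>"
  if G: "cond G" "F \<subseteq> G" and zero: "frc G (ea a) (inst \<phi> Zero)"
   and st: "frc G (ea a) (All (subst (case_nat (Half (Var 0)) (%i. Var (Suc i))) \<phi> \<^bold>\<longrightarrow> \<phi>))" and x: "x \<in> elem" for G x
 proof -
  have st': "frc K (ea (%pt. pr (z pt) (a pt))) \<phi>"
   if "z \<in> elem" "cond K" "G \<subseteq> K" "frc K (ea (%pt. pr (bits (val (z pt) div 2)) (a pt))) \<phi>" for z K
   using st that unfolding frc.simps(6,7) ea_pr frc_subst half by blast
  have zero': "frc G (ea (%pt. pr [] (a pt))) \<phi>" using zero unfolding frc_subst ea_inst by simp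
  show ?thesis
  proof (rule frc_dense[OF G(1) elem_pr[OF x assms(3)]], rule denseI)
   fix G0 assume G0: "cond G0" "G \<subseteq> G0"
   from wit_frc(1)[OF R G0(1) elem_pr[OF elem_const assms(3)] frc_mono[OF zero' G0(2)]]
   obtain K w0 where K: "cond K" "G0 \<subseteq> K" "w0 \<in> elem" "{pt. R (pr [] (a pt)) (w0 pt)} \<in> K" by blast
   \<comment> \<open>The induction step as a task: given a number and a witness for its half, paired
     in \<open>z\<close>, find a witness for the number. \<open>saturation\<close> solves it by one
     polynomial-time function \<open>h\<close>.\<close>
   define \<chi> where "\<chi> l z y \<longleftrightarrow> (R (pr (bits (val (sfst z) div 2)) l) (ssnd z) --> R (pr (bits (val (sfst z))) l) y)" for l z y
   have P\<chi>: "PP (%x. \<chi> (sfst x) (sfst (ssnd x)) (ssnd (ssnd x)))" unfolding \<chi>_def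
    by (intro PP_imp PP_sub[OF witD(1)[OF R]] PF_norm PF_half PF_intros Fn_fst Fn_snd)
   have PX: "PP (%x. R (pr (bits (val (sfst (ssnd x)) div 2)) (sfst x)) (ssnd (ssnd x)))"
    by (intro PP_sub[OF witD(1)[OF R]] PF_half PF_intros Fn_fst Fn_snd)
   have "\<exists>H. cond H & L \<subseteq> H & (\<exists>y \<in> elem. {pt. \<chi> (a pt) (z pt) (y pt)} \<in> H)"
    if z: "z \<in> elem" and L: "cond L" "K \<subseteq> L" for z L
   proof -
    let ?X = "{pt. R (pr (bits (val (sfst (z pt)) div 2)) (a pt)) (ssnd (z pt))}"
    have e: "(%pt. pr (bits (val (sfst (z pt)) div 2)) (a pt)) \<in> elem"
     by (intro elem_pr assms(3) elem_PF[OF PF_half[OF Fn_fst] z])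
    obtain M where M: "cond M" "L \<subseteq> M" "?X \<in> M \<or> - ?X \<in> M"
     by (rule cond_decide[OF L(1) dec2[OF assms(3) z PX]])
    from M(3) show ?thesis
    proof
     assume X: "?X \<in> M"
     have GM: "G \<subseteq> M" using G0 K(2) L(2) M(2) by blast
     have "frc M (ea (%pt. pr (sfst (z pt)) (a pt))) \<phi>"
      by (rule st'[OF elem_sfst[OF z] M(1) GM wit_frc(2)[OF R M(1) e elem_ssnd[OF z] X]])
     then have "frc M (ea (%pt. pr (bits (val (sfst (z pt)))) (a pt))) \<phi>" unfolding ea_norm .
     then obtain H y where H: "cond H" "M \<subseteq> H" "y \<in> elem" "{pt. R (pr (bits (val (sfst (z pt)))) (a pt)) (y pt)} \<in> H"
      using wit_frc(1)[OF R M(1) elem_pr[OF elem_norm[OF elem_sfst[OF z]] assms(3)]] by blast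
     have "{pt. \<chi> (a pt) (z pt) (y pt)} \<in> H" by (rule cond_mono[OF H(1,4)]) (auto simp: \<chi>_def)
     then show ?thesis using H M(2) by (meson order_trans)
    next
     assume X: "- ?X \<in> M"
     have "{pt. \<chi> (a pt) (z pt) []} \<in> M" by (rule cond_mono[OF M(1) X]) (auto simp: \<chi>_def)
     then show ?thesis using M by (intro exI[of _ M] conjI bexI[where x = "%_. []"] elem_const)
    qed
   qed
   from saturation[OF K(1) assms(3) P\<chi> this] obtain h r where h: "PF h" "r \<in> elem"
    "\<forall>z \<in> elem. {pt. \<chi> (a pt) (z pt) (h (pr (z pt) (r pt)))} \<in> K" by blast
   define X where "X c = sfst (sfst c)" for c
   define A where "A c = ssnd (sfst c)" for c
   \<comment> \<open>\<open>dr c u\<close> keeps the \<open>length u\<close> most significant bits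
     of \<open>X c\<close>. One symbol more in \<open>u\<close> passes from a number to one whose
     half it is, so \<open>W\<close> climbs from 0 to the full number in as many steps as there are
     bits.\<close>
   define dr where "dr c u = drop (length (drop (length u) (X c))) (X c)" for c and u :: str
   have dr: "dr c u = drop (length (X c) - length u) (X c)" for c u unfolding dr_def by simp
   define H where "H c u w = (if R (pr (bits (val (dr c (False # u)))) (A c)) (h (pr (pr (dr c (False # u)) w) (sfst (ssnd c))))
     then h (pr (pr (dr c (False # u)) w) (sfst (ssnd c))) else [])" for c u w
   define W where "W c = rec_nat (ssnd (ssnd c)) (%n. H c (U n))" for c
   have W: "W c 0 = ssnd (ssnd c)" "W c (Suc n) = H c (U n) (W c n)" for c n by (simp_all add: W_def)
   have PFX: "PF (%z. X (f z))" "PF (%z. A (f z))" if "PF f" for f unfolding X_def A_def by (intro PF_intros that)+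
   have PFdr: "PF (%z. dr (f z) (g z))" if "PF f" "PF g" for f g unfolding dr_def by (intro PF_drop PFX that)
   have Xl: "length (X c) \<le> length c" "length (A c) \<le> length c" for c
    unfolding X_def A_def using length_sfst[of c] length_sfst[of "sfst c"] length_ssnd[of "sfst c"] by linarith+
   have Wb: "length (W c n) \<le> length c + (3 * length c + 1 + C) ^ C" for c n
   proof (cases n)
    case 0
    have "length (ssnd (ssnd c)) \<le> length c" using length_ssnd[of c] length_ssnd[of "ssnd c"] by linarith
    then show ?thesis unfolding 0 W by (rule trans_le_add1)
   next
    case (Suc k)
    have "length (H c (U k) w) \<le> (3 * length c + 1 + C) ^ C" for w
    proof (cases "R (pr (bits (val (dr c (False # U k)))) (A c)) (h (pr (pr (dr c (False # U k)) w) (sfst (ssnd c))))")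
     case True
     have "length (bits (val (dr c (False # U k)))) \<le> length c"
      using length_bits_val[of "dr c (False # U k)"] Xl(1)[of c] unfolding dr by simp
     then have "(length (pr (bits (val (dr c (False # U k)))) (A c)) + C) ^ C \<le> (3 * length c + 1 + C) ^ C"
      using Xl(2)[of c] by (intro power_mono) auto
     then show ?thesis using witD(2)[OF R True] True unfolding H_def by simp
    next
     case False
     then show ?thesis unfolding H_def by simp
    qed
    then show ?thesis unfolding Suc W by (simp add: trans_le_add2)
   qed
   have PFW: "PF (%z. W (f z) (length (g z)))" if "PF f" "PF g" for f g
   proof (rule PF_rec[where r = W and g = "%c. ssnd (ssnd c)" and H = H])
    show "PF (%x. H (sfst x) (sfst (ssnd x)) (ssnd (ssnd x)))" unfolding H_def
     by (intro PF_if PP_sub[OF witD(1)[OF R]] PF_comp[OF h(1)] PF_norm PFdr PFX PF_intros Fn_fst Fn_snd)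
    have "pb (%(c :: str, n). length c + (3 * length c + 1 + C) ^ C) (%(c, n). length c + n)"
     unfolding case_prod_unfold by (intro pb_intros pb_le) auto
    then show "pb (%(c, n). length (W c n)) (%(c, n). length c + n)"
     by (rule pb_mono) (use Wb in auto)
   qed (use W that in \<open>auto intro: PF_ssnd Fn_snd\<close>)
   define good where "good c u \<longleftrightarrow> R (pr (bits (val (dr c u))) (A c)) (W c (length u))" for c u
   have Pg: "PP (%z. good (f z) (g z))" if "PF f" "PF g" for f g unfolding good_def
    by (intro PP_sub[OF witD(1)[OF R]] PF_norm PFW Fn_pair PFdr PFX that)
   \<comment> \<open>A bad index is one at which the chain of witnesses breaks, and \<open>k\<close>
     computes the first such index.\<close>
   define bad where "bad c u \<longleftrightarrow> good c u & \<not> good c (False # u)" for c u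
   define k where "k c = (if \<exists>i < length (X c). bad c (U i) then True # U (LEAST i. bad c (U i)) else [])" for c
   have Pbad: "PP (%x. bad (sfst x) (ssnd x))" unfolding bad_def
    by (intro PP_conj PP_not Pg PF_cons Fn_fst Fn_snd)
   have k: "PF k" unfolding k_def by (rule PF_least[OF Pbad Fn_id PFX(1)[OF Fn_id]])
   let ?c = "%pt. pr (pr (x pt) (a pt)) (pr (r pt) (w0 pt))"
   have ce: "?c \<in> elem" by (intro elem_pr x assms(3) h(2) K(3))
   have cX: "X (?c pt) = x pt" "A (?c pt) = a pt" for pt by (simp_all add: X_def A_def)
   \<comment> \<open>This element presents to \<open>h\<close> the task at the first break. The
     single instance of \<open>saturation\<close> at \<open>?z\<close> therefore excludes all breaks
     on a member of \<open>K\<close>.\<close>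
   let ?z = "%pt. pr (dr (?c pt) (False # tl (k (?c pt)))) (W (?c pt) (length (tl (k (?c pt)))))"
   have ze: "?z \<in> elem" by (rule elem_PF[OF _ ce, where f = "%c. pr (dr c (False # tl (k c))) (W c (length (tl (k c))))"])
    (intro Fn_pair PFdr PFW PF_cons PF_tl k Fn_id)
   let ?w = "%pt. W (?c pt) (length (x pt))"
   have "(%pt. W (?c pt) (length (X (?c pt)))) \<in> elem"
    by (rule elem_PF[OF _ ce, where f = "%c. W c (length (X c))"]) (rule PFW[OF Fn_id PFX(1)[OF Fn_id]])
   then have we: "?w \<in> elem" unfolding cX .
   have "{pt. R (pr (bits (val (x pt))) (a pt)) (?w pt)} \<in> K"
   proof (rule cond_mono[OF K(1) cond_Int[OF K(1) K(4) h(3)[rule_format, OF ze]]], intro subsetI CollectI)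
    fix pt assume o: "pt \<in> {pt. R (pr [] (a pt)) (w0 pt)} \<inter> {pt. \<chi> (a pt) (?z pt) (h (pr (?z pt) (r pt)))}"
    let ?C = "?c pt"
    have nobad: "\<not> bad ?C (U i)" if i: "i < length (x pt)" for i
    proof
     assume b: "bad ?C (U i)"
     define j where "j = (LEAST i. bad ?C (U i))"
     have j: "bad ?C (U j)" "j \<le> i" unfolding j_def using b by (rule LeastI, rule Least_le)
     have "\<exists>i < length (X ?C). bad ?C (U i)" using b i unfolding cX by blast
     then have kc: "tl (k ?C) = U j" unfolding k_def j_def by (simp only: if_True list.sel)
     have "val (dr ?C (False # U j)) div 2 = val (dr ?C (U j))"
      unfolding dr val_drop cX using i j(2)
      by (simp add: div_mult2_eq[symmetric] power_Suc2[symmetric] Suc_diff_Suc del: power_Suc)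
     note hlf = this
     let ?y = "h (pr (pr (dr ?C (False # U j)) (W ?C j)) (r pt))"
     have "\<chi> (a pt) (pr (dr ?C (False # U j)) (W ?C j)) ?y"
      using o by (simp only: kc length_replicate mem_Collect_eq Int_iff)
     moreover have "R (pr (bits (val (dr ?C (U j)))) (a pt)) (W ?C j)"
      using j(1) unfolding bad_def good_def cX length_replicate by blast
     ultimately have R1: "R (pr (bits (val (dr ?C (False # U j)))) (a pt)) ?y"
      unfolding \<chi>_def by (simp only: hlf sfst_pr ssnd_pr simp_thms)
     have "W ?C (Suc j) = ?y" unfolding W H_def cX ssnd_pr sfst_pr by (simp only: R1 if_True)
     then have "good ?C (False # U j)" unfolding good_def cX using R1 by simp
     then show False using j(1) unfolding bad_def by blast
    qed
    have "i \<le> length (x pt) ==> good ?C (U i)" for i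
    proof (induction i)
     case 0
     show ?case using o by (simp add: good_def dr cX W)
    next
     case (Suc i)
     then show ?case using nobad[of i] unfolding bad_def by simp
    qed
    from this[of "length (x pt)"] show "R (pr (bits (val (x pt))) (a pt)) (?w pt)"
     unfolding good_def dr cX by simp
   qed
   then have "frc K (ea (%pt. pr (bits (val (x pt))) (a pt))) \<phi>"
    by (rule wit_frc(2)[OF R K(1) elem_pr[OF elem_norm[OF x] assms(3)] we])
   then show "\<exists>H. cond H & G0 \<subseteq> H & frc H (ea (%pt. pr (x pt) (a pt))) \<phi>"
    unfolding ea_norm using K by blast
  qed
 qed
 then show ?thesis unfolding PIND_def frc.simps(4,6) frc.simps(7)[of _ _ \<phi>] ea_pr by blast
qed

lemma frc_S12: assumes "\<psi> \<in> S12" "cond F" "a \<in> elem" shows "frc F (ea a) \<psi>"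
proof (cases "\<psi> \<in> BASIC")
 case True
 have "{pt. sat (env (a pt)) \<psi>} = UNIV" using BASIC_true[OF True] by blast
 then show ?thesis using frc_sharply[OF BASIC_sharply[OF True] assms(2,3)] cond_UNIV[OF assms(2)] by simp
next
 case False
 then obtain \<phi> where "\<psi> = PIND \<phi>" "Sigma_b1 \<phi>" using assms(1) unfolding S12_def by blast
 then show ?thesis using frc_PIND[OF Sigma_b1_SW assms(2,3)] by blast
qed

text \<open>This returns from generic elements to algorithms: coordinate 0 carries the input, and
  the others are set to the empty string.\<close>

lemma elem_string: "t \<in> elem ==> PF (%s. t (%i. if i = 0 then s else []))"
proof (induction rule: elem.induct)
 case (elem_coord i)
 show ?case by (cases i) (simp_all add: Fn_id PF_const)
next
 case (elem_pr a b)
 show ?case by (rule Fn_pair) fact+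
next
 case (elem_PF f a)
 show ?case by (rule PF_comp[OF \<open>PF f\<close>]) fact
qed

lemma holds_at_env: "fv \<phi> \<subseteq> {0} ==> holds_at \<phi> (val s) \<longleftrightarrow> sat (env (pr s [])) \<phi>"
 unfolding holds_at_def by (rule sat_fv) (auto simp: env_pr)

lemma Sigma_b1_witness:
 assumes "Sigma_b1 \<phi>" "fv \<phi> \<subseteq> {0}"
 shows "\<exists>R C. PP (%x. R (sfst x) (ssnd x)) & (\<forall>s. holds_at \<phi> (val s) \<longleftrightarrow> (\<exists>w. R s w)) &
  (\<forall>s w. R s w --> length w \<le> (2 * length s + 1 + C) ^ C)"
proof -
 obtain R C where R: "wit R C \<phi>" using Sigma_b1_SW[OF assms(1)] unfolding SW_def by blast
 show ?thesis
 proof (intro exI[of _ "%s w. R (pr s []) w"] exI[of _ C] conjI allI impI)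
  show "PP (%x. R (pr (sfst x) []) (ssnd x))" by (intro PP_sub[OF witD(1)[OF R]] PF_intros Fn_fst Fn_snd)
  show "holds_at \<phi> (val s) \<longleftrightarrow> (\<exists>w. R (pr s []) w)" for s unfolding holds_at_env[OF assms(2)] by (rule witD(3)[OF R])
  show "length w \<le> (2 * length s + 1 + C) ^ C" if "R (pr s []) w" for s w using witD(2)[OF R that] by simp
 qed
qed

text \<open>Let \<open>pt 0\<close> be a generic input and search for a tagged witness of
  \<open>\<phi>\<close> or of the negation of \<open>\<psi>\<close>. A condition refuting all
  candidates would force no instance of \<open>\<phi>\<close> in any extension, hence force the
  negation of \<open>\<psi>\<close>, which has a witness after all. So \<open>cond_avoid\<close> at
  the trivial condition yields one element; as \<open>{UNIV}\<close> has only one member, it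
  succeeds at every point, and its tag decides \<open>\<phi>\<close>.\<close>

theorem Delta_b1_decidable:
 assumes "Delta_b1_in_S12 \<phi>" "fv \<phi> \<subseteq> {0}"
 shows "\<exists>D. PP D & (\<forall>s. D s \<longleftrightarrow> holds_at \<phi> (val s))"
proof -
 obtain \<psi> where \<psi>: "Sigma_b1 \<phi>" "Pi_b1 \<psi>" "prov S12 {} (\<phi> \<^bold>\<longleftrightarrow> \<psi>)" using assms(1) unfolding Delta_b1_in_S12_def by blast
 obtain R C where R: "wit R C \<phi>" using Sigma_b1_SW[OF \<psi>(1)] unfolding SW_def by blast
 obtain S D where S: "wit S D (\<^bold>\<not> \<psi>)" using Pi_b1_SW[OF \<psi>(2)] unfolding SW_def by blast
 have f: "frc F (ea a) \<phi> \<longleftrightarrow> frc F (ea a) \<psi>" if "cond F" "a \<in> elem" for F a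
  using frc_sound[OF \<psi>(3) frc_S12 that] that unfolding frc.simps(4,6) by blast
 define \<theta> where "\<theta> s y \<longleftrightarrow> y \<noteq> [] & (if y \<noteq> [] & hd y then R (pr s []) (tl y) else S (pr s []) (tl y))" for s y
 have \<theta>C: "\<theta> s (True # y) \<longleftrightarrow> R (pr s []) y" "\<theta> s (False # y) \<longleftrightarrow> S (pr s []) y" for s y by (simp_all add: \<theta>_def)
 have P: "PP (%x. \<theta> (sfst x) (ssnd x))" unfolding \<theta>_def
  by (intro PP_conj PP_if PP_sub[OF witD(1)[OF R]] PP_sub[OF witD(1)[OF S]] PF_intros Fn_fst Fn_snd)
 show ?thesis
 proof (rule cond_avoid[OF cond_trivial elem_coord P])
  fix t assume t: "t \<in> elem" "{pt. \<theta> (pt 0) (t pt)} \<in> {UNIV}"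
  define T where "T s = t (%i. if i = 0 then s else [])" for s
  have PT: "PF T" unfolding T_def by (rule elem_string[OF t(1)])
  have "pt \<in> {pt. \<theta> (pt 0) (t pt)}" for pt using t(2) by simp
  then have \<theta>: "\<theta> s (T s)" for s using CollectD[of "%i. if i = 0 then s else []" "%pt. \<theta> (pt 0) (t pt)"] unfolding T_def by simp
  have eq: "sat e \<phi> = sat e \<psi>" for e using S12_sound[OF \<psi>(3), of e] by auto
  have "(T s \<noteq> [] & hd (T s)) \<longleftrightarrow> holds_at \<phi> (val s)" for s
  proof (cases "T s")
   case Nil
   have "\<theta> s []" using \<theta>[of s] unfolding Nil .
   then have "[] \<noteq> ([] :: str)" unfolding \<theta>_def by (rule conjunct1)
   then show ?thesis by (rule notE) (rule refl)
  next
   case (Cons b y)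
   show ?thesis
   proof (cases b)
    case True
    then have "\<theta> s (True # y)" using \<theta>[of s] Cons by simp
    then have "sat (env (pr s [])) \<phi>" unfolding \<theta>C witD(3)[OF R] by (rule exI)
    then show ?thesis unfolding holds_at_env[OF assms(2)] Cons by (simp only: True list.sel list.distinct simp_thms not_False_eq_True)
   next
    case False
    then have "\<theta> s (False # y)" using \<theta>[of s] Cons by simp
    then have "sat (env (pr s [])) (\<^bold>\<not> \<psi>)" unfolding \<theta>C witD(3)[OF S] by (rule exI)
    then show ?thesis unfolding holds_at_env[OF assms(2)] Cons by (simp only: False list.sel list.distinct simp_thms eq sat.simps)
   qed
  qed
  moreover have "PP (%s. T s \<noteq> [] & hd (T s))" by (rule PP_hd[OF PT])
  ultimately show ?thesis by blast
 next
  fix G assume G: "cond G" "{UNIV} \<subseteq> G" "\<And>t. t \<in> elem ==> {pt. \<not> \<theta> (pt 0) (t pt)} \<in> G"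
  have no: False if "cond H" "G \<subseteq> H" "w \<in> elem" "{pt. \<theta> (pt 0) (b # w pt)} \<in> H" for H w b
  proof -
   have "{pt. \<not> \<theta> (pt 0) (b # w pt)} \<in> H" using G(3)[OF elem_PF[OF Fn_cons that(3)]] that(2) by blast
   from cond_disjoint[OF that(1) this that(4)] show False by blast
  qed
  let ?a = "%pt :: point. pr (pt 0) []"
  have a: "?a \<in> elem" by (rule elem.elem_pr[OF elem_coord elem_const])
  have nR: "\<not> frc H (ea ?a) \<phi>" if H: "cond H" "G \<subseteq> H" for H
  proof
   assume "frc H (ea ?a) \<phi>"
   from wit_frc(1)[OF R H(1) a this] obtain K w where K: "cond K" "H \<subseteq> K" "w \<in> elem" "{pt. R (pr (pt 0) []) (w pt)} \<in> K" by blast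
   then show False using no[of K w True] H(2) unfolding \<theta>C by blast
  qed
  then have "frc G (ea ?a) (\<^bold>\<not> \<psi>)" unfolding frc.simps(3) using f a by blast
  from wit_frc(1)[OF S G(1) a this] obtain K w where K: "cond K" "G \<subseteq> K" "w \<in> elem" "{pt. S (pr (pt 0) []) (w pt)} \<in> K" by blast
  then show ?thesis using no[of K w False] unfolding \<theta>C by blast
 qed
qed

section \<open>Universal simulation and evaluation of propositional formulas\<close>

section \<open>A universal machine\<close>

function seek :: "(str => bool) => str => str" where
 "seek P T = (if T = [] \<or> P (sfst T) then T else seek P (ssnd T))"
 by auto
termination by (relation "measure (length \<circ> snd)") (auto intro: length_ssnd_less)

declare seek.simps [simp del]

lemma seek_Nil [simp]: "seek P [] = []"
 by (simp add: seek.simps)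

lemma seek_pr: "seek P (pr e T) = (if P e then pr e T else seek P T)"
 by (subst seek.simps) simp

lemma seek_lst: "seek P (lst es) = lst (dropWhile (%e. \<not> P e) es)"
 by (induction es) (simp_all add: seek_pr)

lemma length_seek: "length (seek P T) \<le> length T"
proof (induction P T rule: seek.induct)
 case (1 P T)
 then show ?case using length_ssnd[of T] by (subst seek.simps) (auto intro: order_trans)
qed

lemma seek_hit: "seek P T \<noteq> [] ==> P (sfst (seek P T))"
proof (induction P T rule: seek.induct)
 case (1 P T)
 then show ?case by (cases "T = [] \<or> P (sfst T)") (simp_all add: seek.simps[of P T] split: if_splits)
qed

definition seek_step :: "(str => bool) => str => str" where
 "seek_step P T = (if T = [] \<or> P (sfst T) then T else ssnd T)"

lemma seek_iter: "length T \<le> n ==> (seek_step P ^^ n) T = seek P T"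
proof (induction n arbitrary: T)
 case (Suc n)
 show ?case
 proof (cases "T = [] \<or> P (sfst T)")
  case True
  have fp: "seek_step P T = T" using True by (auto simp: seek_step_def)
  have "(seek_step P ^^ m) T = T" for m by (induction m) (simp_all add: fp)
  then show ?thesis using True by (subst seek.simps) (simp only: if_True)
 next
  case False
  then have "length (ssnd T) \<le> n" using Suc.prems length_ssnd_less[of T] by simp
  then show ?thesis using Suc.IH[of "ssnd T"] False by (simp add: funpow_swap1 seek.simps[of P T] funpow_Suc_right seek_step_def del: funpow.simps)
 qed
qed simp

lemma PF_seek:
 assumes "PP (%x. P (sfst x) (ssnd x))" "PF a" "PF b"
 shows "PF (%x. seek (P (a x)) (b x))"
proof -
 define r where "r c n = (seek_step (P (sfst c)) ^^ n) (ssnd c)" for c n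
 have P: "PP (%x. P (f x) (g x))" if "PF f" "PF g" for f g
  using PP_comp[OF assms(1) Fn_pair[OF that]] by simp
 have "length (r c n) \<le> length c" for c n
  unfolding r_def by (induction n) (use length_ssnd order_trans in \<open>fastforce simp: seek_step_def\<close>)+
 then have "PF (%x. r (pr (a x) (b x)) (length (b x)))"
  by (intro PF_rec_linear[where r = r and g = ssnd and K = 1 and H = "%c u w. if w = [] \<or> P (sfst c) (sfst w) then w else ssnd w"])
   (auto simp: r_def seek_step_def trans_le_add1 le_SucI intro!: PF_if PP_disj P PF_intros Fn_fst Fn_snd assms)
 moreover have "r (pr (a x) (b x)) (length (b x)) = seek (P (a x)) (b x)" for x
  by (simp add: r_def seek_iter)
 ultimately show ?thesis by simp
qed

definition enc :: "int => str" where
 "enc i = (if i \<ge> 0 then False # U (nat i) else True # U (nat (- i)))"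

lemma enc_inj [simp]: "enc i = enc j \<longleftrightarrow> i = j"
 by (auto simp: enc_def)

lemma length_enc: "i \<ge> 0 ==> length (enc i) = Suc (nat i)"
 by (simp add: enc_def)

text \<open>The moves across the sign change are treated separately, so that every integer keeps a
  unique code: from -1 to the right the code is that of 0 with sign \<open>False\<close>, from 0 to
  the left that of -1.\<close>

definition shift :: "str => str => str" where
 "shift d p = (if d = [] then p
   else if hd d then
    (if p \<noteq> [] & hd p then if tl (tl p) = [] then [False] else True # tl (tl p) else False # p)
   else (if p \<noteq> [] & hd p then True # False # tl p else if tl p = [] then [True, False] else False # tl (tl p)))"

fun dir :: "move => str" where
 "dir MStay = []"
| "dir MRight = [True]"
| "dir MLeft = [False]"

lemma shift_enc: "shift (dir m) (enc h) = enc (h + offset m)"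
proof (cases m)
 case MRight
 show ?thesis
 proof (cases "h \<ge> 0")
  case True
  then have "nat (h + 1) = Suc (nat h)" by simp
  then show ?thesis using MRight True by (simp add: shift_def enc_def)
 next
  case False
  then obtain n where n: "nat (- h) = Suc n" by (metis gr0_implies_Suc zero_less_nat_eq neg_0_less_iff_less not_le)
  then have "n = nat (- h - 1)" "h = - 1 - int n" using False by linarith+
  then show ?thesis using MRight False n by (auto simp: shift_def enc_def)
 qed
next
 case MLeft
 show ?thesis
 proof (cases "h \<ge> 1")
  case True
  then obtain n where n: "nat h = Suc n" by (metis gr0_implies_Suc nat_0_iff not_le zero_less_one_class.zero_less_one order_less_le_trans gr0I)
  then have "nat (h - 1) = n" by linarith
  then show ?thesis using MLeft True n by (simp add: shift_def enc_def)
 next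
  case False
  then have "nat (1 - h) = Suc (nat (- h))" by linarith
  then show ?thesis using MLeft False by (auto simp: shift_def enc_def)
 qed
qed (simp add: shift_def)

lemma length_shift: "length (shift d p) \<le> length p + 2"
 by (auto simp: shift_def)

lemma PF_shift: "PF f ==> PF g ==> PF (%x. shift (f x) (g x))"
proof -
 assume "PF f" "PF g"
 then have "PF (%x. if f x = [] then g x else if f x \<noteq> [] & hd (f x) then
    (if g x \<noteq> [] & hd (g x) then if tl (tl (g x)) = [] then [False] else True # tl (tl (g x)) else False # g x)
   else (if g x \<noteq> [] & hd (g x) then True # False # tl (g x) else if tl (g x) = [] then [True, False] else False # tl (tl (g x))))"
  by (intro PF_intros)
 then show ?thesis by (rule PF_cong) (simp add: shift_def)
qed

text \<open>A tape is stored as its head position together with the list of all writes, most recent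
 first, so that reading is a table lookup.\<close>

definition look :: "str => str => str" where
 "look k T = ssnd (sfst (seek (%e. sfst e = k) T))"

lemma look_pr: "look k (pr (pr j v) T) = (if j = k then v else look k T)"
 by (simp add: look_def seek_pr)

lemma look_Nil [simp]: "look k [] = []"
 by (simp add: look_def)

lemma PF_look: "PF f ==> PF g ==> PF (%x. look (f x) (g x))"
 unfolding look_def by (intro PF_ssnd PF_sfst PF_seek[where P = "%k e. sfst e = k"] PP_eq Fn_snd Fn_fst)

lemma look_bound: "look k T \<noteq> [] ==> length k \<le> length T"
proof -
 assume "look k T \<noteq> []"
 then have "seek (%e. sfst e = k) T \<noteq> []" by (auto simp: look_def)
 from seek_hit[OF this] have "length k = length (sfst (sfst (seek (%e. sfst e = k) T)))" by simp
 then show ?thesis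
  using length_sfst[of "sfst (seek (%e. sfst e = k) T)"] length_sfst[of "seek (%e. sfst e = k) T"] length_seek[of "%e. sfst e = k" T] by linarith
qed

definition rep_tape :: "str => (int => nat) \<times> int => bool" where
 "rep_tape s t \<longleftrightarrow> (\<exists>l. s = pr (enc (snd t)) l & (\<forall>i. look (enc i) l = U (fst t i)))"

definition wr :: "str => str => str" where
 "wr a s = pr (shift (ssnd a) (sfst s)) (pr (pr (sfst s) (sfst a)) (ssnd s))"

definition rd :: "str => str" where
 "rd s = look (sfst s) (ssnd s)"

lemma rd_rep: "rep_tape s t ==> rd s = U (fst t (snd t))"
 by (auto simp: rep_tape_def rd_def)

lemma wr_rep: "rep_tape s t ==> rep_tape (wr (pr (U w) (dir m)) s) (act (w, m) t)"
 by (cases t) (auto simp: rep_tape_def wr_def shift_enc look_pr)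

definition acode :: "nat \<times> move => str" where
 "acode a = pr (U (fst a)) (dir (snd a))"

lemma wr_acode: "rep_tape s t ==> rep_tape (wr (acode a) s) (act a t)"
 using wr_rep[of s t "fst a" "snd a"] by (simp add: acode_def)

definition icode :: "nat \<times> nat list \<times> nat \<times> (nat \<times> move) list => str" where
 "icode = (%(q, rs, q', as). pr (pr (U q) (lst (map U rs))) (pr (U q') (lst (map acode as))))"

definition mcode :: "machine => str" where
 "mcode M = pr (U (num_tapes M)) (lst (map icode (SOME is. set is = instrs M)))"

definition ckey :: "str => str => str" where
 "ckey c s = pr (sfst s) (lst (map (%i. rd (item (ssnd s) (U i))) [0..<length (sfst c)]))"

text \<open>The hint \<open>h\<close> selects among the applicable instructions. The empty hint
  accepts the first applicable one, and thereby also tests whether the configuration has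
  halted.\<close>

definition inst_at :: "str => str => str => str" where
 "inst_at c h s = seek (%e. sfst e = ckey c s & (h = [] \<or> e = h)) (ssnd c)"

definition apply_inst :: "str => str => str => str" where
 "apply_inst c e s = pr (sfst (ssnd e)) (lst (map (%i. wr (item (ssnd (ssnd e)) (U i)) (item (ssnd s) (U i))) [0..<length (sfst c)]))"

definition ustep :: "str => str => str => str" where
 "ustep c h s = (if inst_at c h s = [] then s else apply_inst c (sfst (inst_at c h s)) s)"

definition rep :: "machine => str => config => bool" where
 "rep M s c \<longleftrightarrow> (\<exists>ss. s = pr (U (fst c)) (lst ss) & length (snd c) = num_tapes M & list_all2 rep_tape ss (snd c))"

lemma lst_inj [simp]: "lst xs = lst ys \<longleftrightarrow> xs = ys"
proof (induction xs arbitrary: ys)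
 case Nil
 show ?case by (cases ys) simp_all
next
 case (Cons x xs)
 then show ?case by (cases ys) simp_all
qed

lemma map_U_inj [simp]: "map U xs = map U ys \<longleftrightarrow> xs = ys"
proof -
 have "inj U" by (metis injI length_replicate)
 then show ?thesis by (metis inj_map_eq_map)
qed

lemma map_item: "length xs = n ==> map (%i. f (item (lst xs) (U i))) [0..<n] = map f xs"
 by (rule nth_equalityI) (simp_all add: item_lst)

lemma map_item2: "length xs = n ==> length ys = n ==>
  map (%i. f (item (lst xs) (U i)) (item (lst ys) (U i))) [0..<n] = map2 f xs ys"
 by (rule nth_equalityI) (simp_all add: item_lst)

lemma ckey_rep:
 assumes "rep M s (q, ts)"
 shows "ckey (mcode M) s = pr (U q) (lst (map U (map (%(tp, h). tp h) ts)))"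
proof -
 obtain ss where ss: "s = pr (U q) (lst ss)" "length ts = num_tapes M" "list_all2 rep_tape ss ts"
  using assms unfolding rep_def by auto
 have "map rd ss = map U (map (%(tp, h). tp h) ts)" using ss(3)
  by (induction rule: list_all2_induct) (auto simp: rd_rep case_prod_unfold)
 moreover have "length ss = num_tapes M" using ss(2,3) list_all2_lengthD by metis
 ultimately show ?thesis unfolding ckey_def mcode_def ss(1) by (simp add: map_item)
qed

lemma mcode_table:
 assumes "TM M" obtains il where "set il = instrs M" "ssnd (mcode M) = lst (map icode il)"
proof -
 have "finite (instrs M)" using assms unfolding TM_def by blast
 then have "set (SOME is. set is = instrs M) = instrs M" using finite_list[of "instrs M"] by (metis (mono_tags, lifting) someI_ex)
 then show ?thesis by (intro that[of "SOME is. set is = instrs M"]) (simp_all add: mcode_def)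
qed

lemma apply_rep:
 assumes "rep M s (q, ts)" "length as = num_tapes M"
 shows "rep M (apply_inst (mcode M) (icode (q, rs, q', as)) s) (q', map2 act as ts)"
proof -
 obtain ss where ss: "s = pr (U q) (lst ss)" "length ts = num_tapes M" "list_all2 rep_tape ss ts"
  using assms(1) unfolding rep_def by auto
 have l: "length ss = num_tapes M" using ss(2,3) list_all2_lengthD by metis
 have "list_all2 rep_tape (map2 wr (map acode as) ss) (map2 act as ts)"
  using ss(2,3) l assms(2) by (auto simp: list_all2_conv_all_nth wr_acode)
 moreover have "apply_inst (mcode M) (icode (q, rs, q', as)) s = pr (U q') (lst (map2 wr (map acode as) ss))"
  unfolding apply_inst_def ss(1) by (simp add: icode_def mcode_def map_item2 l assms(2))
 ultimately show ?thesis unfolding rep_def using ss(2) assms(2) by auto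
qed

lemma key_rep:
 assumes "rep M s (q, ts)"
 shows "sfst (icode (q1, rs1, q', as)) = ckey (mcode M) s \<longleftrightarrow> q1 = q & rs1 = map (%(tp, h). tp h) ts"
 unfolding ckey_rep[OF assms] icode_def by (auto simp del: map_map dest: arg_cong[where f = length])

lemma ustep_cases:
 assumes "TM M" "rep M s (q, ts)"
 shows "inst_at (mcode M) h s = [] & (h = [] --> halted M (q, ts)) \<or>
  inst_at (mcode M) h s \<noteq> [] & (\<exists>c'. step M (q, ts) c' & rep M (ustep (mcode M) h s) c')"
proof -
 let ?P = "%h e. sfst e = ckey (mcode M) s & (h = [] \<or> e = h)"
 obtain il where il: "set il = instrs M" "ssnd (mcode M) = lst (map icode il)" by (rule mcode_table[OF assms(1)])
 let ?rs = "map (%(tp, h). tp h) ts"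
 note key = key_rep[OF assms(2)]
 have lenas: "length as = num_tapes M" if "(q1, rs1, q', as) \<in> instrs M" for q1 rs1 q' as
  using assms(1) that unfolding TM_def by auto
 have at: "inst_at (mcode M) h s = lst (dropWhile (%e. \<not> ?P h e) (map icode il))" for h
  unfolding inst_at_def il(2) seek_lst ..
 show "inst_at (mcode M) h s = [] & (h = [] --> halted M (q, ts)) \<or>
  inst_at (mcode M) h s \<noteq> [] & (\<exists>c'. step M (q, ts) c' & rep M (ustep (mcode M) h s) c')"
 proof (cases "dropWhile (%e. \<not> ?P h e) (map icode il)")
  case Nil
  have "halted M (q, ts)" if h: "h = []"
  proof -
   have n: "\<forall>i \<in> set il. sfst (icode i) \<noteq> ckey (mcode M) s" using Nil h by (auto simp: dropWhile_eq_Nil_conv)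
   have "\<not> step M (q, ts) c'" for c'
   proof
    assume "step M (q, ts) c'"
    then obtain q' as where "(q, ?rs, q', as) \<in> instrs M" unfolding step_def by auto
    then show False using n key[of q ?rs q' as] il(1) by blast
   qed
   then show ?thesis unfolding halted_def by blast
  qed
  moreover have "inst_at (mcode M) h s = []" unfolding at Nil by simp
  ultimately show ?thesis by blast
 next
  case (Cons e es)
  have "dropWhile (%e. \<not> ?P h e) (map icode il) \<noteq> []" unfolding Cons by simp
  from hd_dropWhile[OF this] have "?P h e" unfolding Cons list.sel by blast
  moreover have "e \<in> icode ` instrs M" using set_dropWhileD[of e "%e. \<not> ?P h e" "map icode il"] Cons il(1) by simp
  ultimately obtain i where i: "sfst (icode i) = ckey (mcode M) s" "e = icode i" "i \<in> instrs M" by blast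
  obtain q1 rs1 q' as where "i = (q1, rs1, q', as)" by (rule prod_cases4)
  with i key have e: "e = icode (q1, rs1, q', as)" "(q1, rs1, q', as) \<in> instrs M" "q1 = q" "rs1 = ?rs" by blast+
  have "step M (q, ts) (q', map2 act as ts)" using e unfolding step_def by blast
  moreover have "rep M (ustep (mcode M) h s) (q', map2 act as ts)"
   unfolding ustep_def at Cons e(1) using apply_rep[OF assms(2) lenas[OF e(2)], of rs1 q'] e(3) by simp
  moreover have "inst_at (mcode M) h s \<noteq> []" unfolding at Cons by simp
  ultimately show ?thesis by blast
 qed
qed

lemma ustep_complete:
 assumes "TM M" "step M (q, ts) c'"
 shows "\<exists>e. e \<noteq> [] & length e \<le> length (mcode M) & (\<forall>s. rep M s (q, ts) --> rep M (ustep (mcode M) e s) c')"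
proof -
 obtain il where il: "set il = instrs M" "ssnd (mcode M) = lst (map icode il)" by (rule mcode_table[OF assms(1)])
 let ?rs = "map (%(tp, h). tp h) ts"
 have lenas: "length as = num_tapes M" if "(q1, rs1, q', as) \<in> instrs M" for q1 rs1 q' as
  using assms(1) that unfolding TM_def by auto
 from assms(2) obtain q' as where a: "(q, ?rs, q', as) \<in> instrs M" "c' = (q', map2 act as ts)" unfolding step_def by auto
 let ?e = "icode (q, ?rs, q', as)"
 have ne: "?e \<noteq> []" by (simp add: icode_def)
 have mem: "?e \<in> set (map icode il)" using a(1) il(1) by auto
 have "rep M (ustep (mcode M) ?e s) c'" if s: "rep M s (q, ts)" for s
 proof -
  let ?P = "%e. sfst e = ckey (mcode M) s & (?e = [] \<or> e = ?e)"
  have P: "?P ?e" using key_rep[OF s] by blast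
  obtain e es where es: "dropWhile (%e. \<not> ?P e) (map icode il) = e # es"
  proof (cases "dropWhile (%e. \<not> ?P e) (map icode il)")
   case Nil
   then have "\<forall>e \<in> set (map icode il). \<not> ?P e" unfolding dropWhile_eq_Nil_conv .
   then show ?thesis using P mem by blast
  qed (use that in blast)
  then have "?P e" using hd_dropWhile[of "%e. \<not> ?P e" "map icode il"] by simp
  then have "e = ?e" using ne by blast
  then have at: "inst_at (mcode M) ?e s = pr ?e (lst es)" unfolding inst_at_def il(2) seek_lst es by simp
  show ?thesis
   unfolding ustep_def at a(2) using apply_rep[OF s lenas[OF a(1)], of ?rs q'] by simp
 qed
 moreover have "length ?e \<le> length (mcode M)"
 proof -
  have "length x \<le> length (lst xs)" if "x \<in> set xs" for x xs
   using that by (induction xs) auto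
  then have "length ?e \<le> length (ssnd (mcode M))" using mem unfolding il(2) by blast
  then show ?thesis using length_ssnd[of "mcode M"] by linarith
 qed
 ultimately show ?thesis using ne by blast
qed

text \<open>The index is tested and used only through \<open>U i\<close>, which is the form that
  \<open>PF_collect\<close> expects; tape 0 receives the input.\<close>

definition uinit :: "str => str => str" where
 "uinit c x = pr [] (lst (map (%i. pr (enc 0) (if U i = [] then lst (map (%j. pr (False # U j) (if sbit x (length (U j)) then U 2 else U 1)) [0..<length x]) else []))
   [0..<length (sfst c)]))"

fun urun :: "str => str => str => nat => str" where
 "urun c x w 0 = pr (uinit c x) w"
| "urun c x w (Suc n) = pr (ustep c (sfst (ssnd (urun c x w n))) (sfst (urun c x w n))) (ssnd (ssnd (urun c x w n)))"

lemma urun_w: "ssnd (urun c x w n) = (ssnd ^^ n) w"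
 by (induction n) simp_all

abbreviation ustate :: "str => str => str => nat => str" where
 "ustate c x w n \<equiv> sfst (urun c x w n)"

lemma look_input: "look (enc i) (lst (map (%j. pr (False # U j) (g j)) [m..<n])) =
  (if int m \<le> i & i < int n then g (nat i) else [])"
proof (induction "n - m" arbitrary: m)
 case (Suc k)
 then have m: "[m..<n] = m # [Suc m..<n]" by (simp add: upt_conv_Cons)
 have "False # U m = enc (int m)" by (simp add: enc_def)
 then show ?case using Suc.hyps(1)[of "Suc m"] Suc.hyps(2) unfolding m by (auto simp: look_pr)
qed auto

lemma rep_init: assumes "TM M" shows "rep M (uinit (mcode M) x) (start_config M x)"
proof -
 let ?k = "num_tapes M"
 have k: "?k \<ge> 1" using assms unfolding TM_def by blast
 let ?in = "lst (map (%j. pr (False # U j) (if sbit x (length (U j)) then U 2 else U 1)) [0..<length x])"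
 have "rep_tape (pr (enc 0) ?in) (input_tape x, 0)"
  unfolding rep_tape_def by (auto simp: look_input input_tape_def bit_symbol_def sbit_def nat_less_iff)
 moreover have "rep_tape (pr (enc 0) []) (%_. 0, 0)" unfolding rep_tape_def by simp
 ultimately have "list_all2 rep_tape (map (%i. pr (enc 0) (if U i = [] then ?in else [])) [0..<?k]) ((input_tape x, 0) # replicate (?k - 1) (%_. 0, 0))"
  using k by (auto simp: list_all2_conv_all_nth nth_Cons')
 then show ?thesis unfolding rep_def uinit_def start_config_def
  using k by (intro exI[of _ "map (%i. pr (enc 0) (if U i = [] then ?in else [])) [0..<?k]"]) (simp add: mcode_def)
qed

lemma urun_sound: assumes "TM M" shows "\<exists>c. (step M)\<^sup>*\<^sup>* (start_config M x) c & rep M (ustate (mcode M) x w n) c"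
proof (induction n)
 case 0
 show ?case using rep_init[OF assms, of x] by (intro exI[of _ "start_config M x"]) simp
next
 case (Suc n)
 then obtain q ts where c: "(step M)\<^sup>*\<^sup>* (start_config M x) (q, ts)" "rep M (ustate (mcode M) x w n) (q, ts)" by auto
 let ?h = "sfst (ssnd (urun (mcode M) x w n))"
 have s: "ustate (mcode M) x w (Suc n) = ustep (mcode M) ?h (ustate (mcode M) x w n)" by simp
 from ustep_cases(1)[OF assms c(2), of ?h] show ?case unfolding s
 proof
  assume "inst_at (mcode M) ?h (ustate (mcode M) x w n) = [] & (?h = [] --> halted M (q, ts))"
  then have "ustep (mcode M) ?h (ustate (mcode M) x w n) = ustate (mcode M) x w n" by (simp add: ustep_def)
  then show "\<exists>c. (step M)\<^sup>*\<^sup>* (start_config M x) c & rep M (ustep (mcode M) ?h (ustate (mcode M) x w n)) c" using c by auto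
 next
  assume "inst_at (mcode M) ?h (ustate (mcode M) x w n) \<noteq> [] & (\<exists>c'. step M (q, ts) c' & rep M (ustep (mcode M) ?h (ustate (mcode M) x w n)) c')"
  then show "\<exists>c. (step M)\<^sup>*\<^sup>* (start_config M x) c & rep M (ustep (mcode M) ?h (ustate (mcode M) x w n)) c"
   using c(1) by (meson rtranclp.rtrancl_into_rtrancl)
 qed
qed

lemma halted_ustep:
 assumes "TM M" "rep M s c" "halted M c" shows "ustep (mcode M) h s = s" "inst_at (mcode M) [] s = []"
 using ustep_cases(1)[OF assms(1), of s "fst c" "snd c"] assms(2,3) unfolding halted_def ustep_def by (metis prod.collapse)+

lemma halted_ustate:
 assumes "TM M" "rep M (ustate (mcode M) x w n) c" "halted M c" "n \<le> m"
 shows "rep M (ustate (mcode M) x w m) c"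
 using assms(4) by (induction m rule: dec_induct) (use assms(2) halted_ustep(1)[OF assms(1) _ assms(3)] in simp_all)

text \<open>Hints are appended at the end in the induction, so the claim must hold for every
  continuation \<open>r\<close> of the hint list.\<close>

lemma urun_complete:
 assumes "TM M" "(step M ^^ n) (start_config M x) c"
 shows "\<exists>hs. length hs = n & (\<forall>h \<in> set hs. h \<noteq> [] & length h \<le> length (mcode M)) &
  (\<forall>r. rep M (ustate (mcode M) x (lst (hs @ r)) n) c)"
 using assms(2)
proof (induction n arbitrary: c)
 case 0
 then have "c = start_config M x" by simp
 then show ?case using rep_init[OF assms(1), of x] by (intro exI[of _ "[]"]) simp
next
 case (Suc n)
 then obtain q ts where c: "(step M ^^ n) (start_config M x) (q, ts)" "step M (q, ts) c" by auto
 from Suc.IH[OF c(1)] obtain hs where hs: "length hs = n" "\<forall>h \<in> set hs. h \<noteq> [] & length h \<le> length (mcode M)"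
  "\<forall>r. rep M (ustate (mcode M) x (lst (hs @ r)) n) (q, ts)" by blast
 obtain e where e: "e \<noteq> []" "length e \<le> length (mcode M)" "\<forall>s. rep M s (q, ts) --> rep M (ustep (mcode M) e s) c"
  using ustep_complete[OF assms(1) c(2)] by blast
 have "rep M (ustate (mcode M) x (lst ((hs @ [e]) @ r)) (Suc n)) c" for r
 proof -
  have "sfst (ssnd (urun (mcode M) x (lst (hs @ e # r)) n)) = e" unfolding urun_w ssnd_lst using hs(1) by simp
  then show ?thesis using hs(3)[rule_format, of "e # r"] e(3) by simp
 qed
 then show ?case using hs(1,2) e(1,2) by (intro exI[of _ "hs @ [e]"]) auto
qed

lemma urun_deterministic:
 assumes "TM M" "deterministic M" "(step M ^^ n) (start_config M x) c"
 shows "rep M (ustate (mcode M) x (U L) n) c"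
 using assms(3)
proof (induction n arbitrary: c)
 case 0
 then have "c = start_config M x" by simp
 then show ?case using rep_init[OF assms(1), of x] by simp
next
 case (Suc n)
 then obtain q ts where c: "(step M ^^ n) (start_config M x) (q, ts)" "step M (q, ts) c" by auto
 have h: "sfst (ssnd (urun (mcode M) x (U L) n)) = []"
 proof -
  have "sfst (U k) = []" "ssnd (U k) = U (k - 1)" for k
   using sfst_split[of 0 "U (k - 1)"] ssnd_split[of 0 "U (k - 1)"] by (cases k; simp)+
  then have "\<exists>k. (ssnd ^^ n) (U L) = U k" by (induction n) auto
  then show ?thesis unfolding urun_w using \<open>\<And>k. sfst (U k) = []\<close> by auto
 qed
 have uniq: "c1 = c" if "step M (q, ts) c1" for c1
  using that c(2) assms(2) unfolding step_def deterministic_def by blast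
 have "\<not> halted M (q, ts)" using c(2) unfolding halted_def by blast
 then obtain c1 where "step M (q, ts) c1" "rep M (ustep (mcode M) [] (ustate (mcode M) x (U L) n)) c1"
  using ustep_cases(1)[OF assms(1) Suc.IH[OF c(1)], of "[]"] by blast
 then show ?case using uniq h by simp
qed

definition ulen :: "str => nat" where
 "ulen l = (LEAST i. look (False # U i) l = [])"

definition uread :: "str => str" where
 "uread l = map (%i. look (False # U i) l = U 2) [0..<ulen l]"

text \<open>A key longer than the table cannot occur in it. This bounds the search for the first
  blank.\<close>

lemma look_end: "look (False # U (length l)) l = []"
 using look_bound[of "False # U (length l)" l] by fastforce

lemma PF_boolean_cons: "PP P ==> PF f ==> PF (%x. P x # f x)"
 by (rule PF_cong[of "%x. if P x then True # f x else False # f x"]) (auto intro: PF_if PF_cons)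

lemma PF_uread: assumes "PF f" shows "PF (%x. uread (f x))"
proof -
 have P: "PP (%x. look (False # ssnd x) (sfst x) = [])" by (intro PP_eq_Nil PF_look PF_cons Fn_fst Fn_snd)
 let ?m = "%x. if \<exists>i < length (False # f x). look (False # U i) (f x) = [] then True # U (LEAST i. look (False # U i) (f x) = []) else []"
 have m: "PF ?m" by (rule PF_least[OF P assms PF_cons[OF assms]])
 have len: "length (tl (?m x)) = ulen (f x)" for x
 proof -
  have "\<exists>i < length (False # f x). look (False # U i) (f x) = []" using look_end[of "f x"] by (intro exI[of _ "length (f x)"]) simp
  then show ?thesis by (simp only: if_True list.sel length_replicate ulen_def)
 qed
 define r where "r l n = rev (map (%i. look (False # U i) l = U 2) [0..<n])" for l n
 have H: "PF (%x. (look (False # sfst (ssnd x)) (sfst x) = U 2) # ssnd (ssnd x))"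
  by (intro PF_boolean_cons PP_eq PF_look PF_intros Fn_fst Fn_snd)
 have "PF (%x. r (f x) (length (tl (?m x))))"
  by (rule PF_rec_linear[where r = r and g = "%_. []" and K = 1 and H = "%c u w. (look (False # u) c = U 2) # w",
   OF _ _ PF_const H _ assms PF_tl[OF m]]) (simp_all add: r_def)
 then have "PF (%x. rev (r (f x) (length (tl (?m x)))))" by (rule PF_rev)
 then show ?thesis by (rule PF_cong) (simp only: len r_def uread_def rev_rev_ident)
qed

definition uout :: "str => str" where
 "uout s = uread (ssnd (sfst (ssnd s)))"

text \<open>The string \<open>w\<close> is clock and oracle at once: its length is the number of
  steps, and read as a list it provides the hints. For \<open>w = U L\<close> all hints are empty.
  Results of halted runs are pairs, hence nonempty, and \<open>[]\<close> reports a run that has not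
  halted in time.\<close>

definition UM :: "str => str => str => str" where
 "UM c x w = (if inst_at c [] (ustate c x w (length w)) = []
   then pr (sfst (ustate c x w (length w))) (uout (ustate c x w (length w))) else [])"

lemma uout_rep:
 assumes "TM M" "rep M s c" "has_output c y" shows "uout s = y"
proof -
 obtain ss where ss: "s = pr (U (fst c)) (lst ss)" "length (snd c) = num_tapes M" "list_all2 rep_tape ss (snd c)"
  using assms(2) unfolding rep_def by blast
 have "num_tapes M \<ge> 1" using assms(1) unfolding TM_def by blast
 then obtain s1 ss1 t ts where st: "ss = s1 # ss1" "snd c = t # ts" "rep_tape s1 t"
  using ss(2,3) by (cases ss; cases "snd c") auto
 then obtain l where l: "s1 = pr (enc (snd t)) l" "\<And>i. look (enc i) l = U (fst t i)" unfolding rep_tape_def by blast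
 have o: "\<forall>i < length y. fst t (int i) = bit_symbol (y ! i)" "fst t (int (length y)) = 0"
  using assms(3) st(2) unfolding has_output_def Let_def by simp_all
 have k: "look (False # U i) l = U (fst t (int i))" for i using l(2)[of "int i"] by (simp add: enc_def)
 have n: "ulen l = length y" unfolding ulen_def
 proof (rule Least_equality)
  show "look (False # U (length y)) l = []" using k o(2) by simp
  fix i assume "look (False # U i) l = []"
  then have "fst t (int i) = 0" using k[of i] by simp
  note z = this
  show "length y \<le> i"
  proof (rule ccontr)
   assume "\<not> length y \<le> i"
   then have "bit_symbol (y ! i) = 0" using o(1) z by simp
   then show False by (simp add: bit_symbol_def split: if_splits)
  qed
 qed
 have "uread l = y"
 proof (rule nth_equalityI)
  show "length (uread l) = length y" by (simp add: uread_def n)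
  fix i assume "i < length (uread l)"
  then have i: "i < length y" by (simp add: uread_def n)
  have "U (bit_symbol (y ! i)) = U 2 \<longleftrightarrow> y ! i"
   by (metis bit_symbol_def length_replicate num.distinct(1) one_eq_numeral_iff)
  then show "uread l ! i = y ! i" using i o(1) k[of i] by (simp add: uread_def n)
 qed
 then show ?thesis unfolding uout_def ss(1) st(1) l(1) by simp
qed

lemma UM_sound:
 assumes "TM M" "UM (mcode M) x w \<noteq> []"
 shows "\<exists>c. (step M)\<^sup>*\<^sup>* (start_config M x) c & halted M c & sfst (UM (mcode M) x w) = U (fst c) &
  (\<forall>y. has_output c y --> ssnd (UM (mcode M) x w) = y)"
proof -
 let ?s = "ustate (mcode M) x w (length w)"
 obtain q ts where c: "(step M)\<^sup>*\<^sup>* (start_config M x) (q, ts)" "rep M ?s (q, ts)" using urun_sound[OF assms(1)] by (metis prod.collapse)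
 have i: "inst_at (mcode M) [] ?s = []" using assms(2) unfolding UM_def by (auto split: if_splits)
 then have "halted M (q, ts)" using ustep_cases[OF assms(1) c(2), of "[]"] by blast
 moreover have "UM (mcode M) x w = pr (sfst ?s) (uout ?s)" unfolding UM_def using i by (rule if_P)
 moreover have "sfst ?s = U q" using c(2) unfolding rep_def by auto
 ultimately show ?thesis using c uout_rep[OF assms(1) c(2)] by (intro exI[of _ "(q, ts)"]) simp
qed

lemma UM_halted:
 assumes "TM M" "rep M (ustate (mcode M) x w n) c" "halted M c" "n \<le> length w"
 shows "\<exists>o'. UM (mcode M) x w = pr (U (fst c)) o' & (\<forall>y. has_output c y --> o' = y)"
proof -
 let ?s = "ustate (mcode M) x w (length w)"
 have r: "rep M ?s c" by (rule halted_ustate[OF assms])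
 have "UM (mcode M) x w = pr (sfst ?s) (uout ?s)" unfolding UM_def using halted_ustep(2)[OF assms(1) r assms(3)] by (rule if_P)
 moreover have "sfst ?s = U (fst c)" using r unfolding rep_def by auto
 ultimately show ?thesis using uout_rep[OF assms(1) r] by auto
qed

lemma UM_complete:
 assumes "TM M" "(step M ^^ n) (start_config M x) c" "halted M c"
 shows "\<exists>w o'. length w \<le> n * (2 * length (mcode M) + 1) & UM (mcode M) x w = pr (U (fst c)) o'"
proof -
 obtain hs where hs: "length hs = n" "\<forall>h \<in> set hs. h \<noteq> [] & length h \<le> length (mcode M)"
  "\<forall>r. rep M (ustate (mcode M) x (lst (hs @ r)) n) c" using urun_complete[OF assms(1,2)] by blast
 have "length xs \<le> length (lst xs) & ((\<forall>h \<in> set xs. length h \<le> m) --> length (lst xs) \<le> length xs * (2 * m + 1))" for xs m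
  by (induction xs) auto
 then have l: "n \<le> length (lst hs)" "length (lst hs) \<le> n * (2 * length (mcode M) + 1)" using hs(1,2) by blast+
 have "rep M (ustate (mcode M) x (lst hs) n) c" using hs(3)[rule_format, of "[]"] by simp
 from UM_halted[OF assms(1) this assms(3) l(1)] show ?thesis using l(2) by blast
qed

lemma UM_deterministic:
 assumes "TM M" "deterministic M" "(step M ^^ n) (start_config M x) c" "halted M c" "n \<le> L"
 shows "\<exists>o'. UM (mcode M) x (U L) = pr (U (fst c)) o' & (\<forall>y. has_output c y --> o' = y)"
 by (rule UM_halted[OF assms(1) urun_deterministic[OF assms(1-3)] assms(4)]) (simp add: assms(5))

lemma PF_ckey: "PF c ==> PF s ==> PF (%x. ckey (c x) (s x))"
 unfolding ckey_def rd_def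
 by (intro Fn_pair PF_sfst PF_ssnd PF_collect[where f = "%s u. look (sfst (item s u)) (ssnd (item s u))"] PF_look PF_itemf Fn_fst Fn_snd)

lemma PF_inst_at: assumes "PF c" "PF h" "PF s" shows "PF (%x. inst_at (c x) (h x) (s x))"
proof -
 have "PF (%x. seek ((%a e. sfst e = sfst a & (ssnd a = [] \<or> e = ssnd a)) (pr (ckey (c x) (s x)) (h x))) (ssnd (c x)))"
  by (rule PF_seek) (intro PP_conj PP_disj PP_eq PP_eq_Nil PF_intros PF_ckey assms Fn_fst Fn_snd)+
 then show ?thesis by (simp add: inst_at_def)
qed

lemma PF_wr: "PF f ==> PF g ==> PF (%x. wr (f x) (g x))"
 unfolding wr_def by (intro Fn_pair PF_shift PF_sfst PF_ssnd)

lemma PF_apply: assumes "PF c" "PF e" "PF s" shows "PF (%x. apply_inst (c x) (e x) (s x))"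
proof -
 have "PF (%x. lst (map (%i. (%a u. wr (item (ssnd (ssnd (sfst a))) u) (item (ssnd (ssnd a)) u)) (pr (e x) (s x)) (U i)) [0..<length (sfst (c x))]))"
  by (rule PF_collect) (intro PF_wr PF_itemf PF_intros assms Fn_fst Fn_snd)+
 then show ?thesis unfolding apply_inst_def by (intro Fn_pair PF_sfst PF_ssnd assms) simp
qed

lemma PF_ustep: "PF c ==> PF h ==> PF s ==> PF (%x. ustep (c x) (h x) (s x))"
 unfolding ustep_def by (intro PF_if PP_eq_Nil PF_inst_at PF_apply PF_sfst)

lemma PF_uinit: assumes "PF c" "PF f" shows "PF (%x. uinit (c x) (f x))"
proof -
 have 1: "PF (%x. lst (map (%j. (%a u. pr (False # u) (if sbit a (length u) then U 2 else U 1)) (f x) (U j)) [0..<length (f x)]))" if "PF f" for f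
  by (rule PF_collect) (intro PF_intros that PP_bit Fn_fst Fn_snd)+
 have "PF (%x. lst (map (%i. (%a u. pr (enc 0) (if u = [] then lst (map (%j. (%a u. pr (False # u) (if sbit a (length u) then U 2 else U 1)) a (U j)) [0..<length a]) else [])) (f x) (U i)) [0..<length (sfst (c x))]))"
  by (rule PF_collect) (intro PF_intros 1 assms Fn_fst Fn_snd)+
 then show ?thesis unfolding uinit_def by (intro Fn_pair PF_const) simp
qed

text \<open>This size invariant holds for arbitrary strings \<open>c\<close>, not only for codes of
  machines: states are copied out of \<open>c\<close>, head positions grow by at most 2 per step,
  and each write adds one bounded entry to the log of a tape.\<close>

definition fits :: "str => nat => nat => str => bool" where
 "fits c m k s \<longleftrightarrow> (\<exists>q ts. s = pr q (lst ts) & length q \<le> length c & length ts = length (sfst c) &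
   (\<forall>t \<in> set ts. \<exists>p l. t = pr p l & length p \<le> m & length l \<le> k))"

lemma fits_mono: "fits c m k s ==> m \<le> m' ==> k \<le> k' ==> fits c m' k' s"
proof -
 assume "fits c m k s" and m: "m \<le> m'" "k \<le> k'"
 then obtain q ts where s: "s = pr q (lst ts)" "length q \<le> length c" "length ts = length (sfst c)"
  "\<forall>t \<in> set ts. \<exists>p l. t = pr p l & length p \<le> m & length l \<le> k" unfolding fits_def by blast
 have "\<forall>t \<in> set ts. \<exists>p l. t = pr p l & length p \<le> m' & length l \<le> k'" using s(4) m by (meson order_trans)
 then show ?thesis unfolding fits_def using s(1-3) by blast
qed

lemma fits_length: assumes "fits c m k s" shows "length s \<le> 2 * length c + 1 + length c * (2 * (2 * m + 1 + k) + 1)"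
proof -
 obtain q ts where s: "s = pr q (lst ts)" "length q \<le> length c" "length ts = length (sfst c)"
  "\<forall>t \<in> set ts. \<exists>p l. t = pr p l & length p \<le> m & length l \<le> k" using assms unfolding fits_def by blast
 have "length t \<le> 2 * m + 1 + k" if "t \<in> set ts" for t using s(4) that by fastforce
 then have "length (lst ts) \<le> length ts * (2 * (2 * m + 1 + k) + 1)" by (rule length_lst_le)
 also have "\<dots> \<le> length c * (2 * (2 * m + 1 + k) + 1)" using s(3) length_sfst[of c] by (intro mult_right_mono) auto
 finally show ?thesis using s(1,2) by simp
qed

lemma length_item: "length (item w u) \<le> length w"
 unfolding item_def using length_sfst length_ssnd_funpow order_trans by blast

lemma fits_ustep: assumes "fits c m k s" shows "fits c (m + 2) (k + 4 * m + 2 * length c + 3) (ustep c h s)"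
proof (cases "inst_at c h s = []")
 case True
 have "fits c (m + 2) (k + 4 * m + 2 * length c + 3) s" by (rule fits_mono[OF assms]) auto
 then show ?thesis using True by (simp add: ustep_def)
next
 case False
 let ?e = "sfst (inst_at c h s)"
 obtain q ts where s: "s = pr q (lst ts)" "length q \<le> length c" "length ts = length (sfst c)"
  "\<forall>t \<in> set ts. \<exists>p l. t = pr p l & length p \<le> m & length l \<le> k" using assms unfolding fits_def by blast
 have e: "length ?e \<le> length c"
  using length_sfst[of "inst_at c h s"] length_seek[of _ "ssnd c"] length_ssnd[of c] unfolding inst_at_def by (meson order_trans)
 let ?ts = "map (%i. wr (item (ssnd (ssnd ?e)) (U i)) (ts ! i)) [0..<length (sfst c)]"
 have "ustep c h s = pr (sfst (ssnd ?e)) (lst ?ts)" using False s(3)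
  by (auto simp: ustep_def apply_inst_def s(1) item_lst intro!: arg_cong[where f = lst])
 moreover have "length (sfst (ssnd ?e)) \<le> length c" using e length_sfst[of "ssnd ?e"] length_ssnd[of ?e] by linarith
 moreover have "\<exists>p l. t = pr p l & length p \<le> m + 2 & length l \<le> k + 4 * m + 2 * length c + 3" if t: "t \<in> set ?ts" for t
 proof -
  obtain i where i: "i < length (sfst c)" "t = wr (item (ssnd (ssnd ?e)) (U i)) (ts ! i)" using t by auto
  then obtain p l where p: "ts ! i = pr p l" "length p \<le> m" "length l \<le> k" using s(3,4) nth_mem by metis
  let ?a = "item (ssnd (ssnd ?e)) (U i)"
  have "length (sfst ?a) \<le> length c"
   using e length_sfst[of ?a] length_item[of "ssnd (ssnd ?e)" "U i"] length_ssnd[of "ssnd ?e"] length_ssnd[of ?e] by linarith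
  then show ?thesis unfolding i(2) p(1) wr_def using p(2,3) length_shift[of "ssnd ?a" p] by (intro exI conjI) auto
 qed
 ultimately show ?thesis unfolding fits_def by (intro exI[of _ "sfst (ssnd ?e)"] exI[of _ ?ts] conjI) auto
qed

lemma fits_urun: "n \<le> N ==> fits c (2 * n + 1) (length x * (4 * length x + 16) + n * (8 * N + 2 * length c + 7)) (ustate c x w n)"
proof (induction n)
 case 0
 let ?in = "lst (map (%j. pr (False # U j) (if sbit x (length (U j)) then U 2 else U 1)) [0..<length x])"
 have "length ?in \<le> length (map (%j. pr (False # U j) (if sbit x (length (U j)) then U 2 else U 1)) [0..<length x]) * (2 * (2 * length x + 5) + 1)"
  by (rule length_lst_le) auto
 also have "\<dots> \<le> length x * (4 * length x + 16)" by simp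
 finally have "length ?in \<le> length x * (4 * length x + 16)" .
 then show ?case unfolding fits_def urun.simps sfst_pr uinit_def
  by (intro exI[of _ "[]"] exI conjI refl) (auto simp: length_enc)
next
 case (Suc n)
 let ?h = "sfst (ssnd (urun c x w n))"
 have "fits c (2 * n + 1 + 2) (length x * (4 * length x + 16) + n * (8 * N + 2 * length c + 7) + 4 * (2 * n + 1) + 2 * length c + 3) (ustep c ?h (ustate c x w n))"
  using Suc by (intro fits_ustep) simp
 then show ?case unfolding urun.simps sfst_pr by (rule fits_mono) (use Suc.prems in auto)
qed

lemma PF_UM: assumes "PF c" "PF f" "PF g" shows "PF (%x. UM (c x) (f x) (g x))"
proof -
 define r where "r z n = urun (sfst z) (sfst (ssnd z)) (ssnd (ssnd z)) n" for z n
 have "PF (%x. r (pr (c x) (pr (f x) (g x))) (length (g x)))"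
 proof (rule PF_rec[where r = r and g = "%z. pr (uinit (sfst z) (sfst (ssnd z))) (ssnd (ssnd z))" and
   H = "%z u v. pr (ustep (sfst z) (sfst (ssnd v)) (sfst v)) (ssnd (ssnd v))"])
  let ?B = "%l n. 2 * (2 * l + 1 + l * (2 * (2 * (2 * n + 1) + 1 + (l * (4 * l + 16) + n * (8 * n + 2 * l + 7))) + 1)) + l + 1"
  have "pb (%(c :: str, n). ?B (length c) n) (%(c, n). length c + n)"
   unfolding case_prod_unfold by (intro pb_intros pb_le) auto
  then show "pb (%(c, n). length (r c n)) (%(c, n). length c + n)"
  proof (rule pb_mono, clarify)
   fix z :: str and n
   let ?c = "sfst z" and ?x = "sfst (ssnd z)" and ?w = "ssnd (ssnd z)"
   have l: "length ?c \<le> length z" "length ?x \<le> length z" "length ?w \<le> length z"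
    using length_sfst[of z] length_sfst[of "ssnd z"] length_ssnd[of z] length_ssnd[of "ssnd z"] by linarith+
   have "length (ustate ?c ?x ?w n) \<le> 2 * length ?c + 1 + length ?c * (2 * (2 * (2 * n + 1) + 1 + (length ?x * (4 * length ?x + 16) + n * (8 * n + 2 * length ?c + 7))) + 1)"
    by (rule fits_length[OF fits_urun]) simp
   also have "\<dots> \<le> 2 * length z + 1 + length z * (2 * (2 * (2 * n + 1) + 1 + (length z * (4 * length z + 16) + n * (8 * n + 2 * length z + 7))) + 1)"
    using l by (intro add_mono mult_mono) auto
   finally have s: "length (ustate ?c ?x ?w n) \<le> \<dots>" .
   have w: "length (ssnd (urun ?c ?x ?w n)) \<le> length z" unfolding urun_w using length_ssnd_funpow[of n ?w] l(3) by linarith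
   have "urun ?c ?x ?w n = pr (ustate ?c ?x ?w n) (ssnd (urun ?c ?x ?w n))" by (cases n) simp_all
   then have eq: "length (urun ?c ?x ?w n) = 2 * length (ustate ?c ?x ?w n) + length (ssnd (urun ?c ?x ?w n)) + 1"
    by (metis length_pr)
   show "length (r z n) \<le> ?B (length z) n" unfolding r_def eq by (intro add_mono mult_le_mono2 s w order_refl)
  qed
 qed (auto simp: r_def intro!: PF_uinit PF_ustep Fn_pair PF_sfst PF_ssnd assms Fn_fst Fn_snd)
 then have "PF (%x. urun (c x) (f x) (g x) (length (g x)))" by (simp add: r_def)
 then show ?thesis unfolding UM_def uout_def
  by (intro PF_if PP_eq_Nil PF_inst_at PF_uread PF_intros assms)
qed

section \<open>Evaluation of propositional formulas\<close>

lemma last_bits: "n \<noteq> 0 ==> last (bits n)"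
proof (induction n rule: less_induct)
 case (less n)
 show ?case
 proof (cases "n div 2 = 0")
  case True
  then have "n = 1" using less.prems by auto
  then show ?thesis by (simp add: bits.simps)
 next
  case False
  then have "last (bits (n div 2))" using less.prems by (intro less.IH) auto
  then show ?thesis using less.prems False by (simp add: bits.simps[of n])
 qed
qed

lemma bits_canonical: "bs = [] \<or> last bs ==> bits (val bs) = bs"
proof (induction bs)
 case (Cons b bs)
 show ?case
 proof (cases bs)
  case Nil
  then show ?thesis using Cons.prems by (simp add: bits.simps)
 next
  case (Cons c cs)
  then have "last bs" using Cons.prems by simp
  then have IH: "bits (val bs) = bs" using Cons.IH by simp
  then have "val bs \<noteq> 0" using Cons by (metis bits_eq_Nil list.distinct(1))
  then show ?thesis using IH bits_Cons[of b "val bs"] by simp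
 qed
qed simp

text \<open>A truth assignment is given by the list of the codes of its true atoms.\<close>

definition asgs :: "str => str => bool" where
 "asgs v a \<longleftrightarrow> seek (%e. e = a) v \<noteq> []"

abbreviation asg :: "str => nat => bool" where
 "asg v i \<equiv> asgs v (bits i)"

definition hb :: "str => bool" where
 "hb x \<longleftrightarrow> x \<noteq> [] & hd x"

lemma hb_Cons [simp]: "hb (b # x) = b"
 by (simp add: hb_def)

abbreviation pk :: "str => str => str => str" where
 "pk r K m \<equiv> pr r (pr K m)"

text \<open>A state consists of the unread input, a stack of pending operations and a mode: \<open>[]\<close> reads
 a formula, \<open>False # acc\<close> reads an atom whose bits so far are \<open>rev acc\<close>, and \<open>[True, b]\<close>
 returns the value \<open>b\<close>. A stack frame \<open>[True, p, q]\<close> is the function \<open>\<lambda>c. if c then p else q\<close>,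
 and \<open>[False, d, d]\<close> a conjunction (\<open>d = False\<close>) or disjunction that waits for its first
 operand.\<close>

definition est3 :: "str => str => str => str => str => str" where
 "est3 v s r K m =
  (if m = [] then
    if r = [] \<or> tl r = [] then s
    else if hb r then pk (tl (tl r)) (False # hb (tl r) # hb (tl r) # K) []
    else if hb (tl r) then pk (tl (tl r)) (True # False # True # K) []
    else pk (tl (tl r)) K [False]
   else if hb m then
    if K = [] then s
    else if hb K then pk r (tl (tl (tl K))) (True # (if hb (tl m) then hb (tl K) else hb (tl (tl K))) # [])
    else pk r (True # (hb (tl K) \<or> hb (tl m)) # (hb (tl K) & hb (tl m)) # tl (tl (tl K))) []
   else
    if r = [] then s
    else if hb r then if tl r = [] then s else pk (tl (tl r)) K (False # hb (tl r) # tl m)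
    else if tl m = [] \<or> hb (tl m) then pk (tl r) K (True # asgs v (rev (tl m)) # []) else s)"

definition est :: "str => str => str" where
 "est v s = est3 v s (sfst s) (sfst (ssnd s)) (ssnd (ssnd s))"

lemma est_simps:
 "est v (pk (True # d # r) K []) = pk r (False # d # d # K) []"
 "est v (pk (False # True # r) K []) = pk r (True # False # True # K) []"
 "est v (pk (False # False # r) K []) = pk r K [False]"
 "est v (pk (True # b # r) K (False # acc)) = pk r K (False # b # acc)"
 "acc = [] \<or> hd acc ==> est v (pk (False # r) K (False # acc)) = pk r K [True, asgs v (rev acc)]"
 "est v (pk r (True # p # q # K) [True, b]) = pk r K [True, if b then p else q]"
 "est v (pk r (False # d # d' # K) [True, b]) = pk r (True # (d \<or> b) # (d & b) # K) []"
 by (auto simp: est_def est3_def hb_def)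

text \<open>The final state is a fixed point, so that iterating too long is harmless. The other
  fixed points are malformed inputs, which for this reason never reach acceptance.\<close>

lemma est_stuck:
 "est v (pk [] K []) = pk [] K []" "est v (pk [b] K []) = pk [b] K []"
 "est v (pk r [] [True, c]) = pk r [] [True, c]"
 "est v (pk [] K (False # acc)) = pk [] K (False # acc)" "est v (pk [True] K (False # acc)) = pk [True] K (False # acc)"
 "\<not> (acc = [] \<or> hd acc) ==> est v (pk (False # r) K (False # acc)) = pk (False # r) K (False # acc)"
 by (auto simp: est_def est3_def hb_def)

lemma funpow_fixed: "f x = x ==> (f ^^ n) x = x"
 by (induction n) simp_all

lemma funpow_Suc_apply: "(f ^^ Suc n) x = (f ^^ n) (f x)"
 by (simp add: funpow_swap1)

abbreviation acode_bits :: "str => str" where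
 "acode_bits bs \<equiv> concat (map (%b. [True, b]) bs)"

lemma est_atom: "(est v ^^ length bs) (pk (acode_bits bs @ r) K (False # acc)) = pk r K (False # rev bs @ acc)"
proof (induction bs arbitrary: acc)
 case (Cons b bs)
 show ?case unfolding length_Cons funpow_Suc_apply using Cons.IH[of "b # acc"] by (simp add: est_simps)
qed simp

lemma length_acode: "length (acode_bits bs) = 2 * length bs"
 by (induction bs) simp_all

lemma est_complete:
 "\<exists>n \<le> 2 * length (encode A). (est v ^^ n) (pk (encode A @ r) K []) = pk r K [True, psat (asg v) A]"
proof (induction A arbitrary: r K)
 case (Atom i)
 have l: "rev (bits i) = [] \<or> hd (rev (bits i))" using last_bits[of i] by (cases "i = 0") (simp_all add: hd_rev)
 have "(est v ^^ Suc (length (bits i) + 1)) (pk (encode (Atom i) @ r) K []) = (est v ^^ (1 + length (bits i))) (pk (acode_bits (bits i) @ (False # r)) K (False # []))"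
  unfolding funpow_Suc_apply by (simp add: est_simps add.commute)
 also have "\<dots> = est v (pk (False # r) K (False # rev (bits i) @ []))"
  unfolding funpow_add comp_def est_atom by simp
 also have "\<dots> = pk r K [True, psat (asg v) (Atom i)]" using est_simps(5)[of "rev (bits i)" v r K] l by simp
 finally show ?case by (intro exI[of _ "Suc (length (bits i) + 1)"]) (simp add: length_acode)
next
 case (PNot A)
 obtain n where n: "n \<le> 2 * length (encode A)" "(est v ^^ n) (pk (encode A @ r) (True # False # True # K) []) = pk r (True # False # True # K) [True, psat (asg v) A]"
  using PNot by blast
 have "(est v ^^ (Suc (Suc n))) (pk (encode (PNot A) @ r) K []) = est v ((est v ^^ n) (est v (pk (False # True # encode A @ r) K [])))"
  by (simp add: funpow_swap1)
 also have "\<dots> = pk r K [True, psat (asg v) (PNot A)]" unfolding est_simps n(2) by simp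
 finally show ?case using n(1) by (intro exI[of _ "Suc (Suc n)"]) simp
next
 case (PAnd A B)
 obtain n where n: "n \<le> 2 * length (encode A)" "(est v ^^ n) (pk (encode A @ encode B @ r) (False # False # False # K) []) = pk (encode B @ r) (False # False # False # K) [True, psat (asg v) A]"
  using PAnd(1) by blast
 obtain m where m: "m \<le> 2 * length (encode B)" "(est v ^^ m) (pk (encode B @ r) (True # (False \<or> psat (asg v) A) # (False & psat (asg v) A) # K) []) = pk r (True # (False \<or> psat (asg v) A) # (False & psat (asg v) A) # K) [True, psat (asg v) B]"
  using PAnd(2) by blast
 have "(est v ^^ (1 + (m + (1 + (n + 1))))) (pk (encode (PAnd A B) @ r) K []) = est v ((est v ^^ m) (est v ((est v ^^ n) (est v (pk (True # False # encode A @ encode B @ r) K [])))))"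
  unfolding funpow_add by simp
 also have "\<dots> = pk r K [True, psat (asg v) (PAnd A B)]" unfolding est_simps n(2) m(2) by simp
 finally show ?case using n(1) m(1) by (intro exI[of _ "1 + (m + (1 + (n + 1)))"]) simp
next
 case (POr A B)
 obtain n where n: "n \<le> 2 * length (encode A)" "(est v ^^ n) (pk (encode A @ encode B @ r) (False # True # True # K) []) = pk (encode B @ r) (False # True # True # K) [True, psat (asg v) A]"
  using POr(1) by blast
 obtain m where m: "m \<le> 2 * length (encode B)" "(est v ^^ m) (pk (encode B @ r) (True # (True \<or> psat (asg v) A) # (True & psat (asg v) A) # K) []) = pk r (True # (True \<or> psat (asg v) A) # (True & psat (asg v) A) # K) [True, psat (asg v) B]"
  using POr(2) by blast
 have "(est v ^^ (1 + (m + (1 + (n + 1))))) (pk (encode (POr A B) @ r) K []) = est v ((est v ^^ m) (est v ((est v ^^ n) (est v (pk (True # True # encode A @ encode B @ r) K [])))))"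
  unfolding funpow_add by simp
 also have "\<dots> = pk r K [True, psat (asg v) (POr A B)]" unfolding est_simps n(2) m(2) by simp
 finally show ?case using n(1) m(1) by (intro exI[of _ "1 + (m + (1 + (n + 1)))"]) simp
qed

lemma est_atom_sound:
 "(est v ^^ n) (pk y K (False # acc)) = pk [] [] [True, b] ==>
  \<exists>bs r m. m < n & y = acode_bits bs @ False # r & (rev bs @ acc = [] \<or> hd (rev bs @ acc)) &
   (est v ^^ m) (pk r K [True, asgs v (rev acc @ bs)]) = pk [] [] [True, b]"
proof (induction n arbitrary: y acc)
 case (Suc n)
 have stuck: False if "est v (pk y K (False # acc)) = pk y K (False # acc)"
  using Suc.prems funpow_fixed[of "est v", OF that, of "Suc n"] by simp
 consider "y = [] \<or> y = [True]" | c r where "y = True # c # r" | r where "y = False # r"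
  by (metis list.exhaust)
 then show ?case
 proof cases
  case 1
  then show ?thesis using stuck est_stuck(4,5) by blast
 next
  case 2
  have "(est v ^^ n) (pk r K (False # c # acc)) = pk [] [] [True, b]"
   using Suc.prems unfolding funpow_Suc_apply 2 est_simps .
  from Suc.IH[OF this] obtain bs r' m where m: "m < n" "r = acode_bits bs @ False # r'"
   "rev bs @ c # acc = [] \<or> hd (rev bs @ c # acc)" "(est v ^^ m) (pk r' K [True, asgs v (rev (c # acc) @ bs)]) = pk [] [] [True, b]" by blast
  then show ?thesis using 2 by (intro exI[of _ "c # bs"] exI[of _ r'] exI[of _ m]) simp
 next
  case 3
  have ok: "acc = [] \<or> hd acc" using stuck est_stuck(6)[of acc v r K] 3 by blast
  have "(est v ^^ n) (pk r K [True, asgs v (rev acc)]) = pk [] [] [True, b]"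
   using Suc.prems unfolding funpow_Suc_apply 3 est_simps(5)[OF ok] .
  then show ?thesis using 3 ok by (intro exI[of _ "[]"] exI[of _ r] exI[of _ n]) simp
 qed
qed simp

text \<open>A run that ends with empty input and empty stack must have consumed a complete formula
  first; the induction is on the number of steps. Evaluation thus doubles as a syntax check.\<close>

lemma est_sound:
 "(est v ^^ n) (pk y K []) = pk [] [] [True, b] ==>
  \<exists>A r m. m < n & y = encode A @ r & (est v ^^ m) (pk r K [True, psat (asg v) A]) = pk [] [] [True, b]"
proof (induction n arbitrary: y K rule: less_induct)
 case (less n)
 obtain n' where n: "n = Suc n'" using less.prems by (cases n) simp_all
 have stuck: False if "est v (pk y K []) = pk y K []"
  using less.prems funpow_fixed[of "est v", OF that, of n] by simp
 have pop: "\<exists>m'. m = Suc m'" if "(est v ^^ m) (pk r (x # K') k) = pk [] [] [True, b]" for m r x K' k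
  using that by (cases m) simp_all
 consider "y = [] \<or> (\<exists>c. y = [c])" | d r where "y = True # d # r" | r where "y = False # True # r" | r where "y = False # False # r"
  by (metis (full_types) list.exhaust)
 then show ?case
 proof cases
  case 1
  then show ?thesis using stuck est_stuck(1,2) by blast
 next
  case 2
  have "(est v ^^ n') (pk r (False # d # d # K) []) = pk [] [] [True, b]"
   using less.prems unfolding n funpow_Suc_apply 2 est_simps .
  then obtain A r1 m where m: "m < n'" "r = encode A @ r1" "(est v ^^ m) (pk r1 (False # d # d # K) [True, psat (asg v) A]) = pk [] [] [True, b]"
   using less.IH[of n'] n by blast
  obtain m1 where m1: "m = Suc m1" using pop[OF m(3)] by blast
  have "(est v ^^ m1) (pk r1 (True # (d \<or> psat (asg v) A) # (d & psat (asg v) A) # K) []) = pk [] [] [True, b]"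
   using m(3) unfolding m1 funpow_Suc_apply est_simps .
  then obtain B r2 m2 where m2: "m2 < m1" "r1 = encode B @ r2"
   "(est v ^^ m2) (pk r2 (True # (d \<or> psat (asg v) A) # (d & psat (asg v) A) # K) [True, psat (asg v) B]) = pk [] [] [True, b]"
   using less.IH[of m1] n m(1) m1 by (metis Suc_lessD less_SucI)
  obtain m3 where m3: "m2 = Suc m3" using pop[OF m2(3)] by blast
  have f: "(est v ^^ m3) (pk r2 K [True, if psat (asg v) B then d \<or> psat (asg v) A else d & psat (asg v) A]) = pk [] [] [True, b]"
   using m2(3) unfolding m3 funpow_Suc_apply est_simps .
  show ?thesis
  proof (cases d)
   case True
   then show ?thesis using f 2 m m1 m2 m3 n by (intro exI[of _ "POr A B"] exI[of _ r2] exI[of _ m3]) (auto split: if_splits)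
  next
   case False
   then show ?thesis using f 2 m m1 m2 m3 n by (intro exI[of _ "PAnd A B"] exI[of _ r2] exI[of _ m3]) (auto split: if_splits)
  qed
 next
  case 3
  have "(est v ^^ n') (pk r (True # False # True # K) []) = pk [] [] [True, b]"
   using less.prems unfolding n funpow_Suc_apply 3 est_simps .
  then obtain A r1 m where m: "m < n'" "r = encode A @ r1" "(est v ^^ m) (pk r1 (True # False # True # K) [True, psat (asg v) A]) = pk [] [] [True, b]"
   using less.IH[of n'] n by blast
  obtain m1 where m1: "m = Suc m1" using pop[OF m(3)] by blast
  have f: "(est v ^^ m1) (pk r1 K [True, if psat (asg v) A then False else True]) = pk [] [] [True, b]"
   using m(3) unfolding m1 funpow_Suc_apply est_simps .
  have "(if psat (asg v) A then False else True) = psat (asg v) (PNot A)" by simp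
  then show ?thesis using f 3 m m1 n by (intro exI[of _ "PNot A"] exI[of _ r1] exI[of _ m1]) auto
 next
  case 4
  have "(est v ^^ n') (pk r K (False # [])) = pk [] [] [True, b]"
   using less.prems unfolding n funpow_Suc_apply 4 est_simps .
  from est_atom_sound[OF this] obtain bs r1 m where m: "m < n'" "r = acode_bits bs @ False # r1" "bs = [] \<or> hd (rev bs)"
   "(est v ^^ m) (pk r1 K [True, asgs v bs]) = pk [] [] [True, b]" by auto
  have "bits (val bs) = bs" using m(3) by (intro bits_canonical) (auto simp: hd_rev)
  then show ?thesis using 4 m n by (intro exI[of _ "Atom (val bs)"] exI[of _ r1] exI[of _ m]) simp
 qed
qed

text \<open>By \<open>est_complete\<close> the evaluation takes at most twice the length of the
  formula, and extra steps do not leave the final state.\<close>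

definition pe :: "str => str => bool" where
 "pe v y \<longleftrightarrow> (est v ^^ length (y @ y)) (pk y [] []) = pk [] [] [True, True]"

lemma pe_encode: "pe v (encode A) \<longleftrightarrow> psat (asg v) A"
proof -
 obtain n where n: "n \<le> 2 * length (encode A)" "(est v ^^ n) (pk (encode A @ []) [] []) = pk [] [] [True, psat (asg v) A]"
  using est_complete by blast
 then obtain k where k: "length (encode A @ encode A) = k + n" using le_Suc_ex[of n] by (metis add.commute length_append mult_2)
 have "(est v ^^ length (encode A @ encode A)) (pk (encode A) [] []) = pk [] [] [True, psat (asg v) A]"
  unfolding k funpow_add comp_def using n(2) funpow_fixed[of "est v", OF est_stuck(3)] by simp
 then show ?thesis unfolding pe_def by simp
qed

lemma pe_encoding: assumes "pe v y" shows "\<exists>A. y = encode A"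
proof -
 obtain A r m where "y = encode A @ r" "(est v ^^ m) (pk r [] [True, psat (asg v) A]) = pk [] [] [True, True]"
  using est_sound assms unfolding pe_def by blast
 then show ?thesis using funpow_fixed[of "est v", OF est_stuck(3)[of v r]] by auto
qed

fun atoms :: "pform => nat list" where
 "atoms (Atom i) = [i]"
| "atoms (PNot A) = atoms A"
| "atoms (PAnd A B) = atoms A @ atoms B"
| "atoms (POr A B) = atoms A @ atoms B"

lemma psat_atoms: "(\<And>i. i \<in> set (atoms A) ==> a i = a' i) ==> psat a A = psat a' A"
 by (induction A) auto

lemma length_atoms: "length (lst (map bits (atoms A))) \<le> length (encode A)"
proof -
 have app: "length (lst (xs @ ys)) = length (lst xs) + length (lst ys)" for xs ys by (induction xs) simp_all
 show ?thesis by (induction A) (simp_all add: app length_acode)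
qed

lemma length_lst_filter: "length (lst (map f (filter P xs))) \<le> length (lst (map f xs))"
 by (induction xs) auto

lemma valuation_code: "\<exists>v. length v \<le> length (encode A) & psat (asg v) A = psat a A"
proof -
 let ?v = "lst (map bits (filter a (atoms A)))"
 have "asgs (lst xs) e \<longleftrightarrow> e \<in> set xs" for xs e
  unfolding asgs_def by (induction xs) (auto simp: seek_pr)
 then have "psat (asg ?v) A = psat a A" by (intro psat_atoms) auto
 moreover have "length ?v \<le> length (encode A)" using length_lst_filter[of bits a "atoms A"] length_atoms[of A] by linarith
 ultimately show ?thesis by blast
qed

text \<open>Listing the true atoms that occur in a formula takes no more symbols than the formula
  itself, so short assignments suffice. The empty assignment already forces \<open>y\<close> to be
  an encoding.\<close>

lemma TAUT_pe: "y \<in> TAUT \<longleftrightarrow> (\<forall>v. length v \<le> length y --> pe v y)"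
proof
 assume "y \<in> TAUT"
 then show "\<forall>v. length v \<le> length y --> pe v y" unfolding TAUT_def using pe_encode by auto
next
 assume p: "\<forall>v. length v \<le> length y --> pe v y"
 then have "pe [] y" by simp
 then obtain A where A: "y = encode A" using pe_encoding by blast
 have "psat a A" for a
 proof -
  obtain v where "length v \<le> length y" "psat (asg v) A = psat a A" using valuation_code A by blast
  then show ?thesis using p pe_encode A by blast
 qed
 then show "y \<in> TAUT" unfolding TAUT_def A by blast
qed

lemma length_est: "length (est v s) \<le> length s + 10"
proof -
 have "2 * length (sfst s) + 2 * length (sfst (ssnd s)) + length (ssnd (ssnd s)) \<le> length s"
  using length_halves[of s] length_halves[of "ssnd s"] by linarith
 then show ?thesis unfolding est_def est3_def by (simp split: if_split) linarith
qed

lemma PP_hb: "PF f ==> PP (%x. hb (f x))"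
 unfolding hb_def by (rule PP_hd)

lemma PP_pe: assumes "PF f" "PF g" shows "PP (%x. pe (f x) (g x))"
proof -
 define r where "r c n = (est (sfst c) ^^ n) (pk (ssnd c) [] [])" for c n
 have A: "PP (%x. asgs (f x) (g x))" if "PF f" "PF g" for f g unfolding asgs_def
  by (intro PP_neq_Nil PF_seek[where P = "%a e. e = a"] PP_eq Fn_fst Fn_snd that)
 have E: "PF (%x. est (f x) (g x))" if "PF f" "PF g" for f g unfolding est_def est3_def
  by (intro PF_boolean_cons PP_hb A PF_rev PP_if that PF_intros Fn_fst Fn_snd)
 have "PF (%x. r (pr (f x) (g x)) (length (g x @ g x)))"
 proof (rule PF_rec_linear[where r = r and g = "%c. pk (ssnd c) [] []" and H = "%c u w. est (sfst c) w" and K = 10])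
  show "length (r c n) \<le> 10 * (length c + n) + 10" for c n
  proof (induction n)
   case 0
   show ?case using length_ssnd[of c] by (simp add: r_def)
  next
   case (Suc n)
   then show ?case using length_est[of "sfst c" "r c n"] by (simp add: r_def)
  qed
 qed (auto simp: r_def intro!: E PF_append Fn_pair PF_const assms Fn_fst Fn_snd PF_ssnd PF_sfst)
 then show ?thesis unfolding pe_def by (intro PP_eq PF_const) (simp add: r_def)
qed

section \<open>Growth rates: time bounds and iterated exponentials\<close>

section \<open>Bounds\<close>

text \<open>The finitely many values before the asymptotic bound sets in are absorbed by their
  maximum \<open>M\<close>, which goes into \<open>C\<close>.\<close>

lemma Poly_bound: assumes "T \<in> Poly" shows "\<exists>C. \<forall>n. T n \<le> (n + C) ^ C"
proof -
 obtain c where "(%n. real (T n)) \<in> O(%n. real n ^ c)" using assms unfolding Poly_def by blast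
 then obtain K where "K > 0" "eventually (%n. norm (real (T n)) \<le> K * norm (real n ^ c)) at_top" by (rule landau_o.bigE)
 then obtain n0 where n0: "\<And>n. n \<ge> n0 ==> real (T n) \<le> K * real n ^ c" unfolding eventually_at_top_linorder by auto
 define M where "M = Max (T ` {..n0})"
 define k where "k = nat \<lceil>K\<rceil>"
 define C where "C = M + k + c + 1"
 have K: "K \<le> real k" unfolding k_def by linarith
 have "T n \<le> (n + C) ^ C" for n
 proof -
  have "T n \<le> M + k * n ^ c"
  proof (cases "n \<ge> n0")
   case True
   have "real (T n) \<le> real k * real n ^ c" using n0[OF True] K by (meson mult_right_mono order_trans zero_le_power of_nat_0_le_iff)
   then have "real (T n) \<le> real (k * n ^ c)" by simp
   then show ?thesis by linarith
  next
   case False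
   then have "T n \<le> M" unfolding M_def by (intro Max_ge) auto
   then show ?thesis by simp
  qed
  also have "\<dots> \<le> M * (n + C) ^ c + k * (n + C) ^ c" by (intro add_mono mult_left_mono power_mono) (auto simp: C_def)
  also have "\<dots> \<le> (n + C) * (n + C) ^ c" unfolding distrib_right[symmetric] by (intro mult_right_mono) (auto simp: C_def)
  also have "\<dots> = (n + C) ^ Suc c" by simp
  also have "\<dots> \<le> (n + C) ^ C" by (intro power_increasing) (auto simp: C_def)
  finally show ?thesis .
 qed
 then show ?thesis by blast
qed

lemma Poly_power: "(%n. (n + C) ^ C) \<in> Poly"
proof -
 have "(%n. real ((n + C) ^ C)) \<in> O(%n. real n ^ C)"
 proof (rule landau_o.bigI[of "real (1 + C) ^ C"])
  show "eventually (%n. norm (real ((n + C) ^ C)) \<le> real (1 + C) ^ C * norm (real n ^ C)) at_top"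
   using eventually_ge_at_top[of 1]
  proof eventually_elim
   case (elim n)
   have "n + C \<le> (1 + C) * n" using elim by (cases n) auto
   then have "(n + C) ^ C \<le> ((1 + C) * n) ^ C" by (rule power_mono) simp
   then have "real ((n + C) ^ C) \<le> real (((1 + C) * n) ^ C)" by linarith
   then have "real ((n + C) ^ C) \<le> real (1 + C) ^ C * real n ^ C"
    by (simp only: of_nat_power of_nat_mult power_mult_distrib)
   then show ?case by simp
  qed
 qed simp
 then show ?thesis unfolding Poly_def by blast
qed

lemma Expo_bound: assumes "T \<in> Expo" shows "\<exists>d. \<forall>n. T n \<le> 2 ^ ((n + d) ^ d)"
proof -
 obtain c g where g: "g \<in> O(%n. real n ^ c)" "\<forall>n. real (T n) \<le> 2 powr g n" using assms unfolding Expo_def by blast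
 define G where "G n = nat \<lceil>\<bar>g n\<bar>\<rceil>" for n
 have "(%n. real (G n)) \<in> O(%n. real n ^ c)"
 proof -
  obtain K where K: "K > 0" "eventually (%n. norm (g n) \<le> K * norm (real n ^ c)) at_top" using landau_o.bigE[OF g(1)] by blast
  show ?thesis
  proof (rule landau_o.bigI[of "K + 1"])
   show "eventually (%n. norm (real (G n)) \<le> (K + 1) * norm (real n ^ c)) at_top"
    using K(2) eventually_ge_at_top[of 1]
   proof eventually_elim
    case (elim n)
    have "1 \<le> real n ^ c" using elim(2) by simp
    moreover have "real (G n) \<le> \<bar>g n\<bar> + 1" unfolding G_def by linarith
    ultimately show ?case using elim(1) by (simp add: algebra_simps)
   qed
  qed (use K in simp)
 qed
 then have "G \<in> Poly" unfolding Poly_def by blast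
 then obtain d where d: "\<And>n. G n \<le> (n + d) ^ d" using Poly_bound by blast
 have "T n \<le> 2 ^ ((n + d) ^ d)" for n
 proof -
  have "real (T n) \<le> 2 powr g n" using g(2) by blast
  also have "\<dots> \<le> 2 powr real (G n)" unfolding G_def by (intro powr_mono) linarith+
  also have "\<dots> = real (2 ^ G n)" by (simp add: powr_realpow)
  finally have "T n \<le> 2 ^ G n" by linarith
  also have "(2::nat) ^ G n \<le> 2 ^ ((n + d) ^ d)" using d by (intro power_increasing) auto
  finally show ?thesis .
 qed
 then show ?thesis by blast
qed

lemma Expo_power: "(%n. (2 ^ n + C) ^ C) \<in> Expo"
proof -
 have "real ((2 ^ n + C) ^ C) \<le> 2 powr (real C * (real n + real C))" for n
 proof -
  have "2 ^ n + C \<le> 2 ^ n * 2 ^ C"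
  proof -
   have "1 + C \<le> 2 ^ C" using less_exp[of C] by linarith
   then have "2 ^ n * (1 + C) \<le> 2 ^ n * 2 ^ C" by (rule mult_le_mono2)
   moreover have "C \<le> 2 ^ n * C" by simp
   ultimately show ?thesis unfolding distrib_left by linarith
  qed
  then have "(2 ^ n + C) ^ C \<le> (2 ^ (n + C)) ^ C" unfolding power_add by (rule power_mono) simp
  then have "real ((2 ^ n + C) ^ C) \<le> real (2 ^ (C * (n + C)))" by (simp only: of_nat_le_iff power_mult[symmetric] mult.commute)
  then show ?thesis using powr_realpow[of 2 "C * (n + C)"] by simp
 qed
 moreover have "(%n. real n + real C) \<in> O(%n. real n)" by real_asymp
 then have "(%n. real C * (real n + real C)) \<in> O(%n. real n ^ 1)" by (cases "C = 0") simp_all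
 ultimately show ?thesis unfolding Expo_def
  by (intro CollectI exI[of _ 1] bexI[of _ "%n. real C * (real n + real C)"] allI)
qed

lemma exp_bound:
 "real ((2 ^ x + n + D) ^ D) \<le> 2 powr (real D * (real x + log 2 (real n + real D + 2)))"
proof -
 let ?u = "real n + real D + 2"
 have l: "(2::real) powr log 2 ?u = ?u" by simp
 have one: "(2::real) ^ x \<ge> 1" by simp
 then have "0 \<le> ((2::real) ^ x - 1) * (real n + real D) + 2 ^ x" by (intro add_nonneg_nonneg mult_nonneg_nonneg) auto
 moreover have "2 ^ x * ?u - real (2 ^ x + n + D) = ((2::real) ^ x - 1) * (real n + real D) + 2 ^ x"
  by (simp add: algebra_simps)
 ultimately have "real (2 ^ x + n + D) \<le> 2 ^ x * ?u" by linarith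
 also have "\<dots> = 2 powr (real x + log 2 ?u)" unfolding powr_add l by (simp add: powr_realpow)
 finally have "real (2 ^ x + n + D) ^ D \<le> (2 powr (real x + log 2 ?u)) ^ D" by (intro power_mono) auto
 also have "\<dots> = 2 powr (real D * (real x + log 2 ?u))" by (simp add: powr_power mult.commute)
 finally show ?thesis by simp
qed

text \<open>The hypothesis gives \<open>X n\<close> at most the square root of \<open>n + K\<close>.
  The exponent is then a multiple of a square root plus a logarithm, which is o(n).\<close>

lemma subExp_power:
 assumes "\<And>n. X n ^ 2 \<le> n + K" shows "(%n. (2 ^ X n + n + D) ^ D) \<in> subExp"
proof -
 let ?g = "%n. real D * (sqrt (real n + real K) + log 2 (real n + real D + 2))"
 have "(%n. sqrt (real n + real K) + log 2 (real n + real D + 2)) \<in> o(%n. real n)" by real_asymp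
 then have "?g \<in> o(%n. real n)" by (cases "D = 0") simp_all
 moreover have "real ((2 ^ X n + n + D) ^ D) \<le> 2 powr ?g n" for n
 proof -
  have "real (X n) ^ 2 \<le> real n + real K" using assms[of n] by (metis of_nat_add of_nat_le_iff of_nat_power)
  then have "real (X n) \<le> sqrt (real n + real K)" by (simp add: real_le_rsqrt)
  then have "real D * (real (X n) + log 2 (real n + real D + 2)) \<le> ?g n" by (intro mult_left_mono) auto
  then show ?thesis using exp_bound[of "X n" n D] by (meson order_trans powr_mono one_le_numeral)
 qed
 ultimately show ?thesis unfolding subExp_def by (intro CollectI bexI[of _ ?g] allI)
qed

lemma floorlog_log: "n > 0 ==> real (floorlog 2 n) \<le> log 2 (real n) + 1"
proof -
 assume n: "n > 0"
 then have "floorlog 2 n = nat \<lfloor>log 2 (real n)\<rfloor> + 1" by (simp add: floorlog_def)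
 moreover have "log 2 (real n) \<ge> 0" using n by simp
 ultimately show ?thesis by linarith
qed

lemma Qp_power:
 "(%n. (2 ^ ((A + floorlog 2 ((n + C) ^ C)) ^ d) + n + D) ^ D) \<in> Qp"
proof -
 let ?x = "%n. (A + floorlog 2 ((n + C) ^ C)) ^ d"
 let ?g = "%n. real D * (real (?x n) + log 2 (real n + real D + 2))"
 \<comment> \<open>The exponent \<open>d + 1\<close> makes room for the summand
   \<open>log 2 (real n + real D + 2)\<close> even when \<open>d = 0\<close>.\<close>
 have "?g \<in> O(%n. log 2 (real n) ^ (d + 1))"
 proof (rule landau_o.bigI[of "real D * (real (A + 1 + 2 * C) ^ d + 2) + 1"])
  show "eventually (%n. norm (?g n) \<le> (real D * (real (A + 1 + 2 * C) ^ d + 2) + 1) * norm (log 2 (real n) ^ (d + 1))) at_top"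
   using eventually_ge_at_top[of "C + D + 4"]
  proof eventually_elim
   case (elim n)
   let ?l = "log 2 (real n)"
   have l: "?l \<ge> 1" using elim by (simp add: le_log_iff)
   have sq: "log 2 x \<le> 2 * ?l" if "x > 0" "x \<le> real n + real n" for x
   proof -
    have "real n + real n \<le> real n * real n" using mult_right_mono[of 2 "real n" "real n"] elim by simp
    then have "x \<le> real n ^ 2" using that(2) by (simp add: power2_eq_square)
    then have "log 2 x \<le> log 2 (real n ^ 2)" using that(1) elim by (subst log_le_cancel_iff) auto
    also have "\<dots> = 2 * ?l" using elim by (simp add: log_nat_power)
    finally show ?thesis .
   qed
   have "real (floorlog 2 ((n + C) ^ C)) \<le> log 2 (real ((n + C) ^ C)) + 1" using elim by (intro floorlog_log) simp
   also have "log 2 (real ((n + C) ^ C)) = real C * log 2 (real n + real C)" using elim by (simp add: log_nat_power)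
   also have "\<dots> \<le> real C * (2 * ?l)" using elim by (intro mult_left_mono sq) auto
   finally have "real (A + floorlog 2 ((n + C) ^ C)) \<le> real A * 1 + 1 + real C * (2 * ?l)" by simp
   also have "\<dots> \<le> real A * ?l + ?l + real C * (2 * ?l)" using l by (intro add_mono mult_left_mono) auto
   also have "\<dots> = real (A + 1 + 2 * C) * ?l" by (simp add: algebra_simps)
   finally have "real (A + floorlog 2 ((n + C) ^ C)) ^ d \<le> (real (A + 1 + 2 * C) * ?l) ^ d" by (intro power_mono) auto
   also have "\<dots> \<le> real (A + 1 + 2 * C) ^ d * ?l ^ (d + 1)"
    unfolding power_mult_distrib using l by (intro mult_left_mono power_increasing) auto
   finally have x: "real (?x n) \<le> real (A + 1 + 2 * C) ^ d * ?l ^ (d + 1)" by simp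
   have "log 2 (real n + real D + 2) \<le> 2 * ?l" using elim by (intro sq) auto
   also have "\<dots> \<le> 2 * ?l ^ (d + 1)" using l power_increasing[of 1 "d + 1" ?l] by simp
   finally have "real (?x n) + log 2 (real n + real D + 2) \<le> (real (A + 1 + 2 * C) ^ d + 2) * ?l ^ (d + 1)"
    using x by (simp add: algebra_simps)
   then have "?g n \<le> real D * ((real (A + 1 + 2 * C) ^ d + 2) * ?l ^ (d + 1))" by (rule mult_left_mono) simp
   moreover have "0 \<le> ?g n" by (intro mult_nonneg_nonneg add_nonneg_nonneg) auto
   moreover have "0 \<le> ?l ^ (d + 1)" using l by simp
   ultimately show ?case by (simp add: algebra_simps)
  qed
 qed (intro add_nonneg_pos mult_nonneg_nonneg; simp)
 moreover have "real ((2 ^ ?x n + n + D) ^ D) \<le> 2 powr ?g n" for n by (rule exp_bound)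
 ultimately show ?thesis unfolding Qp_def by (intro CollectI exI[of _ "d + 1"] bexI[of _ ?g] allI)
qed

section \<open>Towers\<close>

lemma tower_mono: "x \<le> y ==> tower k x \<le> tower k y"
 by (induction k) (auto intro: power_increasing)

lemma tower_ge: "x \<le> tower k x"
 by (induction k) (auto intro: order_trans less_imp_le[OF less_exp])

lemma tower_Suc_shift: "tower (Suc k) x = tower k (2 ^ x)"
 by (induction k) simp_all

text \<open>An affine change of the argument together with a fixed power costs less than one
  exponential. One level up, the power \<open>e\<close> becomes a factor in the exponent; that
  factor is eventually below the tower itself, and the induction hypothesis for squares absorbs
  it.\<close>

lemma tower_growth: "\<exists>y0. \<forall>y \<ge> y0. tower k (a * y + b) ^ e \<le> 2 ^ tower k y" if "a \<ge> 1"
 using that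
proof (induction k arbitrary: e)
 case 0
 have "(a * y + b) ^ e \<le> 2 ^ y" if y: "y \<ge> Suc e * ((a + b) * Suc e) ^ e + 1" for y
 proof -
  \<comment> \<open>With \<open>t\<close> about \<open>y / (e + 1)\<close>, the constant factors are
    below \<open>t\<close>, so the left side is at most \<open>t ^ Suc e\<close>. The rest is
    \<open>t \<le> 2 ^ (t - 1)\<close> raised to the power \<open>Suc e\<close>.\<close>
  define t where "t = Suc (y div Suc e)"
  have "y mod Suc e < Suc e" by simp
  then have yt: "y \<le> Suc e * t" "Suc e * (t - 1) \<le> y"
   unfolding t_def using mult_div_mod_eq[of "Suc e" y] by (simp_all only: mult_Suc_right diff_Suc_1 diff_Suc_Suc minus_nat.diff_0)
  have "((a + b) * Suc e) ^ e \<le> y div Suc e" using y by (subst less_eq_div_iff_mult_less_eq) (auto simp: mult.commute)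
  then have t: "((a + b) * Suc e) ^ e \<le> t" unfolding t_def by simp
  have "b * 1 \<le> b * y" using y by (intro mult_le_mono2) simp
  then have "a * y + b \<le> (a + b) * y" by (simp add: distrib_right)
  also have "\<dots> \<le> (a + b) * (Suc e * t)" by (intro mult_le_mono2 yt)
  finally have "(a * y + b) ^ e \<le> (((a + b) * Suc e) * t) ^ e" by (intro power_mono) (simp_all only: mult.assoc)
  also have "\<dots> \<le> t * t ^ e" unfolding power_mult_distrib[of _ t] by (rule mult_le_mono1[OF t])
  also have "\<dots> = t ^ Suc e" by simp
  also have "\<dots> \<le> (2 ^ (t - 1)) ^ Suc e" using Suc_leI[OF less_exp[of "y div Suc e"]] unfolding t_def by (intro power_mono) simp_all
  also have "\<dots> \<le> 2 ^ y" unfolding power_mult[symmetric] using yt(2) by (intro power_increasing) (simp_all add: mult.commute)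
  finally show ?thesis .
 qed
 then show ?case by auto
next
 case (Suc k)
 then obtain y0 where y0: "\<And>y. y \<ge> y0 ==> tower k (a * y + b) ^ 2 \<le> 2 ^ tower k y" by blast
 have "tower (Suc k) (a * y + b) ^ e \<le> 2 ^ tower (Suc k) y" if y: "y \<ge> max y0 e" for y
 proof -
  have "y \<le> a * y + b" using Suc.prems by (cases a) auto
  then have "e \<le> tower k (a * y + b)" using y tower_ge[of "a * y + b" k] by linarith
  then have "e * tower k (a * y + b) \<le> tower k (a * y + b) ^ 2" by (simp add: power2_eq_square)
  also have "\<dots> \<le> 2 ^ tower k y" using y by (intro y0) simp
  finally have "(2::nat) ^ (tower k (a * y + b) * e) \<le> 2 ^ (2 ^ tower k y)" by (intro power_increasing) (auto simp: mult.commute)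
  then show ?thesis by (simp add: power_mult)
 qed
 then show ?case by blast
qed

abbreviation flog :: "nat => nat => nat" where
 "flog k \<equiv> floorlog 2 ^^ k"

lemma flog_lower: "q \<le> tower k (flog k q)"
proof (induction k)
 case (Suc k)
 have "flog k q < 2 ^ flog (Suc k) q" using less_floorlog[of "flog k q" "flog (Suc k) q"] by simp
 then have "tower k (flog k q) \<le> tower k (2 ^ flog (Suc k) q)" by (intro tower_mono) simp
 then show ?case using Suc unfolding tower_Suc_shift by linarith
qed simp

lemma flog_upper: "tower k (flog k q - 2) \<le> max q (tower k 0)"
proof (induction k)
 case (Suc k)
 let ?y = "flog k q"
 show ?case
 proof (cases "?y \<ge> 4")
  case True
  let ?z = "flog (Suc k) q"
  have "\<not> ?y < 2 ^ (?z - 1)"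
  proof -
   have "?z > 0" using True by (simp add: floorlog_def)
   then show ?thesis using less_floorlog[of ?y "?z - 1"] by simp
  qed
  moreover have z: "?z > 2"
  proof (rule ccontr)
   assume "\<not> ?z > 2"
   then have "?y < 2 ^ 2" using less_floorlog[of ?y 2] by simp
   then show False using True by simp
  qed
  moreover have "2 * 2 ^ (?z - 2) = (2::nat) ^ (?z - 1)" using z by (simp add: power_Suc[symmetric] Suc_diff_Suc numeral_2_eq_2 del: power_Suc)
  ultimately have "2 ^ (?z - 2) \<le> ?y - 2" using True by linarith
  then have "tower k (2 ^ (?z - 2)) \<le> tower k (?y - 2)" by (rule tower_mono)
  moreover have "tower k 0 \<le> tower (Suc k) 0" unfolding tower_Suc_shift by (rule tower_mono) simp
  ultimately show ?thesis using Suc unfolding tower_Suc_shift by linarith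
 next
  case False
  then have "?y < 2 ^ 2" by simp
  then have "flog (Suc k) q \<le> 2" using less_floorlog[of ?y 2] by simp
  then show ?thesis by simp
 qed
qed simp

text \<open>Let \<open>z\<close> be the iterated bit length of \<open>(n + C) ^ C\<close> and
  \<open>X\<close> the tower on the left. For large \<open>z\<close>, \<open>tower_growth\<close> at
  \<open>z - 2\<close> with exponent \<open>2 * C\<close> and \<open>flog_upper\<close> bound
  \<open>X ^ (2 * C)\<close> by \<open>(n + C) ^ C\<close> or by a constant, and taking roots of
  order \<open>C\<close> gives the claim. The offset \<open>3 * a\<close> comes from
  \<open>Suc z = (z - 2) + 3\<close>; small \<open>z\<close> go into \<open>K\<close>.\<close>

lemma tower_bound:
 assumes "a \<ge> 1" "C \<ge> 1"
 shows "\<exists>K. \<forall>n. tower k (a * Suc (flog (Suc k) ((n + C) ^ C)) + b) ^ 2 \<le> n + K"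
proof -
 obtain y0 where y0: "\<And>y. y \<ge> y0 ==> tower k (a * y + (3 * a + b)) ^ (2 * C) \<le> 2 ^ tower k y"
  using tower_growth[OF assms(1)] by blast
 let ?M = "tower k (a * (y0 + 3) + b)"
 have "tower k (a * Suc (flog (Suc k) ((n + C) ^ C)) + b) ^ 2 \<le> n + (C + tower (Suc k) 0 + ?M ^ 2)" for n
 proof -
  let ?q = "(n + C) ^ C" and ?z = "flog (Suc k) ((n + C) ^ C)"
  let ?X = "tower k (a * Suc ?z + b)"
  show ?thesis
  proof (cases "?z \<ge> y0 + 2")
   case True
   have e: "a * Suc ?z + b = a * (?z - 2) + (3 * a + b)"
   proof -
    have "Suc ?z = (?z - 2) + 3" using True by simp
    then show ?thesis by (metis add.assoc distrib_left mult.commute)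
   qed
   have "?X ^ (2 * C) \<le> 2 ^ tower k (?z - 2)" unfolding e by (rule y0) (use True in simp)
   also have "\<dots> \<le> max ?q (tower (Suc k) 0)" using flog_upper[of "Suc k" ?q] by simp
   finally have m: "?X ^ (2 * C) \<le> max ?q (tower (Suc k) 0)" .
   show ?thesis
   proof (cases "?X ^ (2 * C) \<le> ?q")
    case True
    then have "(?X ^ 2) ^ C \<le> (n + C) ^ C" by (simp add: power_mult)
    then have "?X ^ 2 \<le> n + C" using assms(2) by (simp add: power_mono_iff)
    then show ?thesis by simp
   next
    case False
    then have "?X ^ (2 * C) \<le> tower (Suc k) 0" using m by simp
    moreover have "?X ^ 2 \<le> ?X ^ (2 * C)"
    proof (cases "?X = 0")
     case False
     then show ?thesis using assms(2) by (intro power_increasing) auto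
    qed simp
    ultimately show ?thesis by linarith
   qed
  next
   case False
   then have "?X \<le> ?M" by (intro tower_mono add_mono mult_left_mono) auto
   then have "?X ^ 2 \<le> ?M ^ 2" by (rule power_mono) simp
   then show ?thesis by linarith
  qed
 qed
 then show ?thesis by blast
qed

section \<open>Proof systems whose proofs contain certified machines\<close>

section \<open>Soundness of a machine up to a given length\<close>

text \<open>\<open>N\<close> is both the length bound and the clock, so that a counterexample has
  size polynomial in \<open>N\<close> and \<open>c\<close>. Runs that are cut off claim
  nothing.\<close>

definition sound :: "str => nat => bool" where
 "sound c N \<longleftrightarrow> (\<forall>\<pi>. length \<pi> \<le> N --> UM c \<pi> (U N) \<noteq> [] --> ssnd (UM c \<pi> (U N)) \<in> TAUT)"

lemma TAUT_pe_all: "y \<in> TAUT ==> pe v y"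
 unfolding TAUT_def using pe_encode by auto

lemma PF_upower: assumes "PF f" shows "PF (%x. U (length (f x) ^ n))"
proof (induction n)
 case 0
 show ?case by (simp add: PF_const)
next
 case (Suc n)
 have "PF (%x. U (length (f x) * length (U (length (f x) ^ n))))" by (intro PF_umult assms Suc)
 then show ?case by simp
qed

lemma PF_poly: "PF (%x. U ((length x + C) ^ C))"
proof -
 have "PF (%x. U (length (U C @ x) ^ C))" by (intro PF_upower PF_app_const Fn_id)
 then show ?thesis by (simp add: add.commute)
qed

lemma PF_majorant: assumes "pb F length" shows "\<exists>g. PF g & (\<forall>x. F x \<le> length (g x))"
proof -
 obtain C where "\<And>x. F x \<le> (length x + C) ^ C" using assms unfolding pb_def by blast
 then show ?thesis using PF_poly[of C] by (intro exI[of _ "%x. U ((length x + C) ^ C)"]) simp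
qed

text \<open>A counterexample is an input \<open>\<pi>\<close> together with an assignment under
  which \<open>pe\<close> rejects the output. By \<open>TAUT_pe\<close> the assignment need not be
  longer than the output.\<close>

lemma unsound_NP:
 obtains g chk where "PF g" "PF chk" "\<And>s. length s \<le> length (g s)"
  "\<And>c N. \<not> sound c N \<longleftrightarrow> (\<exists>w. length w = length (g (pr c (U N))) & chk (pr (pr c (U N)) w) \<noteq> [])"
proof -
 have PU: "PF (%z. UM (sfst z) (sfst (ssnd z)) (ssnd (ssnd z)))" by (intro PF_UM PF_intros Fn_fst Fn_snd)
 obtain C where C: "\<And>z. length (UM (sfst z) (sfst (ssnd z)) (ssnd (ssnd z))) \<le> (length z + C) ^ C"
  using PF_bound[OF PU] unfolding pb_def by blast
 \<comment> \<open>This leaves room for a pair nested in a pair, where the inner components are an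
   input and an assignment as long as the output. The last summand yields the clause
   \<open>length s \<le> length (g s)\<close>.\<close>
 let ?F = "%s :: str. 2 * (2 * length s + 1 + (3 * length s + 1 + C) ^ C) + 1 + length s"
 have "pb ?F length" by (intro pb_intros)
 then obtain g where g: "PF g" "\<And>s. ?F s \<le> length (g s)" using PF_majorant by blast
 define o' where "o' z = UM (sfst (sfst z)) (sfst (sfst (ssnd z))) (U (length (ssnd (sfst z))))" for z
 define chk where "chk z = tt (length (sfst (sfst (ssnd z))) \<le> length (ssnd (sfst z)) & o' z \<noteq> [] &
   \<not> pe (ssnd (sfst (ssnd z))) (ssnd (o' z)))" for z
 have o': "PF o'" unfolding o'_def by (intro PF_UM PF_U PF_intros Fn_fst Fn_snd)
 have chk: "PF chk" unfolding chk_def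
  by (intro PF_tt PP_conj PP_not PP_length_le PP_neq_Nil PP_pe PF_intros PF_ssnd[OF o'] o' Fn_fst Fn_snd)
 have iff: "\<not> sound c N \<longleftrightarrow> (\<exists>w. length w = length (g (pr c (U N))) & chk (pr (pr c (U N)) w) \<noteq> [])" for c N
 proof
  assume "\<not> sound c N"
  then obtain \<pi> where p: "length \<pi> \<le> N" "UM c \<pi> (U N) \<noteq> []" "ssnd (UM c \<pi> (U N)) \<notin> TAUT" unfolding sound_def by blast
  then obtain v where v: "length v \<le> length (ssnd (UM c \<pi> (U N)))" "\<not> pe v (ssnd (UM c \<pi> (U N)))"
   using TAUT_pe by blast
  have "length (ssnd (UM c \<pi> (U N))) \<le> (length (pr c (pr \<pi> (U N))) + C) ^ C"
   using C[of "pr c (pr \<pi> (U N))"] length_ssnd[of "UM c \<pi> (U N)"] by simp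
  also have "\<dots> \<le> (3 * length (pr c (U N)) + 1 + C) ^ C" using p(1) by (intro power_mono) auto
  finally have y: "length (ssnd (UM c \<pi> (U N))) \<le> (3 * length (pr c (U N)) + 1 + C) ^ C" .
  define Z where "Z = 2 * length (pr c (U N)) + 1 + (3 * length (pr c (U N)) + 1 + C) ^ C"
  have "2 * length \<pi> + 1 + length v \<le> Z" unfolding Z_def
   using v(1) y p(1) by (intro add_mono) auto
  then have "length (pr \<pi> v) \<le> Z" by simp
  moreover have "2 * Z + 1 + length (pr c (U N)) \<le> length (g (pr c (U N)))" using g(2)[of "pr c (U N)"] unfolding Z_def .
  ultimately have "2 * length (pr \<pi> v) + 1 \<le> length (g (pr c (U N)))" by linarith
  \<comment> \<open>A guess must have exactly the prescribed length; the second component is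
    padding.\<close>
  then show "\<exists>w. length w = length (g (pr c (U N))) & chk (pr (pr c (U N)) w) \<noteq> []"
   using p(1,2) v(2) by (intro exI[of _ "pr (pr \<pi> v) (U (length (g (pr c (U N))) - (2 * length (pr \<pi> v) + 1)))"])
    (simp add: chk_def o'_def)
 next
  assume "\<exists>w. length w = length (g (pr c (U N))) & chk (pr (pr c (U N)) w) \<noteq> []"
  then show "\<not> sound c N" unfolding sound_def chk_def o'_def using TAUT_pe_all by fastforce
 qed
 have "length s \<le> length (g s)" for s using g(2)[of s] by linarith
 then show ?thesis by (rule that[OF g(1) chk _ iff])
qed

lemma halting_unique:
 assumes "deterministic M"
 shows "(step M ^^ n) s a ==> halted M a ==> (step M ^^ m) s b ==> halted M b ==> a = b"
proof (induction n arbitrary: s m)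
 case 0
 then have s: "s = a" by simp
 show ?case
 proof (cases m)
  case (Suc m')
  then obtain s' where "step M s s'" using relpowp_Suc_D2[of m' "step M" s b] 0 by blast
  then show ?thesis using 0(2) s unfolding halted_def by blast
 qed (use 0 s in simp)
next
 case (Suc n)
 obtain s' where s': "step M s s'" "(step M ^^ n) s' a" using relpowp_Suc_D2[OF Suc.prems(1)] by blast
 have "m \<noteq> 0"
 proof
  assume "m = 0"
  then have "s = b" using Suc.prems(3) by simp
  then show False using s'(1) Suc.prems(4) unfolding halted_def by blast
 qed
 then obtain m' where m: "m = Suc m'" by (cases m) auto
 obtain s'' where s'': "step M s s''" "(step M ^^ m') s'' b" using relpowp_Suc_D2[of m' "step M" s b] Suc.prems(3) unfolding m by blast
 have "s' = s''" using s'(1) s''(1) assms unfolding step_def deterministic_def by blast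
 then show ?case using Suc.IH[OF s'(2) Suc.prems(2) _ Suc.prems(4)] s''(2) by blast
qed

text \<open>Soundness holds for every \<open>N\<close>, because a run that is cut off yields
  \<open>[]\<close> and a halting one outputs \<open>Q \<pi>\<close> by determinism. The polynomial
  time bound of \<open>Q\<close> tells how large \<open>N\<close> must be for the run on
  \<open>\<pi>\<close> to finish.\<close>

lemma machine_sound:
 assumes Q: "computable_in Poly Q" "\<And>\<pi>. Q \<pi> \<in> TAUT"
 obtains c C where "C \<ge> 1" "\<And>N. sound c N"
  "\<And>\<pi> N. (length \<pi> + C) ^ C \<le> N ==> length \<pi> \<le> N & UM c \<pi> (U N) \<noteq> [] & ssnd (UM c \<pi> (U N)) = Q \<pi>"
proof -
 obtain T M where TM: "T \<in> Poly" "TM M" "deterministic M"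
  "\<And>x. \<exists>n \<le> T (length x). \<exists>c. (step M ^^ n) (start_config M x) c & halted M c & has_output c (Q x)"
  using Q(1) unfolding computable_in_def computes_within_def by blast
 obtain C0 where C0: "\<And>n. T n \<le> (n + C0) ^ C0" using Poly_bound[OF TM(1)] by blast
 \<comment> \<open>A positive exponent ensures that the time bound also dominates the input
   length.\<close>
 define C where "C = Suc C0"
 have C: "T n \<le> (n + C) ^ C" for n using C0[of n] power_bound_mono[of n n C0 C] unfolding C_def by simp
 show ?thesis
 proof (rule that[of C "mcode M"])
  show "C \<ge> 1" by (simp add: C_def)
  show "sound (mcode M) N" for N unfolding sound_def
  proof (intro allI impI)
   fix \<pi> assume "UM (mcode M) \<pi> (U N) \<noteq> []"
   from UM_sound[OF TM(2) this] obtain c where c: "(step M)\<^sup>*\<^sup>* (start_config M \<pi>) c" "halted M c"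
    "\<forall>y. has_output c y --> ssnd (UM (mcode M) \<pi> (U N)) = y" by blast
   obtain n where "(step M ^^ n) (start_config M \<pi>) c" using c(1) rtranclp_imp_relpowp by metis
   moreover obtain m d where d: "(step M ^^ m) (start_config M \<pi>) d" "halted M d" "has_output d (Q \<pi>)" using TM(4) by blast
   ultimately have "c = d" using halting_unique[OF TM(3)] c(2) by blast
   then show "ssnd (UM (mcode M) \<pi> (U N)) \<in> TAUT" using c(3) d(3) Q(2) by metis
  qed
  fix \<pi> :: str and N assume N: "(length \<pi> + C) ^ C \<le> N"
  obtain n d where d: "n \<le> T (length \<pi>)" "(step M ^^ n) (start_config M \<pi>) d" "halted M d" "has_output d (Q \<pi>)" using TM(4) by blast
  have "n \<le> N" using d(1) C[of "length \<pi>"] N by linarith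
  from UM_deterministic[OF TM(2,3) d(2,3) this] obtain z where "UM (mcode M) \<pi> (U N) = pr (U (fst d)) z" "z = Q \<pi>" using d(4) by blast
  moreover have "length \<pi> + C \<le> (length \<pi> + C) ^ C" by (rule self_le_power) (simp_all add: C_def)
  ultimately show "length \<pi> \<le> N & UM (mcode M) \<pi> (U N) \<noteq> [] & ssnd (UM (mcode M) \<pi> (U N)) = Q \<pi>" using N by simp
 qed
qed

lemma Fn_computable:
 assumes "Fn f S" "\<And>x. S x \<le> s (length x)" "\<And>C. (%n. (s n + C) ^ C) \<in> \<C>"
 shows "computable_in \<C> f"
proof -
 obtain M T where M: "pb T S" "TM M" "deterministic M"
  "\<And>x. \<exists>n \<le> T x. \<exists>c. (step M ^^ n) (start_config M x) c & halted M c & has_output c (f x)" using Fn_TM[OF assms(1)] by blast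
 obtain C where C: "\<And>x. T x \<le> (S x + C) ^ C" using M(1) unfolding pb_def by blast
 have "T x \<le> (s (length x) + C) ^ C" for x
  using C[of x] power_bound_mono[OF assms(2)[of x] order_refl[of C]] by linarith
 then have "computes_within M f (%n. (s n + C) ^ C)" unfolding computes_within_def
  using M(2-4) by (meson order_trans)
 then show ?thesis unfolding computable_in_def using assms(3)[of C] by blast
qed

lemma PF_computable: "PF f ==> computable_in Poly f"
 by (rule Fn_computable[where s = "%n. n"]) (auto intro: Poly_power)

section \<open>Proof systems from certified soundness\<close>

text \<open>A proof \<open>((t, w), \<pi>)\<close> names by its ticket \<open>t\<close> a machine and a length up to which that machine
 is sound, certifies this by \<open>w\<close>, and runs the machine on \<open>\<pi>\<close>.\<close>

definition certified :: "(str => str => bool) => (str => str) => (str => nat) => str => str" where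
 "certified V dc du p =
  (if V (sfst (sfst p)) (ssnd (sfst p)) & length (ssnd p) \<le> du (sfst (sfst p)) &
    UM (dc (sfst (sfst p))) (ssnd p) (U (du (sfst (sfst p)))) \<noteq> []
   then ssnd (UM (dc (sfst (sfst p))) (ssnd p) (U (du (sfst (sfst p))))) else encode (POr (Atom 0) (PNot (Atom 0))))"

text \<open>\<open>dc\<close> and \<open>du\<close> read the machine and the bound off a ticket; the
  bound must be computable in unary, since the simulation runs that long. \<open>tickets\<close>
  asks only that arbitrarily large bounds can be certified; the sizes are left to the two optimality
  criteria below.\<close>

locale certificates =
 fixes V :: "str => str => bool" and dc :: "str => str" and du :: "str => nat"
 assumes V: "PP (%x. V (sfst x) (ssnd x))" and dc: "PF dc" and du: "PF (%t. U (du t))"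
  and V_sound: "V t w ==> sound (dc t) (du t)"
  and tickets: "(\<And>N. sound c N) ==> \<exists>t w. V t w & dc t = c & N0 \<le> du t"
begin

lemma certified_eq:
 assumes "V t w" "length \<pi> \<le> du t" "UM (dc t) \<pi> (U (du t)) \<noteq> []"
 shows "certified V dc du (pr (pr t w) \<pi>) = ssnd (UM (dc t) \<pi> (U (du t)))"
 using assms by (simp add: certified_def)

lemma proof_system: "proof_system (certified V dc du)"
 unfolding proof_system_def
proof
 have du': "PF (%x. U (du (f x)))" if "PF f" for f using PF_comp[OF du that] .
 have "PP (%p. length (ssnd p) \<le> length (U (du (sfst (sfst p)))))" by (intro PP_length_le du' PF_intros Fn_fst Fn_snd)
 then have l: "PP (%p. length (ssnd p) \<le> du (sfst (sfst p)))" by simp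
 have v: "PP (%p. V (sfst (sfst p)) (ssnd (sfst p)))"
  using PP_comp[OF V Fn_fst] .
 have "PF (certified V dc du)" unfolding certified_def
  by (intro PF_if PP_conj v l PP_neq_Nil PF_ssnd PF_UM PF_comp[OF dc] du' PF_sfst PF_const Fn_fst Fn_snd)
 then show "computable_in Poly (certified V dc du)" by (rule PF_computable)
 show "range (certified V dc du) = TAUT"
 proof
  have "encode (POr (Atom 0) (PNot (Atom 0))) \<in> TAUT" unfolding TAUT_def by (intro imageI) simp
  then show "range (certified V dc du) \<subseteq> TAUT"
   using V_sound unfolding certified_def sound_def by auto
  show "TAUT \<subseteq> range (certified V dc du)"
  proof
   fix y assume y: "y \<in> TAUT"
   \<comment> \<open>A machine that prints the tautology \<open>y\<close> on every input is sound,
     and its run on the empty input proves \<open>y\<close>.\<close>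
   obtain c C where c: "\<And>N. sound c N" "\<And>\<pi> N. (length \<pi> + C) ^ C \<le> N ==> length \<pi> \<le> N & UM c \<pi> (U N) \<noteq> [] & ssnd (UM c \<pi> (U N)) = y"
    using machine_sound[OF PF_computable[OF PF_const] y] by metis
   obtain t w where t: "V t w" "dc t = c" "(length ([] :: str) + C) ^ C \<le> du t" using tickets[OF c(1)] by blast
   have "certified V dc du (pr (pr t w) []) = y" using certified_eq[OF t(1), of "[]"] c(2)[OF t(3)] t(2) by simp
   then show "y \<in> range (certified V dc du)" by (metis rangeI)
  qed
 qed
qed

lemma nonuniform_optimalI:
 assumes "\<And>c C. (\<And>N. sound c N) ==> C \<ge> 1 ==> \<exists>h \<in> \<C>. \<forall>n. \<exists>t w. V t w & dc t = c & (n + C) ^ C \<le> du t &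
   length (pr (pr t w) (U n)) \<le> h n"
 shows "nonuniform_optimal \<C> (certified V dc du)"
 unfolding nonuniform_optimal_def
proof (intro conjI proof_system allI impI)
 fix Q assume "proof_system Q"
 then have Q: "computable_in Poly Q" "\<And>\<pi>. Q \<pi> \<in> TAUT" unfolding proof_system_def by auto
 obtain c C where c: "C \<ge> 1" "\<And>N. sound c N"
  "\<And>\<pi> N. (length \<pi> + C) ^ C \<le> N ==> length \<pi> \<le> N & UM c \<pi> (U N) \<noteq> [] & ssnd (UM c \<pi> (U N)) = Q \<pi>"
  using machine_sound[OF Q] by metis
 obtain h where h: "h \<in> \<C>" "\<And>n. \<exists>t w. V t w & dc t = c & (n + C) ^ C \<le> du t & length (pr (pr t w) (U n)) \<le> h n"
  using assms[OF c(2,1)] by blast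
 show "nonuniformly_simulates \<C> (certified V dc du) Q" unfolding nonuniformly_simulates_def
 proof (rule bexI[OF _ h(1)], intro allI impI)
  fix \<pi> \<theta> assume q: "Q \<pi> = \<theta>"
  obtain t w where t: "V t w" "dc t = c" "(length \<pi> + C) ^ C \<le> du t" "length (pr (pr t w) (U (length \<pi>))) \<le> h (length \<pi>)"
   using h(2) by blast
  have "certified V dc du (pr (pr t w) \<pi>) = \<theta>" using certified_eq[OF t(1), of \<pi>] c(3)[OF t(3)] t(2) q by simp
  then show "\<exists>\<pi>'. length \<pi>' \<le> h (length \<pi>) & certified V dc du \<pi>' = \<theta>" using t(4) by (intro exI[of _ "pr (pr t w) \<pi>"]) simp
 qed
qed

lemma optimalI:
 assumes "\<And>c C. (\<And>N. sound c N) ==> C \<ge> 1 ==> \<exists>f. computable_in \<C> (%\<pi>. pr (f \<pi>) \<pi>) &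
   (\<forall>\<pi>. V (sfst (f \<pi>)) (ssnd (f \<pi>)) & f \<pi> = pr (sfst (f \<pi>)) (ssnd (f \<pi>)) & dc (sfst (f \<pi>)) = c &
    (length \<pi> + C) ^ C \<le> du (sfst (f \<pi>)))"
 shows "optimal \<C> (certified V dc du)"
 unfolding optimal_def
proof (intro conjI proof_system allI impI)
 fix Q assume "proof_system Q"
 then have Q: "computable_in Poly Q" "\<And>\<pi>. Q \<pi> \<in> TAUT" unfolding proof_system_def by auto
 obtain c C where c: "C \<ge> 1" "\<And>N. sound c N"
  "\<And>\<pi> N. (length \<pi> + C) ^ C \<le> N ==> length \<pi> \<le> N & UM c \<pi> (U N) \<noteq> [] & ssnd (UM c \<pi> (U N)) = Q \<pi>"
  using machine_sound[OF Q] by metis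
 obtain f where f: "computable_in \<C> (%\<pi>. pr (f \<pi>) \<pi>)" "\<And>\<pi>. V (sfst (f \<pi>)) (ssnd (f \<pi>))"
  "\<And>\<pi>. f \<pi> = pr (sfst (f \<pi>)) (ssnd (f \<pi>))" "\<And>\<pi>. dc (sfst (f \<pi>)) = c" "\<And>\<pi>. (length \<pi> + C) ^ C \<le> du (sfst (f \<pi>))"
  using assms[OF c(2,1)] by blast
 have "certified V dc du (pr (f \<pi>) \<pi>) = Q \<pi>" for \<pi>
  using certified_eq[OF f(2), of \<pi> \<pi>] c(3)[OF f(5)] f(4)[of \<pi>] f(3)[of \<pi>] by metis
 then show "simulates \<C> (certified V dc du) Q" unfolding simulates_def using f(1) by blast
qed

end

lemma Fn_const: "pb length S ==> Fn (%_. c) S"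
 using Fn_PF_comp[OF PF_const Fn_weaken[OF Fn_id]] .

lemma double_iter: "((%x. x @ x) ^^ n) [False] = U (2 ^ n)"
 by (induction n) (simp_all add: replicate_add[symmetric] mult_2)

lemma Fn_exp: "Fn (%u. U (2 ^ length u)) (%u. 2 ^ length u)"
proof -
 have l: "pb length (%u :: str. 2 ^ length u)" by (rule pb_le) (use less_exp less_imp_le in blast)
 have "Fn (%u. ((%x. x @ x) ^^ length u) [False]) (%u. 2 ^ length u)"
 proof (rule Fn_iter[where C = 1])
  show "PF (%x. x @ x)" by (intro PF_append Fn_id)
  show "Fn (%_. [False]) (%u. 2 ^ length u)" by (rule Fn_const[OF l])
  show "Fn (%u. u) (%u. 2 ^ length u)" by (rule Fn_weaken[OF Fn_id l])
  show "length (((%x. x @ x) ^^ i) [False]) \<le> (2 ^ length u + 1) ^ 1" if "i \<le> length u" for u :: str and i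
   unfolding double_iter using that by (simp add: le_SucI)
 qed
 then show ?thesis unfolding double_iter .
qed

section \<open>The tower classes, for statements (1) and (2)\<close>

section \<open>Tickets that are towers\<close>

definition tower_class :: "(fm => bool) => nat => nat set set" where
 "tower_class F k = {L. \<exists>\<phi>. fv \<phi> \<subseteq> {0} & F \<phi> & (\<forall>n. n \<in> L \<longleftrightarrow> holds_at \<phi> (tower k n))}"

lemma tower_classes:
 "E_class k = tower_class Delta_b1_in_S12 k" "NE_class k = tower_class Sigma_b1 k" "CoNE_class k = tower_class Pi_b1 k"
 unfolding E_class_def NE_class_def CoNE_class_def tower_class_def by (rule refl)+

text \<open>Padding: a tower of height \<open>k + 1\<close> over \<open>n\<close> is one of height
  \<open>k\<close> over \<open>2 ^ n\<close>. The inclusion at \<open>k\<close> is applied to the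
  set of all numbers, of which the powers of two are then selected.\<close>

lemma tower_class_Suc:
 assumes "tower_class F k \<subseteq> tower_class G k" shows "tower_class F (Suc k) \<subseteq> tower_class G (Suc k)"
proof
 fix L assume "L \<in> tower_class F (Suc k)"
 then obtain \<phi> where p: "fv \<phi> \<subseteq> {0}" "F \<phi>" "\<And>n. n \<in> L \<longleftrightarrow> holds_at \<phi> (tower k (2 ^ n))"
  unfolding tower_class_def tower_Suc_shift by blast
 have "{m. holds_at \<phi> (tower k m)} \<in> tower_class F k" unfolding tower_class_def using p(1,2) by blast
 then have "{m. holds_at \<phi> (tower k m)} \<in> tower_class G k" using assms by blast
 then obtain \<psi> where q: "fv \<psi> \<subseteq> {0}" "G \<psi>" "\<And>m. m \<in> {m. holds_at \<phi> (tower k m)} \<longleftrightarrow> holds_at \<psi> (tower k m)"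
  unfolding tower_class_def by blast
 have "n \<in> L \<longleftrightarrow> holds_at \<psi> (tower (Suc k) n)" for n
  unfolding p(3) tower_Suc_shift q(3)[symmetric] by simp
 then show "L \<in> tower_class G (Suc k)" unfolding tower_class_def using q(1,2) by blast
qed

lemma tower_class_up: "tower_class F k = tower_class G k ==> tower_class F (Suc (Suc k)) = tower_class G (Suc (Suc k))"
 by (intro equalityI tower_class_Suc) simp_all

definition lgs :: "str => str" where
 "lgs u = U (length (tl (bits (length u))))"

text \<open>In binary, least significant bit first, a power of two is a block of
  \<open>False\<close> followed by one \<open>True\<close>. Repeating this test on the exponent
  recognises towers by their unary representation.\<close>

fun tchk :: "nat => str => bool" where
 "tchk 0 u \<longleftrightarrow> True"
| "tchk (Suc i) u \<longleftrightarrow> bits (length u) = lgs u @ [True] & tchk i (lgs u)"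

lemma PF_lgs: "PF f ==> PF (%x. lgs (f x))"
 unfolding lgs_def by (intro PF_U PF_tl PF_count)

lemma PF_lgs_funpow: "PF f ==> PF (%x. (lgs ^^ i) (f x))"
 by (induction i) (auto intro: PF_lgs)

lemma PP_tchk: "PF f ==> PP (%x. tchk i (f x))"
proof (induction i arbitrary: f)
 case (Suc i)
 show ?case unfolding tchk.simps
  by (intro PP_conj PP_eq PF_count PF_append PF_lgs PF_const Suc.prems Suc.IH[OF PF_lgs[OF Suc.prems]])
qed (simp add: PP_const)

lemma tchk_tower: "tchk i u ==> length u = tower i (length ((lgs ^^ i) u))"
proof (induction i arbitrary: u)
 case (Suc i)
 have "length u = val (bits (length u))" by simp
 also have "\<dots> = 2 ^ length (lgs u)"
  using Suc.prems unfolding tchk.simps by (simp only: val_append) (simp add: lgs_def)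
 also have "length (lgs u) = tower i (length ((lgs ^^ i) (lgs u)))" using Suc by simp
 finally show ?case by (simp add: funpow_swap1)
qed simp

lemma lgs_tower: "lgs (U (tower (Suc i) m)) = U (tower i m)"
 by (simp add: lgs_def bits_pow2)

lemma tchk_U: "tchk i (U (tower i m)) & (lgs ^^ i) (U (tower i m)) = U m"
proof (induction i)
 case (Suc i)
 have "bits (length (U (tower (Suc i) m))) = U (tower i m) @ [True]" by (simp add: bits_pow2)
 then show ?case using Suc by (simp only: tchk.simps lgs_tower funpow_Suc_apply simp_thms)
qed simp

text \<open>After \<open>Suc k\<close> logarithms the base \<open>m\<close> of the tower is left.
  Its binary notation is read as a pair whose first component is the machine.\<close>

definition tcode :: "nat => str => str" where
 "tcode k t = sfst (bits (length ((lgs ^^ Suc k) t)))"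

lemma PF_tcode: "PF f ==> PF (%x. tcode k (f x))"
 unfolding tcode_def by (intro PF_sfst PF_count PF_lgs_funpow)

lemma tcode_U: "tcode k (U (tower (Suc k) m)) = sfst (bits m)"
 unfolding tcode_def using tchk_U[of "Suc k" m] by (simp only: length_replicate)

text \<open>With \<open>N = tower (Suc k) m\<close>, the formula is read at \<open>2 ^ N\<close>,
  which is \<open>num (U N)\<close>. Its input thus has length \<open>N\<close>, and witnesses
  polynomial in \<open>N\<close> are of admissible size.\<close>

lemma unsound_in_NE: "{m. \<not> sound (sfst (bits m)) (tower (Suc k) m)} \<in> NE_class (Suc (Suc k))"
proof -
 obtain g chk where g: "PF g" "PF chk"
  "\<And>c N. \<not> sound c N \<longleftrightarrow> (\<exists>w. length w = length (g (pr c (U N))) & chk (pr (pr c (U N)) w) \<noteq> [])"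
  by (rule unsound_NP) blast
 have "PF (%z. chk (pr (pr (tcode k (sfst z)) (U (length (sfst z)))) (ssnd z)))"
  by (intro PF_comp[OF g(2)] Fn_pair PF_tcode PF_U Fn_fst Fn_snd)
 moreover have "PF (%s. g (pr (tcode k s) (U (length s))))"
  by (intro PF_comp[OF g(1)] Fn_pair PF_tcode PF_U Fn_id)
 ultimately obtain \<phi> where p: "Sigma_b1 \<phi>" "fv \<phi> \<subseteq> {0}"
  "\<And>s. holds_at \<phi> (num s) \<longleftrightarrow> (\<exists>w. length w = length (g (pr (tcode k s) (U (length s)))) &
   chk (pr (pr (tcode k (sfst (pr s w))) (U (length (sfst (pr s w))))) (ssnd (pr s w))) \<noteq> [])"
  using NP_definable by blast
 have "m \<in> {m. \<not> sound (sfst (bits m)) (tower (Suc k) m)} \<longleftrightarrow> holds_at \<phi> (tower (Suc (Suc k)) m)" for m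
 proof -
  have "holds_at \<phi> (num (U (tower (Suc k) m))) \<longleftrightarrow> \<not> sound (sfst (bits m)) (tower (Suc k) m)"
   unfolding p(3) g(3) sfst_pr ssnd_pr length_replicate tcode_U ..
  then show ?thesis by (simp only: num_False tower.simps(2)[of "Suc k"] mem_Collect_eq)
 qed
 then show ?thesis unfolding NE_class_def using p(1,2) by blast
qed

lemma pr_Nil_append: "pr c z = pr c [] @ z"
 by (simp add: pr_def)

text \<open>Attaching the machine to the number \<open>y\<close> is an affine map whose coefficients
  depend only on \<open>c\<close>. These are the constants \<open>a\<close> and \<open>b\<close> of
  \<open>tower_growth\<close>.\<close>

lemma val_code: "val (pr c (bits y)) = 2 ^ (2 * length c + 1) * y + val (pr c [])"
 using val_append[of "pr c []" "bits y"] by (simp add: pr_Nil_append[of c "bits y"])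

lemma bits_code: "y \<ge> 1 ==> bits (val (pr c (bits y))) = pr c (bits y)"
 using last_bits[of y] by (intro bits_canonical) (simp add: pr_Nil_append[of c "bits y"])

text \<open>Two codings of \<open>2 ^ N\<close> meet here: \<open>num (U N)\<close>, used for
  definability, and \<open>val (U N @ [True])\<close>, used for witnesses. Checking that a ticket is
  a tower keeps \<open>tcode\<close> and \<open>length\<close> consistent with
  \<open>m\<close>.\<close>

lemma certificates_tower:
 assumes R: "PP (%x. R (sfst x) (ssnd x))"
  and iff: "\<And>m. sound (sfst (bits m)) (tower (Suc k) m) \<longleftrightarrow> (\<exists>w. R (U (tower (Suc k) m) @ [True]) w)"
 shows "certificates (%t w. tchk (Suc k) t & R (U (length t) @ [True]) w) (tcode k) length"
proof
 show "PP (%x. tchk (Suc k) (sfst x) & R (U (length (sfst x)) @ [True]) (ssnd x))"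
  by (intro PP_conj PP_tchk PP_sub[OF R] PF_append PF_U PF_const Fn_fst Fn_snd)
 show "PF (tcode k)" using PF_tcode[OF Fn_id] .
 show "PF (%t. U (length t))" by (intro PF_U Fn_id)
 show "sound (tcode k t) (length t)" if "tchk (Suc k) t & R (U (length t) @ [True]) w" for t w
 proof -
  let ?m = "length ((lgs ^^ Suc k) t)"
  have l: "length t = tower (Suc k) ?m" by (rule tchk_tower[OF conjunct1[OF that]])
  have "R (U (tower (Suc k) ?m) @ [True]) w" using that unfolding l[symmetric] by blast
  then have "sound (sfst (bits ?m)) (tower (Suc k) ?m)" using iff by blast
  then show ?thesis unfolding tcode_def l[symmetric] .
 qed
 fix c N0 assume c: "\<And>N. sound c N"
 \<comment> \<open>The successor makes the binary notation end in \<open>True\<close>, hence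
   canonical, so that \<open>c\<close> can be recovered; moreover \<open>N0 \<le> ?m\<close>, and
   the tower is larger still.\<close>
 let ?m = "val (pr c (bits (Suc N0)))"
 have m: "sfst (bits ?m) = c" unfolding bits_code[of "Suc N0" c, simplified] by simp
 have "Suc N0 \<le> 2 ^ (2 * length c + 1) * Suc N0" using mult_le_mono1[of 1 "2 ^ (2 * length c + 1)" "Suc N0"] by simp
 then have "N0 \<le> ?m" unfolding val_code by linarith
 then have N0: "N0 \<le> tower (Suc k) ?m" using tower_ge[of ?m "Suc k"] by linarith
 obtain w where "R (U (tower (Suc k) ?m) @ [True]) w" using iff[of ?m] c unfolding m by blast
 then show "\<exists>t w. (tchk (Suc k) t & R (U (length t) @ [True]) w) & tcode k t = c & N0 \<le> length t"
  using N0 tchk_U[of "Suc k" ?m] tcode_U[of k ?m] m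
  by (intro exI[of _ "U (tower (Suc k) ?m)"] exI[of _ w]) (simp only: length_replicate simp_thms)
qed

text \<open>By \<open>flog_lower\<close>, the tower over the iterated bit length of
  \<open>(n + C) ^ C\<close> reaches that number. The base \<open>m n\<close> enlarges this bit
  length by the code of \<open>c\<close>, and \<open>tower_bound\<close> limits the
  overshoot.\<close>

lemma tower_ticket:
 assumes "C \<ge> 1"
 obtains X m K where "\<And>n. X n ^ 2 \<le> n + K" "\<And>n. sfst (bits (m n)) = c" "\<And>n. tower (Suc k) (m n) = 2 ^ X n"
  "\<And>n. (n + C) ^ C \<le> 2 ^ X n" "PF (%\<pi>. U (m (length \<pi>)))"
proof -
 let ?a = "2 ^ (2 * length c + 1)" and ?b = "val (pr c [])"
 \<comment> \<open>The successor provides \<open>y n \<ge> 1\<close>, which \<open>bits_code\<close>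
   needs in order to read \<open>c\<close> back.\<close>
 define y where "y n = Suc (flog (Suc k) ((n + C) ^ C))" for n
 define m where "m n = val (pr c (bits (y n)))" for n
 have m: "m n = ?a * Suc (flog (Suc k) ((n + C) ^ C)) + ?b" for n unfolding m_def val_code y_def ..
 obtain K where K: "\<And>n. tower k (m n) ^ 2 \<le> n + K"
  using tower_bound[of ?a C k ?b] assms unfolding m[symmetric] by auto
 have c: "sfst (bits (m n)) = c" for n unfolding m_def by (subst bits_code) (simp_all add: y_def)
 have big: "(n + C) ^ C \<le> 2 ^ tower k (m n)" for n
 proof -
  have "flog (Suc k) ((n + C) ^ C) \<le> 1 * Suc (flog (Suc k) ((n + C) ^ C))" by simp
  also have "\<dots> \<le> ?a * Suc (flog (Suc k) ((n + C) ^ C))" by (rule mult_le_mono1) simp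
  finally have "flog (Suc k) ((n + C) ^ C) \<le> m n" unfolding m by linarith
  then have "tower (Suc k) (flog (Suc k) ((n + C) ^ C)) \<le> tower (Suc k) (m n)" by (rule tower_mono)
  from order_trans[OF flog_lower this] show ?thesis unfolding tower.simps .
 qed
 have fl: "PF (%\<pi>. U (flog i ((length \<pi> + C) ^ C)))" for i
 proof (induction i)
  case 0
  show ?case using PF_poly[of C] by simp
 next
  case (Suc i)
  have "PF (%\<pi>. U (length (bits (length (U (flog i ((length \<pi> + C) ^ C)))))))" by (intro PF_U PF_count Suc)
  then show ?case by (simp add: length_bits)
 qed
 have "PF (%\<pi>. U ?b @ U (length (U ?a) * length (False # U (flog (Suc k) ((length \<pi> + C) ^ C)))))"
  by (intro PF_app_const PF_umult PF_cons fl PF_const)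
 moreover have "U ?b @ U (length (U ?a) * length (False # U (flog (Suc k) ((length \<pi> + C) ^ C)))) = U (m (length \<pi>))" for \<pi> :: str
  unfolding m replicate_add[symmetric] by (simp only: length_replicate length_Cons add.commute)
 ultimately have "PF (%\<pi>. U (m (length \<pi>)))" by (rule PF_cong)
 then show ?thesis by (intro that[of "%n. tower k (m n)" K m]) (use K c big in auto)
qed

theorem tower_nonuniform:
 assumes "NE_class k = CoNE_class k" shows "\<exists>P. nonuniform_optimal subExp P"
proof -
 have "NE_class (Suc (Suc k)) = CoNE_class (Suc (Suc k))"
  using assms unfolding tower_classes by (rule tower_class_up)
 then obtain \<psi> where p: "fv \<psi> \<subseteq> {0}" "Pi_b1 \<psi>"
  "\<And>m. \<not> sound (sfst (bits m)) (tower (Suc k) m) \<longleftrightarrow> holds_at \<psi> (tower (Suc (Suc k)) m)"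
  using unsound_in_NE[of k] unfolding CoNE_class_def by auto
 have "Sigma_b1 (\<^bold>\<not> \<psi>)" "fv (\<^bold>\<not> \<psi>) \<subseteq> {0}" using p(1,2) by (auto intro: Sigma_b1_Pi_b1.intros)
 then obtain R C1 where R: "PP (%x. R (sfst x) (ssnd x))" "\<And>s. holds_at (\<^bold>\<not> \<psi>) (val s) \<longleftrightarrow> (\<exists>w. R s w)"
  "\<And>s w. R s w ==> length w \<le> (2 * length s + 1 + C1) ^ C1" using Sigma_b1_witness by blast
 have v: "val (U n @ [True]) = 2 ^ n" for n by (simp add: val_append)
 have iff: "sound (sfst (bits m)) (tower (Suc k) m) \<longleftrightarrow> (\<exists>w. R (U (tower (Suc k) m) @ [True]) w)" for m
  unfolding R(2)[symmetric] v using p(3)[of m] unfolding holds_at_def sat.simps tower.simps by blast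
 interpret certificates "%t w. tchk (Suc k) t & R (U (length t) @ [True]) w" "tcode k" length
  by (rule certificates_tower[OF R(1) iff])
 have "nonuniform_optimal subExp (certified (%t w. tchk (Suc k) t & R (U (length t) @ [True]) w) (tcode k) length)"
 proof (rule nonuniform_optimalI)
  fix c C assume c: "\<And>N. sound c N" and C: "(C :: nat) \<ge> 1"
  obtain X m K where X: "\<And>n. X n ^ 2 \<le> n + K" "\<And>n. sfst (bits (m n)) = c" "\<And>n. tower (Suc k) (m n) = 2 ^ X n"
   "\<And>n. (n + C) ^ C \<le> 2 ^ X n" by (rule tower_ticket[OF C, of c k]) blast
  have "pb (%(x, n). 2 * (2 * x + 1 + (2 * (x + 1) + 1 + C1) ^ C1) + 1 + n) (%(x :: nat, n :: nat). x + n)"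
   unfolding case_prod_unfold by (intro pb_intros pb_le) auto
  then obtain D where D: "\<And>x n. 2 * (2 * x + 1 + (2 * (x + 1) + 1 + C1) ^ C1) + 1 + n \<le> (x + n + D) ^ D"
   unfolding pb_def by fastforce
  show "\<exists>h \<in> subExp. \<forall>n. \<exists>t w. (tchk (Suc k) t & R (U (length t) @ [True]) w) & tcode k t = c & (n + C) ^ C \<le> length t &
   length (pr (pr t w) (U n)) \<le> h n"
  proof (rule bexI[OF _ subExp_power[OF X(1), of D]], rule allI)
   fix n
   obtain w where w: "R (U (tower (Suc k) (m n)) @ [True]) w" using iff[of "m n"] c unfolding X(2) by blast
   have lw: "length w \<le> (2 * (2 ^ X n + 1) + 1 + C1) ^ C1" using R(3)[OF w] unfolding X(3) by simp
   have "length (pr (pr (U (tower (Suc k) (m n))) w) (U n)) = 2 * (2 * 2 ^ X n + 1 + length w) + 1 + n"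
    by (simp add: X(3) del: tower.simps)
   also have "\<dots> \<le> 2 * (2 * 2 ^ X n + 1 + (2 * (2 ^ X n + 1) + 1 + C1) ^ C1) + 1 + n"
    by (intro add_mono mult_le_mono2 lw order_refl)
   also note D[of "2 ^ X n" n]
   finally show "\<exists>t w. (tchk (Suc k) t & R (U (length t) @ [True]) w) & tcode k t = c & (n + C) ^ C \<le> length t &
    length (pr (pr t w) (U n)) \<le> (2 ^ X n + n + D) ^ D"
    using w tchk_U[of "Suc k" "m n"] X(4)[of n]
    by - (rule exI[of _ "U (tower (Suc k) (m n))"], rule exI[of _ w], intro conjI,
     simp_all only: length_replicate tcode_U X(2) X(3)[symmetric] simp_thms)
  qed
 qed
 then show ?thesis by blast
qed

lemma Fn_tower:
 assumes "PF (%\<pi>. U (m \<pi>))" "pb length S" "\<And>\<pi>. tower i (m \<pi>) \<le> S \<pi>" shows "Fn (%\<pi>. U (tower i (m \<pi>))) S"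
 using assms(3)
proof (induction i)
 case 0
 show ?case using Fn_weaken[OF assms(1,2)] by simp
next
 case (Suc i)
 have le: "tower i (m \<pi>) \<le> S \<pi>" for \<pi> using Suc.prems[of \<pi>] less_exp[of "tower i (m \<pi>)"] unfolding tower.simps by linarith
 have "pb (%\<pi>. 2 ^ length (U (tower i (m \<pi>)))) S" by (rule pb_le) (use Suc.prems in simp)
 from Fn_comp[OF Fn_exp Suc.IH[OF le] this] show ?case by simp
qed

theorem tower_uniform:
 assumes "E_class k = NE_class k" shows "\<exists>P. optimal subExp P"
proof -
 have eq: "E_class (Suc (Suc k)) = NE_class (Suc (Suc k))"
  using assms unfolding tower_classes by (rule tower_class_up)
 have L: "{m. \<not> sound (sfst (bits m)) (tower (Suc k) m)} \<in> E_class (Suc (Suc k))"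
  unfolding eq by (rule unsound_in_NE)
 obtain \<psi> where p: "fv \<psi> \<subseteq> {0}" "Delta_b1_in_S12 \<psi>"
  "\<And>m. \<not> sound (sfst (bits m)) (tower (Suc k) m) \<longleftrightarrow> holds_at \<psi> (tower (Suc (Suc k)) m)"
  using L unfolding E_class_def mem_Collect_eq by blast
 obtain D where D: "PP D" "\<And>s. D s \<longleftrightarrow> holds_at \<psi> (val s)" using Delta_b1_decidable[OF p(2,1)] by blast
 \<comment> \<open>Soundness is now decidable from the ticket in polynomial time, so the empty
   string is the certificate and only the ticket has to be computed.\<close>
 let ?R = "%s w :: str. \<not> D s & w = []"
 have R: "PP (%x. ?R (sfst x) (ssnd x))" by (intro PP_conj PP_not PP_comp[OF D(1)] PP_eq_Nil Fn_fst Fn_snd)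
 have v: "val (U n @ [True]) = 2 ^ n" for n by (simp add: val_append)
 have iff: "sound (sfst (bits m)) (tower (Suc k) m) \<longleftrightarrow> (\<exists>w. ?R (U (tower (Suc k) m) @ [True]) w)" for m
  unfolding D(2) v using p(3)[of m] unfolding tower.simps by blast
 interpret certificates "%t w. tchk (Suc k) t & ?R (U (length t) @ [True]) w" "tcode k" length
  by (rule certificates_tower[OF R iff])
 have "optimal subExp (certified (%t w. tchk (Suc k) t & ?R (U (length t) @ [True]) w) (tcode k) length)"
 proof (rule optimalI)
  fix c C assume c: "\<And>N. sound c N" and C: "(C :: nat) \<ge> 1"
  obtain X m K where X: "\<And>n. X n ^ 2 \<le> n + K" "\<And>n. sfst (bits (m n)) = c" "\<And>n. tower (Suc k) (m n) = 2 ^ X n"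
   "\<And>n. (n + C) ^ C \<le> 2 ^ X n" "PF (%\<pi>. U (m (length \<pi>)))" by (rule tower_ticket[OF C, of c k]) blast
  let ?f = "%\<pi> :: str. pr (U (tower (Suc k) (m (length \<pi>)))) []"
  let ?S = "%\<pi> :: str. 2 ^ X (length \<pi>) + length \<pi>"
  have l: "pb length ?S" by (rule pb_le) simp
  have "Fn (%\<pi>. pr (?f \<pi>) \<pi>) ?S"
   by (intro Fn_pair Fn_tower[OF X(5) l] Fn_const[OF l] Fn_weaken[OF Fn_id l]) (simp add: X(3) del: tower.simps)
  then have "computable_in subExp (%\<pi>. pr (?f \<pi>) \<pi>)"
   by (rule Fn_computable[where s = "%n. 2 ^ X n + n"]) (use subExp_power[OF X(1)] in auto)
  moreover have "tchk (Suc k) (sfst (?f \<pi>)) & ?R (U (length (sfst (?f \<pi>))) @ [True]) (ssnd (?f \<pi>)) &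
    ?f \<pi> = pr (sfst (?f \<pi>)) (ssnd (?f \<pi>)) & tcode k (sfst (?f \<pi>)) = c & (length \<pi> + C) ^ C \<le> length (sfst (?f \<pi>))" for \<pi>
  proof -
   have "?R (U (tower (Suc k) (m (length \<pi>))) @ [True]) []" using iff[of "m (length \<pi>)"] c unfolding X(2) by blast
   then show ?thesis using tchk_U[of "Suc k" "m (length \<pi>)"] X(4)[of "length \<pi>"]
    unfolding sfst_pr ssnd_pr length_replicate tcode_U X(2)
    by (simp add: X(3) del: tower.simps tchk.simps funpow.simps)
  qed
  ultimately show "\<exists>f. computable_in subExp (%\<pi>. pr (f \<pi>) \<pi>) &
   (\<forall>\<pi>. (tchk (Suc k) (sfst (f \<pi>)) & ?R (U (length (sfst (f \<pi>))) @ [True]) (ssnd (f \<pi>))) &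
    f \<pi> = pr (sfst (f \<pi>)) (ssnd (f \<pi>)) & tcode k (sfst (f \<pi>)) = c & (length \<pi> + C) ^ C \<le> length (sfst (f \<pi>)))"
   by (intro exI[of _ ?f]) blast
 qed
 then show ?thesis by blast
qed

section \<open>Exponential time, for statements (3) and (4)\<close>

section \<open>Binary tickets\<close>

abbreviation unsound_codes :: "str set" where
 "unsound_codes \<equiv> {s. \<not> sound (sfst s) (val (ssnd s))}"

text \<open>The bound \<open>N\<close> has to be expanded from binary to unary, which
  \<open>PF_unary\<close> does relative to a long string. For the guess length this is
  \<open>U (2 ^ length s)\<close>. In the polynomial-time check it is the guess itself, which is
  long enough because \<open>g\<close> does not shorten its argument.\<close>

lemma unsound_in_NEXP: "unsound_codes \<in> NEXP"
proof -
 obtain g chk where g: "PF g" "PF chk" "\<And>s. length s \<le> length (g s)"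
  "\<And>c N. \<not> sound c N \<longleftrightarrow> (\<exists>w. length w = length (g (pr c (U N))) & chk (pr (pr c (U N)) w) \<noteq> [])"
  by (rule unsound_NP) blast
 obtain u where u: "PF u" "\<And>x. val (ssnd (sfst x)) \<le> length (ssnd x) ==> u x = U (val (ssnd (sfst x)))"
  using PF_unary[OF PF_ssnd[OF Fn_fst] Fn_snd] by blast
 let ?S = "%s :: str. 2 ^ length s"
 have l: "pb length ?S" by (rule pb_le) (use less_exp less_imp_le in blast)
 let ?g = "%s. g (pr (sfst s) (u (pr s (U (2 ^ length s)))))"
 have id: "Fn (%s. s) ?S" by (rule Fn_weaken[OF Fn_id l])
 have G: "Fn ?g ?S"
  by (intro Fn_PF_comp[OF g(1)] Fn_pair Fn_PF_comp[OF Fn_fst] Fn_PF_comp[OF u(1)] Fn_exp id)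
 have u2: "u (pr s (U (2 ^ length s))) = U (val (ssnd s))" for s
 proof -
  have "val (ssnd s) \<le> 2 ^ length s"
   using less_le_trans[OF val_less[of "ssnd s"] power_increasing[OF length_ssnd[of s], of "2::nat"]] by simp
  then show ?thesis using u(2)[of "pr s (U (2 ^ length s))"] by simp
 qed
 have CH: "PF (%z. chk (pr (pr (sfst (sfst z)) (u z)) (ssnd z)))"
  by (intro PF_comp[OF g(2)] Fn_pair PF_sfst u(1) Fn_fst Fn_snd)
 obtain M T where M: "pb T ?S" "TM M" "\<And>x. (\<forall>n c. (step M ^^ n) (start_config M x) c --> n \<le> T x) &
  ((\<exists>w. length w = length (?g x) & chk (pr (pr (sfst (sfst (pr x w))) (u (pr x w))) (ssnd (pr x w))) \<noteq> []) \<longleftrightarrow>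
   (\<exists>c. (step M)\<^sup>*\<^sup>* (start_config M x) c & halted M c & fst c = 1))"
  using Fn_NTM[OF G CH] by blast
 obtain C where C: "\<And>x. T x \<le> (2 ^ length x + C) ^ C" using M(1) unfolding pb_def by blast
 have eq: "(\<exists>w. length w = length (?g x) & chk (pr (pr (sfst (sfst (pr x w))) (u (pr x w))) (ssnd (pr x w))) \<noteq> []) \<longleftrightarrow> x \<in> unsound_codes" for x
 proof -
  have "u (pr x w) = U (val (ssnd x))" if "length w = length (g (pr (sfst x) (U (val (ssnd x)))))" for w
   using u(2)[of "pr x w"] g(3)[of "pr (sfst x) (U (val (ssnd x)))"] that by simp
  then show ?thesis unfolding u2 sfst_pr ssnd_pr mem_Collect_eq g(4) by metis
 qed
 have "decides_within M unsound_codes (%n. (2 ^ n + C) ^ C)"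
  unfolding decides_within_def
 proof (intro conjI allI impI)
  show "n \<le> (2 ^ length x + C) ^ C" if "(step M ^^ n) (start_config M x) c" for x n c
   using M(3)[of x] that C[of x] by (meson order_trans)
  show "(x \<in> unsound_codes) = (\<exists>c. (step M)\<^sup>*\<^sup>* (start_config M x) c & halted M c & fst c = 1)" for x
   using M(3)[of x] unfolding eq by blast
 qed (rule M(2))
 then show ?thesis unfolding NEXP_def using Expo_power[of C] by blast
qed

text \<open>A ticket carries its bound in unary, as the proof system must run that long; the
  exponential-time set expects it in binary. The gap is what keeps certificates
  quasipolynomial.\<close>

definition vcode :: "str => str" where
 "vcode t = pr (sfst t) (bits (length (ssnd t)))"

text \<open>The flag \<open>b\<close> tells which answer certifies soundness: \<open>True\<close>
  for a machine that accepts the sound codes, \<open>False\<close> for a deterministic one that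
  decides the unsound codes and halts outside the accepting state 1.\<close>

definition vcheck :: "machine => bool => str => str => bool" where
 "vcheck M b s w \<longleftrightarrow> UM (mcode M) s w \<noteq> [] & (sfst (UM (mcode M) s w) = U 1 \<longleftrightarrow> b)"

lemma certificates_binary:
 assumes "\<And>s w. vcheck M b s w ==> s \<notin> unsound_codes" "\<And>s. s \<notin> unsound_codes ==> \<exists>w. vcheck M b s w"
 shows "certificates (%t w. vcheck M b (vcode t) w) sfst (%t. length (ssnd t))"
proof
 show "PP (%x. vcheck M b (vcode (sfst x)) (ssnd x))" unfolding vcheck_def vcode_def
  by (intro PP_conj PP_iff PP_neq_Nil PP_eq PF_sfst PF_UM PF_count PF_ssnd Fn_pair PP_const PF_const Fn_fst Fn_snd)
 show "PF sfst" by (rule Fn_fst)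
 show "PF (%t. U (length (ssnd t)))" by (intro PF_U Fn_snd)
 show "sound (sfst t) (length (ssnd t))" if "vcheck M b (vcode t) w" for t w
  using assms(1)[OF that] by (simp add: vcode_def)
 fix c N0 assume c: "\<And>N. sound c N"
 have "vcode (pr c (U N0)) \<notin> unsound_codes" using c by (simp add: vcode_def)
 then obtain w where "vcheck M b (vcode (pr c (U N0))) w" using assms(2) by blast
 then show "\<exists>t w. vcheck M b (vcode t) w & sfst t = c & N0 \<le> length (ssnd t)"
  by (intro exI[of _ "pr c (U N0)"] exI[of _ w]) simp
qed

text \<open>The certificate lists the instructions of an accepting run. The run is exponential in a
  power of the length of the binary ticket, which is logarithmic in \<open>n\<close> for a fixed
  machine \<open>c\<close>.\<close>

theorem binary_nonuniform:
 assumes "NEXP = CoNEXP" shows "\<exists>P. nonuniform_optimal Qp P"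
proof -
 have "- unsound_codes \<in> NEXP" using unsound_in_NEXP assms unfolding CoNEXP_def by blast
 then obtain T M where M: "T \<in> Expo" "TM M"
  "\<And>x n c. (step M ^^ n) (start_config M x) c ==> n \<le> T (length x)"
  "\<And>x. x \<in> - unsound_codes \<longleftrightarrow> (\<exists>c. (step M)\<^sup>*\<^sup>* (start_config M x) c & halted M c & fst c = 1)"
  unfolding NEXP_def decides_within_def by blast
 obtain d where d: "\<And>n. T n \<le> 2 ^ ((n + d) ^ d)" using Expo_bound[OF M(1)] by blast
 let ?K = "2 * length (mcode M) + 1"
 have U1: "U n = U 1 \<longleftrightarrow> n = 1" for n by (metis length_replicate)
 have snd: "s \<notin> unsound_codes" if v: "vcheck M True s w" for s w
 proof -
  obtain c where "(step M)\<^sup>*\<^sup>* (start_config M s) c" "halted M c" "sfst (UM (mcode M) s w) = U (fst c)"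
   using UM_sound[OF M(2)] v unfolding vcheck_def by blast
  note c = this
  then have "fst c = 1" using v U1[of "fst c"] unfolding vcheck_def by simp
  then show ?thesis using M(4)[of s] c(1,2) by blast
 qed
 have cmp: "\<exists>w. vcheck M True s w & length w \<le> 2 ^ ((length s + d) ^ d) * ?K" if s: "s \<notin> unsound_codes" for s
 proof -
  obtain c where c: "(step M)\<^sup>*\<^sup>* (start_config M s) c" "halted M c" "fst c = 1" using M(4)[of s] s by blast
  obtain n where n: "(step M ^^ n) (start_config M s) c" using c(1) rtranclp_imp_relpowp by metis
  obtain w o' where w: "length w \<le> n * ?K" "UM (mcode M) s w = pr (U (fst c)) o'"
   using UM_complete[OF M(2) n c(2)] by blast
  have "n \<le> 2 ^ ((length s + d) ^ d)" using M(3)[OF n] d[of "length s"] by linarith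
  then have "n * ?K \<le> 2 ^ ((length s + d) ^ d) * ?K" by (rule mult_le_mono1)
  then have "length w \<le> 2 ^ ((length s + d) ^ d) * ?K" using w(1) by linarith
  moreover have "vcheck M True s w" using w(2) c(3) by (simp add: vcheck_def)
  ultimately show ?thesis by blast
 qed
 interpret certificates "%t w. vcheck M True (vcode t) w" sfst "%t. length (ssnd t)"
  by (rule certificates_binary) (use snd cmp in blast)+
 have "nonuniform_optimal Qp (certified (%t w. vcheck M True (vcode t) w) sfst (%t. length (ssnd t)))"
 proof (rule nonuniform_optimalI)
  fix c C assume c: "\<And>N. sound c N" and C: "(C :: nat) \<ge> 1"
  let ?A = "2 * length c + 1 + d"
  let ?x = "%n. 2 ^ ((?A + floorlog 2 ((n + C) ^ C)) ^ d)"
  have "pb (%(x, n). 2 * (2 * (2 * length c + 1 + (n + C) ^ C) + 1 + x * ?K) + 1 + n) (%(x :: nat, n :: nat). x + n)"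
   unfolding case_prod_unfold by (intro pb_intros pb_le) auto
  then obtain D where D: "\<And>x n. 2 * (2 * (2 * length c + 1 + (n + C) ^ C) + 1 + x * ?K) + 1 + n \<le> (x + n + D) ^ D"
   unfolding pb_def by fastforce
  show "\<exists>h \<in> Qp. \<forall>n. \<exists>t w. vcheck M True (vcode t) w & sfst t = c & (n + C) ^ C \<le> length (ssnd t) &
   length (pr (pr t w) (U n)) \<le> h n"
  proof (rule bexI[OF _ Qp_power[of ?A C d D]], rule allI)
   fix n
   let ?t = "pr c (U ((n + C) ^ C))"
   have "vcode ?t \<notin> unsound_codes" using c by (simp add: vcode_def)
   then obtain w where w: "vcheck M True (vcode ?t) w" "length w \<le> 2 ^ ((length (vcode ?t) + d) ^ d) * ?K" using cmp by blast
   have e: "length (vcode ?t) + d = ?A + floorlog 2 ((n + C) ^ C)" by (simp add: vcode_def length_bits)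
   have "length w \<le> ?x n * ?K" using w(2) unfolding e .
   note lw = this
   have "length (pr (pr ?t w) (U n)) = 2 * (2 * (2 * length c + 1 + (n + C) ^ C) + 1 + length w) + 1 + n" by simp
   also have "\<dots> \<le> 2 * (2 * (2 * length c + 1 + (n + C) ^ C) + 1 + ?x n * ?K) + 1 + n"
    by (intro add_mono mult_le_mono2 lw order_refl)
   also note D[of n "?x n"]
   finally show "\<exists>t w. vcheck M True (vcode t) w & sfst t = c & (n + C) ^ C \<le> length (ssnd t) &
    length (pr (pr t w) (U n)) \<le> (?x n + n + D) ^ D" using w(1)
    by - (rule exI[of _ ?t], rule exI[of _ w], intro conjI, simp_all only: sfst_pr ssnd_pr length_replicate order_refl)
  qed
 qed
 then show ?thesis by blast
qed

text \<open>For a deterministic decision procedure the certificate is a mere clock, so it can be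
  written down without knowing the run.\<close>

theorem binary_uniform:
 assumes "EXP = NEXP" shows "\<exists>P. optimal Qp P"
proof -
 have "unsound_codes \<in> EXP" using unsound_in_NEXP assms by blast
 then obtain T M where M: "T \<in> Expo" "TM M" "deterministic M"
  "\<And>x n c. (step M ^^ n) (start_config M x) c ==> n \<le> T (length x)"
  "\<And>x. x \<in> unsound_codes \<longleftrightarrow> (\<exists>c. (step M)\<^sup>*\<^sup>* (start_config M x) c & halted M c & fst c = 1)"
  unfolding EXP_def decides_within_def by blast
 obtain d where d: "\<And>n. T n \<le> 2 ^ ((n + d) ^ d)" using Expo_bound[OF M(1)] by blast
 have U1: "U n = U 1 \<longleftrightarrow> n = 1" for n by (metis length_replicate)
 have snd: "s \<notin> unsound_codes" if v: "vcheck M False s w" for s w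
 proof
  assume "s \<in> unsound_codes"
  then obtain b where b: "(step M)\<^sup>*\<^sup>* (start_config M s) b" "halted M b" "fst b = 1" using M(5)[of s] by blast
  obtain c where c: "(step M)\<^sup>*\<^sup>* (start_config M s) c" "halted M c" "sfst (UM (mcode M) s w) = U (fst c)"
   using UM_sound[OF M(2)] v unfolding vcheck_def by blast
  obtain n m where "(step M ^^ n) (start_config M s) b" "(step M ^^ m) (start_config M s) c"
   using b(1) c(1) rtranclp_imp_relpowp by metis
  then have "b = c" using halting_unique[OF M(3)] b(2) c(2) by blast
  then show False using v b(3) c(3) unfolding vcheck_def by simp
 qed
 \<comment> \<open>\<open>decides_within\<close> bounds the length of all paths. Without a halting
   configuration, paths could be prolonged beyond that bound.\<close>
 have halts: "\<exists>n c. (step M ^^ n) (start_config M s) c & halted M c" for s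
 proof (rule ccontr)
  assume n: "\<not> ?thesis"
  have "\<exists>c. (step M ^^ n) (start_config M s) c" for n
  proof (induction n)
   case (Suc n)
   then obtain c where c: "(step M ^^ n) (start_config M s) c" by blast
   then obtain c' where "step M c c'" using n unfolding halted_def by blast
   then show ?case using c by (intro exI[of _ c']) auto
  qed simp
  then show False using M(4)[of "Suc (T (length s))" s] by fastforce
 qed
 have cmp: "vcheck M False s (U (2 ^ ((length s + d) ^ d)))" if s: "s \<notin> unsound_codes" for s
 proof -
  obtain n c where c: "(step M ^^ n) (start_config M s) c" "halted M c" using halts by blast
  have "(step M)\<^sup>*\<^sup>* (start_config M s) c" using c(1) by (rule relpowp_imp_rtranclp)
  then have "fst c \<noteq> 1" using M(5)[of s] s c(2) by blast
  moreover have "n \<le> 2 ^ ((length s + d) ^ d)" using M(4)[OF c(1)] d[of "length s"] by linarith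
  ultimately show ?thesis using UM_deterministic[OF M(2,3) c] U1 unfolding vcheck_def by fastforce
 qed
 interpret certificates "%t w. vcheck M False (vcode t) w" sfst "%t. length (ssnd t)"
  by (rule certificates_binary) (use snd cmp in blast)+
 have "optimal Qp (certified (%t w. vcheck M False (vcode t) w) sfst (%t. length (ssnd t)))"
 proof (rule optimalI)
  fix c C assume c: "\<And>N. sound c N" and C: "(C :: nat) \<ge> 1"
  let ?A = "2 * length c + 1 + d"
  let ?x = "%n. 2 ^ ((?A + floorlog 2 ((n + C) ^ C)) ^ d)"
  let ?t = "%\<pi> :: str. pr c (U ((length \<pi> + C) ^ C))"
  let ?f = "%\<pi>. pr (?t \<pi>) (U (2 ^ ((length (vcode (?t \<pi>)) + d) ^ d)))"
  have vl: "length (vcode (?t \<pi>)) + d = ?A + floorlog 2 ((length \<pi> + C) ^ C)" for \<pi>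
   by (simp add: vcode_def length_bits)
  let ?S = "%\<pi> :: str. ?x (length \<pi>) + length \<pi>"
  have l: "pb length ?S" by (rule pb_le) simp
  have t: "PF ?t" by (intro Fn_pair PF_const PF_poly)
  have "PF (%\<pi>. vcode (?t \<pi>))" unfolding vcode_def by (intro Fn_pair PF_sfst PF_count PF_ssnd t)
  then have "PF (%\<pi>. U ((length (vcode (?t \<pi>)) + d) ^ d))" by (rule PF_comp[OF PF_poly])
  from Fn_tower[OF this l, of 1] have e: "Fn (%\<pi>. U (2 ^ ((length (vcode (?t \<pi>)) + d) ^ d))) ?S" by (simp add: vl)
  have "Fn (%\<pi>. pr (?f \<pi>) \<pi>) ?S" by (intro Fn_pair e Fn_weaken[OF t l] Fn_weaken[OF Fn_id l])
  then have "computable_in Qp (%\<pi>. pr (?f \<pi>) \<pi>)"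
   by (rule Fn_computable[where s = "%n. ?x n + n"]) (use Qp_power[of ?A C d] in auto)
  moreover have "vcheck M False (vcode (sfst (?f \<pi>))) (ssnd (?f \<pi>)) & ?f \<pi> = pr (sfst (?f \<pi>)) (ssnd (?f \<pi>)) &
    sfst (sfst (?f \<pi>)) = c & (length \<pi> + C) ^ C \<le> length (ssnd (sfst (?f \<pi>)))" for \<pi>
  proof -
   have "vcode (?t \<pi>) \<notin> unsound_codes" using c by (simp add: vcode_def)
   from cmp[OF this] show ?thesis by simp
  qed
  ultimately show "\<exists>f. computable_in Qp (%\<pi>. pr (f \<pi>) \<pi>) &
   (\<forall>\<pi>. vcheck M False (vcode (sfst (f \<pi>))) (ssnd (f \<pi>)) & f \<pi> = pr (sfst (f \<pi>)) (ssnd (f \<pi>)) &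
    sfst (sfst (f \<pi>)) = c & (length \<pi> + C) ^ C \<le> length (ssnd (sfst (f \<pi>))))"
   by (intro exI[of _ ?f]) blast
 qed
 then show ?thesis by blast
qed

theorem theorem4p2:
 "((\<nexists>P. nonuniform_optimal subExp P) \<longrightarrow> (\<forall>k. NE_class k \<noteq> CoNE_class k)) \<and>
  ((\<nexists>P. optimal subExp P) \<longrightarrow> (\<forall>k. E_class k \<noteq> NE_class k)) \<and>
  ((\<nexists>P. nonuniform_optimal Qp P) \<longrightarrow> NEXP \<noteq> CoNEXP) \<and>
  ((\<nexists>P. optimal Qp P) \<longrightarrow> EXP \<noteq> NEXP)"
 using tower_nonuniform tower_uniform binary_nonuniform binary_uniform by blast

end
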